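(* Let $d\ge3$ and let $\Omega\subset\mathbb{R}^d$ be a Lipschitz cluster with $N$ connected components $\omega_1,\dots,\omega_N$. Then the null-space of the magnetic potential operator $P_{\Omega^c\leftarrow\Omega}$ on $L^2(\Omega;\mathbb{R}^d)$ is $$\mathscr{N}[P_{\Omega^c\leftarrow\Omega}]=\bigoplus_{i=1}^N\Big(\nabla H_0^1(\omega_i)+H_{\mathrm{div},0}(\omega_i)\Big),$$ where fields on $\omega_i$ are extended by zero to $\Omega$.
   Context: An open set is Lipschitz if its boundary is compact and, near each boundary point and after a rigid motion, the boundary is the graph of a Lipschitz function; consequently the connected components of a Lipschitz open set are finite in number and at positive distance from each other. A Lipschitz domain is a connected Lipschitz open set. A Lipschitz cluster is a Lipschitz open set that is a union of finitely many disjoint, bounded and simply connected Lipschitz domains. $\Omega^c:=\mathbb{R}^d\setminus\overline\Omega$. With $N(x)=\frac{1}{(d-2)\omega_d}|x|^{2-d}$, where $\omega_d$ is the area of the unit sphere in $\mathbb{R}^d$, the magnetic potential of $\mathbf f\in L^2(\Omega;\mathbb{R}^d)$ is $P_{\Omega^c\leftarrow\Omega}(\mathbf f)(x)=\int_\Omega\nabla N(x-y)\cdot\mathbf f(y)\,dy$, $x\in\Omega^c$. For a bounded open set $U$, $\nabla H_0^1(U)$ is the space of gradients of functions in $H^1_0(U)$, and $H_{\mathrm{div},0}(U)$ is the $L^2$-closure of $\{\mathbf f\in C_0^\infty(U;\mathbb{R}^d):\operatorname{div}\mathbf f=0\}$. *)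

theory Defs
  imports "HOL-Analysis.Analysis"
begin

section \<open>Lipschitz open sets and clusters\<close>

definition rigid_motion :: "('a::euclidean_space \<Rightarrow> 'a) \<Rightarrow> bool" where
  "rigid_motion T \<longleftrightarrow> (\<exists>c R. orthogonal_transformation R \<and> T = (\<lambda>x. c + R x))"

text \<open>
  In the coordinates of \<open>T\<close>, points are written as \<open>y + t *\<^sub>R b\<close> with \<open>y\<close> orthogonal to the
  basis vector \<open>b\<close>. As is standard (and as is needed for the components to be at positive
  distance from each other), the set lies locally on one side of the graph.
\<close>

definition lipschitz_boundary_at :: "'a::euclidean_space set \<Rightarrow> 'a \<Rightarrow> bool" where
  "lipschitz_boundary_at \<Omega> p \<longleftrightarrow>
    (\<exists>U T b \<phi> L. open U \<and> p \<in> U \<and> rigid_motion T \<and> b \<in> Basis \<and>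
       L-lipschitz_on {y. y \<bullet> b = 0} (\<phi> :: 'a \<Rightarrow> real) \<and>
       (\<forall>x\<in>U. (x \<in> frontier \<Omega> \<longleftrightarrow> T x \<bullet> b = \<phi> (T x - (T x \<bullet> b) *\<^sub>R b)) \<and>
              (x \<in> \<Omega> \<longleftrightarrow> T x \<bullet> b > \<phi> (T x - (T x \<bullet> b) *\<^sub>R b))))"

definition lipschitz_open :: "'a::euclidean_space set \<Rightarrow> bool" where
  "lipschitz_open \<Omega> \<longleftrightarrow>
    open \<Omega> \<and> compact (frontier \<Omega>) \<and> (\<forall>p\<in>frontier \<Omega>. lipschitz_boundary_at \<Omega> p)"

definition lipschitz_domain :: "'a::euclidean_space set \<Rightarrow> bool" where
  "lipschitz_domain D \<longleftrightarrow> lipschitz_open D \<and> connected D"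

definition lipschitz_cluster :: "'a::euclidean_space set \<Rightarrow> bool" where
  "lipschitz_cluster \<Omega> \<longleftrightarrow> lipschitz_open \<Omega> \<and>
    (\<exists>\<D>. finite \<D> \<and> pairwise disjnt \<D> \<and> \<Union>\<D> = \<Omega> \<and>
         (\<forall>D\<in>\<D>. lipschitz_domain D \<and> bounded D \<and> simply_connected D))"

section \<open>Differential operators and test functions\<close>

definition gradient :: "('a::euclidean_space \<Rightarrow> real) \<Rightarrow> 'a \<Rightarrow> 'a" where
  "gradient u x = (\<Sum>b\<in>Basis. frechet_derivative u (at x) b *\<^sub>R b)"

definition divergence :: "('a::euclidean_space \<Rightarrow> 'a) \<Rightarrow> 'a \<Rightarrow> real" where
  "divergence f x = (\<Sum>b\<in>Basis. frechet_derivative f (at x) b \<bullet> b)"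

primrec times_cont_diff :: "nat \<Rightarrow> ('a::euclidean_space \<Rightarrow> 'b::euclidean_space) \<Rightarrow> bool" where
  "times_cont_diff 0 f \<longleftrightarrow> continuous_on UNIV f"
| "times_cont_diff (Suc k) f \<longleftrightarrow> (\<forall>x. f differentiable (at x)) \<and>
     (\<forall>b\<in>Basis. times_cont_diff k (\<lambda>x. frechet_derivative f (at x) b))"

text \<open>Elements of \<open>C\<^sub>0\<^sup>\<infinity>(U)\<close> are represented by their extensions by zero to the whole space.\<close>

definition test_functions :: "'a::euclidean_space set \<Rightarrow> ('a \<Rightarrow> 'b::euclidean_space) set" where
  "test_functions U = {\<phi>. (\<forall>k. times_cont_diff k \<phi>) \<and>
     compact (closure {x. \<phi> x \<noteq> 0}) \<and> closure {x. \<phi> x \<noteq> 0} \<subseteq> U}"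

section \<open>Function spaces\<close>

text \<open>
  Elements of \<open>L\<^sup>2(U)\<close> are represented by functions on the whole space, two of which represent the
  same element iff they agree almost everywhere on \<open>U\<close>; values outside \<open>U\<close> are irrelevant.
  All the function spaces below are closed under passing to another representative, except
  for the images under \<open>zero_ext\<close>, which are only used up to almost everywhere equality.
\<close>

definition L2 :: "'a::euclidean_space set \<Rightarrow> ('a \<Rightarrow> 'b::euclidean_space) set" where
  "L2 U = {f \<in> borel_measurable (lebesgue_on U). integrable (lebesgue_on U) (\<lambda>x. (norm (f x))\<^sup>2)}"

definition L2_dist ::
    "'a::euclidean_space set \<Rightarrow> ('a \<Rightarrow> 'b::euclidean_space) \<Rightarrow> ('a \<Rightarrow> 'b) \<Rightarrow> real" where
  "L2_dist U f g = sqrt (LINT x|lebesgue_on U. (norm (f x - g x))\<^sup>2)"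

definition has_weak_gradient ::
    "'a::euclidean_space set \<Rightarrow> ('a \<Rightarrow> real) \<Rightarrow> ('a \<Rightarrow> 'a) \<Rightarrow> bool" where
  "has_weak_gradient U u G \<longleftrightarrow> (\<forall>\<phi>\<in>test_functions U.
     (LINT x|lebesgue_on U. u x *\<^sub>R gradient \<phi> x) = - (LINT x|lebesgue_on U. \<phi> x *\<^sub>R G x))"

text \<open>\<open>H\<^sub>0\<^sup>1(U)\<close> is the closure of the test functions in \<open>H\<^sup>1(U)\<close>.\<close>

definition H1_0 :: "'a::euclidean_space set \<Rightarrow> ('a \<Rightarrow> real) set" where
  "H1_0 U = {u \<in> L2 U. \<exists>G\<in>L2 U. has_weak_gradient U u G \<and>
     (\<forall>\<epsilon>>0. \<exists>\<phi>\<in>test_functions U. L2_dist U u \<phi> < \<epsilon> \<and> L2_dist U G (gradient \<phi>) < \<epsilon>)}"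

definition grad_H1_0 :: "'a::euclidean_space set \<Rightarrow> ('a \<Rightarrow> 'a) set" where
  "grad_H1_0 U = {G \<in> L2 U. \<exists>u\<in>H1_0 U. has_weak_gradient U u G}"

definition H_div_0 :: "'a::euclidean_space set \<Rightarrow> ('a \<Rightarrow> 'a) set" where
  "H_div_0 U = {f \<in> L2 U. \<forall>\<epsilon>>0. \<exists>\<phi>\<in>test_functions U.
     (\<forall>x. divergence \<phi> x = 0) \<and> L2_dist U f \<phi> < \<epsilon>}"

definition space_sum :: "('a \<Rightarrow> 'b::plus) set \<Rightarrow> ('a \<Rightarrow> 'b) set \<Rightarrow> ('a \<Rightarrow> 'b) set" where
  "space_sum V W = {\<lambda>x. g x + h x |g h. g \<in> V \<and> h \<in> W}"

definition zero_ext :: "'a set \<Rightarrow> ('a \<Rightarrow> 'b::zero) \<Rightarrow> 'a \<Rightarrow> 'b" where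
  "zero_ext U f x = (if x \<in> U then f x else 0)"

text \<open>\<open>S\<close> is the internal direct sum of the subspaces \<open>V i\<close> of \<open>L\<^sup>2(\<Omega>)\<close>.\<close>

definition L2_direct_sum :: "'a::euclidean_space set \<Rightarrow> 'i set \<Rightarrow>
    ('i \<Rightarrow> ('a \<Rightarrow> 'b::euclidean_space) set) \<Rightarrow> ('a \<Rightarrow> 'b) set \<Rightarrow> bool" where
  "L2_direct_sum \<Omega> I V S \<longleftrightarrow>
     S = {f \<in> L2 \<Omega>. \<exists>g. (\<forall>i\<in>I. g i \<in> V i) \<and>
            (AE x in lebesgue_on \<Omega>. f x = (\<Sum>i\<in>I. g i x))} \<and>
     (\<forall>g h. (\<forall>i\<in>I. g i \<in> V i \<and> h i \<in> V i) \<and>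
            (AE x in lebesgue_on \<Omega>. (\<Sum>i\<in>I. g i x) = (\<Sum>i\<in>I. h i x)) \<longrightarrow>
            (\<forall>i\<in>I. AE x in lebesgue_on \<Omega>. g i x = h i x))"

section \<open>The magnetic potential\<close>

text \<open>
  The area of the unit sphere, as the cone measure (polar coordinates): \<open>d\<close> times the volume of
  the cone over the sphere with apex \<open>0\<close>, that is, of the unit ball.
\<close>

definition unit_sphere_area :: "'a::euclidean_space itself \<Rightarrow> real" where
  "unit_sphere_area _ = real DIM('a) * measure lebesgue (ball (0::'a) 1)"

definition newton_kernel :: "'a::euclidean_space \<Rightarrow> real" where
  "newton_kernel x =
     1 / ((real DIM('a) - 2) * unit_sphere_area TYPE('a)) * norm x powr (2 - real DIM('a))"

definition magnetic_potential ::
    "'a::euclidean_space set \<Rightarrow> ('a \<Rightarrow> 'a) \<Rightarrow> 'a \<Rightarrow> real" where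
  "magnetic_potential \<Omega> f x = (LINT y|lebesgue_on \<Omega>. gradient newton_kernel (x - y) \<bullet> f y)"

definition magnetic_null_space :: "'a::euclidean_space set \<Rightarrow> ('a \<Rightarrow> 'a) set" where
  "magnetic_null_space \<Omega> = {f \<in> L2 \<Omega>. \<forall>x\<in>- closure \<Omega>. magnetic_potential \<Omega> f x = 0}"

end

theory Submission
  imports Defs
begin

text \<open>
  Let \<open>K\<^sub>\<delta>\<close> be the kernel \<open>x / |x|\<^sup>d\<close>, which is \<open>\<nabla>N\<close> up to a constant factor, modified inside
  the ball of radius \<open>\<delta>\<close> so that it becomes a \<open>C\<^sup>1\<close> gradient field; its divergence is an
  approximate identity \<open>\<rho>\<^sub>\<delta>\<close>. For a field \<open>f\<close> in the null space put \<open>u\<^sub>\<delta> = K\<^sub>\<delta> * f\<close>. Because the potential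
  of \<open>f\<close> vanishes off the closure of \<open>\<Omega>\<close>, \<open>u\<^sub>\<delta>\<close> is supported in the \<open>\<delta>\<close>-neighbourhood of \<open>\<Omega>\<close>,
  and \<open>\<rho>\<^sub>\<delta> * f = \<nabla>u\<^sub>\<delta> + h\<^sub>\<delta>\<close> with \<open>h\<^sub>\<delta>\<close> solenoidal and supported there as well. The two parts are orthogonal
  in \<open>L\<^sup>2\<close>, so both converge as \<open>\<delta>\<close> tends to 0. The local graph condition yields a \<open>C\<^sup>1\<close> vector field
  \<open>X\<close> such that \<open>id + t X\<close> maps the closure of \<open>\<Omega>\<close> into \<open>\<Omega>\<close>; composing \<open>u\<^sub>\<delta>\<close> with \<open>id - t X\<close>, pushing
  \<open>h\<^sub>\<delta>\<close> forward along \<open>id + t X\<close>, and mollifying, turns the supports into compact subsets of \<open>\<Omega>\<close> at the cost of a small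
  \<open>L\<^sup>2\<close> error. Conversely, \<open>\<nabla>N(x - \<cdot>)\<close> is a harmonic gradient near the closure of \<open>\<Omega>\<close> whenever \<open>x\<close> lies off that
  closure, hence orthogonal to gradients of test functions and to solenoidal test fields.
\<close>

section \<open>Square integrable functions\<close>

text \<open>No bound for the singular integral operator given by the second derivatives of the
  Newton potential is invoked. Changing the kernel only inside a small ball controls supports
  exactly, since old and new kernel agree at larger distances, and the modified field stays radial,
  hence a gradient with symmetric Jacobian; this symmetry is the reason why the second part is
  solenoidal. Pythagoras, applied to differences of two approximations, then makes the gradient
  parts Cauchy because the mollified fields are. The two parts transform differently: composition
  with a map keeps gradients but not solenoidal fields, which have to be multiplied by the
  derivative of the map as well. The order of choices is delicate. The vector field must be fixed
  before the index of the approximating sequence, because this index depends on the gap that the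
  field opens; hence estimates whose smallness threshold depends on one reference field only. All of
  this happens on the whole of \<Omega>. The components enter at the end, where a compact subset of
  \<Omega> meets each of them in a compact set.\<close>

definition square_integrable :: "('a::euclidean_space \<Rightarrow> 'b::euclidean_space) \<Rightarrow> bool" where
  "square_integrable f \<longleftrightarrow> f \<in> borel_measurable borel \<and> integrable lborel (\<lambda>x. (norm (f x))\<^sup>2)"

definition l2_norm :: "('a::euclidean_space \<Rightarrow> 'b::euclidean_space) \<Rightarrow> real" where
  "l2_norm f = sqrt (LINT x|lborel. (norm (f x))\<^sup>2)"

lemma square_integrable_measurable [measurable_dest]:
  "square_integrable f \<Longrightarrow> f \<in> borel_measurable borel"
  by (simp add: square_integrable_def)

lemma l2_norm_nonneg [simp]: "0 \<le> l2_norm f"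
  by (simp add: l2_norm_def)

lemma l2_norm_power2: "(l2_norm f)\<^sup>2 = (LINT x|lborel. (norm (f x))\<^sup>2)"
  by (simp add: l2_norm_def)

section \<open>Sums, products and the inequalities of Cauchy-Schwarz and Minkowski\<close>

lemma integrable_norm_mult:
  fixes f :: "'a::euclidean_space \<Rightarrow> 'b::euclidean_space" and g :: "'a \<Rightarrow> 'c::euclidean_space"
  assumes "square_integrable f" "square_integrable g"
  shows "integrable lborel (\<lambda>x. norm (f x) * norm (g x))"
proof (rule Bochner_Integration.integrable_bound)
  show "integrable lborel (\<lambda>x. (norm (f x))\<^sup>2 + (norm (g x))\<^sup>2)"
    using assms by (auto simp: square_integrable_def)
  show "(\<lambda>x. norm (f x) * norm (g x)) \<in> borel_measurable lborel"
    using assms by (auto simp: square_integrable_def)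
  have "a * b \<le> a\<^sup>2 + b\<^sup>2" if "a \<ge> 0" "b \<ge> 0" for a b :: real
    using sum_squares_bound[of a b] that mult_nonneg_nonneg[OF that] by linarith
  then show "AE x in lborel. norm (norm (f x) * norm (g x)) \<le> norm ((norm (f x))\<^sup>2 + (norm (g x))\<^sup>2)"
    by simp
qed

lemma square_integrable_add:
  assumes "square_integrable f" "square_integrable g"
  shows "square_integrable (\<lambda>x. f x + g x)"
  unfolding square_integrable_def
proof
  show [measurable]: "(\<lambda>x. f x + g x) \<in> borel_measurable borel"
    using assms by (auto simp: square_integrable_def)
  show "integrable lborel (\<lambda>x. (norm (f x + g x))\<^sup>2)"
  proof (rule Bochner_Integration.integrable_bound)
    show "integrable lborel (\<lambda>x. (norm (f x))\<^sup>2 + 2 * (norm (f x) * norm (g x)) + (norm (g x))\<^sup>2)"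
      using assms integrable_norm_mult[OF assms] by (auto simp: square_integrable_def)
    have "(norm (f x + g x))\<^sup>2 \<le> (norm (f x))\<^sup>2 + 2 * (norm (f x) * norm (g x)) + (norm (g x))\<^sup>2" for x
      using power_mono[OF norm_triangle_ineq[of "f x" "g x"], of 2] by (simp add: power2_eq_square algebra_simps)
    then show "AE x in lborel. norm ((norm (f x + g x))\<^sup>2) \<le>
        norm ((norm (f x))\<^sup>2 + 2 * (norm (f x) * norm (g x)) + (norm (g x))\<^sup>2)"
      by simp
  qed simp
qed

lemma square_integrable_scaleR:
  assumes "square_integrable f"
  shows "square_integrable (\<lambda>x. c *\<^sub>R f x)"
  using assms by (auto simp: square_integrable_def power_mult_distrib)

lemma l2_norm_scaleR: "l2_norm (\<lambda>x. c *\<^sub>R f x) = \<bar>c\<bar> * l2_norm f"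
  by (simp add: l2_norm_def power_mult_distrib real_sqrt_mult)

lemma square_integrable_minus: "square_integrable f \<Longrightarrow> square_integrable (\<lambda>x. - f x)"
  using square_integrable_scaleR[of f "-1"] by simp

lemma square_integrable_diff:
  assumes "square_integrable f" "square_integrable g"
  shows "square_integrable (\<lambda>x. f x - g x)"
  using square_integrable_add[OF assms(1) square_integrable_minus[OF assms(2)]] by simp

text \<open>For positive \<open>A\<close> and \<open>B\<close> the right side is least at
  \<open>t = B / A\<close>, where it equals \<open>2 * A * B\<close>. As \<open>A\<close> or
  \<open>B\<close> may vanish, \<open>t = (B + s) / (A + s)\<close> is inserted instead, with a
  small \<open>s\<close>.\<close>

lemma real_le_mult_of_scaled_squares:
  fixes P A B :: real
  assumes "A \<ge> 0" "B \<ge> 0" and le: "\<And>t. t > 0 \<Longrightarrow> 2 * P \<le> t * A\<^sup>2 + B\<^sup>2 / t"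
  shows "P \<le> A * B"
proof (rule field_le_epsilon)
  fix e :: real assume "e > 0"
  \<comment> \<open>\<open>(B + s) * (A + s)\<close> exceeds \<open>A * B\<close> by
    \<open>s * (A + B) + s * s\<close>. For \<open>s \<le> 1\<close> this is at most
    \<open>s * (A + B + 1)\<close>, and the second bound on \<open>s\<close> makes that at most
    \<open>e\<close>.\<close>
  define s where "s = min 1 (e / (A + B + 1))"
  have s: "s > 0" "s \<le> 1" "s \<le> e / (A + B + 1)" using assms \<open>e > 0\<close> by (simp_all add: s_def)
  have "2 * P \<le> (B + s) / (A + s) * A\<^sup>2 + B\<^sup>2 / ((B + s) / (A + s))"
    using s assms by (intro le) auto
  also have "\<dots> \<le> (B + s) * (A + s) + (B + s) * (A + s)"
  proof (rule add_mono)
    have "A\<^sup>2 \<le> (A + s)\<^sup>2" using s assms by (intro power_mono) auto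
    then have "(B + s) / (A + s) * A\<^sup>2 \<le> (B + s) / (A + s) * (A + s)\<^sup>2"
      using s assms by (intro mult_left_mono) auto
    then show "(B + s) / (A + s) * A\<^sup>2 \<le> (B + s) * (A + s)"
      using s assms by (simp add: power2_eq_square)
    have "B\<^sup>2 \<le> (B + s)\<^sup>2" using s assms by (intro power_mono) auto
    then have "B\<^sup>2 / ((B + s) / (A + s)) \<le> (B + s)\<^sup>2 / ((B + s) / (A + s))"
      using s assms by (intro divide_right_mono) auto
    then show "B\<^sup>2 / ((B + s) / (A + s)) \<le> (B + s) * (A + s)"
      using s assms by (simp add: power2_eq_square)
  qed
  finally have "P \<le> (B + s) * (A + s)" by linarith
  moreover have "s * s \<le> s" using s by (simp add: mult_left_le)
  then have "(B + s) * (A + s) \<le> A * B + s * (A + B + 1)"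
    by (simp add: algebra_simps)
  moreover have "s * (A + B + 1) \<le> e" using assms s(3) by (simp add: le_divide_eq)
  ultimately show "P \<le> A * B + e" by linarith
qed

text \<open>The inequality of arithmetic and geometric means with a free weight \<open>t\<close> is
  integrated, and the weight is optimised afterwards. With norms inside the integral the two
  functions may have different target spaces.\<close>

lemma l2_cauchy_schwarz_norm:
  fixes f :: "'a::euclidean_space \<Rightarrow> 'b::euclidean_space" and g :: "'a \<Rightarrow> 'c::euclidean_space"
  assumes "square_integrable f" "square_integrable g"
  shows "(LINT x|lborel. norm (f x) * norm (g x)) \<le> l2_norm f * l2_norm g"
proof (rule real_le_mult_of_scaled_squares)
  fix t :: real assume t: "t > 0"
  have pw: "2 * (norm (f x) * norm (g x)) \<le> t * (norm (f x))\<^sup>2 + (norm (g x))\<^sup>2 / t" for x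
  proof -
    have "0 \<le> (sqrt t * norm (f x) - norm (g x) / sqrt t)\<^sup>2" by simp
    also have "\<dots> = t * (norm (f x))\<^sup>2 - 2 * (norm (f x) * norm (g x)) + (norm (g x))\<^sup>2 / t"
      using t by (simp add: power2_diff power_mult_distrib power_divide)
    finally show ?thesis by simp
  qed
  have "(LINT x|lborel. 2 * (norm (f x) * norm (g x))) \<le>
      (LINT x|lborel. t * (norm (f x))\<^sup>2 + (norm (g x))\<^sup>2 / t)"
    using assms integrable_norm_mult[OF assms] pw
    by (intro integral_mono) (auto simp: square_integrable_def)
  also have "\<dots> = t * (l2_norm f)\<^sup>2 + (l2_norm g)\<^sup>2 / t"
    using assms by (simp add: l2_norm_power2 square_integrable_def)
  finally show "2 * (LINT x|lborel. norm (f x) * norm (g x)) \<le> t * (l2_norm f)\<^sup>2 + (l2_norm g)\<^sup>2 / t"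
    by simp
qed auto

lemma integrable_inner_l2:
  assumes "square_integrable f" "square_integrable g"
  shows "integrable lborel (\<lambda>x. f x \<bullet> g x)"
  using assms
  by (intro Bochner_Integration.integrable_bound[OF integrable_norm_mult[OF assms]])
     (auto simp: square_integrable_def Cauchy_Schwarz_ineq2)

lemma l2_cauchy_schwarz:
  assumes "square_integrable f" "square_integrable g"
  shows "\<bar>LINT x|lborel. f x \<bullet> g x\<bar> \<le> l2_norm f * l2_norm g"
proof -
  have "\<bar>LINT x|lborel. f x \<bullet> g x\<bar> \<le> (LINT x|lborel. norm (f x) * norm (g x))"
    using integral_abs_bound[of lborel "\<lambda>x. f x \<bullet> g x"]
      integral_mono[OF integrable_abs[OF integrable_inner_l2[OF assms]] integrable_norm_mult[OF assms]]
      Cauchy_Schwarz_ineq2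
    by (meson order_trans)
  then show ?thesis using l2_cauchy_schwarz_norm[OF assms] by simp
qed

lemma l2_norm_triangle:
  assumes "square_integrable f" "square_integrable g"
  shows "l2_norm (\<lambda>x. f x + g x) \<le> l2_norm f + l2_norm g"
proof (rule power2_le_imp_le)
  have "(l2_norm (\<lambda>x. f x + g x))\<^sup>2 = (LINT x|lborel. (norm (f x + g x))\<^sup>2)"
    by (rule l2_norm_power2)
  also have "\<dots> \<le> (LINT x|lborel. (norm (f x))\<^sup>2 + 2 * (norm (f x) * norm (g x)) + (norm (g x))\<^sup>2)"
  proof (rule integral_mono)
    show "(norm (f x + g x))\<^sup>2 \<le> (norm (f x))\<^sup>2 + 2 * (norm (f x) * norm (g x)) + (norm (g x))\<^sup>2" for x
      using power_mono[OF norm_triangle_ineq[of "f x" "g x"], of 2] by (simp add: power2_eq_square algebra_simps)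
  qed (use assms integrable_norm_mult[OF assms] square_integrable_add[OF assms] in
        \<open>auto simp: square_integrable_def\<close>)
  also have "\<dots> = (l2_norm f)\<^sup>2 + 2 * (LINT x|lborel. norm (f x) * norm (g x)) + (l2_norm g)\<^sup>2"
    using assms integrable_norm_mult[OF assms] by (simp add: square_integrable_def l2_norm_power2)
  also have "\<dots> \<le> (l2_norm f + l2_norm g)\<^sup>2"
    using l2_cauchy_schwarz_norm[OF assms] by (simp add: power2_eq_square algebra_simps)
  finally show "(l2_norm (\<lambda>x. f x + g x))\<^sup>2 \<le> (l2_norm f + l2_norm g)\<^sup>2" .
qed simp

lemma l2_norm_minus: "l2_norm (\<lambda>x. - f x) = l2_norm f"
  by (simp add: l2_norm_def)

lemma l2_norm_diff_commute: "l2_norm (\<lambda>x. f x - g x) = l2_norm (\<lambda>x. g x - f x)"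
  by (simp add: l2_norm_def norm_minus_commute)

lemma l2_norm_triangle_sub:
  assumes "square_integrable f" "square_integrable g" "square_integrable h"
  shows "l2_norm (\<lambda>x. f x - h x) \<le> l2_norm (\<lambda>x. f x - g x) + l2_norm (\<lambda>x. g x - h x)"
  using l2_norm_triangle[of "\<lambda>x. f x - g x" "\<lambda>x. g x - h x"] assms square_integrable_diff
  by fastforce

lemma l2_norm_mono:
  assumes "square_integrable g" "f \<in> borel_measurable borel" "\<And>x. norm (f x) \<le> norm (g x)"
  shows "square_integrable f" "l2_norm f \<le> l2_norm g"
proof -
  have pw: "(norm (f x))\<^sup>2 \<le> (norm (g x))\<^sup>2" for x using assms(3) by (intro power_mono) auto
  then show *: "square_integrable f"
    using assms unfolding square_integrable_def
    by (auto intro!: Bochner_Integration.integrable_bound[of _ "\<lambda>x. (norm (g x))\<^sup>2" "\<lambda>x. (norm (f x))\<^sup>2"])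
  show "l2_norm f \<le> l2_norm g"
    unfolding l2_norm_def real_sqrt_le_iff using * assms pw
    by (intro integral_mono) (auto simp: square_integrable_def)
qed

section \<open>Functions of bounded support and completeness\<close>

lemma integrable_bounded_support:
  fixes f :: "'a::euclidean_space \<Rightarrow> 'b::{banach,second_countable_topology}"
  assumes [measurable]: "f \<in> borel_measurable borel" and "\<And>x. norm (f x) \<le> M" "\<And>x. x \<notin> cball 0 R \<Longrightarrow> f x = 0"
  shows "integrable lborel f"
proof (rule Bochner_Integration.integrable_bound)
  show "integrable lborel (\<lambda>x. M * indicator (cball (0::'a) R) x)"
    using emeasure_bounded_finite[of "cball (0::'a) R"] by (intro integrable_mult_right integrable_real_indicator) auto
  show "AE x in lborel. norm (f x) \<le> norm (M * indicator (cball 0 R) x)"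
  proof (rule AE_I2)
    fix x show "norm (f x) \<le> norm (M * indicator (cball 0 R) x)"
      using assms(2)[of x] assms(3)[of x] by (cases "x \<in> cball 0 R") (auto simp: indicator_def)
  qed
qed simp

lemma square_integrable_bounded_support:
  fixes f :: "'a::euclidean_space \<Rightarrow> 'b::euclidean_space"
  assumes [measurable]: "f \<in> borel_measurable borel" and bd: "\<And>x. norm (f x) \<le> M" "\<And>x. x \<notin> cball 0 R \<Longrightarrow> f x = 0"
  shows "square_integrable f" "l2_norm f \<le> M * sqrt (measure lborel (cball (0::'a) R))"
proof -
  have M: "M \<ge> 0" using bd(1) norm_ge_zero order_trans by blast
  have 1: "(norm (f x))\<^sup>2 \<le> M\<^sup>2 * indicator (cball 0 R) x" for x
    using bd(1)[of x] bd(2)[of x] power_mono[of "norm (f x)" M 2] by (cases "x \<in> cball 0 R") auto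
  have i: "integrable lborel (\<lambda>x. M\<^sup>2 * indicator (cball (0::'a) R) x)"
    using emeasure_bounded_finite[of "cball (0::'a) R"] by (intro integrable_mult_right integrable_real_indicator) auto
  have i2: "integrable lborel (\<lambda>x. (norm (f x))\<^sup>2)"
    using 1 by (intro Bochner_Integration.integrable_bound[OF i]) (auto intro: order_trans[OF _ abs_ge_self])
  then show "square_integrable f" by (simp add: square_integrable_def)
  have "(LINT x|lborel. (norm (f x))\<^sup>2) \<le> (LINT x|lborel. M\<^sup>2 * indicator (cball (0::'a) R) x)"
    using 1 by (intro integral_mono i i2)
  also have "\<dots> = M\<^sup>2 * measure lborel (cball (0::'a) R)" by simp
  finally have "l2_norm f \<le> sqrt (M\<^sup>2 * measure lborel (cball (0::'a) R))"
    by (simp add: l2_norm_def)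
  then show "l2_norm f \<le> M * sqrt (measure lborel (cball (0::'a) R))"
    using M by (simp add: real_sqrt_mult)
qed

lemma square_integrable_imp_integrable:
  fixes f :: "'a::euclidean_space \<Rightarrow> 'b::euclidean_space"
  assumes sq: "square_integrable f" and supp: "\<And>x. x \<notin> cball 0 R \<Longrightarrow> f x = 0"
  shows "integrable lborel f"
proof -
  have [measurable]: "f \<in> borel_measurable borel" using sq by (rule square_integrable_measurable)
  have sq1: "square_integrable (indicator (cball (0::'a) R) :: 'a \<Rightarrow> real)"
    by (rule square_integrable_bounded_support(1)[of _ 1 R])
       (auto intro: borel_measurable_indicator simp: indicator_def)
  show ?thesis
    by (rule Bochner_Integration.integrable_bound[OF integrable_norm_mult[OF sq sq1]])
       (use supp in \<open>auto simp: indicator_def\<close>)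
qed

text \<open>Along a subsequence the squared increments are at most \<open>4\<^sup>-\<^sup>k\<close> in mean, so they are summable
  against the weights \<open>2\<^sup>k\<close> almost everywhere; the limit function is then square integrable by Fatou.\<close>

lemma l2_complete:
  fixes g :: "nat \<Rightarrow> 'a::euclidean_space \<Rightarrow> 'b::euclidean_space"
  assumes sq: "\<And>n. square_integrable (g n)"
    and cauchy: "\<And>e. e > 0 \<Longrightarrow> \<exists>N. \<forall>m\<ge>N. \<forall>n\<ge>N. l2_norm (\<lambda>x. g m x - g n x) < e"
  obtains h where "square_integrable h" "(\<lambda>n. l2_norm (\<lambda>x. g n x - h x)) \<longlonglongrightarrow> 0"
proof -
  have [measurable]: "g n \<in> borel_measurable borel" for n using sq by (rule square_integrable_measurable)
  have "\<forall>k. \<exists>N. \<forall>m\<ge>N. \<forall>n\<ge>N. l2_norm (\<lambda>x. g m x - g n x) < (1/2)^k"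
    using cauchy by simp
  then obtain N where N: "\<And>k m n. m \<ge> N k \<Longrightarrow> n \<ge> N k \<Longrightarrow> l2_norm (\<lambda>x. g m x - g n x) < (1/2)^k"
    by metis
  \<comment> \<open>The sum puts \<open>r k\<close> beyond \<open>N k\<close> and makes
    \<open>r\<close> nondecreasing, so that \<open>r k\<close> and \<open>r (Suc k)\<close> both lie
    beyond \<open>N k\<close>; the summand \<open>k\<close> makes \<open>r\<close> tend to
    infinity.\<close>
  define r where "r k = (\<Sum>i\<le>k. N i) + k" for k
  have rN: "r k \<ge> N k" for k unfolding r_def by (simp add: member_le_sum trans_le_add1)
  have rmono: "r k \<le> r (Suc k)" for k by (simp add: r_def)
  have rk: "r k \<ge> k" for k by (simp add: r_def)
  define d where "d k x = (norm (g (r (Suc k)) x - g (r k) x))\<^sup>2" for k x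
  have dint: "integrable lborel (d k)" for k
    unfolding d_def using square_integrable_diff[OF sq sq] by (simp add: square_integrable_def)
  have [measurable]: "d k \<in> borel_measurable borel" for k unfolding d_def by measurable
  have dle: "(LINT x|lborel. d k x) \<le> (1/4)^k" for k
  proof -
    have "l2_norm (\<lambda>x. g (r (Suc k)) x - g (r k) x) \<le> (1/2)^k"
      using N[of k "r (Suc k)" "r k"] rN[of k] rmono[of k] by auto
    then have "(l2_norm (\<lambda>x. g (r (Suc k)) x - g (r k) x))\<^sup>2 \<le> ((1/2)^k)\<^sup>2"
      by (intro power_mono) auto
    also have "((1/2)^k)\<^sup>2 = (1/4::real)^k" by (simp add: power2_eq_square power_mult_distrib[symmetric])
    finally show ?thesis unfolding l2_norm_power2 d_def .
  qed
  have "(\<integral>\<^sup>+x. (\<Sum>k. ennreal (2^k * d k x)) \<partial>lborel) = (\<Sum>k. \<integral>\<^sup>+x. ennreal (2^k * d k x) \<partial>lborel)"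
    by (rule nn_integral_suminf) simp
  also have "\<dots> \<le> (\<Sum>k. ennreal ((1/2)^k))"
  proof (rule suminf_le)
    fix k
    have "(\<integral>\<^sup>+x. ennreal (2^k * d k x) \<partial>lborel) = ennreal (LINT x|lborel. 2^k * d k x)"
      by (intro nn_integral_eq_integral integrable_mult_right dint) (simp add: d_def)
    also have "\<dots> \<le> ennreal ((1/2)^k)"
    proof (rule ennreal_leI)
      have "(LINT x|lborel. 2^k * d k x) \<le> 2^k * (1/4)^k"
        using dle[of k] by simp
      also have "\<dots> = (1/2::real)^k" by (simp add: power_mult_distrib[symmetric])
      finally show "(LINT x|lborel. 2^k * d k x) \<le> (1/2)^k" .
    qed
    finally show "(\<integral>\<^sup>+x. ennreal (2^k * d k x) \<partial>lborel) \<le> ennreal ((1/2)^k)" .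
  qed auto
  also have "\<dots> = ennreal (\<Sum>k. (1/2)^k)"
    by (intro suminf_ennreal2) (auto intro: summable_geometric)
  also have "\<dots> < top" by simp
  finally have fin: "(\<integral>\<^sup>+x. (\<Sum>k. ennreal (2^k * d k x)) \<partial>lborel) \<noteq> \<infinity>" by simp
  have "AE x in lborel. (\<Sum>k. ennreal (2^k * d k x)) \<noteq> \<infinity>"
    by (rule nn_integral_noteq_infinite[OF _ fin]) simp
  then have conv: "AE x in lborel. convergent (\<lambda>k. g (r k) x)"
  proof (rule AE_mp, intro AE_I2 impI)
    fix x assume x: "(\<Sum>k. ennreal (2^k * d k x)) \<noteq> \<infinity>"
    have s: "summable (\<lambda>k. 2^k * d k x)"
      by (rule summable_suminf_not_top) (use x in \<open>auto simp: d_def\<close>)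
    have dnn: "d k x \<ge> 0" for k by (simp add: d_def)
    define c where "c = (\<Sum>k. 2^k * d k x)"
    have c: "2^k * d k x \<le> c" for k
      unfolding c_def using sum_le_suminf[OF s, of "{k}"] dnn by auto
    \<comment> \<open>Each term of the weighted series is at most its sum \<open>c\<close>, so the
      increments decay geometrically with ratio \<open>sqrt (1/2)\<close>.\<close>
    have nle: "norm (g (r (Suc k)) x - g (r k) x) \<le> sqrt c * (sqrt (1/2))^k" for k
    proof -
      have "d k x \<le> c * (1/2)^k" using c[of k] by (simp add: field_simps)
      then have "sqrt (d k x) \<le> sqrt (c * (1/2)^k)" by simp
      then show ?thesis by (simp add: d_def real_sqrt_mult real_sqrt_power)
    qed
    have "summable (\<lambda>k. sqrt c * (sqrt (1/2))^k)"
      by (intro summable_mult summable_geometric) simp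
    then have "summable (\<lambda>k. g (r (Suc k)) x - g (r k) x)"
      by (rule summable_comparison_test') (use nle in auto)
    then have "convergent (\<lambda>n. \<Sum>k<n. g (r (Suc k)) x - g (r k) x)"
      by (simp add: summable_iff_convergent)
    moreover have "(\<lambda>n. \<Sum>k<n. g (r (Suc k)) x - g (r k) x) = (\<lambda>n. g (r n) x - g (r 0) x)"
      by (rule ext) (rule sum_lessThan_telescope)
    ultimately have "convergent (\<lambda>n. g (r n) x - g (r 0) x)" by simp
    from convergent_add[OF this convergent_const[of "g (r 0) x"]]
    show "convergent (\<lambda>k. g (r k) x)" by simp
  qed
  define h where "h x = lim (\<lambda>k. g (r k) x)" for x
  have [measurable]: "h \<in> borel_measurable borel" unfolding h_def by measurable
  have lim: "AE x in lborel. (\<lambda>k. g (r k) x) \<longlonglongrightarrow> h x"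
    using conv by (simp add: h_def convergent_LIMSEQ_iff)
  have fatou: "(\<integral>\<^sup>+x. ennreal ((norm (g n x - h x))\<^sup>2) \<partial>lborel) \<le> ennreal (e\<^sup>2)"
    if e: "e > 0" and M: "\<And>m n. m \<ge> M \<Longrightarrow> n \<ge> M \<Longrightarrow> l2_norm (\<lambda>x. g m x - g n x) < e" and n: "n \<ge> M" for e M n
  proof -
    have "(\<integral>\<^sup>+x. ennreal ((norm (g n x - h x))\<^sup>2) \<partial>lborel)
        = (\<integral>\<^sup>+x. liminf (\<lambda>k. ennreal ((norm (g n x - g (r k) x))\<^sup>2)) \<partial>lborel)"
    proof (rule nn_integral_cong_AE, rule AE_mp[OF lim], intro AE_I2 impI)
      fix x assume "(\<lambda>k. g (r k) x) \<longlonglongrightarrow> h x"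
      then have "(\<lambda>k. ennreal ((norm (g n x - g (r k) x))\<^sup>2)) \<longlonglongrightarrow> ennreal ((norm (g n x - h x))\<^sup>2)"
        by (intro tendsto_intros)
      then show "ennreal ((norm (g n x - h x))\<^sup>2) = liminf (\<lambda>k. ennreal ((norm (g n x - g (r k) x))\<^sup>2))"
          by (rule lim_imp_Liminf[OF trivial_limit_sequentially, symmetric])
    qed
    also have "\<dots> \<le> liminf (\<lambda>k. \<integral>\<^sup>+x. ennreal ((norm (g n x - g (r k) x))\<^sup>2) \<partial>lborel)"
      by (rule nn_integral_liminf) measurable
    also have "\<dots> \<le> ennreal (e\<^sup>2)"
    proof (rule Liminf_le)
      show "\<forall>\<^sub>F k in sequentially. (\<integral>\<^sup>+x. ennreal ((norm (g n x - g (r k) x))\<^sup>2) \<partial>lborel) \<le> ennreal (e\<^sup>2)"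
      proof (rule eventually_sequentiallyI[of M])
        fix k assume "k \<ge> M"
        then have "l2_norm (\<lambda>x. g n x - g (r k) x) < e" using M n rk[of k] by simp
        then have "(l2_norm (\<lambda>x. g n x - g (r k) x))\<^sup>2 \<le> e\<^sup>2" by (intro power_mono) auto
        moreover have "(\<integral>\<^sup>+x. ennreal ((norm (g n x - g (r k) x))\<^sup>2) \<partial>lborel) = ennreal ((l2_norm (\<lambda>x. g n x - g (r k) x))\<^sup>2)"
          unfolding l2_norm_power2
          using square_integrable_diff[OF sq sq] by (intro nn_integral_eq_integral) (auto simp: square_integrable_def)
        ultimately show "(\<integral>\<^sup>+x. ennreal ((norm (g n x - g (r k) x))\<^sup>2) \<partial>lborel) \<le> ennreal (e\<^sup>2)"
          by (simp add: ennreal_leI)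
      qed
    qed simp
    finally show ?thesis .
  qed
  have diffsq: "square_integrable (\<lambda>x. g n x - h x) \<and> l2_norm (\<lambda>x. g n x - h x) \<le> e"
    if e: "e > 0" and M: "\<And>m n. m \<ge> M \<Longrightarrow> n \<ge> M \<Longrightarrow> l2_norm (\<lambda>x. g m x - g n x) < e" and n: "n \<ge> M" for e M n
  proof -
    note f = fatou[OF that]
    have i: "integrable lborel (\<lambda>x. (norm (g n x - h x))\<^sup>2)"
    proof (rule integrableI_bounded)
      show "(\<integral>\<^sup>+x. ennreal (norm ((norm (g n x - h x))\<^sup>2)) \<partial>lborel) < \<infinity>"
        using le_less_trans[OF f ennreal_less_top] by simp
    qed simp
    then have "ennreal ((l2_norm (\<lambda>x. g n x - h x))\<^sup>2) \<le> ennreal (e\<^sup>2)"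
      using f unfolding l2_norm_power2 by (subst nn_integral_eq_integral[symmetric]) auto
    then have "(l2_norm (\<lambda>x. g n x - h x))\<^sup>2 \<le> e\<^sup>2" by (simp add: ennreal_le_iff)
    then have "l2_norm (\<lambda>x. g n x - h x) \<le> e" by (rule power2_le_imp_le) (use e in simp)
    then show ?thesis using i by (simp add: square_integrable_def)
  qed
  have "square_integrable (\<lambda>x. g (N 0) x - h x)"
    using diffsq[OF zero_less_one, of "N 0" "N 0"] N[of 0] by simp
  from square_integrable_diff[OF sq this, of "N 0"] have "square_integrable h" by simp
  moreover have "(\<lambda>n. l2_norm (\<lambda>x. g n x - h x)) \<longlonglongrightarrow> 0"
  proof (rule LIMSEQ_I)
    fix e :: real assume e: "e > 0"
    then have "e/2 > 0" by simp
    from cauchy[OF this] obtain M where "\<forall>m\<ge>M. \<forall>n\<ge>M. l2_norm (\<lambda>x. g m x - g n x) < e/2" ..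
    then have M: "\<And>m n. m \<ge> M \<Longrightarrow> n \<ge> M \<Longrightarrow> l2_norm (\<lambda>x. g m x - g n x) < e/2" by blast
    have "l2_norm (\<lambda>x. g n x - h x) < e" if "n \<ge> M" for n
      using diffsq[OF \<open>e/2 > 0\<close> M that] e by linarith
    then show "\<exists>no. \<forall>n\<ge>no. norm (l2_norm (\<lambda>x. g n x - h x) - 0) < e"
      by auto
  qed
  ultimately show ?thesis by (rule that)
qed

section \<open>Continuously differentiable functions and integration by parts\<close>

text \<open>The gradient is an explicit argument and its continuity is part of the notion, so that
  C^1 functions can be combined without computing with \<open>frechet_derivative\<close>.\<close>

definition has_grad :: "('a::euclidean_space \<Rightarrow> real) \<Rightarrow> ('a \<Rightarrow> 'a) \<Rightarrow> bool" where
  "has_grad f r \<longleftrightarrow> (\<forall>x. (f has_derivative (\<lambda>v. r x \<bullet> v)) (at x)) \<and> continuous_on UNIV r"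

lemma has_gradD: "has_grad f r \<Longrightarrow> (f has_derivative (\<lambda>v. r x \<bullet> v)) (at x)"
  by (simp add: has_grad_def)

lemma has_grad_continuous_grad: "has_grad f r \<Longrightarrow> continuous_on UNIV r"
  by (simp add: has_grad_def)

lemma has_grad_continuous: "has_grad f r \<Longrightarrow> continuous_on UNIV f"
  by (meson has_gradD has_derivative_continuous continuous_at_imp_continuous_on)

lemma gradient_eqI: "(f has_derivative (\<lambda>v. g \<bullet> v)) (at x) \<Longrightarrow> gradient f x = g"
  unfolding gradient_def by (subst frechet_derivative_at[symmetric]) (auto simp: euclidean_representation)

lemma has_grad_gradient: "has_grad f r \<Longrightarrow> gradient f = r"
  by (intro ext gradient_eqI has_gradD)

lemma has_grad_add:
  assumes "has_grad f r" "has_grad g s"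
  shows "has_grad (\<lambda>x. f x + g x) (\<lambda>x. r x + s x)"
  using assms unfolding has_grad_def
  by (auto intro!: derivative_eq_intros continuous_intros simp: inner_add_left)

lemma has_grad_cmult:
  assumes "has_grad f r"
  shows "has_grad (\<lambda>x. c * f x) (\<lambda>x. c *\<^sub>R r x)"
  using assms unfolding has_grad_def
  by (auto intro!: derivative_eq_intros continuous_intros)

lemma has_grad_diff:
  assumes "has_grad f r" "has_grad g s"
  shows "has_grad (\<lambda>x. f x - g x) (\<lambda>x. r x - s x)"
  using has_grad_add[OF assms(1) has_grad_cmult[OF assms(2), of "-1"]] by simp

lemma has_grad_mult:
  assumes f: "has_grad f r" and g: "has_grad g s"
  shows "has_grad (\<lambda>x. f x * g x) (\<lambda>x. f x *\<^sub>R s x + g x *\<^sub>R r x)"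
  using assms has_grad_continuous[OF f] has_grad_continuous[OF g] unfolding has_grad_def
  by (auto intro!: derivative_eq_intros continuous_intros simp: inner_add_left)

lemma has_grad_affine:
  assumes "has_grad f r"
  shows "has_grad (\<lambda>x. f (a + c *\<^sub>R x)) (\<lambda>x. c *\<^sub>R r (a + c *\<^sub>R x))"
  unfolding has_grad_def
proof (intro conjI allI)
  fix x
  have "((\<lambda>x. a + c *\<^sub>R x) has_derivative (\<lambda>v. c *\<^sub>R v)) (at x)"
    by (auto intro!: derivative_eq_intros)
  from has_derivative_compose[OF this has_gradD[OF assms]]
  have "((\<lambda>x. f (a + c *\<^sub>R x)) has_derivative (\<lambda>v. r (a + c *\<^sub>R x) \<bullet> (c *\<^sub>R v))) (at x)" .
  moreover have "(\<lambda>v. r (a + c *\<^sub>R x) \<bullet> (c *\<^sub>R v)) = (\<bullet>) (c *\<^sub>R r (a + c *\<^sub>R x))"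
    by (simp add: fun_eq_iff)
  ultimately show "((\<lambda>x. f (a + c *\<^sub>R x)) has_derivative (\<bullet>) (c *\<^sub>R r (a + c *\<^sub>R x))) (at x)"
    by simp
  show "continuous_on UNIV (\<lambda>x. c *\<^sub>R r (a + c *\<^sub>R x))"
    by (intro continuous_intros continuous_on_compose2[OF has_grad_continuous_grad[OF assms]]) auto
qed

lemma has_grad_translate: "has_grad f r \<Longrightarrow> has_grad (\<lambda>x. f (x - a)) (\<lambda>x. r (x - a))"
  using has_grad_affine[of f r "-a" 1] by simp

lemma has_grad_reflect: "has_grad f r \<Longrightarrow> has_grad (\<lambda>x. f (a - x)) (\<lambda>x. - r (a - x))"
  using has_grad_affine[of f r a "-1"] by simp

lemma has_grad_eq_0_on_open:
  assumes "has_grad f r" "open S" "\<And>x. x \<in> S \<Longrightarrow> f x = 0" "x \<in> S"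
  shows "r x = 0"
proof -
  have "((\<lambda>x. 0) has_derivative (\<lambda>v. r x \<bullet> v)) (at x)"
    using has_derivative_transform_within_open[OF has_gradD[OF assms(1)] assms(2,4)] assms(3) by auto
  then have "(\<lambda>v. r x \<bullet> v) = (\<lambda>v. 0)" using has_derivative_unique has_derivative_const by blast
  then have "r x \<bullet> r x = 0" by metis
  then show ?thesis by simp
qed

lemma has_grad_support:
  assumes "has_grad f r" "\<And>x. x \<notin> cball 0 R \<Longrightarrow> f x = 0" "x \<notin> cball 0 R"
  shows "r x = 0"
  using has_grad_eq_0_on_open[OF assms(1), of "- cball 0 R"] assms(2,3) by auto

text \<open>Uniform continuity of the gradient on a compact ball makes the linearisation error
  uniform in the base point. This is what allows differentiation under the integral sign against
  weights that are merely integrable.\<close>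

lemma has_grad_uniform_linearization:
  fixes f :: "'a::euclidean_space \<Rightarrow> real"
  assumes "has_grad f r" "e > 0"
  obtains d where "d > 0" "\<And>z v. z \<in> cball 0 R \<Longrightarrow> norm v < d \<Longrightarrow> \<bar>f (z + v) - f z - r z \<bullet> v\<bar> \<le> e * norm v"
proof -
  \<comment> \<open>The radius grows by 1 because \<open>z + v\<close> may leave the ball in which
    \<open>z\<close> lies.\<close>
  have "uniformly_continuous_on (cball 0 (R + 1)) r"
    using has_grad_continuous_grad[OF assms(1)] by (intro compact_uniformly_continuous) (auto intro: continuous_on_subset)
  then obtain d where d: "d > 0" "\<And>x y. x \<in> cball 0 (R+1) \<Longrightarrow> y \<in> cball 0 (R+1) \<Longrightarrow> dist y x < d \<Longrightarrow> dist (r y) (r x) < e"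
    using \<open>e > 0\<close> unfolding uniformly_continuous_on_def by metis
  show ?thesis
  proof (rule that[of "min 1 d"])
    fix z v :: 'a assume z: "z \<in> cball 0 R" and v: "norm v < min 1 d"
    have "norm (f (z + v) - f z - r z \<bullet> (z + v - z)) \<le> norm (z + v - z) * e"
    proof (rule differentiable_bound_linearization[where S = "ball z (min 1 d)" and f' = "\<lambda>x v. r x \<bullet> v"])
      fix t :: real assume t: "t \<in> {0..1}"
      have "norm (t *\<^sub>R v) \<le> 1 * norm v" using t unfolding norm_scaleR by (intro mult_right_mono) auto
      then show "z + t *\<^sub>R (z + v - z) \<in> ball z (min 1 d)" using v by (simp add: dist_norm)
    next
      show "(f has_derivative (\<bullet>) (r x)) (at x within ball z (min 1 d))" for x
        using has_gradD[OF assms(1)] by (rule has_derivative_at_withinI)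
      show "z \<in> ball z (min 1 d)" using d by simp
      fix x assume x: "x \<in> ball z (min 1 d)"
      then have "norm x \<le> R + 1" using z norm_triangle_ineq2[of x z] by (auto simp: dist_norm norm_minus_commute)
      then have "norm (r x - r z) \<le> e"
        using d(2)[of z x] x z by (auto simp: dist_norm norm_minus_commute less_imp_le)
      then have "onorm (\<lambda>v. r x \<bullet> v - r z \<bullet> v) \<le> e"
        by (intro onorm_le) (metis inner_diff_left Cauchy_Schwarz_ineq2 order_trans mult_right_mono norm_ge_zero real_norm_def)
      then show "onorm ((\<bullet>) (r x) - (\<bullet>) (r z)) \<le> e"
        by (simp add: fun_diff_def)
    qed
    then show "\<bar>f (z + v) - f z - r z \<bullet> v\<bar> \<le> e * norm v"
      by (simp add: mult.commute)
  qed (use d in auto)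
qed

section \<open>Continuous kernels and integrals depending on a parameter\<close>

lemma continuous_bounded_on_cball:
  fixes f :: "'a::euclidean_space \<Rightarrow> 'b::real_normed_vector"
  assumes "continuous_on UNIV f"
  obtains B where "B > 0" "\<And>x. x \<in> cball 0 R \<Longrightarrow> norm (f x) \<le> B"
proof -
  have "compact (f ` cball 0 R)"
    using assms by (intro compact_continuous_image) (auto intro: continuous_on_subset)
  then have "bounded (f ` cball 0 R)" by (rule compact_imp_bounded)
  then show ?thesis using that unfolding bounded_pos by blast
qed

lemma borel_measurable_continuous: "continuous_on UNIV f \<Longrightarrow> f \<in> borel_measurable borel"
  by (rule borel_measurable_continuous_onI)

lemma integrable_continuous_scaleR:
  fixes \<kappa> :: "'c::euclidean_space \<Rightarrow> real" and w :: "'c \<Rightarrow> 'b::euclidean_space"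
  assumes \<kappa>: "continuous_on UNIV \<kappa>" and w: "integrable lborel w" and supp: "\<And>y. y \<notin> cball 0 R \<Longrightarrow> w y = 0"
  shows "integrable lborel (\<lambda>y. \<kappa> y *\<^sub>R w y)"
proof -
  obtain B where B: "B > 0" "\<And>y. y \<in> cball 0 R \<Longrightarrow> norm (\<kappa> y) \<le> B"
    using continuous_bounded_on_cball[OF \<kappa>] by metis
  have [measurable]: "w \<in> borel_measurable borel" "\<kappa> \<in> borel_measurable borel"
    using w \<kappa> by (auto dest: borel_measurable_integrable intro: borel_measurable_continuous)
  show ?thesis
  proof (rule Bochner_Integration.integrable_bound)
    show "integrable lborel (\<lambda>y. B *\<^sub>R w y)" using w by simp
    show "AE y in lborel. norm (\<kappa> y *\<^sub>R w y) \<le> norm (B *\<^sub>R w y)"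
    proof (rule AE_I2)
      fix y show "norm (\<kappa> y *\<^sub>R w y) \<le> norm (B *\<^sub>R w y)"
        using B supp by (cases "y \<in> cball 0 R") (auto intro!: mult_right_mono)
    qed
  qed simp
qed

lemma integrable_continuous_bounded_support:
  fixes f :: "'a::euclidean_space \<Rightarrow> 'b::euclidean_space"
  assumes "continuous_on UNIV f" "\<And>x. x \<notin> cball 0 R \<Longrightarrow> f x = 0"
  shows "integrable lborel f"
proof -
  obtain B where B: "B > 0" "\<And>y. y \<in> cball 0 R \<Longrightarrow> norm (f y) \<le> B"
    using continuous_bounded_on_cball[OF assms(1)] by metis
  show ?thesis
  proof (rule integrable_bounded_support[of f B R])
    show "norm (f x) \<le> B" for x using B assms(2)[of x] by (cases "x \<in> cball 0 R") auto
  qed (use assms borel_measurable_continuous in auto)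
qed

lemma square_integrable_continuous_bounded_support:
  fixes f :: "'a::euclidean_space \<Rightarrow> 'b::euclidean_space"
  assumes "continuous_on UNIV f" "\<And>x. x \<notin> cball 0 R \<Longrightarrow> f x = 0"
  shows "square_integrable f"
proof -
  obtain B where B: "B > 0" "\<And>y. y \<in> cball 0 R \<Longrightarrow> norm (f y) \<le> B"
    using continuous_bounded_on_cball[OF assms(1)] by metis
  show ?thesis
  proof (rule square_integrable_bounded_support(1)[of f B R])
    show "norm (f x) \<le> B" for x using B assms(2)[of x] by (cases "x \<in> cball 0 R") auto
  qed (use assms borel_measurable_continuous in auto)
qed

lemma continuous_kernel_integral:
  fixes \<kappa> :: "'a::euclidean_space \<Rightarrow> 'c::euclidean_space \<Rightarrow> real" and w :: "'c \<Rightarrow> 'b::euclidean_space"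
  assumes \<kappa>: "continuous_on UNIV (\<lambda>(x, y). \<kappa> x y)" and w: "integrable lborel w"
    and supp: "\<And>y. y \<notin> cball 0 R \<Longrightarrow> w y = 0"
  shows "continuous_on UNIV (\<lambda>x. LINT y|lborel. \<kappa> x y *\<^sub>R w y)"
proof (rule continuous_on_sequentiallyI)
  fix u :: "nat \<Rightarrow> 'a" and a assume u: "u \<longlonglongrightarrow> a"
  have \<kappa>x: "continuous_on UNIV (\<kappa> x)" for x
  proof -
    have "continuous_on UNIV (\<lambda>y. (x, y))" by (intro continuous_intros)
    from continuous_on_compose2[OF \<kappa> this] show ?thesis by simp
  qed
  have [measurable]: "w \<in> borel_measurable borel" "\<And>x. \<kappa> x \<in> borel_measurable borel"
    using w \<kappa>x by (auto dest: borel_measurable_integrable intro: borel_measurable_continuous)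
  have "bounded (range u)" using u by (rule convergent_imp_bounded)
  then obtain S where S: "\<And>n. norm (u n) \<le> S" unfolding bounded_iff by auto
  obtain B where B: "B > 0" "\<And>z. z \<in> cball 0 S \<times> cball 0 R \<Longrightarrow> norm (\<kappa> (fst z) (snd z)) \<le> B"
  proof -
    have "compact ((\<lambda>(x, y). \<kappa> x y) ` (cball 0 S \<times> cball 0 R))"
      using \<kappa> by (intro compact_continuous_image compact_Times) (auto intro: continuous_on_subset)
    then have "bounded ((\<lambda>(x, y). \<kappa> x y) ` (cball 0 S \<times> cball 0 R))" by (rule compact_imp_bounded)
    then show ?thesis using that unfolding bounded_pos by (auto simp: case_prod_beta)
  qed
  show "(\<lambda>n. LINT y|lborel. \<kappa> (u n) y *\<^sub>R w y) \<longlonglongrightarrow> (LINT y|lborel. \<kappa> a y *\<^sub>R w y)"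
  proof (rule integral_dominated_convergence[where w = "\<lambda>y. B * norm (w y)"])
    show "integrable lborel (\<lambda>y. B * norm (w y))" using w by simp
    show "AE y in lborel. (\<lambda>n. \<kappa> (u n) y *\<^sub>R w y) \<longlonglongrightarrow> \<kappa> a y *\<^sub>R w y"
    proof (rule AE_I2)
      fix y
      have "continuous_on UNIV (\<lambda>x. \<kappa> x y)"
      proof -
        have "continuous_on UNIV (\<lambda>x. (x, y))" by (intro continuous_intros)
        from continuous_on_compose2[OF \<kappa> this] show ?thesis by simp
      qed
      then have "(\<lambda>n. \<kappa> (u n) y) \<longlonglongrightarrow> \<kappa> a y"
        using u continuous_on_tendsto_compose[of UNIV "\<lambda>x. \<kappa> x y" u a] by simp
      then show "(\<lambda>n. \<kappa> (u n) y *\<^sub>R w y) \<longlonglongrightarrow> \<kappa> a y *\<^sub>R w y"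
        by (intro tendsto_intros)
    qed
    show "AE y in lborel. norm (\<kappa> (u n) y *\<^sub>R w y) \<le> B * norm (w y)" for n
    proof (rule AE_I2)
      fix y show "norm (\<kappa> (u n) y *\<^sub>R w y) \<le> B * norm (w y)"
        using B(2)[of "(u n, y)"] S[of n] supp[of y] by (cases "y \<in> cball 0 R") (auto intro!: mult_right_mono)
    qed
  qed auto
qed

lemma continuous_on_diff_image:
  fixes \<Phi> :: "'c::euclidean_space \<Rightarrow> 'a::euclidean_space"
  assumes "continuous_on UNIV f" "continuous_on UNIV \<Phi>"
  shows "continuous_on UNIV (\<lambda>(x, y). f (x - \<Phi> y))" "continuous_on UNIV (\<lambda>y. f (x - \<Phi> y))"
proof -
  have "continuous_on UNIV (\<lambda>z. f (fst z - \<Phi> (snd z)))"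
    by (intro continuous_on_compose2[OF assms(1)] continuous_intros continuous_on_compose2[OF assms(2)]) auto
  then show "continuous_on UNIV (\<lambda>(x, y). f (x - \<Phi> y))" by (simp add: case_prod_beta')
  show "continuous_on UNIV (\<lambda>y. f (x - \<Phi> y))"
    by (intro continuous_on_compose2[OF assms(1)] continuous_intros assms(2)) auto
qed

text \<open>The linearisation error of \<open>\<rho>\<close> is bounded uniformly on a ball that
  contains all \<open>x - \<Phi> y\<close> with \<open>y\<close> in the support of \<open>w\<close>.
  The inner map \<open>\<Phi>\<close> is arbitrary so that convolutions, reflections and kernels
  centred at displaced points \<open>y + X y\<close> are all covered.\<close>

lemma has_derivative_kernel_integral:
  fixes \<rho> :: "'a::euclidean_space \<Rightarrow> real" and \<Phi> :: "'c::euclidean_space \<Rightarrow> 'a" and w :: "'c \<Rightarrow> 'b::euclidean_space"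
  assumes \<rho>: "has_grad \<rho> r" and \<Phi>: "continuous_on UNIV \<Phi>"
    and w: "integrable lborel w" and supp: "\<And>y. y \<notin> cball 0 R \<Longrightarrow> w y = 0"
  shows "((\<lambda>x. LINT y|lborel. \<rho> (x - \<Phi> y) *\<^sub>R w y) has_derivative
          (\<lambda>v. LINT y|lborel. (r (x - \<Phi> y) \<bullet> v) *\<^sub>R w y)) (at x)"
proof -
  note rc = has_grad_continuous_grad[OF \<rho>] and \<rho>c = has_grad_continuous[OF \<rho>]
  have i1: "integrable lborel (\<lambda>y. \<rho> (x - \<Phi> y) *\<^sub>R w y)" for x
    by (rule integrable_continuous_scaleR[OF continuous_on_diff_image(2)[OF \<rho>c \<Phi>] w supp])
  have i2: "integrable lborel (\<lambda>y. (r (x - \<Phi> y) \<bullet> v) *\<^sub>R w y)" for x v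
    by (rule integrable_continuous_scaleR[OF continuous_on_inner[OF continuous_on_diff_image(2)[OF rc \<Phi>] continuous_on_const] w supp])
  show ?thesis
    unfolding has_derivative_at_alt
  proof (intro conjI allI impI)
    have "linear (\<lambda>v. LINT y|lborel. (r (x - \<Phi> y) \<bullet> v) *\<^sub>R w y)"
    proof (rule linearI)
      fix b1 b2
      show "(LINT y|lborel. (r (x - \<Phi> y) \<bullet> (b1 + b2)) *\<^sub>R w y) =
        (LINT y|lborel. (r (x - \<Phi> y) \<bullet> b1) *\<^sub>R w y) + (LINT y|lborel. (r (x - \<Phi> y) \<bullet> b2) *\<^sub>R w y)"
        by (subst Bochner_Integration.integral_add[symmetric, OF i2 i2]) (simp add: inner_add_right scaleR_add_left)
    next
      fix c b
      show "(LINT y|lborel. (r (x - \<Phi> y) \<bullet> (c *\<^sub>R b)) *\<^sub>R w y) = c *\<^sub>R (LINT y|lborel. (r (x - \<Phi> y) \<bullet> b) *\<^sub>R w y)"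
        by (subst integral_scaleR_right[symmetric]) simp
    qed
    then show "bounded_linear (\<lambda>v. LINT y|lborel. (r (x - \<Phi> y) \<bullet> v) *\<^sub>R w y)"
      by (rule linear_conv_bounded_linear[THEN iffD1])
  next
    fix e :: real assume e: "e > 0"
    have "continuous_on UNIV (\<lambda>y. x - \<Phi> y)" by (intro continuous_intros \<Phi>)
    then obtain C where C: "C > 0" "\<And>y. y \<in> cball 0 R \<Longrightarrow> norm (x - \<Phi> y) \<le> C"
      by (rule continuous_bounded_on_cball[where R = R]) blast
    \<comment> \<open>The divisor \<open>W + 1\<close> in place of \<open>W\<close> avoids a
      division by 0 when \<open>w\<close> vanishes almost everywhere.\<close>
    define W where "W = (LINT y|lborel. norm (w y))"
    have W: "W \<ge> 0" by (simp add: W_def)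
    then have e': "e / (W + 1) > 0" using e by simp
    obtain d where d: "d > 0" "\<And>z v. z \<in> cball 0 C \<Longrightarrow> norm v < d \<Longrightarrow> \<bar>\<rho> (z + v) - \<rho> z - r z \<bullet> v\<bar> \<le> e / (W + 1) * norm v"
      using has_grad_uniform_linearization[OF \<rho> e'] by metis
    show "\<exists>d>0. \<forall>y. norm (y - x) < d \<longrightarrow> norm ((LINT ya|lborel. \<rho> (y - \<Phi> ya) *\<^sub>R w ya) -
        (LINT y|lborel. \<rho> (x - \<Phi> y) *\<^sub>R w y) - (LINT ya|lborel. (r (x - \<Phi> ya) \<bullet> (y - x)) *\<^sub>R w ya)) \<le> e * norm (y - x)"
    proof (intro exI[of _ d] conjI allI impI)
      fix z assume z: "norm (z - x) < d"
      have "(LINT y|lborel. \<rho> (z - \<Phi> y) *\<^sub>R w y) - (LINT y|lborel. \<rho> (x - \<Phi> y) *\<^sub>R w y) - (LINT y|lborel. (r (x - \<Phi> y) \<bullet> (z - x)) *\<^sub>R w y)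
        = (LINT y|lborel. (\<rho> (z - \<Phi> y) - \<rho> (x - \<Phi> y) - r (x - \<Phi> y) \<bullet> (z - x)) *\<^sub>R w y)"
        by (simp add: scaleR_diff_left i1 i2 Bochner_Integration.integral_diff)
      also have "norm \<dots> \<le> (LINT y|lborel. norm ((\<rho> (z - \<Phi> y) - \<rho> (x - \<Phi> y) - r (x - \<Phi> y) \<bullet> (z - x)) *\<^sub>R w y))"
        by (rule integral_norm_bound)
      also have "\<dots> \<le> (LINT y|lborel. (e / (W + 1) * norm (z - x)) * norm (w y))"
      proof (rule integral_mono)
        show "integrable lborel (\<lambda>y. norm ((\<rho> (z - \<Phi> y) - \<rho> (x - \<Phi> y) - r (x - \<Phi> y) \<bullet> (z - x)) *\<^sub>R w y))"
          by (intro integrable_norm) (simp add: scaleR_diff_left i1 i2 Bochner_Integration.integrable_diff)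
        fix y
        show "norm ((\<rho> (z - \<Phi> y) - \<rho> (x - \<Phi> y) - r (x - \<Phi> y) \<bullet> (z - x)) *\<^sub>R w y) \<le> e / (W + 1) * norm (z - x) * norm (w y)"
        proof (cases "y \<in> cball 0 R")
          case True
          then have "norm (\<rho> (z - \<Phi> y) - \<rho> (x - \<Phi> y) - r (x - \<Phi> y) \<bullet> (z - x)) \<le> e / (W + 1) * norm (z - x)"
            using d(2)[of "x - \<Phi> y" "z - x"] C(2)[of y] z by simp
          then show ?thesis unfolding norm_scaleR real_norm_def by (rule mult_right_mono) simp
        qed (use supp in simp)
      qed (use w in auto)
      also have "\<dots> = (e * norm (z - x)) * (W / (W + 1))" by (simp add: W_def)
      also have "\<dots> \<le> (e * norm (z - x)) * 1" using W e by (intro mult_left_mono) auto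
      finally show "norm ((LINT ya|lborel. \<rho> (z - \<Phi> ya) *\<^sub>R w ya) -
        (LINT y|lborel. \<rho> (x - \<Phi> y) *\<^sub>R w y) - (LINT ya|lborel. (r (x - \<Phi> ya) \<bullet> (z - x)) *\<^sub>R w ya)) \<le> e * norm (z - x)"
        by simp
    qed (rule d(1))
  qed
qed

section \<open>Translation invariance and integration by parts\<close>

lemma lborel_integral_affine:
  fixes f :: "'a::euclidean_space \<Rightarrow> 'b::{banach,second_countable_topology}"
  assumes [measurable]: "f \<in> borel_measurable borel" and c: "c \<noteq> 0"
  shows "(LINT x|lborel. f x) = \<bar>c\<bar> ^ DIM('a) *\<^sub>R (LINT x|lborel. f (a + c *\<^sub>R x))"
  by (subst lborel_affine[OF c, of a]) (simp add: integral_density integral_distr)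

lemma lborel_integral_translate:
  fixes f :: "'a::euclidean_space \<Rightarrow> 'b::{banach,second_countable_topology}"
  assumes "f \<in> borel_measurable borel"
  shows "(LINT x|lborel. f (x + a)) = (LINT x|lborel. f x)"
  using lborel_integral_affine[OF assms, of 1 a] by (simp add: add.commute)

lemma lborel_integral_reflect:
  fixes f :: "'a::euclidean_space \<Rightarrow> 'b::{banach,second_countable_topology}"
  assumes "f \<in> borel_measurable borel"
  shows "(LINT x|lborel. f (a - x)) = (LINT x|lborel. f x)"
  using lborel_integral_affine[OF assms, of "-1" a] by simp

text \<open>The integral of \<open>f (x - y)\<close> over \<open>y\<close> does not depend on \<open>x\<close>, so its derivative vanishes.\<close>

lemma integral_grad_eq_0:
  fixes f :: "'a::euclidean_space \<Rightarrow> real"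
  assumes f: "has_grad f r" and supp: "\<And>x. x \<notin> cball 0 R \<Longrightarrow> f x = 0"
  shows "(LINT x|lborel. r x \<bullet> v) = 0"
proof -
  \<comment> \<open>For \<open>x\<close> in the unit ball, \<open>y \<mapsto> f (x - y)\<close> is
    supported in the ball of radius \<open>R + 1\<close>. The indicator supplies the integrable
    weight for \<open>has_derivative_kernel_integral\<close> and changes nothing for such
    \<open>x\<close>.\<close>
  let ?w = "indicator (cball (0::'a) (R + 1)) :: 'a \<Rightarrow> real"
  have w: "integrable lborel ?w"
    using emeasure_bounded_finite[of "cball (0::'a) (R+1)"] by (intro integrable_real_indicator) auto
  have d: "((\<lambda>x. LINT y|lborel. f (x - y) *\<^sub>R ?w y) has_derivative
          (\<lambda>v. LINT y|lborel. (r (0 - y) \<bullet> v) *\<^sub>R ?w y)) (at 0)"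
    by (rule has_derivative_kernel_integral[OF f _ w, of "\<lambda>y. y" "R + 1"]) (auto intro: continuous_intros)
  have [measurable]: "f \<in> borel_measurable borel" "r \<in> borel_measurable borel"
    using has_grad_continuous[OF f] has_grad_continuous_grad[OF f] by (auto intro: borel_measurable_continuous)
  have c: "(LINT y|lborel. f y) = (LINT y|lborel. f (x - y) *\<^sub>R ?w y)" if "x \<in> ball 0 1" for x
  proof -
    have *: "f (x - y) *\<^sub>R ?w y = f (x - y)" for y
    proof (cases "y \<in> cball 0 (R + 1)")
      case False
      then have "norm (x - y) > R" using that norm_triangle_ineq2[of y x] by (auto simp: norm_minus_commute)
      then show ?thesis using supp[of "x - y"] by auto
    qed auto
    show ?thesis unfolding * by (rule lborel_integral_reflect[symmetric]) simp
  qed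
  have "((\<lambda>x. LINT y|lborel. f y) has_derivative
          (\<lambda>v. LINT y|lborel. (r (0 - y) \<bullet> v) *\<^sub>R ?w y)) (at 0)"
    using has_derivative_transform_within_open[OF d, of "ball 0 1" "\<lambda>x. LINT y|lborel. f y"] c by simp
  then have "(\<lambda>v. LINT y|lborel. (r (0 - y) \<bullet> v) *\<^sub>R ?w y) = (\<lambda>v. 0)"
    using has_derivative_unique has_derivative_const by blast
  then have "(LINT y|lborel. (r (0 - y) \<bullet> v) *\<^sub>R ?w y) = 0" by metis
  moreover have *: "(r (0 - y) \<bullet> v) *\<^sub>R ?w y = r (0 - y) \<bullet> v" for y
  proof (cases "y \<in> cball 0 (R + 1)")
    case False
    then have "r (0 - y) = 0" by (intro has_grad_support[OF f supp]) auto
    then show ?thesis by simp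
  qed simp
  ultimately have "(LINT y|lborel. r (0 - y) \<bullet> v) = 0" by (simp only: *)
  then show ?thesis using lborel_integral_reflect[of "\<lambda>y. r y \<bullet> v" 0] by simp
qed

text \<open>The bounded support of \<open>f\<close> is inherited by the product
  \<open>f x * g x\<close>, whose gradient therefore has integral 0.\<close>

lemma integral_by_parts:
  fixes f g :: "'a::euclidean_space \<Rightarrow> real"
  assumes f: "has_grad f r" and supp: "\<And>x. x \<notin> cball 0 R \<Longrightarrow> f x = 0" and g: "has_grad g s"
  shows "(LINT x|lborel. (r x \<bullet> v) * g x) = - (LINT x|lborel. f x * (s x \<bullet> v))"
proof -
  note fc = has_grad_continuous[OF f] and gc = has_grad_continuous[OF g]
    and rc = has_grad_continuous_grad[OF f] and sc = has_grad_continuous_grad[OF g]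
  have "(LINT x|lborel. (f x *\<^sub>R s x + g x *\<^sub>R r x) \<bullet> v) = 0"
    by (rule integral_grad_eq_0[OF has_grad_mult[OF f g]]) (use supp in auto)
  moreover have "integrable lborel (\<lambda>x. f x * (s x \<bullet> v))"
    by (rule integrable_continuous_bounded_support[of _ R]) (use supp in \<open>auto intro!: continuous_intros fc sc\<close>)
  moreover have "integrable lborel (\<lambda>x. (r x \<bullet> v) * g x)"
    by (rule integrable_continuous_bounded_support[of _ R])
       (use has_grad_support[OF f supp] in \<open>auto intro!: continuous_intros gc rc\<close>)
  ultimately show ?thesis by (simp add: inner_add_left mult.commute)
qed

text \<open>Both sides are, up to sign, derivatives at \<open>z = 0\<close> of the same function
  \<open>\<integral> (a x \<bullet> v) * g (x - z) dx = - \<integral> f (x + z) * (b x \<bullet> v) dx\<close>.\<close>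

lemma integral_partials_swap:
  fixes f g :: "'a::euclidean_space \<Rightarrow> real"
  assumes f: "has_grad f a" and g: "has_grad g b" and supp: "\<And>x. x \<notin> cball 0 R \<Longrightarrow> g x = 0"
  shows "(LINT x|lborel. (a x \<bullet> v) * (b x \<bullet> u)) = (LINT x|lborel. (a x \<bullet> u) * (b x \<bullet> v))"
proof -
  note fc = has_grad_continuous[OF f] and gc = has_grad_continuous[OF g]
    and ac = has_grad_continuous_grad[OF f] and bc = has_grad_continuous_grad[OF g]
  have bsupp: "b x = 0" if "x \<notin> cball 0 R" for x using has_grad_support[OF g supp that] .
  have [measurable]: "f \<in> borel_measurable borel" "a \<in> borel_measurable borel" "g \<in> borel_measurable borel" "b \<in> borel_measurable borel"
    using fc gc ac bc by (auto intro: borel_measurable_continuous)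
  \<comment> \<open>\<open>a\<close> need not have bounded support. The cutoff at radius
    \<open>R + 1\<close> makes it an integrable weight and is invisible for
    \<open>norm z < 1\<close>, as \<open>g (x - z)\<close> vanishes beyond that radius.\<close>
  define w1 where "w1 x = (a x \<bullet> v) * indicator (cball 0 (R + 1)) x" for x
  define w2 where "w2 x = b x \<bullet> v" for x
  have w1: "integrable lborel w1"
  proof -
    have "continuous_on UNIV (\<lambda>y. a y \<bullet> v)" by (intro continuous_intros ac)
    then obtain B where B: "B > 0" "\<And>y. y \<in> cball 0 (R + 1) \<Longrightarrow> norm (a y \<bullet> v) \<le> B"
      by (rule continuous_bounded_on_cball[where R = "R + 1"]) blast
    show ?thesis
      unfolding w1_def
    proof (rule integrable_bounded_support[of _ B "R + 1"])
      fix x show "norm ((a x \<bullet> v) * indicator (cball 0 (R + 1)) x) \<le> B"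
        using B(1) B(2)[of x] by (cases "x \<in> cball 0 (R + 1)") auto
    qed (measurable, auto)
  qed
  have w2: "integrable lborel w2"
    by (rule integrable_continuous_bounded_support[of _ R]) (use bsupp in \<open>auto simp: w2_def intro!: continuous_intros bc\<close>)
  have d1: "((\<lambda>z. LINT x|lborel. g (0 - (z - x)) *\<^sub>R w1 x) has_derivative
      (\<lambda>u. LINT x|lborel. (- b (0 - (0 - x)) \<bullet> u) *\<^sub>R w1 x)) (at 0)"
    by (rule has_derivative_kernel_integral[OF has_grad_reflect[OF g] _ w1, of "\<lambda>x. x" "R + 1"])
       (auto simp: w1_def intro: continuous_intros)
  have d2: "((\<lambda>z. LINT x|lborel. f (z - - x) *\<^sub>R w2 x) has_derivative
      (\<lambda>u. LINT x|lborel. (a (0 - - x) \<bullet> u) *\<^sub>R w2 x)) (at 0)"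
    by (rule has_derivative_kernel_integral[OF f _ w2, of "\<lambda>x. - x" "R"])
       (use bsupp in \<open>auto simp: w2_def intro!: continuous_intros\<close>)
  have eq: "(LINT x|lborel. g (0 - (z - x)) *\<^sub>R w1 x) = - (LINT x|lborel. f (z - - x) *\<^sub>R w2 x)" if z: "z \<in> ball 0 1" for z
  proof -
    have "g (0 - (z - x)) *\<^sub>R w1 x = (a x \<bullet> v) * g (x - z)" for x
    proof (cases "x \<in> cball 0 (R + 1)")
      case False
      then have "norm (x - z) > R" using z norm_triangle_ineq2[of x z] by auto
      then show ?thesis using supp[of "x - z"] False by (auto simp: w1_def)
    qed (auto simp: w1_def)
    then have "(LINT x|lborel. g (0 - (z - x)) *\<^sub>R w1 x) = (LINT x|lborel. (a x \<bullet> v) * g (x - z))"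
      by (rule Bochner_Integration.integral_cong[OF refl])
    also have "\<dots> = (LINT x|lborel. (a (x + z) \<bullet> v) * g x)"
      using lborel_integral_translate[of "\<lambda>x. (a x \<bullet> v) * g (x - z)" z] by simp
    also have "\<dots> = - (LINT x|lborel. (b x \<bullet> v) * f (x + z))"
      using integral_by_parts[OF g supp has_grad_affine[OF f, of z 1], where v = v]
      by (simp add: add.commute mult.commute)
    finally show ?thesis by (simp add: w2_def mult.commute add.commute)
  qed
  have "((\<lambda>z. - (LINT x|lborel. f (z - - x) *\<^sub>R w2 x)) has_derivative
      (\<lambda>u. LINT x|lborel. (- b (0 - (0 - x)) \<bullet> u) *\<^sub>R w1 x)) (at 0)"
    using has_derivative_transform_within_open[OF d1, of "ball 0 1"] eq by simp
  then have "(\<lambda>u. LINT x|lborel. (- b (0 - (0 - x)) \<bullet> u) *\<^sub>R w1 x) = (\<lambda>u. - (LINT x|lborel. (a (0 - - x) \<bullet> u) *\<^sub>R w2 x))"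
    using has_derivative_unique has_derivative_minus[OF d2] by blast
  then have "(LINT x|lborel. (- b (0 - (0 - x)) \<bullet> u) *\<^sub>R w1 x) = - (LINT x|lborel. (a (0 - - x) \<bullet> u) *\<^sub>R w2 x)"
    by metis
  moreover have *: "(- b (0 - (0 - x)) \<bullet> u) *\<^sub>R w1 x = - ((a x \<bullet> v) * (b x \<bullet> u))" for x
    using bsupp[of x] by (cases "x \<in> cball 0 R") (auto simp: w1_def indicator_def)
  ultimately have "- (LINT x|lborel. (a x \<bullet> v) * (b x \<bullet> u)) = - (LINT x|lborel. (a (0 - - x) \<bullet> u) *\<^sub>R w2 x)"
    by (simp only: * Bochner_Integration.integral_minus)
  then show ?thesis by (simp add: w2_def)
qed

text \<open>The kernel is bounded on the product of the two supports, so a multiple of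
  \<open>w1 x * w2 y\<close> is an integrable majorant.\<close>

lemma fubini_kernel:
  fixes \<kappa> :: "'a::euclidean_space \<Rightarrow> 'c::euclidean_space \<Rightarrow> real" and w1 :: "'a \<Rightarrow> real" and w2 :: "'c \<Rightarrow> real"
  assumes \<kappa>: "continuous_on UNIV (\<lambda>(x, y). \<kappa> x y)" and w1: "integrable lborel w1" and w2: "integrable lborel w2"
    and supp1: "\<And>x. x \<notin> cball 0 R \<Longrightarrow> w1 x = 0" and supp2: "\<And>y. y \<notin> cball 0 R \<Longrightarrow> w2 y = 0"
  shows "(LINT x|lborel. (LINT y|lborel. \<kappa> x y * w2 y) * w1 x) = (LINT y|lborel. (LINT x|lborel. \<kappa> x y * w1 x) * w2 y)"
proof -
  have \<kappa>m: "(\<lambda>(x, y). \<kappa> x y) \<in> borel_measurable (lborel \<Otimes>\<^sub>M lborel)"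
    using borel_measurable_continuous[OF \<kappa>] by (simp add: borel_prod[symmetric] cong: measurable_cong_sets)
  have [measurable]: "w1 \<in> borel_measurable borel" "w2 \<in> borel_measurable borel"
    using w1 w2 by (auto dest: borel_measurable_integrable)
  obtain B where B: "B > 0" "\<And>x y. x \<in> cball 0 R \<Longrightarrow> y \<in> cball 0 R \<Longrightarrow> norm (\<kappa> x y) \<le> B"
  proof -
    have "compact ((\<lambda>(x, y). \<kappa> x y) ` (cball 0 R \<times> cball 0 R))"
      using \<kappa> by (intro compact_continuous_image compact_Times) (auto intro: continuous_on_subset)
    then have "bounded ((\<lambda>(x, y). \<kappa> x y) ` (cball 0 R \<times> cball 0 R))" by (rule compact_imp_bounded)
    then show ?thesis using that unfolding bounded_pos by (auto simp: case_prod_beta)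
  qed
  have "integrable (lborel \<Otimes>\<^sub>M lborel) (\<lambda>(x, y). w1 x * w2 y)"
  proof (rule lborel_pair.Fubini_integrable)
    show "integrable lborel (\<lambda>x. LINT y|lborel. norm (case (x, y) of (x, y) \<Rightarrow> w1 x * w2 y))"
      using w1 by (simp add: abs_mult)
    show "AE x in lborel. integrable lborel (\<lambda>y. case (x, y) of (x, y) \<Rightarrow> w1 x * w2 y)"
      using w2 by simp
  qed measurable
  then have i: "integrable (lborel \<Otimes>\<^sub>M lborel) (\<lambda>z. B * (case z of (x, y) \<Rightarrow> w1 x * w2 y))"
    by (rule integrable_mult_right)
  have "integrable (lborel \<Otimes>\<^sub>M lborel) (\<lambda>z. (case z of (x, y) \<Rightarrow> \<kappa> x y) * (case z of (x, y) \<Rightarrow> w1 x * w2 y))"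
  proof (rule Bochner_Integration.integrable_bound[OF i])
    show "(\<lambda>z. (case z of (x, y) \<Rightarrow> \<kappa> x y) * (case z of (x, y) \<Rightarrow> w1 x * w2 y)) \<in> borel_measurable (lborel \<Otimes>\<^sub>M lborel)"
      by (intro borel_measurable_times \<kappa>m) measurable
    have "norm (\<kappa> x y * (w1 x * w2 y)) \<le> norm (B * (w1 x * w2 y))" for x y
      using B(1) B(2)[of x y] supp1[of x] supp2[of y]
      by (cases "x \<in> cball 0 R"; cases "y \<in> cball 0 R") (auto simp: abs_mult intro!: mult_right_mono)
    then show "AE z in lborel \<Otimes>\<^sub>M lborel. norm ((case z of (x, y) \<Rightarrow> \<kappa> x y) * (case z of (x, y) \<Rightarrow> w1 x * w2 y))
       \<le> norm (B * (case z of (x, y) \<Rightarrow> w1 x * w2 y))"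
      by (auto split: prod.split)
  qed
  then have "integrable (lborel \<Otimes>\<^sub>M lborel) (\<lambda>(x, y). \<kappa> x y * w1 x * w2 y)"
    by (simp add: case_prod_beta' mult.assoc)
  from lborel_pair.Fubini_integral[OF this]
  have "(LINT y|lborel. (LINT x|lborel. \<kappa> x y * w1 x * w2 y)) = (LINT x|lborel. (LINT y|lborel. \<kappa> x y * w1 x * w2 y))" .
  moreover have "(LINT y|lborel. \<kappa> x y * w1 x * w2 y) = (LINT y|lborel. \<kappa> x y * w2 y) * w1 x" for x
    by (subst integral_mult_left_zero[symmetric]) (simp add: ac_simps)
  ultimately show ?thesis by simp
qed

section \<open>Integral operators and approximate identities\<close>

lemma kernel_section_continuous:
  assumes "continuous_on UNIV (\<lambda>(x, y). \<kappa> x y)"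
  shows "continuous_on UNIV (\<kappa> x)"
proof -
  have "continuous_on UNIV (\<lambda>y. (x, y))" by (intro continuous_intros)
  from continuous_on_compose2[OF assms this] show ?thesis by simp
qed

text \<open>Cauchy-Schwarz with \<open>\<kappa>\<close> split into two square roots bounds the
  square of the integral by the row mass times the integral of
  \<open>\<kappa> x y * (norm (g y))\<^sup>2\<close>; exchanging the order of integration then
  brings in the column mass. Rows and columns have separate bounds because for kernels with a
  displaced centre only one of the two masses is known to be 1.\<close>

lemma schur_bound:
  fixes \<kappa> :: "'a::euclidean_space \<Rightarrow> 'c::euclidean_space \<Rightarrow> real" and g :: "'c \<Rightarrow> 'b::euclidean_space"
  assumes \<kappa>: "continuous_on UNIV (\<lambda>(x, y). \<kappa> x y)" and \<kappa>0: "\<And>x y. 0 \<le> \<kappa> x y"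
    and g: "square_integrable g" and supp: "\<And>y. y \<notin> cball 0 R \<Longrightarrow> g y = 0"
    and A: "\<And>x. (\<integral>\<^sup>+y. ennreal (\<kappa> x y) \<partial>lborel) \<le> ennreal A" "A \<ge> 0"
    and B: "\<And>y. (\<integral>\<^sup>+x. ennreal (\<kappa> x y) \<partial>lborel) \<le> ennreal B" "B \<ge> 0"
  shows "square_integrable (\<lambda>x. LINT y|lborel. \<kappa> x y *\<^sub>R g y)"
    and "l2_norm (\<lambda>x. LINT y|lborel. \<kappa> x y *\<^sub>R g y) \<le> sqrt (A * B) * l2_norm g"
proof -
  let ?T = "\<lambda>x. LINT y|lborel. \<kappa> x y *\<^sub>R g y"
  have gi: "integrable lborel g" by (rule square_integrable_imp_integrable[OF g supp])
  have [measurable]: "g \<in> borel_measurable borel" using g by (rule square_integrable_measurable)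
  have \<kappa>x: "continuous_on UNIV (\<kappa> x)" for x by (rule kernel_section_continuous[OF \<kappa>])
  have [measurable]: "\<kappa> x \<in> borel_measurable borel" for x by (rule borel_measurable_continuous[OF \<kappa>x])
  have Tm: "?T \<in> borel_measurable borel"
    by (rule borel_measurable_continuous[OF continuous_kernel_integral[OF \<kappa> gi supp]])
  have \<kappa>m [measurable]: "(\<lambda>(x, y). \<kappa> x y) \<in> borel_measurable (lborel \<Otimes>\<^sub>M lborel)"
    using borel_measurable_continuous[OF \<kappa>] by (simp add: borel_prod[symmetric] cong: measurable_cong_sets)
  have \<kappa>i: "integrable lborel (\<kappa> x)" for x
    by (rule integrableI_nonneg) (use \<kappa>0 A(1)[of x] in \<open>auto intro: le_less_trans\<close>)
  have \<kappa>le: "(LINT y|lborel. \<kappa> x y) \<le> A" for x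
    using A(1)[of x] A(2) nn_integral_eq_integral[OF \<kappa>i, of x] \<kappa>0 by (simp add: ennreal_le_iff)
  have ki2: "integrable lborel (\<lambda>y. \<kappa> x y * (norm (g y))\<^sup>2)" for x
    using integrable_continuous_scaleR[OF \<kappa>x, of "\<lambda>y. (norm (g y))\<^sup>2" R] g supp by (simp add: square_integrable_def)
  have pw: "(norm (?T x))\<^sup>2 \<le> A * (LINT y|lborel. \<kappa> x y * (norm (g y))\<^sup>2)" for x
  proof -
    define p where "p y = sqrt (\<kappa> x y)" for y
    define q where "q y = sqrt (\<kappa> x y) * norm (g y)" for y
    have sp: "square_integrable p" unfolding square_integrable_def p_def using \<kappa>i \<kappa>0 by auto
    have sq: "square_integrable q" unfolding square_integrable_def q_def
      using ki2[of x] \<kappa>0 by (auto simp: power_mult_distrib)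
    have "norm (?T x) \<le> (LINT y|lborel. norm (\<kappa> x y *\<^sub>R g y))" by (rule integral_norm_bound)
    also have "\<dots> = (LINT y|lborel. norm (p y) * norm (q y))"
      using \<kappa>0 by (simp add: p_def q_def mult.assoc[symmetric] abs_mult)
    also have "\<dots> \<le> l2_norm p * l2_norm q" by (rule l2_cauchy_schwarz_norm[OF sp sq])
    finally have "(norm (?T x))\<^sup>2 \<le> (l2_norm p * l2_norm q)\<^sup>2" by (intro power_mono) auto
    also have "\<dots> = (LINT y|lborel. \<kappa> x y) * (LINT y|lborel. \<kappa> x y * (norm (g y))\<^sup>2)"
      unfolding power_mult_distrib l2_norm_power2 p_def q_def using \<kappa>0 by (simp add: power_mult_distrib)
    also have "\<dots> \<le> A * (LINT y|lborel. \<kappa> x y * (norm (g y))\<^sup>2)"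
      by (intro mult_right_mono \<kappa>le integral_nonneg_AE) (use \<kappa>0 in auto)
    finally show ?thesis .
  qed
  have "(\<integral>\<^sup>+x. ennreal ((norm (?T x))\<^sup>2) \<partial>lborel) \<le> (\<integral>\<^sup>+x. ennreal A * (\<integral>\<^sup>+y. ennreal (\<kappa> x y) * ennreal ((norm (g y))\<^sup>2) \<partial>lborel) \<partial>lborel)"
  proof (rule nn_integral_mono)
    fix x
    have "ennreal ((norm (?T x))\<^sup>2) \<le> ennreal (A * (LINT y|lborel. \<kappa> x y * (norm (g y))\<^sup>2))"
      by (intro ennreal_leI pw)
    also have "\<dots> = ennreal A * ennreal (LINT y|lborel. \<kappa> x y * (norm (g y))\<^sup>2)"
      by (intro ennreal_mult A integral_nonneg_AE) (use \<kappa>0 in auto)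
    also have "ennreal (LINT y|lborel. \<kappa> x y * (norm (g y))\<^sup>2) = (\<integral>\<^sup>+y. ennreal (\<kappa> x y * (norm (g y))\<^sup>2) \<partial>lborel)"
      by (intro nn_integral_eq_integral[symmetric] ki2) (use \<kappa>0 in auto)
    finally show "ennreal ((norm (?T x))\<^sup>2) \<le> ennreal A * (\<integral>\<^sup>+y. ennreal (\<kappa> x y) * ennreal ((norm (g y))\<^sup>2) \<partial>lborel)"
      using \<kappa>0 by (simp add: ennreal_mult)
  qed
  also have "\<dots> = ennreal A * (\<integral>\<^sup>+x. (\<integral>\<^sup>+y. ennreal (\<kappa> x y) * ennreal ((norm (g y))\<^sup>2) \<partial>lborel) \<partial>lborel)"
    by (intro nn_integral_cmult) measurable
  also have "(\<integral>\<^sup>+x. (\<integral>\<^sup>+y. ennreal (\<kappa> x y) * ennreal ((norm (g y))\<^sup>2) \<partial>lborel) \<partial>lborel)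
      = (\<integral>\<^sup>+y. (\<integral>\<^sup>+x. ennreal (\<kappa> x y) * ennreal ((norm (g y))\<^sup>2) \<partial>lborel) \<partial>lborel)"
    by (rule lborel_pair.Fubini'[symmetric]) measurable
  also have "\<dots> \<le> (\<integral>\<^sup>+y. ennreal B * ennreal ((norm (g y))\<^sup>2) \<partial>lborel)"
  proof (rule nn_integral_mono)
    fix y
    have [measurable]: "(\<lambda>x. \<kappa> x y) \<in> borel_measurable borel"
    proof (rule borel_measurable_continuous)
      have "continuous_on UNIV (\<lambda>x. (x, y))" by (intro continuous_intros)
      from continuous_on_compose2[OF \<kappa> this] show "continuous_on UNIV (\<lambda>x. \<kappa> x y)" by simp
    qed
    show "(\<integral>\<^sup>+x. ennreal (\<kappa> x y) * ennreal ((norm (g y))\<^sup>2) \<partial>lborel) \<le> ennreal B * ennreal ((norm (g y))\<^sup>2)"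
      by (subst nn_integral_multc) (auto intro!: mult_right_mono B)
  qed
  also have "\<dots> = ennreal B * (\<integral>\<^sup>+y. ennreal ((norm (g y))\<^sup>2) \<partial>lborel)"
    by (intro nn_integral_cmult) measurable
  also have "(\<integral>\<^sup>+y. ennreal ((norm (g y))\<^sup>2) \<partial>lborel) = ennreal ((l2_norm g)\<^sup>2)"
    unfolding l2_norm_power2 using g by (intro nn_integral_eq_integral) (auto simp: square_integrable_def)
  finally have "(\<integral>\<^sup>+x. ennreal ((norm (?T x))\<^sup>2) \<partial>lborel) \<le> ennreal A * (ennreal B * ennreal ((l2_norm g)\<^sup>2))"
    by (simp add: mult_left_mono)
  then have fin: "(\<integral>\<^sup>+x. ennreal ((norm (?T x))\<^sup>2) \<partial>lborel) \<le> ennreal (A * B * (l2_norm g)\<^sup>2)"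
    using A B by (simp add: ennreal_mult[symmetric] mult.assoc)
  have i: "integrable lborel (\<lambda>x. (norm (?T x))\<^sup>2)"
    by (rule integrableI_nonneg) (use le_less_trans[OF fin] Tm in auto)
  then show "square_integrable ?T" using Tm by (simp add: square_integrable_def)
  have "ennreal ((l2_norm ?T)\<^sup>2) \<le> ennreal (A * B * (l2_norm g)\<^sup>2)"
    using fin nn_integral_eq_integral[OF i] by (simp add: l2_norm_power2)
  then have "(l2_norm ?T)\<^sup>2 \<le> A * B * (l2_norm g)\<^sup>2" using A B by (simp add: ennreal_le_iff)
  also have "\<dots> = (sqrt (A * B) * l2_norm g)\<^sup>2" using A B by (simp add: power_mult_distrib)
  finally show "l2_norm ?T \<le> sqrt (A * B) * l2_norm g"
    by (rule power2_le_imp_le) (use A B in simp)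
qed

lemma measure_lborel_cball:
  "r \<ge> 0 \<Longrightarrow> measure lborel (cball (c::'a::euclidean_space) r) = unit_ball_vol (DIM('a)) * r ^ DIM('a)"
  using content_cball[of r c] by simp

text \<open>The set where \<open>f\<close> is nonzero lies in the ball of radius \<open>s\<close>
  about any of its points.\<close>

lemma nn_integral_small_support:
  fixes f :: "'a::euclidean_space \<Rightarrow> real"
  assumes le: "\<And>x. f x \<le> M" and M: "M \<ge> 0" and s: "s \<ge> 0"
    and near: "\<And>x x'. f x \<noteq> 0 \<Longrightarrow> f x' \<noteq> 0 \<Longrightarrow> norm (x - x') \<le> s"
  shows "(\<integral>\<^sup>+x. ennreal (f x) \<partial>lborel) \<le> ennreal (M * (unit_ball_vol (DIM('a)) * s ^ DIM('a)))"
proof (cases "\<exists>x0. f x0 \<noteq> 0")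
  case True
  then obtain x0 where x0: "f x0 \<noteq> 0" by blast
  have "(\<integral>\<^sup>+x. ennreal (f x) \<partial>lborel) \<le> (\<integral>\<^sup>+x. ennreal M * indicator (cball x0 s) x \<partial>lborel)"
  proof (rule nn_integral_mono)
    fix x
    show "ennreal (f x) \<le> ennreal M * indicator (cball x0 s) x"
    proof (cases "x \<in> cball x0 s")
      case False
      then have "f x = 0" using near[OF x0, of x] by (auto simp: dist_norm)
      then show ?thesis by simp
    qed (use le[of x] in \<open>simp add: ennreal_leI\<close>)
  qed
  also have "\<dots> = ennreal M * emeasure lborel (cball x0 s)"
    by (rule nn_integral_cmult_indicator) simp
  also have "\<dots> = ennreal (M * (unit_ball_vol (DIM('a)) * s ^ DIM('a)))"
    using s M by (simp add: emeasure_cball ennreal_mult)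
  finally show ?thesis .
qed simp

section \<open>Rescaled kernels and their masses\<close>

definition rescale :: "real \<Rightarrow> ('a::euclidean_space \<Rightarrow> real) \<Rightarrow> 'a \<Rightarrow> real" where
  "rescale e f x = (1 / e) ^ DIM('a) * f ((1 / e) *\<^sub>R x)"

text \<open>The integral is not normalised: besides the mollifier, of integral 1, the notion has to
  cover the divergence of the regularised kernel, whose integral is only shown to be
  positive.\<close>

definition unit_kernel :: "('a::euclidean_space \<Rightarrow> real) \<Rightarrow> bool" where
  "unit_kernel \<sigma> \<longleftrightarrow> continuous_on UNIV \<sigma> \<and> (\<forall>x. 0 \<le> \<sigma> x) \<and> (\<forall>x. x \<notin> cball 0 1 \<longrightarrow> \<sigma> x = 0)"

lemma unit_kernel_bounded:
  assumes "unit_kernel \<sigma>"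
  obtains M where "M > 0" "\<And>x. \<sigma> x \<le> M"
proof -
  have "continuous_on UNIV \<sigma>" using assms by (simp add: unit_kernel_def)
  then obtain B where B: "B > 0" "\<And>x. x \<in> cball 0 1 \<Longrightarrow> norm (\<sigma> x) \<le> B"
    by (rule continuous_bounded_on_cball[where R = 1]) blast
  have "\<sigma> x \<le> B" for x
    using B(1) B(2)[of x] assms unfolding unit_kernel_def by (cases "x \<in> cball 0 1") auto
  then show ?thesis using B(1) that by blast
qed

lemma continuous_rescale:
  assumes "continuous_on UNIV \<sigma>" shows "continuous_on UNIV (rescale e \<sigma>)"
  unfolding rescale_def by (intro continuous_intros continuous_on_compose2[OF assms]) auto

lemma rescale_eq_0:
  assumes "unit_kernel \<sigma>" "e > 0" "norm x > e" shows "rescale e \<sigma> x = 0"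
proof -
  have "(1 / e) *\<^sub>R x \<notin> cball 0 1" using assms by simp
  then show ?thesis using assms(1) by (simp add: unit_kernel_def rescale_def)
qed

lemma rescale_nonneg: "unit_kernel \<sigma> \<Longrightarrow> e > 0 \<Longrightarrow> rescale e \<sigma> x \<ge> 0"
  by (simp add: unit_kernel_def rescale_def)

lemma integral_rescale:
  fixes \<sigma> :: "'a::euclidean_space \<Rightarrow> real"
  assumes \<sigma>: "continuous_on UNIV \<sigma>" and "e > 0"
  shows "(LINT y|lborel. rescale e \<sigma> (x - y)) = (LINT y|lborel. \<sigma> y)"
proof -
  have [measurable]: "\<sigma> \<in> borel_measurable borel" using borel_measurable_continuous[OF \<sigma>] .
  have "(LINT y|lborel. \<sigma> y) = \<bar>- (1/e)\<bar> ^ DIM('a) *\<^sub>R (LINT y|lborel. \<sigma> ((1/e) *\<^sub>R x + (- (1/e)) *\<^sub>R y))"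
    by (rule lborel_integral_affine) (use \<open>e > 0\<close> in auto)
  also have "\<dots> = (LINT y|lborel. (1/e) ^ DIM('a) * \<sigma> ((1/e) *\<^sub>R x + (- (1/e)) *\<^sub>R y))"
    using \<open>e > 0\<close> by simp
  also have "\<dots> = (LINT y|lborel. rescale e \<sigma> (x - y))"
    by (simp add: rescale_def scaleR_diff_right)
  finally show ?thesis ..
qed

lemma integrable_rescale:
  fixes \<sigma> :: "'a::euclidean_space \<Rightarrow> real"
  assumes \<sigma>: "unit_kernel \<sigma>" and "e > 0"
  shows "integrable lborel (\<lambda>y::'a. rescale e \<sigma> (x - y))"
proof (rule integrable_continuous_bounded_support[of _ "norm x + e"])
  have "continuous_on UNIV \<sigma>" using \<sigma> by (simp add: unit_kernel_def)
  from continuous_on_diff_image(2)[OF continuous_rescale[OF this] continuous_on_id, where x = x]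
  show "continuous_on UNIV (\<lambda>y::'a. rescale e \<sigma> (x - y))" .
  fix y :: 'a assume "y \<notin> cball 0 (norm x + e)"
  then have "norm (x - y) > e" using norm_triangle_ineq2[of y x] by (simp add: norm_minus_commute)
  then show "rescale e \<sigma> (x - y) = 0" using rescale_eq_0[OF \<sigma> \<open>e > 0\<close>] by simp
qed

lemma nn_integral_rescale:
  fixes \<sigma> :: "'a::euclidean_space \<Rightarrow> real"
  assumes \<sigma>: "unit_kernel \<sigma>" and e: "e > 0"
  shows "(\<integral>\<^sup>+y. ennreal (rescale e \<sigma> (x - y)) \<partial>lborel) = ennreal (LINT y|lborel. \<sigma> y)"
    "(\<integral>\<^sup>+y. ennreal (rescale e \<sigma> (y - x)) \<partial>lborel) = ennreal (LINT y|lborel. \<sigma> y)"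
proof -
  have c: "continuous_on UNIV \<sigma>" using \<sigma> by (simp add: unit_kernel_def)
  show "(\<integral>\<^sup>+y. ennreal (rescale e \<sigma> (x - y)) \<partial>lborel) = ennreal (LINT y|lborel. \<sigma> y)"
    using nn_integral_eq_integral[OF integrable_rescale[OF \<sigma> e]] rescale_nonneg[OF \<sigma> e] integral_rescale[OF c e]
    by simp
  \<comment> \<open>The kernel need not be even, so the mass of
    \<open>y \<mapsto> rescale e \<sigma> (y - x)\<close> is obtained from the reflected
    kernel.\<close>
  define \<sigma>' where "\<sigma>' z = \<sigma> (- z)" for z
  have "continuous_on UNIV \<sigma>'" unfolding \<sigma>'_def
    by (intro continuous_on_compose2[OF c] continuous_intros) auto
  then have \<sigma>': "unit_kernel \<sigma>'" using \<sigma> by (auto simp: unit_kernel_def \<sigma>'_def)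
  have "rescale e \<sigma> (y - x) = rescale e \<sigma>' (x - y)" for y :: 'a
    by (simp add: rescale_def \<sigma>'_def scaleR_diff_right)
  moreover have "(LINT y|lborel. \<sigma>' y) = (LINT y|lborel. \<sigma> y)"
    using lborel_integral_reflect[OF borel_measurable_continuous[OF c], of 0] by (simp add: \<sigma>'_def)
  moreover have c': "continuous_on UNIV \<sigma>'" using \<sigma>' by (simp add: unit_kernel_def)
  ultimately show "(\<integral>\<^sup>+y. ennreal (rescale e \<sigma> (y - x)) \<partial>lborel) = ennreal (LINT y|lborel. \<sigma> y)"
    using nn_integral_eq_integral[OF integrable_rescale[OF \<sigma>' e]] rescale_nonneg[OF \<sigma>' e] integral_rescale[OF c' e]
    by simp
qed

text \<open>If \<open>\<Phi>\<close> contracts distances by at most a factor 2, the preimage of a ball of radius \<open>e\<close> has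
  diameter at most \<open>4 e\<close>; this replaces the change of variables formula.\<close>

lemma nn_integral_rescale_bilipschitz:
  fixes \<sigma> :: "'a::euclidean_space \<Rightarrow> real" and \<Phi> :: "'a \<Rightarrow> 'a"
  assumes \<sigma>: "unit_kernel \<sigma>" and e: "e > 0" and M: "\<And>x. \<sigma> x \<le> M" "M \<ge> 0"
    and \<Phi>: "\<And>x y. norm (x - y) \<le> 2 * norm (\<Phi> x - \<Phi> y)"
  shows "(\<integral>\<^sup>+y. ennreal (rescale e \<sigma> (x - \<Phi> y)) \<partial>lborel) \<le> ennreal (M * (unit_ball_vol (DIM('a)) * 4 ^ DIM('a)))"
    "(\<integral>\<^sup>+y. ennreal (rescale e \<sigma> (\<Phi> y - x)) \<partial>lborel) \<le> ennreal (M * (unit_ball_vol (DIM('a)) * 4 ^ DIM('a)))"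
proof -
  have m: "rescale e \<sigma> z \<le> (1/e) ^ DIM('a) * M" for z
    unfolding rescale_def using e M by (intro mult_left_mono) auto
  have nr: "norm z \<le> e" if "rescale e \<sigma> z \<noteq> 0" for z using rescale_eq_0[OF \<sigma> e, of z] that by linarith
  \<comment> \<open>The height of the rescaled kernel is multiplied by the volume of a ball of
    radius \<open>4 * e\<close>; the powers of \<open>e\<close> cancel, so the bound is uniform in
    \<open>e\<close>.\<close>
  have eq: "(1/e) ^ DIM('a) * M * (unit_ball_vol (DIM('a)) * (4 * e) ^ DIM('a)) = M * (unit_ball_vol (DIM('a)) * 4 ^ DIM('a))"
    using e by (simp add: power_mult_distrib field_simps)
  show "(\<integral>\<^sup>+y. ennreal (rescale e \<sigma> (x - \<Phi> y)) \<partial>lborel) \<le> ennreal (M * (unit_ball_vol (DIM('a)) * 4 ^ DIM('a)))"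
    unfolding eq[symmetric]
  proof (rule nn_integral_small_support)
    show "rescale e \<sigma> (x - \<Phi> y) \<le> (1/e) ^ DIM('a) * M" for y by (rule m)
  next
    fix y y' assume "rescale e \<sigma> (x - \<Phi> y) \<noteq> 0" "rescale e \<sigma> (x - \<Phi> y') \<noteq> 0"
    then have "norm (x - \<Phi> y) \<le> e" "norm (x - \<Phi> y') \<le> e" using nr by auto
    then have "norm (\<Phi> y - \<Phi> y') \<le> 2 * e" using norm_triangle_ineq4[of "x - \<Phi> y'" "x - \<Phi> y"] by simp
    then show "norm (y - y') \<le> 4 * e" using \<Phi>[of y y'] by linarith
  qed (use e M in auto)
  show "(\<integral>\<^sup>+y. ennreal (rescale e \<sigma> (\<Phi> y - x)) \<partial>lborel) \<le> ennreal (M * (unit_ball_vol (DIM('a)) * 4 ^ DIM('a)))"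
    unfolding eq[symmetric]
  proof (rule nn_integral_small_support)
    show "rescale e \<sigma> (\<Phi> y - x) \<le> (1/e) ^ DIM('a) * M" for y by (rule m)
  next
    fix y y' assume "rescale e \<sigma> (\<Phi> y - x) \<noteq> 0" "rescale e \<sigma> (\<Phi> y' - x) \<noteq> 0"
    then have "norm (\<Phi> y - x) \<le> e" "norm (\<Phi> y' - x) \<le> e" using nr by auto
    then have "norm (\<Phi> y - \<Phi> y') \<le> 2 * e" using norm_triangle_ineq4[of "\<Phi> y - x" "\<Phi> y' - x"] by simp
    then show "norm (y - y') \<le> 4 * e" using \<Phi>[of y y'] by linarith
  qed (use e M in auto)
qed

section \<open>Density of continuous functions\<close>

lemma uniformly_continuous_bounded_support:
  fixes g :: "'a::euclidean_space \<Rightarrow> 'b::euclidean_space"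
  assumes "continuous_on UNIV g" "\<And>x. x \<notin> cball 0 R \<Longrightarrow> g x = 0" "\<eta> > 0"
  obtains d where "d > 0" "\<And>x y. norm (x - y) < d \<Longrightarrow> norm (g x - g y) < \<eta>"
proof -
  have "uniformly_continuous_on (cball 0 (R + 1)) g"
    using assms(1) by (intro compact_uniformly_continuous) (auto intro: continuous_on_subset)
  then obtain d where d: "d > 0" "\<And>x y. x \<in> cball 0 (R+1) \<Longrightarrow> y \<in> cball 0 (R+1) \<Longrightarrow> dist y x < d \<Longrightarrow> dist (g y) (g x) < \<eta>"
    using \<open>\<eta> > 0\<close> unfolding uniformly_continuous_on_def by metis
  show ?thesis
  proof (rule that[of "min 1 d"])
    fix x y :: 'a assume xy: "norm (x - y) < min 1 d"
    show "norm (g x - g y) < \<eta>"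
    proof (cases "x \<in> cball 0 (R+1) \<and> y \<in> cball 0 (R+1)")
      case True then show ?thesis using d(2)[of x y] xy by (auto simp: dist_norm norm_minus_commute)
    next
      case False
      then have "x \<notin> cball 0 R" "y \<notin> cball 0 R"
        using xy norm_triangle_ineq2[of x y] norm_triangle_ineq2[of y x] by (auto simp: norm_minus_commute)
      then show ?thesis using assms by simp
    qed
  qed (use d in auto)
qed

text \<open>Measurability yields continuous functions converging to \<open>f\<close> almost
  everywhere, but without any bound. Truncating the values to norm \<open>M\<close> and the domain
  to a ball supplies the majorants for two applications of dominated convergence: from
  \<open>f\<close> to its truncation, and from there to the truncated continuous functions.\<close>

lemma continuous_dense_l2:
  fixes f :: "'a::euclidean_space \<Rightarrow> 'b::euclidean_space"
  assumes f: "square_integrable f" and supp: "\<And>x. x \<notin> cball 0 R \<Longrightarrow> f x = 0" and \<eta>: "\<eta> > 0"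
  obtains g where "continuous_on UNIV g" "\<And>x. x \<notin> cball 0 (R + 1) \<Longrightarrow> g x = 0" "l2_norm (\<lambda>x. f x - g x) < \<eta>"
proof -
  have [measurable]: "f \<in> borel_measurable borel" using f by (rule square_integrable_measurable)
  then have "f \<in> borel_measurable lebesgue" by (simp add: measurable_completion)
  then have "f measurable_on UNIV" using measurable_on_iff_borel_measurable[of UNIV f] by (simp add: lebesgue_on_UNIV_eq)
  then obtain N g where N: "negligible N" and g: "\<And>n. continuous_on UNIV (g n)"
    and lim: "\<And>x. x \<notin> N \<Longrightarrow> (\<lambda>n. g n x) \<longlonglongrightarrow> f x"
    unfolding measurable_on_def by auto
  have AEN: "AE x in lborel. x \<notin> N"
    using N by (metis AE_completion_iff AE_not_in negligible_iff_null_sets)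
  \<comment> \<open>truncate the range to the ball of radius \<open>m\<close>, and the domain to the ball of radius \<open>R + 1\<close>\<close>
  define c where "c m v = (min 1 (m / max 1 (norm v))) *\<^sub>R v" for m :: real and v :: 'b
  define cut where "cut x = max 0 (min 1 (R + 1 - norm x))" for x :: 'a
  have ccont: "continuous_on UNIV (c m)" for m
    unfolding c_def by (intro continuous_intros) auto
  have cutcont: "continuous_on UNIV cut" unfolding cut_def by (intro continuous_intros)
  have cle: "norm (c m v) \<le> m" if "m \<ge> 1" for m v
  proof -
    have "min 1 (m / max 1 (norm v)) * norm v \<le> m / max 1 (norm v) * norm v"
      by (intro mult_right_mono) auto
    also have "\<dots> \<le> m" using that by (simp add: divide_le_eq mult_left_mono)
    finally show ?thesis using that by (simp add: c_def)
  qed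
  have cle2: "norm (c m v) \<le> norm v" if "m \<ge> 1" for m v
    using that mult_right_mono[of "min 1 (m / max 1 (norm v))" 1 "norm v"] by (simp add: c_def)
  have cid: "c m v = v" if "m \<ge> 1" "norm v \<le> m" for m v
  proof -
    have "m / max 1 (norm v) \<ge> 1" using that by (simp add: le_divide_eq)
    then show ?thesis by (simp add: c_def)
  qed
  have [measurable]: "c m \<in> borel_measurable borel" for m by (rule borel_measurable_continuous[OF ccont])
  have [measurable]: "g n \<in> borel_measurable borel" for n by (rule borel_measurable_continuous[OF g])
  have [measurable]: "cut \<in> borel_measurable borel" by (rule borel_measurable_continuous[OF cutcont])
  have lim1: "(\<lambda>m. LINT x|lborel. (norm (f x - c (real (Suc m)) (f x)))\<^sup>2) \<longlonglongrightarrow> (LINT x::'a|lborel. (norm (0::'b))\<^sup>2)"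
  proof (rule integral_dominated_convergence[where w = "\<lambda>x. 4 * (norm (f x))\<^sup>2"])
    show "integrable lborel (\<lambda>x. 4 * (norm (f x))\<^sup>2)" using f by (simp add: square_integrable_def)
    show "AE x in lborel. (\<lambda>m. (norm (f x - c (real (Suc m)) (f x)))\<^sup>2) \<longlonglongrightarrow> (norm (0::'b))\<^sup>2"
    proof (rule AE_I2)
      fix x
      obtain m0 where m0: "norm (f x) \<le> real m0" using real_arch_simple by blast
      have "(norm (f x - c (real (Suc m)) (f x)))\<^sup>2 = (norm (0::'b))\<^sup>2" if "m \<ge> m0" for m
        using cid[of "real (Suc m)" "f x"] m0 that by simp
      then show "(\<lambda>m. (norm (f x - c (real (Suc m)) (f x)))\<^sup>2) \<longlonglongrightarrow> (norm (0::'b))\<^sup>2"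
        by (intro tendsto_eventually eventually_sequentiallyI[of m0])
    qed
    show "AE x in lborel. norm ((norm (f x - c (real (Suc m)) (f x)))\<^sup>2) \<le> 4 * (norm (f x))\<^sup>2" for m
    proof (rule AE_I2)
      fix x
      have "norm (f x - c (real (Suc m)) (f x)) \<le> 2 * norm (f x)"
        using norm_triangle_ineq4[of "f x" "c (real (Suc m)) (f x)"] cle2[of "real (Suc m)" "f x"] by simp
      then have "(norm (f x - c (real (Suc m)) (f x)))\<^sup>2 \<le> (2 * norm (f x))\<^sup>2" by (intro power_mono) auto
      then show "norm ((norm (f x - c (real (Suc m)) (f x)))\<^sup>2) \<le> 4 * (norm (f x))\<^sup>2" by (simp add: power_mult_distrib)
    qed
  qed measurable
  then have "(\<lambda>m. l2_norm (\<lambda>x. f x - c (real (Suc m)) (f x))) \<longlonglongrightarrow> 0"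
    unfolding l2_norm_def using tendsto_real_sqrt by fastforce
  then have "eventually (\<lambda>m. l2_norm (\<lambda>x. f x - c (real (Suc m)) (f x)) < \<eta> / 2) sequentially"
    by (rule order_tendstoD(2)) (use \<eta> in simp)
  then obtain m where m: "l2_norm (\<lambda>x. f x - c (real (Suc m)) (f x)) < \<eta> / 2"
    unfolding eventually_sequentially by blast
  define M where "M = real (Suc m)"
  have M1: "M \<ge> 1" by (simp add: M_def)
  have lim2: "(\<lambda>n. LINT x|lborel. (norm (c M (f x) - cut x *\<^sub>R c M (g n x)))\<^sup>2) \<longlonglongrightarrow> (LINT x::'a|lborel. (norm (0::'b))\<^sup>2)"
  proof (rule integral_dominated_convergence[where w = "\<lambda>x. (2 * M)\<^sup>2 * indicator (cball 0 (R+1)) x"])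
    show "integrable lborel (\<lambda>x. (2 * M)\<^sup>2 * indicator (cball (0::'a) (R + 1)) x)"
      using emeasure_bounded_finite[of "cball (0::'a) (R+1)"] by (intro integrable_mult_right integrable_real_indicator) auto
    show "AE x in lborel. (\<lambda>n. (norm (c M (f x) - cut x *\<^sub>R c M (g n x)))\<^sup>2) \<longlonglongrightarrow> (norm (0::'b))\<^sup>2"
    proof (rule AE_mp[OF AEN], intro AE_I2 impI)
      fix x assume "x \<notin> N"
      then have "(\<lambda>n. c M (g n x)) \<longlonglongrightarrow> c M (f x)"
        using continuous_on_tendsto_compose[OF ccont lim] by simp
      then have "(\<lambda>n. (norm (c M (f x) - cut x *\<^sub>R c M (g n x)))\<^sup>2) \<longlonglongrightarrow> (norm (c M (f x) - cut x *\<^sub>R c M (f x)))\<^sup>2"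
        by (intro tendsto_intros)
      \<comment> \<open>On the ball of radius \<open>R\<close> the cutoff equals 1, and outside that
        ball \<open>f\<close> vanishes.\<close>
      moreover have "c M (f x) - cut x *\<^sub>R c M (f x) = 0"
        using supp[of x] by (cases "x \<in> cball 0 R") (auto simp: cut_def c_def)
      ultimately show "(\<lambda>n. (norm (c M (f x) - cut x *\<^sub>R c M (g n x)))\<^sup>2) \<longlonglongrightarrow> (norm (0::'b))\<^sup>2" by simp
    qed
    show "AE x in lborel. norm ((norm (c M (f x) - cut x *\<^sub>R c M (g n x)))\<^sup>2) \<le> (2 * M)\<^sup>2 * indicator (cball 0 (R+1)) x" for n
    proof (rule AE_I2)
      fix x
      show "norm ((norm (c M (f x) - cut x *\<^sub>R c M (g n x)))\<^sup>2) \<le> (2 * M)\<^sup>2 * indicator (cball 0 (R+1)) x"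
      proof (cases "x \<in> cball 0 (R+1)")
        case True
        have "norm (cut x *\<^sub>R c M (g n x)) \<le> 1 * M"
          unfolding norm_scaleR using cle[OF M1] by (intro mult_mono) (auto simp: cut_def)
        then have "norm (c M (f x) - cut x *\<^sub>R c M (g n x)) \<le> 2 * M"
          using norm_triangle_ineq4[of "c M (f x)" "cut x *\<^sub>R c M (g n x)"] cle[OF M1, of "f x"] by simp
        then have "(norm (c M (f x) - cut x *\<^sub>R c M (g n x)))\<^sup>2 \<le> (2 * M)\<^sup>2" by (intro power_mono) auto
        then show ?thesis using True by simp
      next
        case False
        then have "f x = 0" "cut x = 0" using supp[of x] by (auto simp: cut_def)
        then show ?thesis by (simp add: c_def)
      qed
    qed
  qed measurable
  then have "(\<lambda>n. l2_norm (\<lambda>x. c M (f x) - cut x *\<^sub>R c M (g n x))) \<longlonglongrightarrow> 0"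
    unfolding l2_norm_def using tendsto_real_sqrt by fastforce
  then have "eventually (\<lambda>n. l2_norm (\<lambda>x. c M (f x) - cut x *\<^sub>R c M (g n x)) < \<eta> / 2) sequentially"
    by (rule order_tendstoD(2)) (use \<eta> in simp)
  then obtain n where n: "l2_norm (\<lambda>x. c M (f x) - cut x *\<^sub>R c M (g n x)) < \<eta> / 2"
    unfolding eventually_sequentially by blast
  let ?g = "\<lambda>x. cut x *\<^sub>R c M (g n x)"
  have cont: "continuous_on UNIV ?g"
    by (intro continuous_intros cutcont continuous_on_compose2[OF ccont g]) auto
  have gsupp: "?g x = 0" if "x \<notin> cball 0 (R + 1)" for x using that by (simp add: cut_def)
  have s1: "square_integrable (\<lambda>x. c M (f x))"
    by (rule l2_norm_mono(1)[OF f]) (use cle2[OF M1] in auto)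
  have s2: "square_integrable ?g"
    by (rule square_integrable_continuous_bounded_support[OF cont gsupp])
  have "l2_norm (\<lambda>x. f x - ?g x) \<le> l2_norm (\<lambda>x. f x - c M (f x)) + l2_norm (\<lambda>x. c M (f x) - ?g x)"
    by (rule l2_norm_triangle_sub[OF f s1 s2])
  then have "l2_norm (\<lambda>x. f x - ?g x) < \<eta>" using m n by (simp add: M_def)
  then show ?thesis using that cont gsupp by blast
qed

section \<open>Smooth mollifiers\<close>

lemma times_cont_diff_SucI:
  assumes "\<And>x. (f has_derivative f' x) (at x)" "\<And>b. b \<in> Basis \<Longrightarrow> times_cont_diff k (\<lambda>x. f' x b)"
  shows "times_cont_diff (Suc k) f"
proof -
  have "frechet_derivative f (at x) = f' x" for x using frechet_derivative_at[OF assms(1)] by simp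
  then show ?thesis using assms by (auto simp: differentiable_def)
qed

lemma times_cont_diff_continuous: "times_cont_diff k f \<Longrightarrow> continuous_on UNIV f"
  by (cases k) (auto simp: differentiable_imp_continuous_within continuous_at_imp_continuous_on)

lemma times_cont_diff_SucD:
  assumes "times_cont_diff (Suc k) f"
  shows "(f has_derivative frechet_derivative f (at x)) (at x)"
    "b \<in> Basis \<Longrightarrow> times_cont_diff k (\<lambda>x. frechet_derivative f (at x) b)"
  using assms by (auto simp: frechet_derivative_works)

lemma smooth_has_grad:
  fixes f :: "'a::euclidean_space \<Rightarrow> real"
  assumes "\<And>k. times_cont_diff k f"
  shows "has_grad f (gradient f)" "b \<in> Basis \<Longrightarrow> times_cont_diff k (\<lambda>x. gradient f x \<bullet> b)"
proof -
  have d: "(f has_derivative frechet_derivative f (at x)) (at x)" for x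
    using times_cont_diff_SucD(1)[OF assms] .
  have c: "gradient f x \<bullet> b = frechet_derivative f (at x) b" if "b \<in> Basis" for x b
    using that by (simp add: gradient_def inner_sum_left inner_Basis if_distrib sum.delta cong: if_cong)
  have g: "gradient f x \<bullet> v = frechet_derivative f (at x) v" for x v
  proof -
    have "frechet_derivative f (at x) v = frechet_derivative f (at x) (\<Sum>b\<in>Basis. (v \<bullet> b) *\<^sub>R b)"
      by (simp add: euclidean_representation)
    also have "\<dots> = (\<Sum>b\<in>Basis. (v \<bullet> b) * frechet_derivative f (at x) b)"
      using has_derivative_linear[OF d] by (simp add: linear_sum linear_scale)
    also have "\<dots> = gradient f x \<bullet> v"
      by (simp add: gradient_def inner_sum_left inner_commute[of v] mult.commute)
    finally show ?thesis by simp
  qed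
  have tc: "times_cont_diff k (\<lambda>x. gradient f x \<bullet> b)" if "b \<in> Basis" for k b
    using times_cont_diff_SucD(2)[OF assms that] c[OF that] by simp
  then show "b \<in> Basis \<Longrightarrow> times_cont_diff k (\<lambda>x. gradient f x \<bullet> b)" .
  have "continuous_on UNIV (gradient f)"
    by (subst continuous_on_componentwise) (use times_cont_diff_continuous[OF tc] in auto)
  moreover have "(\<lambda>v. gradient f x \<bullet> v) = frechet_derivative f (at x)" for x using g by auto
  ultimately show "has_grad f (gradient f)"
    using d unfolding has_grad_def by simp
qed

text \<open>The factor \<open>m\<close> is there for the induction, since differentiation brings out
  a factor \<open>c\<close>.\<close>

lemma smooth_affine:
  fixes f :: "'a::euclidean_space \<Rightarrow> real"
  assumes "times_cont_diff k f"
  shows "times_cont_diff k (\<lambda>x. m * f (a + c *\<^sub>R x))"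
  using assms
proof (induction k arbitrary: f m)
  case 0
  then have f: "continuous_on UNIV f" by simp
  have "continuous_on UNIV (\<lambda>x. f (a + c *\<^sub>R x))"
    by (rule continuous_on_compose2[OF f]) (auto intro!: continuous_intros)
  then have "continuous_on UNIV (\<lambda>x. m * f (a + c *\<^sub>R x))" by (rule continuous_on_mult_left)
  then show ?case by simp
next
  case (Suc k)
  note d = times_cont_diff_SucD[OF Suc.prems]
  show ?case
  proof (rule times_cont_diff_SucI)
    fix x
    have "((\<lambda>x. a + c *\<^sub>R x) has_derivative (\<lambda>v. c *\<^sub>R v)) (at x)"
      by (auto intro!: derivative_eq_intros)
    from has_derivative_mult_right[OF has_derivative_compose[OF this d(1)], of m]
    show "((\<lambda>x. m * f (a + c *\<^sub>R x)) has_derivative (\<lambda>v. m * frechet_derivative f (at (a + c *\<^sub>R x)) (c *\<^sub>R v))) (at x)" .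
  next
    fix b :: 'a assume b: "b \<in> Basis"
    have *: "m * frechet_derivative f (at (a + c *\<^sub>R x)) (c *\<^sub>R b) = (m * c) * frechet_derivative f (at (a + c *\<^sub>R x)) b" for x
      using has_derivative_linear[OF d(1)] by (simp add: linear_scale)
    show "times_cont_diff k (\<lambda>x. m * frechet_derivative f (at (a + c *\<^sub>R x)) (c *\<^sub>R b))"
      unfolding * by (rule Suc.IH[OF d(2)[OF b]])
  qed
qed

text \<open>A partial derivative of the integral is the same integral with \<open>\<rho>\<close>
  replaced by a partial derivative of \<open>\<rho>\<close>; hence the induction ranges over all
  smooth kernels.\<close>

lemma smooth_kernel_integral:
  fixes \<rho> :: "'a::euclidean_space \<Rightarrow> real" and \<Phi> :: "'c::euclidean_space \<Rightarrow> 'a" and w :: "'c \<Rightarrow> 'b::euclidean_space"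
  assumes "\<And>k. times_cont_diff k \<rho>" and \<Phi>: "continuous_on UNIV \<Phi>"
    and w: "integrable lborel w" and supp: "\<And>y. y \<notin> cball 0 R \<Longrightarrow> w y = 0"
  shows "times_cont_diff k (\<lambda>x. LINT y|lborel. \<rho> (x - \<Phi> y) *\<^sub>R w y)"
  using assms(1)
proof (induction k arbitrary: \<rho>)
  case 0
  have "continuous_on UNIV (\<lambda>x. LINT y|lborel. \<rho> (x - \<Phi> y) *\<^sub>R w y)"
    by (rule continuous_kernel_integral[OF continuous_on_diff_image(1)[OF times_cont_diff_continuous[OF 0] \<Phi>] w supp])
  then show ?case by simp
next
  case (Suc k)
  note g = smooth_has_grad[OF Suc.prems]
  show ?case
    by (rule times_cont_diff_SucI[OF has_derivative_kernel_integral[OF g(1) \<Phi> w supp]])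
       (use Suc.IH[OF g(2)] in auto)
qed

section \<open>A smooth bump function\<close>

definition flat :: "nat \<Rightarrow> real \<Rightarrow> real" where
  "flat m s = (if s > 0 then exp (- 1 / s) / s ^ m else 0)"

lemma flat_nonneg: "flat m s \<ge> 0"
  by (simp add: flat_def)

lemma power_le_fact_exp:
  fixes y :: real assumes "y \<ge> 0" shows "y ^ n \<le> fact n * exp y"
proof -
  have "(\<Sum>i\<in>{n}. y ^ i /\<^sub>R fact i) \<le> (\<Sum>i. y ^ i /\<^sub>R fact i)"
    using assms by (intro sum_le_suminf summable_exp_generic) auto
  then show ?thesis by (simp add: exp_def field_simps)
qed

text \<open>This is \<open>power_le_fact_exp\<close> at \<open>1 / s\<close> with exponent
  \<open>Suc m\<close>. The linear decay at 0 is what the derivative there requires.\<close>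

lemma flat_le: "flat m s \<le> fact (Suc m) * \<bar>s\<bar>"
proof (cases "s > 0")
  case False
  then show ?thesis using mult_nonneg_nonneg[of "fact (Suc m)" "\<bar>s\<bar>"] by (simp add: flat_def del: fact_Suc)
next
  case True
  have "(1 / s) ^ Suc m \<le> fact (Suc m) * exp (1 / s)" using True by (intro power_le_fact_exp) auto
  then have "(1 / s) ^ m * (1 / s) \<le> fact (Suc m) * exp (1 / s)" by (simp add: mult.commute)
  then have "(1 / s) ^ m \<le> fact (Suc m) * exp (1 / s) * s" using True by (simp add: pos_divide_le_eq)
  then have "(1 / s) ^ m * exp (- (1 / s)) \<le> fact (Suc m) * exp (1 / s) * s * exp (- (1 / s))"
    by (intro mult_right_mono) auto
  also have "\<dots> = fact (Suc m) * s" by (simp add: exp_minus)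
  finally show ?thesis using True by (simp add: flat_def power_inverse mult.commute divide_inverse)
qed

text \<open>The powers in the denominator of \<open>flat\<close> serve this closure of the family
  under differentiation.\<close>

lemma flat_has_derivative:
  "(flat m has_real_derivative (- real m * flat (m + 1) s + flat (m + 2) s)) (at s)"
proof -
  consider "s > 0" | "s < 0" | "s = 0" by linarith
  then show ?thesis
  proof cases
    case 1
    have "((\<lambda>s. exp (- 1 / s) / s ^ m) has_real_derivative
        (exp (- 1 / s) * (1 / s ^ 2) * s ^ m - exp (- 1 / s) * (real m * s ^ (m - 1))) / (s ^ m * s ^ m)) (at s)"
      using 1 by (auto intro!: derivative_eq_intros simp: power2_eq_square)
    moreover have "(exp (- 1 / s) * (1 / s ^ 2) * s ^ m - exp (- 1 / s) * (real m * s ^ (m - 1))) / (s ^ m * s ^ m)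
        = - real m * flat (m + 1) s + flat (m + 2) s"
      using 1 by (cases m) (auto simp: flat_def field_simps power2_eq_square)
    ultimately have "((\<lambda>s. exp (- 1 / s) / s ^ m) has_real_derivative - real m * flat (m + 1) s + flat (m + 2) s) (at s)"
      by simp
    then show ?thesis
      by (rule has_field_derivative_transform_within_open[of _ _ _ "{0<..}"]) (use 1 in \<open>auto simp: flat_def\<close>)
  next
    case 2
    have "((\<lambda>s. 0) has_real_derivative - real m * flat (m + 1) s + flat (m + 2) s) (at s)"
      using 2 by (simp add: flat_def)
    then show ?thesis
      by (rule has_field_derivative_transform_within_open[of _ _ _ "{..<0}"]) (use 2 in \<open>auto simp: flat_def\<close>)
  next
    case 3
    \<comment> \<open>The difference quotient of \<open>flat m\<close> at 0 is
      \<open>flat (m + 1)\<close>.\<close>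
    have "((\<lambda>h. flat (m + 1) h) \<longlongrightarrow> 0) (at 0)"
    proof (rule Lim_null_comparison)
      show "\<forall>\<^sub>F h in at 0. norm (flat (m + 1) h) \<le> fact (Suc (m + 1)) * \<bar>h\<bar>"
        using flat_le[of "m + 1"] flat_nonneg[of "m+1"] by (intro always_eventually) simp
      show "((\<lambda>h. fact (Suc (m + 1)) * \<bar>h\<bar>) \<longlongrightarrow> (0::real)) (at 0)"
        by (auto intro!: tendsto_eq_intros)
    qed
    then have "((\<lambda>h. (flat m (0 + h) - flat m 0) / h) \<longlongrightarrow> 0) (at 0)"
      by (rule Lim_transform_eventually) (auto simp: eventually_at_filter flat_def)
    then show ?thesis using 3 by (simp add: DERIV_def flat_def)
  qed
qed

text \<open>A class of functions closed under directional derivatives: all of its members are smooth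
  by induction on the order, and no formula for higher derivatives of the bump is needed.\<close>

inductive bump_algebra :: "('a::euclidean_space \<Rightarrow> real) \<Rightarrow> bool" where
  const: "bump_algebra (\<lambda>x. c)"
| coordinate: "bump_algebra (\<lambda>x. x \<bullet> b)"
| flat: "bump_algebra (\<lambda>x. flat m (1 - x \<bullet> x))"
| add: "bump_algebra f \<Longrightarrow> bump_algebra g \<Longrightarrow> bump_algebra (\<lambda>x. f x + g x)"
| mult: "bump_algebra f \<Longrightarrow> bump_algebra g \<Longrightarrow> bump_algebra (\<lambda>x. f x * g x)"

lemma bump_algebra_derivative:
  assumes "bump_algebra f"
  shows "\<exists>f'. (\<forall>x. (f has_derivative f' x) (at x)) \<and> (\<forall>v. bump_algebra (\<lambda>x. f' x v))"
  using assms
proof induction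
  case (const c)
  show ?case by (intro exI[of _ "\<lambda>x v. 0"]) (auto intro: bump_algebra.const)
next
  case (coordinate b)
  show ?case
    by (intro exI[of _ "\<lambda>x v. v \<bullet> b"]) (auto intro!: derivative_eq_intros bump_algebra.const)
next
  case (flat m)
  let ?f' = "\<lambda>x v. (- real m * flat (m + 1) (1 - x \<bullet> x) + flat (m + 2) (1 - x \<bullet> x)) * ((- 2) * (x \<bullet> v))"
  have "((\<lambda>x. flat m (1 - x \<bullet> x)) has_derivative ?f' x) (at x)" for x :: 'a
  proof -
    have "((\<lambda>x. 1 - x \<bullet> x) has_derivative (\<lambda>v. (- 2) * (x \<bullet> v))) (at x)"
      by (auto intro!: derivative_eq_intros simp: inner_commute)
    from has_derivative_compose[OF this flat_has_derivative[unfolded has_field_derivative_def]]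
    show ?thesis .
  qed
  moreover have "bump_algebra (\<lambda>x. ?f' x v)" for v :: 'a
    by (intro bump_algebra.intros)
  ultimately show ?case by (intro exI[of _ ?f']) auto
next
  case (add f g)
  then obtain f' g' where "\<And>x. (f has_derivative f' x) (at x)" "\<And>v. bump_algebra (\<lambda>x. f' x v)"
    "\<And>x. (g has_derivative g' x) (at x)" "\<And>v. bump_algebra (\<lambda>x. g' x v)" by blast
  then show ?case
    by (intro exI[of _ "\<lambda>x v. f' x v + g' x v"]) (auto intro: has_derivative_add bump_algebra.intros)
next
  case (mult f g)
  then obtain f' g' where "\<And>x. (f has_derivative f' x) (at x)" "\<And>v. bump_algebra (\<lambda>x. f' x v)"
    "\<And>x. (g has_derivative g' x) (at x)" "\<And>v. bump_algebra (\<lambda>x. g' x v)" by blast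
  then show ?case using mult.hyps
    by (intro exI[of _ "\<lambda>x v. f x * g' x v + f' x v * g x"] conjI allI has_derivative_mult
        bump_algebra.add[OF bump_algebra.mult bump_algebra.mult]) auto
qed

lemma bump_algebra_smooth: "bump_algebra f \<Longrightarrow> times_cont_diff k f"
proof (induction k arbitrary: f)
  case 0
  then obtain f' where "\<And>x. (f has_derivative f' x) (at x)" using bump_algebra_derivative by blast
  then have "continuous_on UNIV f" by (intro continuous_at_imp_continuous_on ballI has_derivative_continuous)
  then show ?case by simp
next
  case (Suc k)
  then obtain f' where f': "\<And>x. (f has_derivative f' x) (at x)" "\<And>v. bump_algebra (\<lambda>x. f' x v)"
    using bump_algebra_derivative by blast
  show ?case by (rule times_cont_diff_SucI[OF f'(1) Suc.IH[OF f'(2)]])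
qed

definition mollifier :: "'a::euclidean_space \<Rightarrow> real" where
  "mollifier x = 1 / (LINT y|lborel. flat 0 (1 - (y::'a) \<bullet> y)) * flat 0 (1 - x \<bullet> x)"

lemma smooth_mollifier: "times_cont_diff k (mollifier :: 'a::euclidean_space \<Rightarrow> real)"
  unfolding mollifier_def [abs_def] by (intro bump_algebra_smooth bump_algebra.intros)

lemma mollifier_unit_kernel: "unit_kernel (mollifier :: 'a::euclidean_space \<Rightarrow> real)"
  and integral_mollifier: "(LINT x|lborel. mollifier (x::'a::euclidean_space)) = 1"
proof -
  let ?b = "\<lambda>x::'a. flat 0 (1 - x \<bullet> x)"
  have bc: "continuous_on UNIV ?b"
    by (rule times_cont_diff_continuous[OF bump_algebra_smooth[OF bump_algebra.flat], of 0])
  have b0: "?b x = 0" if "x \<notin> cball 0 1" for x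
  proof -
    have "1 < norm x" using that by simp
    then have "1 < (norm x)\<^sup>2" by (simp add: power2_eq_square less_1_mult)
    then show ?thesis by (simp add: flat_def power2_norm_eq_inner)
  qed
  have bi: "integrable lborel ?b" by (rule integrable_continuous_bounded_support[OF bc b0])
  \<comment> \<open>On the ball of radius 1/2 the number \<open>1 - x \<bullet> x\<close> is at
    least \<open>3 / 4\<close>, so the exponent in the bump is at least
    \<open>- 4 / 3\<close>.\<close>
  have "(LINT x|lborel. exp (- 4 / 3) * indicator (cball (0::'a) (1/2)) x) \<le> (LINT x|lborel. ?b x)"
  proof (rule integral_mono[OF _ bi])
    show "integrable lborel (\<lambda>x. exp (- 4 / 3) * indicator (cball (0::'a) (1/2)) x :: real)"
      using emeasure_bounded_finite[of "cball (0::'a) (1/2)"] by (intro integrable_mult_right integrable_real_indicator) auto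
    fix x :: 'a
    show "exp (- 4 / 3) * indicator (cball (0::'a) (1/2)) x \<le> ?b x"
    proof (cases "x \<in> cball 0 (1/2)")
      case True
      then have "(norm x)\<^sup>2 \<le> (1/2)\<^sup>2" by (intro power_mono) auto
      then have "x \<bullet> x \<le> (1/2)\<^sup>2" unfolding power2_norm_eq_inner .
      then have *: "1 - x \<bullet> x \<ge> 3 / 4" by (simp add: power2_eq_square)
      then have "1 / (1 - x \<bullet> x) \<le> 1 / (3 / 4)" by (intro divide_left_mono) auto
      then have "- 4 / 3 \<le> - 1 / (1 - x \<bullet> x)" by simp
      then show ?thesis using True * by (simp add: flat_def)
    qed (simp add: flat_nonneg)
  qed
  moreover have "(LINT x|lborel. exp (- 4 / 3) * indicator (cball (0::'a) (1/2)) x) > (0::real)"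
    by simp
  ultimately have pos: "(LINT x|lborel. ?b x) > 0" by linarith
  show "unit_kernel (mollifier :: 'a \<Rightarrow> real)"
    unfolding unit_kernel_def mollifier_def [abs_def]
    using bc b0 pos flat_nonneg by (auto intro!: continuous_intros)
  show "(LINT x|lborel. mollifier (x::'a)) = 1"
    unfolding mollifier_def [abs_def] using pos by simp
qed

lemma smooth_rescale_mollifier:
  "times_cont_diff k (rescale e (mollifier :: 'a::euclidean_space \<Rightarrow> real))"
  "times_cont_diff k (\<lambda>y. rescale e (mollifier :: 'a::euclidean_space \<Rightarrow> real) (x - y))"
  using smooth_affine[OF smooth_mollifier, of k "(1 / e) ^ DIM('a)" "0::'a" "1 / e"]
    smooth_affine[OF smooth_mollifier, of k "(1 / e) ^ DIM('a)" "(1 / e) *\<^sub>R x" "- (1 / e)"]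
  by (simp_all add: rescale_def[abs_def] scaleR_diff_right)

section \<open>Convolution with an approximate identity\<close>

definition smear :: "('a::euclidean_space \<Rightarrow> real) \<Rightarrow> real \<Rightarrow> ('a \<Rightarrow> 'b::euclidean_space) \<Rightarrow> 'a \<Rightarrow> 'b" where
  "smear \<sigma> e f x = (LINT y|lborel. rescale e \<sigma> (x - y) *\<^sub>R f y)"

lemma kernel_eq_0:
  assumes \<sigma>: "unit_kernel \<sigma>" and e: "e > 0" and "\<And>y. w y \<noteq> 0 \<Longrightarrow> norm (x - \<Phi> y) > e"
  shows "(LINT y|lborel. rescale e \<sigma> (x - \<Phi> y) *\<^sub>R w y) = 0"
proof -
  have *: "rescale e \<sigma> (x - \<Phi> y) *\<^sub>R w y = 0" for y
    using rescale_eq_0[OF \<sigma> e] assms(3)[of y] by (cases "w y = 0") auto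
  show ?thesis by (simp only: * Bochner_Integration.integral_zero)
qed

lemma continuous_rescale_diff:
  assumes \<sigma>: "unit_kernel (\<sigma> :: 'a::euclidean_space \<Rightarrow> real)" and \<Phi>: "continuous_on UNIV (\<Phi> :: 'c::euclidean_space \<Rightarrow> 'a)"
  shows "continuous_on UNIV (\<lambda>(x, y). rescale e \<sigma> (x - \<Phi> y))" "continuous_on UNIV (\<lambda>y. rescale e \<sigma> (x - \<Phi> y))"
proof -
  have "continuous_on UNIV (rescale e \<sigma>)" using \<sigma> by (simp add: unit_kernel_def continuous_rescale)
  from continuous_on_diff_image[OF this \<Phi>]
  show "continuous_on UNIV (\<lambda>(x, y). rescale e \<sigma> (x - \<Phi> y))" "continuous_on UNIV (\<lambda>y. rescale e \<sigma> (x - \<Phi> y))"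
    by auto
qed

lemma continuous_smear:
  assumes "unit_kernel \<sigma>" "integrable lborel f" "\<And>y. y \<notin> cball 0 R \<Longrightarrow> f y = 0"
  shows "continuous_on UNIV (smear \<sigma> e f)"
  unfolding smear_def [abs_def]
  by (rule continuous_kernel_integral[OF continuous_rescale_diff(1)[OF assms(1) continuous_on_id] assms(2,3)])

lemma smear_bound:
  fixes \<sigma> :: "'a::euclidean_space \<Rightarrow> real" and f :: "'a \<Rightarrow> 'b::euclidean_space"
  assumes \<sigma>: "unit_kernel \<sigma>" and e: "e > 0" and f: "square_integrable f" and supp: "\<And>y. y \<notin> cball 0 R \<Longrightarrow> f y = 0"
  shows "square_integrable (smear \<sigma> e f)" "l2_norm (smear \<sigma> e f) \<le> (LINT y|lborel. \<sigma> y) * l2_norm f"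
proof -
  have I: "(LINT y|lborel. \<sigma> y) \<ge> 0" using \<sigma> by (simp add: unit_kernel_def)
  note s = schur_bound[OF continuous_rescale_diff(1)[OF \<sigma> continuous_on_id] rescale_nonneg[OF \<sigma> e] f supp
      eq_refl[OF nn_integral_rescale(1)[OF \<sigma> e]] I eq_refl[OF nn_integral_rescale(2)[OF \<sigma> e]] I]
  show "square_integrable (smear \<sigma> e f)" "l2_norm (smear \<sigma> e f) \<le> (LINT y|lborel. \<sigma> y) * l2_norm f"
    using s I by (simp_all add: smear_def[abs_def])
qed

lemma smear_uniform:
  fixes \<sigma> :: "'a::euclidean_space \<Rightarrow> real" and g :: "'a \<Rightarrow> 'b::euclidean_space"
  assumes \<sigma>: "unit_kernel \<sigma>" and e: "e > 0" and g: "continuous_on UNIV g"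
    and near: "\<And>x y. norm (x - y) \<le> e \<Longrightarrow> norm (g x - g y) \<le> \<eta>"
  shows "norm (smear \<sigma> e g x - (LINT y|lborel. \<sigma> y) *\<^sub>R g x) \<le> (LINT y|lborel. \<sigma> y) * \<eta>"
proof -
  have c: "continuous_on UNIV \<sigma>" using \<sigma> by (simp add: unit_kernel_def)
  note k = continuous_rescale_diff(2)[OF \<sigma> continuous_on_id, of e x]
  have i1: "integrable lborel (\<lambda>y. rescale e \<sigma> (x - y))" by (rule integrable_rescale[OF \<sigma> e])
  have z: "rescale e \<sigma> (x - y) = 0" if "y \<notin> cball 0 (norm x + e)" for y
  proof -
    have "norm (x - y) > e" using that norm_triangle_ineq2[of y x] by (simp add: norm_minus_commute)
    then show ?thesis using rescale_eq_0[OF \<sigma> e] by simp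
  qed
  have i2: "integrable lborel (\<lambda>y. rescale e \<sigma> (x - y) *\<^sub>R g y)"
    by (rule integrable_continuous_bounded_support[of _ "norm x + e"]) (use z in \<open>auto intro!: continuous_intros k g\<close>)
  have "smear \<sigma> e g x - (LINT y|lborel. \<sigma> y) *\<^sub>R g x = (LINT y|lborel. rescale e \<sigma> (x - y) *\<^sub>R (g y - g x))"
    using i1 i2 integral_rescale[OF c e, of x] by (simp add: smear_def scaleR_diff_right)
  also have "norm \<dots> \<le> (LINT y|lborel. norm (rescale e \<sigma> (x - y) *\<^sub>R (g y - g x)))" by (rule integral_norm_bound)
  also have "\<dots> \<le> (LINT y|lborel. rescale e \<sigma> (x - y) * \<eta>)"
  proof (rule integral_mono)
    show "integrable lborel (\<lambda>y. norm (rescale e \<sigma> (x - y) *\<^sub>R (g y - g x)))"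
      using i1 i2 by (intro integrable_norm) (simp add: scaleR_diff_right)
    fix y
    show "norm (rescale e \<sigma> (x - y) *\<^sub>R (g y - g x)) \<le> rescale e \<sigma> (x - y) * \<eta>"
    proof (cases "norm (x - y) \<le> e")
      case True
      then show ?thesis using rescale_nonneg[OF \<sigma> e, of "x - y"] near[of x y]
        by (auto simp: norm_minus_commute intro!: mult_left_mono)
    qed (use rescale_eq_0[OF \<sigma> e, of "x - y"] in auto)
  qed (use i1 in auto)
  also have "\<dots> = (LINT y|lborel. \<sigma> y) * \<eta>" using integral_rescale[OF c e, of x] by simp
  finally show ?thesis .
qed

lemma smear_eq_0:
  assumes \<sigma>: "unit_kernel \<sigma>" and e: "e > 0" and "\<And>y. f y \<noteq> 0 \<Longrightarrow> norm (x - y) > e"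
  shows "smear \<sigma> e f x = 0"
  unfolding smear_def by (rule kernel_eq_0[OF \<sigma> e]) (use assms(3) in auto)

lemma smear_support:
  assumes \<sigma>: "unit_kernel \<sigma>" and e: "0 < e" "e \<le> 1" and supp: "\<And>y. y \<notin> cball 0 R \<Longrightarrow> f y = 0" and x: "x \<notin> cball 0 (R + 1)"
  shows "smear \<sigma> e f x = 0"
proof (rule smear_eq_0[OF \<sigma> e(1)])
  fix y assume "f y \<noteq> 0"
  then have "norm y \<le> R" using supp[of y] by auto
  then show "e < norm (x - y)" using x e norm_triangle_ineq2[of x y] by auto
qed

lemma smear_diff:
  assumes \<sigma>: "unit_kernel \<sigma>" and f: "integrable lborel f" "\<And>y. y \<notin> cball 0 R \<Longrightarrow> f y = 0"
    and g: "integrable lborel g" "\<And>y. y \<notin> cball 0 R' \<Longrightarrow> g y = 0"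
  shows "smear \<sigma> e (\<lambda>y. f y - g y) x = smear \<sigma> e f x - smear \<sigma> e g x"
  unfolding smear_def scaleR_diff_right
  by (intro Bochner_Integration.integral_diff
      integrable_continuous_scaleR[OF continuous_rescale_diff(2)[OF \<sigma> continuous_on_id] f]
      integrable_continuous_scaleR[OF continuous_rescale_diff(2)[OF \<sigma> continuous_on_id] g])

text \<open>For a continuous \<open>g\<close> of bounded support the convergence is uniform; the
  remainder \<open>f - g\<close> is controlled by Schur's test uniformly in \<open>e\<close>. The
  limit carries the mass of \<open>\<sigma>\<close>, which is not normalised.\<close>

lemma smear_tendsto_l2:
  fixes \<sigma> :: "'a::euclidean_space \<Rightarrow> real" and f :: "'a \<Rightarrow> 'b::euclidean_space"
  assumes \<sigma>: "unit_kernel \<sigma>" and f: "square_integrable f" and supp: "\<And>y. y \<notin> cball 0 R \<Longrightarrow> f y = 0" and \<eta>: "\<eta> > 0"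
  obtains \<tau> where "\<tau> > 0" "\<And>e. 0 < e \<Longrightarrow> e < \<tau> \<Longrightarrow> l2_norm (\<lambda>x. smear \<sigma> e f x - (LINT y|lborel. \<sigma> y) *\<^sub>R f x) < \<eta>"
proof -
  define I where "I = (LINT y|lborel. \<sigma> y)"
  have I: "I \<ge> 0" using \<sigma> by (simp add: unit_kernel_def I_def)
  \<comment> \<open>Three errors of at most \<open>I * \<theta>\<close> each; with
    \<open>I + 1\<close> in the denominator their sum is less than \<open>\<eta>\<close> even for
    \<open>I = 0\<close>.\<close>
  define \<theta> where "\<theta> = \<eta> / (3 * (I + 1))"
  have \<theta>: "\<theta> > 0" using I \<eta> by (simp add: \<theta>_def)
  obtain g where g: "continuous_on UNIV g" "\<And>x. x \<notin> cball 0 (R + 1) \<Longrightarrow> g x = 0" "l2_norm (\<lambda>x. f x - g x) < \<theta>"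
    using continuous_dense_l2[OF f supp \<theta>] by metis
  have gs: "square_integrable g" by (rule square_integrable_continuous_bounded_support[OF g(1,2)])
  define V where "V = sqrt (measure lborel (cball (0::'a) (R + 2)))"
  have V: "V \<ge> 0" by (simp add: V_def)
  \<comment> \<open>\<open>V\<close> converts a uniform bound on the ball of radius
    \<open>R + 2\<close> into an \<open>L\<^sup>2\<close> bound: \<open>g\<close> is supported in
    radius \<open>R + 1\<close>, and smearing widens the support by at most 1.\<close>
  define \<mu> where "\<mu> = \<theta> / (V + 1)"
  have \<mu>: "\<mu> > 0" using V \<theta> by (simp add: \<mu>_def)
  obtain d where d: "d > 0" "\<And>x y. norm (x - y) < d \<Longrightarrow> norm (g x - g y) < \<mu>"
    using uniformly_continuous_bounded_support[OF g(1,2) \<mu>] by metis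
  show ?thesis
  proof (rule that[of "min 1 d"])
    show "min 1 d > 0" using d by simp
    fix e assume e: "0 < e" "e < min 1 d"
    have fi: "integrable lborel f" by (rule square_integrable_imp_integrable[OF f supp])
    have gi: "integrable lborel g" by (rule square_integrable_imp_integrable[OF gs g(2)])
    have fgs: "square_integrable (\<lambda>x. f x - g x)" by (rule square_integrable_diff[OF f gs])
    have fgsupp: "f y - g y = 0" if "y \<notin> cball 0 (R + 1)" for y using supp[of y] g(2)[of y] that by auto
    have sb: "square_integrable (smear \<sigma> e (\<lambda>y. f y - g y))"
      "l2_norm (smear \<sigma> e (\<lambda>y. f y - g y)) \<le> I * l2_norm (\<lambda>y. f y - g y)"
      unfolding I_def by (rule smear_bound[OF \<sigma> e(1) fgs, of "R + 1"]; use fgsupp in blast)+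
    have 1: "l2_norm (smear \<sigma> e (\<lambda>y. f y - g y)) \<le> I * \<theta>"
      using sb(2) g(3) I mult_left_mono[of "l2_norm (\<lambda>x. f x - g x)" \<theta> I] by simp
    have un: "norm (smear \<sigma> e g x - I *\<^sub>R g x) \<le> I * \<mu>" for x
      unfolding I_def by (rule smear_uniform[OF \<sigma> e(1) g(1)]) (use d(2) e in \<open>force intro: less_imp_le\<close>)
    have z: "smear \<sigma> e g x - I *\<^sub>R g x = 0" if "x \<notin> cball 0 (R + 2)" for x
    proof -
      have "smear \<sigma> e g x = 0"
        by (rule smear_support[OF \<sigma> e(1), of "R + 1"]) (use g(2) that e in auto)
      then show ?thesis using g(2)[of x] that by simp
    qed
    have c: "continuous_on UNIV (\<lambda>x. smear \<sigma> e g x - I *\<^sub>R g x)"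
      by (intro continuous_intros continuous_smear[OF \<sigma> gi g(2)] g(1))
    have 2: "square_integrable (\<lambda>x. smear \<sigma> e g x - I *\<^sub>R g x)" "l2_norm (\<lambda>x. smear \<sigma> e g x - I *\<^sub>R g x) \<le> I * \<mu> * V"
      using square_integrable_bounded_support[OF borel_measurable_continuous[OF c] un z] by (auto simp: V_def)
    have 3: "square_integrable (\<lambda>x. I *\<^sub>R (f x - g x))" "l2_norm (\<lambda>x. I *\<^sub>R (f x - g x)) \<le> I * \<theta>"
      using square_integrable_scaleR[OF fgs, of I] g(3) I by (auto simp: l2_norm_scaleR intro: mult_left_mono)
    have sd: "smear \<sigma> e (\<lambda>y. f y - g y) x = smear \<sigma> e f x - smear \<sigma> e g x" for x
      by (rule smear_diff[OF \<sigma> fi _ gi, where R = R and R' = "R + 1"]) (use supp g(2) in auto)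
    have eq: "smear \<sigma> e f x - I *\<^sub>R f x = (smear \<sigma> e (\<lambda>y. f y - g y) x + (smear \<sigma> e g x - I *\<^sub>R g x)) - I *\<^sub>R (f x - g x)" for x
      using sd[of x] by (simp add: algebra_simps)
    have "l2_norm (\<lambda>x. smear \<sigma> e f x - I *\<^sub>R f x) \<le>
        l2_norm (\<lambda>x. smear \<sigma> e (\<lambda>y. f y - g y) x + (smear \<sigma> e g x - I *\<^sub>R g x)) + l2_norm (\<lambda>x. - (I *\<^sub>R (f x - g x)))"
      using l2_norm_triangle[OF square_integrable_add[OF sb(1) 2(1)] square_integrable_minus[OF 3(1)]] by (simp add: eq)
    also have "\<dots> \<le> (I * \<theta> + I * \<mu> * V) + I * \<theta>"
      using l2_norm_triangle[OF sb(1) 2(1)] 1 2(2) 3(2) by (simp add: l2_norm_minus)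
    also have "\<mu> * V \<le> \<theta>" using V \<theta> by (simp add: \<mu>_def field_simps)
    then have "(I * \<theta> + I * \<mu> * V) + I * \<theta> \<le> I * \<theta> + I * \<theta> + I * \<theta>"
      using I by (simp add: mult_left_mono mult.assoc)
    also have "\<dots> = I * (3 * \<theta>)" by (simp add: algebra_simps)
    also have "3 * \<theta> = \<eta> / (I + 1)" unfolding \<theta>_def by (simp add: field_split_simps)
    also have "I * (\<eta> / (I + 1)) = \<eta> * (I / (I + 1))" by simp
    also have "\<dots> < \<eta> * 1" using I \<eta> by (intro mult_strict_left_mono) auto
    finally show "l2_norm (\<lambda>x. smear \<sigma> e f x - (LINT y|lborel. \<sigma> y) *\<^sub>R f x) < \<eta>" by (simp add: I_def)
  qed
qed

section \<open>Pull-back along a shear map and transport of solenoidal fields\<close>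

lemma test_functionsI:
  assumes "\<And>k. times_cont_diff k \<phi>" "compact C" "C \<subseteq> U" "\<And>x. \<phi> x \<noteq> 0 \<Longrightarrow> x \<in> C"
  shows "\<phi> \<in> test_functions U"
proof -
  have "closure {x. \<phi> x \<noteq> 0} \<subseteq> C"
    using assms by (intro closure_minimal) (auto simp: compact_imp_closed)
  then show ?thesis
    using assms compact_Int_closed[OF assms(2), of "closure {x. \<phi> x \<noteq> 0}"]
    by (auto simp: test_functions_def inf.absorb2)
qed

lemma test_functionsD:
  assumes "\<phi> \<in> test_functions U"
  shows "\<And>k. times_cont_diff k \<phi>" "compact (closure {x. \<phi> x \<noteq> 0})" "\<And>x. \<phi> x \<noteq> 0 \<Longrightarrow> x \<in> U"
  using assms closure_subset by (fastforce simp: test_functions_def)+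

lemma compact_subset_cball:
  fixes C :: "'a::real_normed_vector set"
  assumes "compact C" obtains R where "C \<subseteq> cball 0 R"
  using compact_imp_bounded[OF assms] unfolding bounded_iff by (auto simp: subset_iff)

text \<open>Differentiation under the integral puts the gradient on the mollifier, and integration
  by parts moves it onto \<open>v\<close>. Convergence of gradients thus reduces to
  \<open>smear_tendsto_l2\<close>.\<close>

lemma has_grad_smear_mollifier:
  fixes v :: "'a::euclidean_space \<Rightarrow> real"
  assumes v: "has_grad v p" and supp: "\<And>x. x \<notin> cball 0 R \<Longrightarrow> v x = 0"
  shows "has_grad (smear mollifier e v) (smear mollifier e p)"
proof -
  note vc = has_grad_continuous[OF v] and pc = has_grad_continuous_grad[OF v]
  have psupp: "p x = 0" if "x \<notin> cball 0 R" for x using has_grad_support[OF v supp that] .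
  have vi: "integrable lborel v" by (rule integrable_continuous_bounded_support[OF vc supp])
  have pi: "integrable lborel p" by (rule integrable_continuous_bounded_support[OF pc psupp])
  define r where "r = gradient (rescale e (mollifier :: 'a \<Rightarrow> real))"
  have r: "has_grad (rescale e mollifier) r"
    unfolding r_def by (rule smooth_has_grad(1)[OF smooth_rescale_mollifier(1)])
  show ?thesis
    unfolding has_grad_def
  proof (intro conjI allI)
    show "continuous_on UNIV (smear mollifier e p)"
      by (rule continuous_smear[OF mollifier_unit_kernel pi psupp])
    fix x
    have d: "(smear mollifier e v has_derivative (\<lambda>u. LINT y|lborel. (r (x - y) \<bullet> u) *\<^sub>R v y)) (at x)"
      unfolding smear_def[abs_def]
      by (rule has_derivative_kernel_integral[OF r continuous_on_id vi supp])
    have i: "integrable lborel (\<lambda>y. rescale e mollifier (x - y) *\<^sub>R p y)"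
      by (rule integrable_continuous_scaleR[OF continuous_rescale_diff(2)[OF mollifier_unit_kernel continuous_on_id] pi psupp])
    have "(LINT y|lborel. (r (x - y) \<bullet> u) *\<^sub>R v y) = smear mollifier e p x \<bullet> u" for u
    proof -
      have "smear mollifier e p x \<bullet> u = (LINT y|lborel. (p y \<bullet> u) * rescale e mollifier (x - y))"
        unfolding smear_def by (subst integral_inner_left[OF i, symmetric]) (simp add: mult.commute)
      also have "\<dots> = - (LINT y|lborel. v y * (- r (x - y) \<bullet> u))"
        by (rule integral_by_parts[OF v supp has_grad_reflect[OF r]])
      also have "\<dots> = (LINT y|lborel. (r (x - y) \<bullet> u) *\<^sub>R v y)" by (simp add: mult.commute)
      finally show ?thesis ..
    qed
    then show "(smear mollifier e v has_derivative (\<bullet>) (smear mollifier e p x)) (at x)" using d by simp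
  qed
qed

lemma smear_mollifier_test_function:
  fixes f :: "'a::euclidean_space \<Rightarrow> 'b::euclidean_space"
  assumes f: "integrable lborel f" and C: "compact C" "\<And>y. f y \<noteq> 0 \<Longrightarrow> y \<in> C"
    and e: "e > 0" "\<And>y. y \<in> C \<Longrightarrow> cball y e \<subseteq> U"
  shows "smear mollifier e f \<in> test_functions U"
proof (rule test_functionsI)
  obtain R where R: "C \<subseteq> cball 0 R" using compact_subset_cball[OF C(1)] .
  show "times_cont_diff k (smear mollifier e f)" for k
    unfolding smear_def[abs_def]
    by (rule smooth_kernel_integral[OF smooth_rescale_mollifier(1) continuous_on_id f, of R]) (use C(2) R in blast)
  show "compact {x + y |x y. x \<in> C \<and> y \<in> cball 0 e}" by (rule compact_sums[OF C(1) compact_cball])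
  show "{x + y |x y. x \<in> C \<and> y \<in> cball 0 e} \<subseteq> U"
  proof safe
    fix x y assume "x \<in> C" "y \<in> cball (0::'a) e"
    then have "x + y \<in> cball x e" by (simp add: dist_norm)
    then show "x + y \<in> U" using e(2)[OF \<open>x \<in> C\<close>] by blast
  qed
  fix x assume "smear mollifier e f x \<noteq> 0"
  then obtain y where "f y \<noteq> 0" "norm (x - y) \<le> e"
    using smear_eq_0[OF mollifier_unit_kernel e(1), of f x] by force
  then have "x = y + (x - y)" "y \<in> C" "x - y \<in> cball 0 e" using C by auto
  then show "x \<in> {x + y |x y. x \<in> C \<and> y \<in> cball 0 e}" by blast
qed

text \<open>At a scale below the distance from \<open>C\<close> to the complement of
  \<open>U\<close> the mollified function is a test function on \<open>U\<close>, and its gradient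
  is the mollified gradient.\<close>

lemma c1_approx_test_function:
  fixes v :: "'a::euclidean_space \<Rightarrow> real"
  assumes v: "has_grad v p" and C: "compact C" "\<And>y. v y \<noteq> 0 \<Longrightarrow> y \<in> C" and U: "open U" "C \<subseteq> U" and \<eta>: "\<eta> > 0"
  obtains \<phi> where "\<phi> \<in> test_functions U" "l2_norm (\<lambda>x. gradient \<phi> x - p x) < \<eta>"
proof -
  obtain R where R: "C \<subseteq> cball 0 R" using compact_subset_cball[OF C(1)] .
  have supp: "v y = 0" if "y \<notin> cball 0 R" for y using C(2) R that by blast
  have psupp: "p y = 0" if "y \<notin> cball 0 R" for y using has_grad_support[OF v supp that] .
  note pc = has_grad_continuous_grad[OF v] and vc = has_grad_continuous[OF v]
  have ps: "square_integrable p" by (rule square_integrable_continuous_bounded_support[OF pc psupp])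
  have vi: "integrable lborel v" by (rule integrable_continuous_bounded_support[OF vc supp])
  obtain d where d: "d > 0" "(\<Union>y\<in>C. cball y d) \<subseteq> U"
    using compact_subset_open_imp_cball_epsilon_subset[OF C(1) U] .
  obtain \<tau> where \<tau>: "\<tau> > 0" "\<And>e. 0 < e \<Longrightarrow> e < \<tau> \<Longrightarrow>
      l2_norm (\<lambda>x. smear mollifier e p x - (LINT y|lborel. (mollifier :: 'a \<Rightarrow> real) y) *\<^sub>R p x) < \<eta>"
    using smear_tendsto_l2[OF mollifier_unit_kernel ps psupp \<eta>] by blast
  define e where "e = min d (\<tau> / 2)"
  have e: "0 < e" "e \<le> d" "e < \<tau>" using d \<tau> by (auto simp: e_def min_def)
  show ?thesis
  proof (rule that)
    show "smear mollifier e v \<in> test_functions U"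
    proof (rule smear_mollifier_test_function[OF vi C e(1)])
      fix y assume "y \<in> C"
      then show "cball y e \<subseteq> U" using d(2) e(2) subset_cball[of e d y] by blast
    qed
    have "gradient (smear mollifier e v) = smear mollifier e p"
      by (rule has_grad_gradient[OF has_grad_smear_mollifier[OF v supp]])
    then show "l2_norm (\<lambda>x. gradient (smear mollifier e v) x - p x) < \<eta>"
      using \<tau>(2)[OF e(1,3)] by (simp add: integral_mollifier)
  qed
qed

text \<open>One constant bounds both the field and its derivative, so that a small \<open>L\<close>
  makes \<open>id + X\<close> and \<open>id - X\<close> close to the identity in the C^1
  sense.\<close>

definition c1_field :: "('a::euclidean_space \<Rightarrow> 'a) \<Rightarrow> ('a \<Rightarrow> 'a \<Rightarrow> 'a) \<Rightarrow> real \<Rightarrow> bool" where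
  "c1_field X X' L \<longleftrightarrow> (\<forall>x. (X has_derivative X' x) (at x)) \<and> (\<forall>v. continuous_on UNIV (\<lambda>x. X' x v)) \<and>
     (\<forall>x v. norm (X' x v) \<le> L * norm v) \<and> (\<forall>x. norm (X x) \<le> L)"

lemma c1_fieldD:
  assumes "c1_field X X' L"
  shows "(X has_derivative X' x) (at x)" "continuous_on UNIV (\<lambda>x. X' x v)" "norm (X' x v) \<le> L * norm v"
    "norm (X x) \<le> L" "L \<ge> 0" "linear (X' x)" "continuous_on UNIV X"
proof -
  show d: "(X has_derivative X' x) (at x)" for x using assms by (simp add: c1_field_def)
  show "continuous_on UNIV (\<lambda>x. X' x v)" "norm (X' x v) \<le> L * norm v" "norm (X x) \<le> L"
    using assms by (auto simp: c1_field_def)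
  then show "L \<ge> 0" using norm_ge_zero order_trans by blast
  show "linear (X' x)" by (rule has_derivative_linear[OF d])
  show "continuous_on UNIV X" using d by (intro continuous_at_imp_continuous_on ballI has_derivative_continuous)
qed

lemma c1_field_scaleR:
  assumes "c1_field X X' L" "t \<ge> 0"
  shows "c1_field (\<lambda>x. t *\<^sub>R X x) (\<lambda>x v. t *\<^sub>R X' x v) (t * L)"
  using assms unfolding c1_field_def
  by (auto intro!: derivative_eq_intros continuous_intros mult_left_mono simp: mult.assoc)

lemma c1_field_lipschitz:
  assumes X: "c1_field X X' L"
  shows "norm (X x - X y) \<le> L * norm (x - y)"
proof (rule differentiable_bound[of UNIV X X' L])
  show "(X has_derivative X' x) (at x within UNIV)" for x using c1_fieldD(1)[OF X] .
  show "onorm (X' x) \<le> L" for x using c1_fieldD(3)[OF X] by (intro onorm_le) auto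
qed auto

text \<open>The Lipschitz constant of \<open>X\<close> is at most 1/2. This is the quantitative
  injectivity that \<open>nn_integral_rescale_bilipschitz\<close> asks for, in both directions of
  the displacement.\<close>

lemma c1_field_expansion:
  assumes X: "c1_field X X' L" "L \<le> 1/2"
  shows "norm (x - y) \<le> 2 * norm ((x - X x) - (y - X y))" "norm (x - y) \<le> 2 * norm ((x + X x) - (y + X y))"
proof -
  have *: "norm (X x - X y) \<le> 1/2 * norm (x - y)"
    using c1_field_lipschitz[OF X(1), of x y] mult_right_mono[OF X(2), of "norm (x - y)"] by simp
  have "norm (x - y) \<le> norm ((x - X x) - (y - X y)) + norm (X x - X y)"
    using norm_triangle_ineq[of "(x - X x) - (y - X y)" "X x - X y"] by (simp add: algebra_simps)
  then show "norm (x - y) \<le> 2 * norm ((x - X x) - (y - X y))" using * by simp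
  have "norm (x - y) \<le> norm ((x + X x) - (y + X y)) + norm (X x - X y)"
    using norm_triangle_ineq4[of "(x + X x) - (y + X y)" "X x - X y"] by (simp add: algebra_simps)
  then show "norm (x - y) \<le> 2 * norm ((x + X x) - (y + X y))" using * by simp
qed

section \<open>Pull-back of gradient fields\<close>

lemma norm_adjoint_le:
  fixes f :: "'a::euclidean_space \<Rightarrow> 'a"
  assumes "linear f" "\<And>v. norm (f v) \<le> L * norm v"
  shows "norm (adjoint f w) \<le> L * norm w"
proof (cases "adjoint f w = 0")
  case True
  have "0 \<le> L * norm w" using assms(2)[of w] norm_ge_zero order_trans by blast
  then show ?thesis using True by simp
next
  case False
  have "norm (adjoint f w) * norm (adjoint f w) = adjoint f w \<bullet> adjoint f w" by (simp add: dot_square_norm power2_eq_square)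
  also have "\<dots> = f (adjoint f w) \<bullet> w" by (rule adjoint_works[OF assms(1)])
  also have "\<dots> \<le> norm (f (adjoint f w)) * norm w" by (rule norm_cauchy_schwarz)
  also have "\<dots> \<le> (L * norm (adjoint f w)) * norm w" by (intro mult_right_mono assms) auto
  finally have "norm (adjoint f w) * norm (adjoint f w) \<le> (L * norm w) * norm (adjoint f w)" by (simp add: ac_simps)
  then show ?thesis using False by simp
qed

lemma continuous_adjoint:
  assumes X: "c1_field X X' L" and p: "continuous_on UNIV (p :: 'a::euclidean_space \<Rightarrow> 'a)"
  shows "continuous_on UNIV (\<lambda>x. adjoint (X' x) (p x))"
proof -
  have "adjoint (X' x) (p x) = (\<Sum>b\<in>Basis. (p x \<bullet> X' x b) *\<^sub>R b)" for x
    by (subst euclidean_representation[symmetric, of "adjoint (X' x) (p x)"])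
       (simp add: adjoint_works[OF c1_fieldD(6)[OF X]] adjoint_clauses[OF c1_fieldD(6)[OF X]] inner_commute)
  then show ?thesis by (simp add: continuous_intros p c1_fieldD(2)[OF X])
qed

text \<open>After mollification of \<open>g\<close>, the composition
  \<open>x \<mapsto> smear mollifier e g (\<Psi> x)\<close> is an integral operator to which Schur's
  test applies, with column masses bounded by \<open>nn_integral_rescale_bilipschitz\<close>. The
  mollified functions converge uniformly, so the bound passes to \<open>g\<close>. The constant is
  fixed before \<open>g\<close>, \<open>\<Psi>\<close> and \<open>R\<close>.\<close>

lemma l2_compose_bound:
  obtains C where "C \<ge> 0" "\<And>(g :: 'a::euclidean_space \<Rightarrow> 'b::euclidean_space) \<Psi> R.
      \<lbrakk>continuous_on UNIV g; \<And>x. x \<notin> cball 0 R \<Longrightarrow> g x = 0; continuous_on UNIV \<Psi>;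
        \<And>x y. norm (x - y) \<le> 2 * norm (\<Psi> x - \<Psi> y); \<And>x. norm (\<Psi> x - x) \<le> 1\<rbrakk>
      \<Longrightarrow> square_integrable (\<lambda>x. g (\<Psi> x)) \<and> l2_norm (\<lambda>x. g (\<Psi> x)) \<le> C * l2_norm g"
proof -
  obtain M where M: "M > 0" "\<And>x::'a. mollifier x \<le> M" by (rule unit_kernel_bounded[OF mollifier_unit_kernel]) blast
  define D where "D = M * (unit_ball_vol (DIM('a)) * 4 ^ DIM('a))"
  have D: "D \<ge> 0" using M by (simp add: D_def)
  show ?thesis
  proof (rule that[of "sqrt (D * 1)"])
    show "0 \<le> sqrt (D * 1)" using D by simp
    fix g :: "'a \<Rightarrow> 'b" and \<Psi> :: "'a \<Rightarrow> 'a" and R :: real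
    assume g: "continuous_on UNIV g" "\<And>x. x \<notin> cball 0 R \<Longrightarrow> g x = 0" and \<Psi>: "continuous_on UNIV \<Psi>"
      and ex: "\<And>x y. norm (x - y) \<le> 2 * norm (\<Psi> x - \<Psi> y)" and near: "\<And>x. norm (\<Psi> x - x) \<le> 1"
    have gs: "square_integrable g" by (rule square_integrable_continuous_bounded_support[OF g])
    have gi: "integrable lborel g" by (rule square_integrable_imp_integrable[OF gs g(2)])
    have gc: "continuous_on UNIV (\<lambda>x. g (\<Psi> x))" by (rule continuous_on_compose2[OF g(1) \<Psi>]) auto
    have large: "norm (\<Psi> x) > R + 1" if "x \<notin> cball 0 (R + 2)" for x
      using that near[of x] norm_triangle_ineq2[of x "x - \<Psi> x"] by (auto simp: norm_minus_commute)
    have gsupp: "g (\<Psi> x) = 0" if "x \<notin> cball 0 (R + 2)" for x using large[OF that] g(2)[of "\<Psi> x"] by auto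
    have gps: "square_integrable (\<lambda>x. g (\<Psi> x))" by (rule square_integrable_continuous_bounded_support[OF gc gsupp])
    have "l2_norm (\<lambda>x. g (\<Psi> x)) \<le> sqrt (D * 1) * l2_norm g + \<epsilon>" if \<epsilon>: "\<epsilon> > 0" for \<epsilon>
    proof -
      \<comment> \<open>\<open>R + 2\<close> allows the support of \<open>g\<close> to be widened by
        at most 1 through \<open>\<Psi>\<close> and by at most 1 through the mollification.\<close>
      define V where "V = sqrt (measure lborel (cball (0::'a) (R + 2)))"
      define \<eta> where "\<eta> = \<epsilon> / (V + 1)"
      have V: "V \<ge> 0" by (simp add: V_def)
      have \<eta>: "\<eta> > 0" using \<epsilon> V by (simp add: \<eta>_def)
      obtain d where d: "d > 0" "\<And>x y. norm (x - y) < d \<Longrightarrow> norm (g x - g y) < \<eta>"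
        using uniformly_continuous_bounded_support[OF g \<eta>] by blast
      define e where "e = min 1 (d / 2)"
      have e: "e > 0" "e \<le> 1" "e < d" using d by (auto simp: e_def min_def)
      have un: "norm (smear mollifier e g x - g x) \<le> \<eta>" for x
        using smear_uniform[OF mollifier_unit_kernel e(1) g(1), of \<eta> x] d(2) e(3)
        by (simp add: integral_mollifier) (meson le_less_trans less_imp_le)
      have k1: "continuous_on UNIV (\<lambda>(x, y). rescale e mollifier (\<Psi> x - y))"
      proof -
        have rc: "continuous_on UNIV (rescale e (mollifier :: 'a \<Rightarrow> real))"
          using mollifier_unit_kernel[where 'a = 'a] by (intro continuous_rescale) (simp add: unit_kernel_def)
        have "continuous_on UNIV (\<lambda>z :: 'a \<times> 'a. \<Psi> (fst z) - snd z)"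
          by (intro continuous_intros continuous_on_compose2[OF \<Psi>, of _ fst]) auto
        from continuous_on_compose2[OF rc this]
        have "continuous_on UNIV (\<lambda>z. rescale e mollifier (\<Psi> (fst z) - snd z))" by simp
        then show ?thesis by (simp add: case_prod_beta')
      qed
      have A1: "(\<integral>\<^sup>+y. ennreal (rescale e mollifier (\<Psi> x - y)) \<partial>lborel) \<le> ennreal 1" for x
        using nn_integral_rescale(1)[OF mollifier_unit_kernel e(1), of "\<Psi> x"] by (simp add: integral_mollifier)
      have B1: "(\<integral>\<^sup>+x. ennreal (rescale e mollifier (\<Psi> x - y)) \<partial>lborel) \<le> ennreal D" for y
        unfolding D_def
        by (rule nn_integral_rescale_bilipschitz(2)[OF mollifier_unit_kernel e(1) M(2) less_imp_le[OF M(1)] ex])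
      have sch: "square_integrable (\<lambda>x. LINT y|lborel. rescale e mollifier (\<Psi> x - y) *\<^sub>R g y)"
        "l2_norm (\<lambda>x. LINT y|lborel. rescale e mollifier (\<Psi> x - y) *\<^sub>R g y) \<le> sqrt (1 * D) * l2_norm g"
        by (rule schur_bound[OF k1 rescale_nonneg[OF mollifier_unit_kernel e(1)] gs _ A1 zero_le_one B1 D, where R = R];
            use g(2) in blast)+
      have sch': "square_integrable (\<lambda>x. smear mollifier e g (\<Psi> x))"
        "l2_norm (\<lambda>x. smear mollifier e g (\<Psi> x)) \<le> sqrt (D * 1) * l2_norm g"
        using sch by (simp_all add: smear_def)
      have sc: "continuous_on UNIV (smear mollifier e g)" by (rule continuous_smear[OF mollifier_unit_kernel gi g(2)])
      have c: "continuous_on UNIV (\<lambda>x. g (\<Psi> x) - smear mollifier e g (\<Psi> x))"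
        by (intro continuous_intros gc continuous_on_compose2[OF sc \<Psi>]) auto
      have z: "g (\<Psi> x) - smear mollifier e g (\<Psi> x) = 0" if "x \<notin> cball 0 (R + 2)" for x
      proof -
        have "smear mollifier e g (\<Psi> x) = 0"
          by (rule smear_support[OF mollifier_unit_kernel e(1,2), of R]) (use g(2) large[OF that] in auto)
        then show ?thesis using gsupp[OF that] by simp
      qed
      have nb: "norm (g (\<Psi> x) - smear mollifier e g (\<Psi> x)) \<le> \<eta>" for x
        using un[of "\<Psi> x"] by (simp add: norm_minus_commute)
      have 2: "square_integrable (\<lambda>x. g (\<Psi> x) - smear mollifier e g (\<Psi> x))"
          "l2_norm (\<lambda>x. g (\<Psi> x) - smear mollifier e g (\<Psi> x)) \<le> \<eta> * V"
        using square_integrable_bounded_support[OF borel_measurable_continuous[OF c] nb z] by (auto simp: V_def)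
      have "\<eta> * V \<le> \<epsilon>" using V \<epsilon> by (simp add: \<eta>_def field_simps)
      moreover have "l2_norm (\<lambda>x. g (\<Psi> x)) \<le> l2_norm (\<lambda>x. g (\<Psi> x) - smear mollifier e g (\<Psi> x)) + l2_norm (\<lambda>x. smear mollifier e g (\<Psi> x))"
        using l2_norm_triangle[OF 2(1) sch'(1)] by simp
      ultimately show ?thesis using 2(2) sch'(2) by linarith
    qed
    then have "l2_norm (\<lambda>x. g (\<Psi> x)) \<le> sqrt (D * 1) * l2_norm g" by (rule field_le_epsilon)
    then show "square_integrable (\<lambda>x. g (\<Psi> x)) \<and> l2_norm (\<lambda>x. g (\<Psi> x)) \<le> sqrt (D * 1) * l2_norm g"
      using gps by blast
  qed
qed

lemma has_grad_pullback:
  fixes u :: "'a::euclidean_space \<Rightarrow> real"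
  assumes u: "has_grad u p" and X: "c1_field X X' L"
  shows "has_grad (\<lambda>x. u (x - X x)) (\<lambda>x. p (x - X x) - adjoint (X' x) (p (x - X x)))"
  unfolding has_grad_def
proof (intro conjI allI)
  have c: "continuous_on UNIV (\<lambda>x. p (x - X x))"
    by (rule continuous_on_compose2[OF has_grad_continuous_grad[OF u]]) (auto intro!: continuous_intros c1_fieldD(7)[OF X])
  then show "continuous_on UNIV (\<lambda>x. p (x - X x) - adjoint (X' x) (p (x - X x)))"
    by (intro continuous_intros continuous_adjoint[OF X])
  fix x
  have "((\<lambda>x. x - X x) has_derivative (\<lambda>v. v - X' x v)) (at x)"
    by (auto intro!: derivative_eq_intros c1_fieldD(1)[OF X])
  from has_derivative_compose[OF this has_gradD[OF u]]
  have "((\<lambda>x. u (x - X x)) has_derivative (\<lambda>v. p (x - X x) \<bullet> (v - X' x v))) (at x)" .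
  moreover have "(\<lambda>v. p (x - X x) \<bullet> (v - X' x v)) = (\<bullet>) (p (x - X x) - adjoint (X' x) (p (x - X x)))"
    by (simp add: fun_eq_iff inner_diff_left inner_diff_right adjoint_clauses[OF c1_fieldD(6)[OF X]])
  ultimately show "((\<lambda>x. u (x - X x)) has_derivative (\<bullet>) (p (x - X x) - adjoint (X' x) (p (x - X x)))) (at x)" by simp
qed

text \<open>The threshold \<open>L0\<close> depends on the reference field \<open>p0\<close> and not
  on \<open>p\<close>, so that a vector field can be fixed first and \<open>p\<close> near
  \<open>p0\<close> chosen afterwards. The difference \<open>p - p0\<close> is treated by
  \<open>l2_compose_bound\<close>, the displacement of \<open>p0\<close> itself by uniform
  continuity.\<close>

lemma pullback_estimate:
  obtains C where "C \<ge> 0" "\<And>(p0 :: 'a::euclidean_space \<Rightarrow> 'a) R \<eta>.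
     \<lbrakk>continuous_on UNIV p0; \<And>x. x \<notin> cball 0 R \<Longrightarrow> p0 x = 0; \<eta> > 0\<rbrakk> \<Longrightarrow>
     \<exists>L0>0. \<forall>X X' L p. c1_field X X' L \<and> L \<le> L0 \<and> continuous_on UNIV p \<and> (\<forall>x. x \<notin> cball 0 R \<longrightarrow> p x = 0) \<longrightarrow>
       l2_norm (\<lambda>x. p (x - X x) - adjoint (X' x) (p (x - X x)) - p0 x) \<le> C * l2_norm (\<lambda>x. p x - p0 x) + \<eta>"
proof -
  obtain C where C: "C \<ge> 0" "\<And>(g :: 'a \<Rightarrow> 'a) \<Psi> R.
      \<lbrakk>continuous_on UNIV g; \<And>x. x \<notin> cball 0 R \<Longrightarrow> g x = 0; continuous_on UNIV \<Psi>;
        \<And>x y. norm (x - y) \<le> 2 * norm (\<Psi> x - \<Psi> y); \<And>x. norm (\<Psi> x - x) \<le> 1\<rbrakk>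
      \<Longrightarrow> square_integrable (\<lambda>x. g (\<Psi> x)) \<and> l2_norm (\<lambda>x. g (\<Psi> x)) \<le> C * l2_norm g"
    using l2_compose_bound[where 'a = 'a and 'b = 'a] by blast
  show ?thesis
  \<comment> \<open>The factor 2 bounds the operator norm of \<open>id - adjoint (X' x)\<close>, as
    \<open>L \<le> 1/2\<close>.\<close>
  proof (rule that[of "2 * C"])
    show "0 \<le> 2 * C" using C by simp
    fix p0 :: "'a \<Rightarrow> 'a" and R \<eta> :: real
    assume p0: "continuous_on UNIV p0" "\<And>x. x \<notin> cball 0 R \<Longrightarrow> p0 x = 0" and \<eta>: "\<eta> > 0"
    obtain S where S: "S > 0" "\<And>x. x \<in> cball 0 R \<Longrightarrow> norm (p0 x) \<le> S"
      by (rule continuous_bounded_on_cball[OF p0(1), of R]) blast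
    have S': "norm (p0 x) \<le> S" for x using S p0(2)[of x] by (cases "x \<in> cball 0 R") auto
    define V where "V = sqrt (measure lborel (cball (0::'a) (R + 2)))"
    have V: "V \<ge> 0" by (simp add: V_def)
    define \<mu> where "\<mu> = \<eta> / (2 * (V + 1))"
    have \<mu>: "\<mu> > 0" using \<eta> V by (simp add: \<mu>_def)
    obtain d where d: "d > 0" "\<And>x y. norm (x - y) < d \<Longrightarrow> norm (p0 x - p0 y) < \<mu>"
      using uniformly_continuous_bounded_support[OF p0 \<mu>] by blast
    \<comment> \<open>The bound \<open>1/2\<close> keeps \<open>id - X\<close> from contracting
      distances by more than the factor 2, \<open>d/2\<close> keeps displacements below
      \<open>d\<close>, and \<open>\<mu> / S\<close> makes the adjoint term of \<open>p0\<close> at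
      most \<open>\<mu>\<close>.\<close>
    define L0 where "L0 = min (1/2) (min (d/2) (\<mu> / S))"
    have "min (d/2) (\<mu> / S) \<le> d/2" by (rule min.cobounded1)
    moreover have "L0 \<le> min (d/2) (\<mu> / S)" unfolding L0_def by (rule min.cobounded2)
    moreover have "min (d/2) (\<mu> / S) \<le> \<mu> / S" by (rule min.cobounded2)
    moreover have "L0 > 0" using d(1) \<mu> S(1) by (simp add: L0_def)
    moreover have "L0 \<le> 1/2" unfolding L0_def by (rule min.cobounded1)
    ultimately have L0: "L0 > 0" "L0 \<le> 1/2" "L0 < d" "L0 \<le> \<mu> / S"
      using d(1) by linarith+
    show "\<exists>L0>0. \<forall>X X' L p. c1_field X X' L \<and> L \<le> L0 \<and> continuous_on UNIV p \<and> (\<forall>x. x \<notin> cball 0 R \<longrightarrow> p x = 0) \<longrightarrow>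
       l2_norm (\<lambda>x. p (x - X x) - adjoint (X' x) (p (x - X x)) - p0 x) \<le> 2 * C * l2_norm (\<lambda>x. p x - p0 x) + \<eta>"
    proof (intro exI[of _ L0] conjI allI impI, rule L0(1), elim conjE)
      fix X p :: "'a \<Rightarrow> 'a" and X' L
      assume X: "c1_field X X' L" and L: "L \<le> L0" and p: "continuous_on UNIV p" "\<forall>x. x \<notin> cball 0 R \<longrightarrow> p x = 0"
      note XD = c1_fieldD[OF X]
      define \<Psi> where "\<Psi> x = x - X x" for x
      define A where "A x w = w - adjoint (X' x) w" for x w
      have Llin: "linear (A x)" for x
        unfolding A_def by (intro linear_compose_sub adjoint_linear XD linear_id[unfolded id_def])
      have \<Psi>c: "continuous_on UNIV \<Psi>" unfolding \<Psi>_def by (intro continuous_intros XD)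
      have \<Psi>ex: "norm (x - y) \<le> 2 * norm (\<Psi> x - \<Psi> y)" for x y
        unfolding \<Psi>_def using c1_field_expansion(1)[OF X] L L0 by simp
      have \<Psi>L: "norm (\<Psi> x - x) \<le> L" for x unfolding \<Psi>_def using XD(4)[of x] by simp
      have \<Psi>1: "norm (\<Psi> x - x) \<le> 1" for x using \<Psi>L[of x] L L0 by linarith
      have adj: "norm (adjoint (X' x) w) \<le> L * norm w" for x w by (rule norm_adjoint_le[OF XD(6) XD(3)])
      have Ale: "norm (A x w) \<le> 2 * norm w" for x w
      proof -
        have "L * norm w \<le> 1 * norm w" using L L0 by (intro mult_right_mono) auto
        then show ?thesis using adj[of x w] norm_triangle_ineq4[of w "adjoint (X' x) w"] by (simp add: A_def)
      qed
      have Ac: "continuous_on UNIV (\<lambda>x. A x (q (\<Psi> x)))" if "continuous_on UNIV q" for q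
        unfolding A_def by (intro continuous_intros continuous_adjoint[OF X] continuous_on_compose2[OF that \<Psi>c]) auto
      have pd: "continuous_on UNIV (\<lambda>x. p x - p0 x)" "\<And>x. x \<notin> cball 0 R \<Longrightarrow> p x - p0 x = 0"
        using p p0 by (auto intro: continuous_intros)
      have 1: "square_integrable (\<lambda>x. p (\<Psi> x) - p0 (\<Psi> x))" "l2_norm (\<lambda>x. p (\<Psi> x) - p0 (\<Psi> x)) \<le> C * l2_norm (\<lambda>x. p x - p0 x)"
        using C(2)[OF pd \<Psi>c \<Psi>ex \<Psi>1] by blast+
      have 2: "square_integrable (\<lambda>x. A x (p (\<Psi> x) - p0 (\<Psi> x)))"
        "l2_norm (\<lambda>x. A x (p (\<Psi> x) - p0 (\<Psi> x))) \<le> l2_norm (\<lambda>x. 2 *\<^sub>R (p (\<Psi> x) - p0 (\<Psi> x)))"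
      proof -
        have m: "(\<lambda>x. A x (p (\<Psi> x) - p0 (\<Psi> x))) \<in> borel_measurable borel"
          by (rule borel_measurable_continuous[OF Ac[OF pd(1)]])
        have le: "norm (A x (p (\<Psi> x) - p0 (\<Psi> x))) \<le> norm (2 *\<^sub>R (p (\<Psi> x) - p0 (\<Psi> x)))" for x
          using Ale by simp
        show "square_integrable (\<lambda>x. A x (p (\<Psi> x) - p0 (\<Psi> x)))"
          "l2_norm (\<lambda>x. A x (p (\<Psi> x) - p0 (\<Psi> x))) \<le> l2_norm (\<lambda>x. 2 *\<^sub>R (p (\<Psi> x) - p0 (\<Psi> x)))"
          using l2_norm_mono[OF square_integrable_scaleR[OF 1(1)] m le] by auto
      qed
      have le2: "l2_norm (\<lambda>x. A x (p (\<Psi> x) - p0 (\<Psi> x))) \<le> 2 * C * l2_norm (\<lambda>x. p x - p0 x)"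
        using 1(2) 2(2) l2_norm_scaleR[of 2 "\<lambda>x. p (\<Psi> x) - p0 (\<Psi> x)"] by linarith
      have c3: "continuous_on UNIV (\<lambda>x. A x (p0 (\<Psi> x)) - p0 x)" by (intro continuous_intros Ac p0)
      have z3: "A x (p0 (\<Psi> x)) - p0 x = 0" if x: "x \<notin> cball 0 (R + 2)" for x
      proof -
        have "norm (\<Psi> x) > R" using x \<Psi>1[of x] norm_triangle_ineq2[of x "x - \<Psi> x"] by (auto simp: norm_minus_commute)
        then have "p0 (\<Psi> x) = 0" "p0 x = 0" using p0(2)[of "\<Psi> x"] p0(2)[of x] x by auto
        then show ?thesis using linear_0[OF Llin] by simp
      qed
      have b3: "norm (A x (p0 (\<Psi> x)) - p0 x) \<le> 2 * \<mu>" for x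
      proof -
        have "norm (p0 (\<Psi> x) - p0 x) \<le> \<mu>" using d(2)[of "\<Psi> x" x] \<Psi>L[of x] L L0(3) by force
        moreover have "norm (adjoint (X' x) (p0 (\<Psi> x))) \<le> \<mu>"
        proof -
          have "L * norm (p0 (\<Psi> x)) \<le> (\<mu> / S) * S" using L L0(4) S' \<mu> S by (intro mult_mono) auto
          then show ?thesis using adj[of x "p0 (\<Psi> x)"] S by simp
        qed
        ultimately show ?thesis
          using norm_triangle_ineq4[of "p0 (\<Psi> x) - p0 x" "adjoint (X' x) (p0 (\<Psi> x))"] by (simp add: A_def algebra_simps)
      qed
      have 3: "square_integrable (\<lambda>x. A x (p0 (\<Psi> x)) - p0 x)" "l2_norm (\<lambda>x. A x (p0 (\<Psi> x)) - p0 x) \<le> 2 * \<mu> * V"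
        using square_integrable_bounded_support[OF borel_measurable_continuous[OF c3] b3 z3] by (auto simp: V_def)
      have "2 * \<mu> * V \<le> \<eta>" using V \<eta> by (simp add: \<mu>_def field_simps)
      moreover have eq: "A x (p (\<Psi> x)) - p0 x = A x (p (\<Psi> x) - p0 (\<Psi> x)) + (A x (p0 (\<Psi> x)) - p0 x)" for x
        using linear_diff[OF Llin] by simp
      have "l2_norm (\<lambda>x. A x (p (\<Psi> x)) - p0 x) \<le> l2_norm (\<lambda>x. A x (p (\<Psi> x) - p0 (\<Psi> x))) + l2_norm (\<lambda>x. A x (p0 (\<Psi> x)) - p0 x)"
        unfolding eq by (rule l2_norm_triangle[OF 2(1) 3(1)])
      ultimately show "l2_norm (\<lambda>x. p (x - X x) - adjoint (X' x) (p (x - X x)) - p0 x) \<le> 2 * C * l2_norm (\<lambda>x. p x - p0 x) + \<eta>"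
        using le2 3(2) by (simp add: A_def \<Psi>_def)
    qed
  qed
qed

section \<open>Push-forward of solenoidal fields\<close>

lemma mollifier_lipschitz:
  obtains A where "A \<ge> 0" "\<And>x y :: 'a::euclidean_space. \<bar>mollifier x - mollifier y\<bar> \<le> A * norm (x - y)"
proof -
  let ?\<rho> = "mollifier :: 'a \<Rightarrow> real"
  have g: "has_grad ?\<rho> (gradient ?\<rho>)" by (rule smooth_has_grad(1)[OF smooth_mollifier])
  have supp: "?\<rho> x = 0" if "x \<notin> cball 0 1" for x using mollifier_unit_kernel[where 'a = 'a] that by (auto simp: unit_kernel_def)
  obtain A where A: "A > 0" "\<And>x. x \<in> cball 0 1 \<Longrightarrow> norm (gradient ?\<rho> x) \<le> A"
    by (rule continuous_bounded_on_cball[OF has_grad_continuous_grad[OF g], of 1]) blast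
  have A': "norm (gradient ?\<rho> x) \<le> A" for x
  proof (cases "x \<in> cball 0 1")
    case False
    then show ?thesis using has_grad_support[OF g supp False] A(1) by simp
  qed (rule A(2))
  show ?thesis
  proof (rule that[of A])
    fix x y :: 'a
    have "norm (?\<rho> x - ?\<rho> y) \<le> A * norm (x - y)"
    proof (rule differentiable_bound[of UNIV ?\<rho> "\<lambda>x v. gradient ?\<rho> x \<bullet> v"])
      show "(?\<rho> has_derivative (\<bullet>) (gradient ?\<rho> x)) (at x within UNIV)" for x using has_gradD[OF g] .
      fix x
      have "norm (gradient ?\<rho> x \<bullet> v) \<le> A * norm v" for v
        using Cauchy_Schwarz_ineq2[of "gradient ?\<rho> x" v] mult_right_mono[OF A'[of x], of "norm v"] by simp
      then show "onorm ((\<bullet>) (gradient ?\<rho> x)) \<le> A" by (intro onorm_le) 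
    qed auto
    then show "\<bar>?\<rho> x - ?\<rho> y\<bar> \<le> A * norm (x - y)" by simp
  qed (use A in simp)
qed

text \<open>A solution is a fixed point of the contraction
  \<open>y \<mapsto> x - X y\<close>.\<close>

lemma c1_field_shift_surj:
  assumes X: "c1_field X X' L" "L \<le> 1/2"
  obtains y where "y + X y = (x :: 'a::euclidean_space)"
proof -
  have "\<exists>!y. x - X y = y"
  proof (rule banach_fix_type[of "1/2"])
    show "\<forall>y z. dist (x - X y) (x - X z) \<le> 1/2 * dist y z"
    proof (intro allI)
      fix y z
      have "norm (X z - X y) \<le> L * norm (z - y)" by (rule c1_field_lipschitz[OF X(1)])
      also have "\<dots> \<le> 1/2 * norm (z - y)" using X(2) by (intro mult_right_mono) auto
      finally show "dist (x - X y) (x - X z) \<le> 1/2 * dist y z" by (simp add: dist_norm norm_minus_commute)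
    qed
  qed auto
  then show ?thesis using that by (metis diff_add_cancel)
qed

text \<open>The displaced kernel is compared with the plain one centred at the point
  \<open>y0\<close> for which \<open>y0 + X y0 = x\<close>. Both live in the ball of radius
  \<open>2 * e\<close> about \<open>y0\<close>, and there the rescaled arguments differ by
  \<open>(X y0 - X y) / e\<close>, of norm at most \<open>2 * L\<close>. This takes the place of an
  estimate of a Jacobian determinant.\<close>

lemma mollifier_mass_shift:
  obtains B where "B \<ge> 0" "\<And>X X' L e x. \<lbrakk>c1_field X X' L; L \<le> 1/2; e > 0\<rbrakk> \<Longrightarrow>
     \<bar>(LINT y|lborel. rescale e mollifier (x - (y + X y))) - 1\<bar> \<le> B * L \<and>
     integrable lborel (\<lambda>y::'a::euclidean_space. rescale e mollifier (x - (y + X y)))"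
proof -
  obtain A where A: "A \<ge> 0" "\<And>x y :: 'a. \<bar>mollifier x - mollifier y\<bar> \<le> A * norm (x - y)"
    by (rule mollifier_lipschitz) blast
  \<comment> \<open>The Lipschitz constant \<open>A\<close> times the difference
    \<open>2 * L\<close> of the arguments, times the volume of the ball of radius
    \<open>2 * e\<close>; the rescaling cancels the powers of \<open>e\<close>.\<close>
  define B where "B = 2 * A * (unit_ball_vol DIM('a) * 2 ^ DIM('a))"
  show ?thesis
  proof (rule that[of B])
    show "B \<ge> 0" using A by (simp add: B_def)
    fix X :: "'a \<Rightarrow> 'a" and X' L e x
    assume X: "c1_field X X' L" "L \<le> 1/2" and e: "e > (0::real)"
    note XD = c1_fieldD[OF X(1)]
    obtain y0 where y0: "y0 + X y0 = x" by (rule c1_field_shift_surj[OF X])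
    define k1 where "k1 y = rescale e mollifier (x - (y + X y))" for y
    define k2 where "k2 y = rescale e mollifier (y0 - y)" for y
    note mu = mollifier_unit_kernel[where 'a = 'a]
    have far1: "k1 y = 0" if "norm (y - y0) > 2 * e" for y
    proof -
      have "norm (y - y0) \<le> 2 * norm ((y + X y) - x)" using c1_field_expansion(2)[OF X, of y y0] y0 by simp
      then have "norm (x - (y + X y)) > e" using that by (simp add: norm_minus_commute)
      then show ?thesis using rescale_eq_0[OF mu e] by (simp add: k1_def)
    qed
    have far2: "k2 y = 0" if "norm (y - y0) > 2 * e" for y
      using that e rescale_eq_0[OF mu e, of "y0 - y"] by (simp add: k2_def norm_minus_commute)
    have c1: "continuous_on UNIV k1" unfolding k1_def[abs_def]
      by (rule continuous_rescale_diff(2)[OF mu]) (intro continuous_intros XD)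
    have z: "norm (y - y0) > 2 * e" if "y \<notin> cball 0 (norm y0 + 2 * e)" for y
      using that norm_triangle_ineq2[of y y0] by auto
    have i1: "integrable lborel k1"
      by (rule integrable_continuous_bounded_support[OF c1, of "norm y0 + 2 * e"]) (use far1 z in blast)
    have i2: "integrable lborel k2" unfolding k2_def[abs_def] by (rule integrable_rescale[OF mu e])
    have diff: "\<bar>k1 y - k2 y\<bar> \<le> (1/e) ^ DIM('a) * (2 * A * L) * indicator (cball y0 (2 * e)) y" for y
    proof (cases "norm (y - y0) \<le> 2 * e")
      case True
      have "k1 y - k2 y = (1/e) ^ DIM('a) * (mollifier ((1/e) *\<^sub>R (x - (y + X y))) - mollifier ((1/e) *\<^sub>R (y0 - y)))"
        by (simp add: k1_def k2_def rescale_def algebra_simps)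
      then have "\<bar>k1 y - k2 y\<bar> = (1/e) ^ DIM('a) * \<bar>mollifier ((1/e) *\<^sub>R (x - (y + X y))) - mollifier ((1/e) *\<^sub>R (y0 - y))\<bar>"
        using e by (simp add: abs_mult)
      also have "\<dots> \<le> (1/e) ^ DIM('a) * (A * norm ((1/e) *\<^sub>R (x - (y + X y)) - (1/e) *\<^sub>R (y0 - y)))"
        using e by (intro mult_left_mono A) auto
      also have "(1/e) *\<^sub>R (x - (y + X y)) - (1/e) *\<^sub>R (y0 - y) = (1/e) *\<^sub>R (X y0 - X y)"
        unfolding y0[symmetric] by (simp add: algebra_simps)
      also have "(1/e) ^ DIM('a) * (A * norm ((1/e) *\<^sub>R (X y0 - X y))) \<le> (1/e) ^ DIM('a) * (A * ((1/e) * (L * (2 * e))))"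
      proof (intro mult_left_mono)
        have "norm (X y0 - X y) \<le> L * norm (y0 - y)" by (rule c1_field_lipschitz[OF X(1)])
        also have "\<dots> \<le> L * (2 * e)" using True XD(5) by (intro mult_left_mono) (auto simp: norm_minus_commute)
        finally have "(1/e) * norm (X y0 - X y) \<le> (1/e) * (L * (2 * e))" using e by (intro mult_left_mono) auto
        moreover have "norm ((1/e) *\<^sub>R (X y0 - X y)) = (1/e) * norm (X y0 - X y)" using e by simp
        ultimately show "norm ((1/e) *\<^sub>R (X y0 - X y)) \<le> (1/e) * (L * (2 * e))" by (simp only:)
      qed (use e A in auto)
      finally show ?thesis using True e by (simp add: dist_norm norm_minus_commute ac_simps)
    next
      case False
      then show ?thesis using far1[of y] far2[of y] e A XD(5) by simp
    qed
    have "\<bar>(LINT y|lborel. k1 y) - 1\<bar> = \<bar>LINT y|lborel. k1 y - k2 y\<bar>"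
      using i1 i2 integral_rescale[of mollifier e y0] e mu unfolding unit_kernel_def
      by (simp add: k2_def[abs_def] integral_mollifier)
    also have "\<dots> \<le> (LINT y|lborel. \<bar>k1 y - k2 y\<bar>)" by (rule integral_abs_bound)
    also have "\<dots> \<le> (LINT y|lborel. (1/e) ^ DIM('a) * (2 * A * L) * indicator (cball y0 (2 * e)) y)"
    proof (rule integral_mono)
      show "integrable lborel (\<lambda>y. (1/e) ^ DIM('a) * (2 * A * L) * indicator (cball y0 (2 * e)) y)"
        using emeasure_bounded_finite[of "cball y0 (2 * e)"] by (intro integrable_mult_right integrable_real_indicator) auto
    qed (use i1 i2 diff in auto)
    also have "\<dots> = (1/e) ^ DIM('a) * (2 * A * L) * (unit_ball_vol DIM('a) * (2 * e) ^ DIM('a))"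
      using e by (simp add: measure_lborel_cball)
    also have "\<dots> = B * L" using e by (simp add: B_def power_mult_distrib field_simps)
    finally show "\<bar>(LINT y|lborel. rescale e mollifier (x - (y + X y))) - 1\<bar> \<le> B * L \<and>
        integrable lborel (\<lambda>y. rescale e mollifier (x - (y + X y)))"
      using i1 by (simp add: k1_def[abs_def])
  qed
qed

text \<open>A smoothed version of the push-forward of the field \<open>h\<close> by the map \<open>y \<mapsto> y + X y\<close>;
  like the push-forward it preserves solenoidal fields.\<close>

definition transport :: "('a::euclidean_space \<Rightarrow> 'a) \<Rightarrow> ('a \<Rightarrow> 'a \<Rightarrow> 'a) \<Rightarrow> real \<Rightarrow> ('a \<Rightarrow> 'a) \<Rightarrow> 'a \<Rightarrow> 'a" where
  "transport X X' e h x = (LINT y|lborel. rescale e mollifier (x - (y + X y)) *\<^sub>R (h y + X' y (h y)))"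

lemma continuous_field_apply:
  assumes X: "c1_field X X' L" and h: "continuous_on UNIV (h :: 'a::euclidean_space \<Rightarrow> 'a)"
  shows "continuous_on UNIV (\<lambda>y. X' y (h y))"
proof -
  have "X' y (h y) = (\<Sum>b\<in>Basis. (h y \<bullet> b) *\<^sub>R X' y b)" for y
  proof -
    have "X' y (h y) = X' y (\<Sum>b\<in>Basis. (h y \<bullet> b) *\<^sub>R b)" by (simp add: euclidean_representation)
    then show ?thesis using c1_fieldD(6)[OF X] by (simp add: linear_sum linear_scale)
  qed
  then show ?thesis by (simp add: continuous_intros h c1_fieldD(2)[OF X])
qed

text \<open>As in \<open>pullback_estimate\<close> the threshold depends on the reference field
  only. Schur's test with row bound \<open>D\<close> and column bound 1 controls
  \<open>h - h0\<close>, with a factor 2 for applying the derivative of \<open>id + X\<close>. For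
  \<open>h0\<close> itself, the oscillation over the support of the kernel and the defect of mass
  are uniformly small.\<close>

lemma transport_estimate:
  obtains C where "C \<ge> 0" "\<And>(h0 :: 'a::euclidean_space \<Rightarrow> 'a) R \<eta>.
     \<lbrakk>continuous_on UNIV h0; \<And>x. x \<notin> cball 0 R \<Longrightarrow> h0 x = 0; \<eta> > 0\<rbrakk> \<Longrightarrow>
     \<exists>L0>0. \<forall>X X' L h e. c1_field X X' L \<and> L \<le> L0 \<and> 0 < e \<and> e \<le> L0 \<and> continuous_on UNIV h \<and> (\<forall>x. x \<notin> cball 0 R \<longrightarrow> h x = 0) \<longrightarrow>
       l2_norm (\<lambda>x. transport X X' e h x - h0 x) \<le> C * l2_norm (\<lambda>x. h x - h0 x) + \<eta>"
proof -
  obtain M where M: "M > 0" "\<And>x::'a. mollifier x \<le> M" by (rule unit_kernel_bounded[OF mollifier_unit_kernel]) blast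
  define D where "D = M * (unit_ball_vol (DIM('a)) * 4 ^ DIM('a))"
  have D: "D \<ge> 0" using M by (simp add: D_def)
  obtain B where B: "B \<ge> 0" "\<And>X X' L e x. \<lbrakk>c1_field X X' L; L \<le> 1/2; e > 0\<rbrakk> \<Longrightarrow>
     \<bar>(LINT y|lborel. rescale e mollifier (x - (y + X y))) - 1\<bar> \<le> B * L \<and>
     integrable lborel (\<lambda>y::'a. rescale e mollifier (x - (y + X y)))"
    by (rule mollifier_mass_shift) blast
  show ?thesis
  proof (rule that[of "2 * sqrt (D * 1)"])
    show "0 \<le> 2 * sqrt (D * 1)" using D by simp
    fix h0 :: "'a \<Rightarrow> 'a" and R \<eta> :: real
    assume h0: "continuous_on UNIV h0" "\<And>x. x \<notin> cball 0 R \<Longrightarrow> h0 x = 0" and \<eta>: "\<eta> > 0"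
    obtain S where S: "S > 0" "\<And>x. x \<in> cball 0 R \<Longrightarrow> norm (h0 x) \<le> S"
      by (rule continuous_bounded_on_cball[OF h0(1), of R]) blast
    have S': "norm (h0 x) \<le> S" for x using S h0(2)[of x] by (cases "x \<in> cball 0 R") auto
    define V where "V = sqrt (measure lborel (cball (0::'a) (R + 2)))"
    have V: "V \<ge> 0" by (simp add: V_def)
    \<comment> \<open>The pointwise error of \<open>h0\<close> will be
      \<open>(2 * (B + 1) + 1) * \<mu>\<close>: an oscillation of \<open>2 * \<mu>\<close> against
      kernels of mass at most \<open>B + 1\<close>, plus \<open>\<mu>\<close> for the defect of
      mass.\<close>
    define \<mu> where "\<mu> = \<eta> / ((2 * (B + 1) + 1) * (V + 1))"
    have \<mu>: "\<mu> > 0" using \<eta> V B by (simp add: \<mu>_def)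
    obtain d where d: "d > 0" "\<And>x y. norm (x - y) < d \<Longrightarrow> norm (h0 x - h0 y) < \<mu>"
      using uniformly_continuous_bounded_support[OF h0 \<mu>] by blast
    \<comment> \<open>\<open>d/4\<close> because \<open>x\<close> and \<open>y\<close> are at most
      \<open>e + L \<le> 2 * L0\<close> apart wherever the kernel is nonzero; the second bound makes
      both \<open>L * S\<close> and \<open>B * L * S\<close> at most \<open>\<mu>\<close>.\<close>
    define m1 where "m1 = min (d/4) (\<mu> / (S * (B + 1)))"
    define L0 where "L0 = min (1/2) m1"
    have "m1 \<le> d/4" "m1 \<le> \<mu> / (S * (B + 1))" "L0 \<le> 1/2" "L0 \<le> m1"
      unfolding m1_def L0_def by (rule min.cobounded1 min.cobounded2)+
    moreover have "L0 > 0" using d(1) \<mu> S(1) B(1) by (simp add: L0_def m1_def)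
    ultimately have L0: "L0 > 0" "L0 \<le> 1/2" "2 * L0 < d" "L0 \<le> \<mu> / (S * (B + 1))"
      using d(1) by linarith+
    show "\<exists>L0>0. \<forall>X X' L h e. c1_field X X' L \<and> L \<le> L0 \<and> 0 < e \<and> e \<le> L0 \<and> continuous_on UNIV h \<and> (\<forall>x. x \<notin> cball 0 R \<longrightarrow> h x = 0) \<longrightarrow>
       l2_norm (\<lambda>x. transport X X' e h x - h0 x) \<le> 2 * sqrt (D * 1) * l2_norm (\<lambda>x. h x - h0 x) + \<eta>"
    proof (intro exI[of _ L0] conjI allI impI, rule L0(1), elim conjE)
      fix X h :: "'a \<Rightarrow> 'a" and X' L e
      assume X: "c1_field X X' L" and L: "L \<le> L0" and e: "0 < e" "e \<le> L0"
        and h: "continuous_on UNIV h" "\<forall>x. x \<notin> cball 0 R \<longrightarrow> h x = 0"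
      note XD = c1_fieldD[OF X] and mu = mollifier_unit_kernel[where 'a = 'a]
      have L2: "L \<le> 1/2" using L L0(2) by simp
      define \<Phi> where "\<Phi> y = y + X y" for y
      define W where "W g y = g y + X' y (g y)" for g y
      define \<kappa> where "\<kappa> x y = rescale e mollifier (x - \<Phi> y)" for x y
      have \<Phi>c: "continuous_on UNIV \<Phi>" unfolding \<Phi>_def[abs_def] by (intro continuous_intros XD)
      have \<Phi>ex: "norm (x - y) \<le> 2 * norm (\<Phi> x - \<Phi> y)" for x y
        unfolding \<Phi>_def by (rule c1_field_expansion(2)[OF X L2])
      have \<kappa>c: "continuous_on UNIV (\<lambda>(x, y). \<kappa> x y)" unfolding \<kappa>_def by (rule continuous_rescale_diff(1)[OF mu \<Phi>c])
      have \<kappa>x: "continuous_on UNIV (\<kappa> x)" for x by (rule kernel_section_continuous[OF \<kappa>c])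
      have \<kappa>0: "0 \<le> \<kappa> x y" for x y unfolding \<kappa>_def by (rule rescale_nonneg[OF mu e(1)])
      have \<kappa>far: "norm (x - y) \<le> e + L" if "\<kappa> x y \<noteq> 0" for x y
      proof -
        have "norm (x - \<Phi> y) \<le> e" using rescale_eq_0[OF mu e(1), of "x - \<Phi> y"] that unfolding \<kappa>_def by linarith
        then show ?thesis using norm_triangle_ineq[of "x - \<Phi> y" "X y"] XD(4)[of y] by (simp add: \<Phi>_def)
      qed
      have A1: "(\<integral>\<^sup>+y. ennreal (\<kappa> x y) \<partial>lborel) \<le> ennreal D" for x
        unfolding D_def \<kappa>_def by (rule nn_integral_rescale_bilipschitz(1)[OF mu e(1) M(2) less_imp_le[OF M(1)] \<Phi>ex])
      have B1: "(\<integral>\<^sup>+x. ennreal (\<kappa> x y) \<partial>lborel) \<le> ennreal 1" for y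
        using nn_integral_rescale(2)[OF mu e(1), of "\<Phi> y"] by (simp add: \<kappa>_def integral_mollifier)
      have WB: "norm (W g y) \<le> 2 * norm (g y)" for g y
      proof -
        have "norm (X' y (g y)) \<le> L * norm (g y)" by (rule XD(3))
        also have "\<dots> \<le> 1 * norm (g y)" using L2 by (intro mult_right_mono) auto
        finally show ?thesis using norm_triangle_ineq[of "g y" "X' y (g y)"] by (simp add: W_def)
      qed
      have Wc: "continuous_on UNIV (W g)" if "continuous_on UNIV g" for g
        unfolding W_def[abs_def] by (intro continuous_intros that continuous_field_apply[OF X that])
      have W0: "W g y = 0" if "g y = 0" for g y using WB[of g y] that by simp
      have Wd: "W (\<lambda>y. h y - h0 y) y = W h y - W h0 y" for y using linear_diff[OF XD(6)] by (simp add: W_def)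
      define T where "T g x = (LINT y|lborel. \<kappa> x y *\<^sub>R W g y)" for g x
      have iT: "integrable lborel (\<lambda>y. \<kappa> x y *\<^sub>R W g y)" if g: "continuous_on UNIV g" "\<And>x. x \<notin> cball 0 R \<Longrightarrow> g x = 0" for g x
        by (rule integrable_continuous_bounded_support[of _ R]) (use g W0 in \<open>auto intro!: continuous_intros \<kappa>x Wc\<close>)
      have hd: "continuous_on UNIV (\<lambda>x. h x - h0 x)" "\<And>x. x \<notin> cball 0 R \<Longrightarrow> h x - h0 x = 0"
        using h h0 by (auto intro: continuous_intros)
      have hds: "square_integrable (\<lambda>x. h x - h0 x)" by (rule square_integrable_continuous_bounded_support[OF hd])
      have Wm: "W (\<lambda>x. h x - h0 x) \<in> borel_measurable borel" by (rule borel_measurable_continuous[OF Wc[OF hd(1)]])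
      have Wle: "norm (W (\<lambda>x. h x - h0 x) y) \<le> norm (2 *\<^sub>R (h y - h0 y))" for y using WB[of "\<lambda>x. h x - h0 x" y] by simp
      note WI = l2_norm_mono[OF square_integrable_scaleR[OF hds] Wm Wle]
      have WS: "W (\<lambda>x. h x - h0 x) y = 0" if "y \<notin> cball 0 R" for y by (rule W0) (rule hd(2)[OF that])
      have T1: "square_integrable (T (\<lambda>x. h x - h0 x))"
        "l2_norm (T (\<lambda>x. h x - h0 x)) \<le> sqrt (D * 1) * l2_norm (W (\<lambda>x. h x - h0 x))"
        unfolding T_def[abs_def]
        by (rule schur_bound[OF \<kappa>c \<kappa>0 WI(1) _ A1 D B1 zero_le_one, where R = R]; erule WS)+
      have T1': "l2_norm (T (\<lambda>x. h x - h0 x)) \<le> 2 * sqrt (D * 1) * l2_norm (\<lambda>x. h x - h0 x)"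
        using T1(2) mult_left_mono[OF WI(2), of "sqrt (D * 1)"] D l2_norm_scaleR[of 2 "\<lambda>x. h x - h0 x"] by simp
      have Td: "T (\<lambda>x. h x - h0 x) x = T h x - T h0 x" for x
        unfolding T_def Wd scaleR_diff_right using h h0 by (intro Bochner_Integration.integral_diff iT) auto
      have \<kappa>i: "integrable lborel (\<kappa> x)" and \<kappa>1: "\<bar>(LINT y|lborel. \<kappa> x y) - 1\<bar> \<le> B * L" for x
        using B(2)[OF X L2 e(1), of x] by (auto simp: \<kappa>_def[abs_def] \<Phi>_def)
      have \<kappa>1': "(LINT y|lborel. \<kappa> x y) \<le> B + 1" for x
      proof -
        have "B * L \<le> B * 1" using B(1) L2 by (intro mult_left_mono) auto
        then show ?thesis using \<kappa>1[of x] by linarith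
      qed
      have LS: "L * S \<le> \<mu>" and LB: "B * L * S \<le> \<mu>"
      proof -
        have "L * (S * (B + 1)) \<le> L0 * (S * (B + 1))" using L S(1) B(1) by (intro mult_right_mono) auto
        moreover have "L0 * (S * (B + 1)) \<le> \<mu>" using L0(4) S(1) B(1) by (simp add: le_divide_eq)
        ultimately have *: "L * S * (B + 1) \<le> \<mu>" by (simp add: mult.assoc)
        have "0 \<le> L * S" using XD(5) S(1) by simp
        then have "L * S * 1 \<le> L * S * (B + 1)" "L * S * B \<le> L * S * (B + 1)" using B(1) by (intro mult_left_mono; simp)+
        then show "L * S \<le> \<mu>" "B * L * S \<le> \<mu>" using * by (simp_all add: ac_simps)
      qed
      have bd: "norm (T h0 x - h0 x) \<le> (2 * (B + 1) + 1) * \<mu>" for x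
      proof -
        have i0: "integrable lborel (\<lambda>y. \<kappa> x y *\<^sub>R W h0 y)" by (rule iT[OF h0])
        \<comment> \<open>The error splits into an average of \<open>W h0 y - h0 x\<close> and the
          defect of mass times \<open>h0 x\<close>.\<close>
        have eq: "T h0 x - h0 x = (LINT y|lborel. \<kappa> x y *\<^sub>R (W h0 y - h0 x)) + ((LINT y|lborel. \<kappa> x y) - 1) *\<^sub>R h0 x"
          using i0 \<kappa>i by (simp add: T_def scaleR_diff_right scaleR_diff_left)
        have "norm (LINT y|lborel. \<kappa> x y *\<^sub>R (W h0 y - h0 x)) \<le> (LINT y|lborel. norm (\<kappa> x y *\<^sub>R (W h0 y - h0 x)))"
          by (rule integral_norm_bound)
        also have "\<dots> \<le> (LINT y|lborel. \<kappa> x y * (2 * \<mu>))"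
        proof (rule integral_mono)
          show "integrable lborel (\<lambda>y. norm (\<kappa> x y *\<^sub>R (W h0 y - h0 x)))"
            using i0 \<kappa>i by (intro integrable_norm) (simp add: scaleR_diff_right)
          fix y
          show "norm (\<kappa> x y *\<^sub>R (W h0 y - h0 x)) \<le> \<kappa> x y * (2 * \<mu>)"
          proof (cases "\<kappa> x y = 0")
            case False
            then have "norm (h0 y - h0 x) \<le> \<mu>" using d(2)[of y x] \<kappa>far[of x y] L e L0(3) by (simp add: norm_minus_commute less_imp_le)
            moreover have "norm (X' y (h0 y)) \<le> \<mu>"
              using XD(3)[of y "h0 y"] mult_left_mono[OF S'[of y] XD(5)] LS by linarith
            ultimately have "norm (W h0 y - h0 x) \<le> 2 * \<mu>"
              using norm_triangle_ineq[of "h0 y - h0 x" "X' y (h0 y)"] by (simp add: W_def algebra_simps)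
            then show ?thesis using \<kappa>0 by (simp add: mult_left_mono)
          qed simp
        qed (use \<kappa>i in auto)
        also have "\<dots> \<le> (B + 1) * (2 * \<mu>)" using \<kappa>1'[of x] \<mu> by (simp add: mult_right_mono)
        finally have 1: "norm (LINT y|lborel. \<kappa> x y *\<^sub>R (W h0 y - h0 x)) \<le> (B + 1) * (2 * \<mu>)" .
        have "norm (((LINT y|lborel. \<kappa> x y) - 1) *\<^sub>R h0 x) \<le> (B * L) * S"
          unfolding norm_scaleR real_norm_def using \<kappa>1 S' B(1) XD(5) by (intro mult_mono) auto
        then have 2: "norm (((LINT y|lborel. \<kappa> x y) - 1) *\<^sub>R h0 x) \<le> \<mu>" using LB by linarith
        show ?thesis unfolding eq using norm_triangle_le[OF add_mono[OF 1 2]] by (simp add: algebra_simps)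
      qed
      have Tc: "continuous_on UNIV (T h0)" unfolding T_def[abs_def]
        by (rule continuous_kernel_integral[OF \<kappa>c, of _ R], rule integrable_continuous_bounded_support[of _ R])
           (use h0 W0 in \<open>auto intro!: Wc\<close>)
      have c: "continuous_on UNIV (\<lambda>x. T h0 x - h0 x)" by (intro continuous_intros Tc h0)
      have z: "T h0 x - h0 x = 0" if x: "x \<notin> cball 0 (R + 2)" for x
      proof -
        have *: "\<kappa> x y *\<^sub>R W h0 y = 0" for y
        proof (cases "y \<in> cball 0 R")
          case True
          then have "norm (x - y) > 2" using x norm_triangle_ineq2[of x y] by auto
          have "\<kappa> x y = 0"
          proof (rule ccontr)
            assume "\<kappa> x y \<noteq> 0"
            then show False using \<open>norm (x - y) > 2\<close> \<kappa>far[of x y] L e L0(2) by linarith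
          qed
          then show ?thesis by simp
        qed (use W0[of h0 y] h0(2)[of y] in simp)
        have "T h0 x = 0" unfolding T_def by (simp only: * Bochner_Integration.integral_zero)
        then show ?thesis using h0(2)[of x] x by simp
      qed
      have T2: "square_integrable (\<lambda>x. T h0 x - h0 x)" "l2_norm (\<lambda>x. T h0 x - h0 x) \<le> (2 * (B + 1) + 1) * \<mu> * V"
        using square_integrable_bounded_support[OF borel_measurable_continuous[OF c] bd z] by (auto simp: V_def)
      have "(2 * (B + 1) + 1) * \<mu> * (V + 1) = \<eta>" using V B(1) by (simp add: \<mu>_def)
      moreover have "(2 * (B + 1) + 1) * \<mu> * V \<le> (2 * (B + 1) + 1) * \<mu> * (V + 1)"
        using \<mu> B(1) by (intro mult_left_mono) auto
      moreover have eq: "T h x - h0 x = T (\<lambda>x. h x - h0 x) x + (T h0 x - h0 x)" for x using Td[of x] by simp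
      have "l2_norm (\<lambda>x. T h x - h0 x) \<le> l2_norm (T (\<lambda>x. h x - h0 x)) + l2_norm (\<lambda>x. T h0 x - h0 x)"
        unfolding eq by (rule l2_norm_triangle[OF T1(1) T2(1)])
      moreover have "T h = transport X X' e h"
        by (simp add: fun_eq_iff T_def \<kappa>_def \<Phi>_def W_def transport_def)
      ultimately show "l2_norm (\<lambda>x. transport X X' e h x - h0 x) \<le> 2 * sqrt (D * 1) * l2_norm (\<lambda>x. h x - h0 x) + \<eta>"
        using T1' T2(2) by simp
    qed
  qed
qed

text \<open>Tested against C^1 functions rather than smooth ones, because
  \<open>transport_test_function\<close> uses it with a mollifier composed with the C^1 map
  \<open>y \<mapsto> y + X y\<close>.\<close>

definition weakly_div_free :: "('a::euclidean_space \<Rightarrow> 'a) \<Rightarrow> bool" where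
  "weakly_div_free h \<longleftrightarrow> (\<forall>\<psi> s R. has_grad \<psi> s \<and> (\<forall>x. x \<notin> cball 0 R \<longrightarrow> \<psi> x = 0) \<longrightarrow> (LINT x|lborel. h x \<bullet> s x) = 0)"

text \<open>Let \<open>\<Phi> y = y + X y\<close>, and let \<open>W\<close> be the derivative of
  \<open>\<Phi>\<close> applied to \<open>h\<close>. By the chain rule the divergence in
  \<open>x\<close> of \<open>rescale e mollifier (x - \<Phi> y) *\<^sub>R W y\<close> is minus the
  inner product of \<open>h y\<close> with the gradient in \<open>y\<close> of
  \<open>rescale e mollifier (x - \<Phi> y)\<close>, and \<open>h\<close> is orthogonal to such
  gradients.\<close>

lemma transport_test_function:
  fixes h :: "'a::euclidean_space \<Rightarrow> 'a"
  assumes X: "c1_field X X' L" and h: "continuous_on UNIV h" "\<And>x. x \<notin> cball 0 R \<Longrightarrow> h x = 0"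
    and C: "compact C" "C \<subseteq> U" "\<And>x y. h y \<noteq> 0 \<Longrightarrow> norm (x - (y + X y)) \<le> e \<Longrightarrow> x \<in> C"
    and e: "e > 0" and df: "weakly_div_free h"
  shows "transport X X' e h \<in> test_functions U" "divergence (transport X X' e h) x = 0"
proof -
  note XD = c1_fieldD[OF X] and mu = mollifier_unit_kernel[where 'a = 'a]
  define \<Phi> where "\<Phi> y = y + X y" for y
  define W where "W y = h y + X' y (h y)" for y
  have T: "transport X X' e h = (\<lambda>x. LINT y|lborel. rescale e mollifier (x - \<Phi> y) *\<^sub>R W y)"
    by (simp add: fun_eq_iff transport_def \<Phi>_def W_def)
  have \<Phi>c: "continuous_on UNIV \<Phi>" unfolding \<Phi>_def[abs_def] by (intro continuous_intros XD)
  have W0: "W y = 0" if "h y = 0" for y using that linear_0[OF XD(6)] by (simp add: W_def)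
  have Wc: "continuous_on UNIV W" unfolding W_def[abs_def] by (intro continuous_intros h continuous_field_apply[OF X])
  have Wsupp: "W y = 0" if "y \<notin> cball 0 R" for y using W0 h(2) that by blast
  have Wi: "integrable lborel W" by (rule integrable_continuous_bounded_support[OF Wc Wsupp])
  show "transport X X' e h \<in> test_functions U"
  proof (rule test_functionsI[OF _ C(1,2)])
    show "times_cont_diff k (transport X X' e h)" for k
      unfolding T by (rule smooth_kernel_integral[OF smooth_rescale_mollifier(1) \<Phi>c Wi Wsupp])
    fix x assume "transport X X' e h x \<noteq> 0"
    then obtain y where "W y \<noteq> 0" "norm (x - \<Phi> y) \<le> e"
      unfolding T using kernel_eq_0[OF mu e, of W x \<Phi>] by force
    then show "x \<in> C" using C(3)[of y x] W0[of y] by (auto simp: \<Phi>_def)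
  qed
  define r where "r = gradient (rescale e (mollifier :: 'a \<Rightarrow> real))"
  have r: "has_grad (rescale e mollifier) r"
    unfolding r_def by (rule smooth_has_grad(1)[OF smooth_rescale_mollifier(1)])
  note rc = has_grad_continuous_grad[OF r]
  have d: "(transport X X' e h has_derivative (\<lambda>v. LINT y|lborel. (r (x - \<Phi> y) \<bullet> v) *\<^sub>R W y)) (at x)"
    unfolding T by (rule has_derivative_kernel_integral[OF r \<Phi>c Wi Wsupp])
  have rxc: "continuous_on UNIV (\<lambda>y. r (x - \<Phi> y))" by (rule continuous_on_diff_image(2)[OF rc \<Phi>c])
  have i: "integrable lborel (\<lambda>y. (r (x - \<Phi> y) \<bullet> b) *\<^sub>R W y)" for b
    by (rule integrable_continuous_scaleR[OF continuous_on_inner[OF rxc continuous_on_const] Wi Wsupp])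
  have i2: "integrable lborel (\<lambda>y. (r (x - \<Phi> y) \<bullet> b) * (W y \<bullet> b))" for b
    using integrable_inner_left[OF i, of b b] by simp
  have "divergence (transport X X' e h) x = (\<Sum>b\<in>Basis. (LINT y|lborel. (r (x - \<Phi> y) \<bullet> b) *\<^sub>R W y) \<bullet> b)"
    unfolding divergence_def frechet_derivative_at[OF d, symmetric] ..
  also have "\<dots> = (\<Sum>b\<in>Basis. LINT y|lborel. (r (x - \<Phi> y) \<bullet> b) * (W y \<bullet> b))"
    by (simp add: integral_inner_left[OF i, symmetric])
  also have "\<dots> = (LINT y|lborel. (\<Sum>b\<in>Basis. (r (x - \<Phi> y) \<bullet> b) * (W y \<bullet> b)))"
    using i2 by (subst Bochner_Integration.integral_sum) auto
  also have "\<dots> = (LINT y|lborel. r (x - \<Phi> y) \<bullet> W y)" by (subst euclidean_inner) simp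
  also have "\<dots> = 0"
  proof -
    define s where "s y = - (r (x - \<Phi> y) + adjoint (X' y) (r (x - \<Phi> y)))" for y
    have "has_grad (\<lambda>y. rescale e mollifier (x - \<Phi> y)) s"
      unfolding has_grad_def
    proof (intro conjI allI)
      show "continuous_on UNIV s" unfolding s_def[abs_def] by (intro continuous_intros rxc continuous_adjoint[OF X])
      fix y
      have "((\<lambda>y. x - \<Phi> y) has_derivative (\<lambda>v. - (v + X' y v))) (at y)"
        unfolding \<Phi>_def by (auto intro!: derivative_eq_intros XD(1))
      from has_derivative_compose[OF this has_gradD[OF r]]
      have "((\<lambda>y. rescale e mollifier (x - \<Phi> y)) has_derivative (\<lambda>v. r (x - \<Phi> y) \<bullet> (- (v + X' y v)))) (at y)" .
      moreover have "(\<lambda>v. r (x - \<Phi> y) \<bullet> (- (v + X' y v))) = (\<bullet>) (s y)"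
        by (simp add: fun_eq_iff s_def inner_diff_left inner_diff_right adjoint_clauses[OF XD(6)])
      ultimately show "((\<lambda>y. rescale e mollifier (x - \<Phi> y)) has_derivative (\<bullet>) (s y)) (at y)" by simp
    qed
    \<comment> \<open>Bounded support in \<open>y\<close>: a point with image within
      \<open>e\<close> of \<open>x\<close> is itself within \<open>e + L\<close> of
      \<open>x\<close>, as \<open>X\<close> moves points by at most \<open>L\<close>.\<close>
    moreover have "rescale e mollifier (x - \<Phi> y) = 0" if "y \<notin> cball 0 (norm x + e + L)" for y
    proof -
      have "norm (x - \<Phi> y) > e"
        using that XD(4)[of y] norm_triangle_ineq2[of y "X y + (x - \<Phi> y)"] norm_triangle_ineq[of "X y" "x - \<Phi> y"]
          norm_triangle_ineq2[of y x] norm_triangle_ineq4[of "y - x" "- X y"] 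
        by (auto simp: \<Phi>_def algebra_simps norm_minus_commute)
      then show ?thesis by (rule rescale_eq_0[OF mu e])
    qed
    ultimately have "(LINT y|lborel. h y \<bullet> s y) = 0" using df unfolding weakly_div_free_def by blast
    moreover have "h y \<bullet> s y = - (r (x - \<Phi> y) \<bullet> W y)" for y
      by (simp add: s_def W_def inner_diff_right inner_add_right adjoint_works[OF XD(6)] inner_commute)
    ultimately show ?thesis by simp
  qed
  finally show "divergence (transport X X' e h) x = 0" .
qed

section \<open>Pushing a Lipschitz open set into itself\<close>

text \<open>The direction \<open>e\<close> is the preimage of the vertical axis \<open>b\<close>
  under the rotation. Moving along it keeps the horizontal coordinates and raises the vertical one,
  so that points on or above the graph end strictly above it.\<close>

lemma lipschitz_boundary_inward:
  fixes \<Omega> :: "'a::euclidean_space set"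
  assumes "lipschitz_boundary_at \<Omega> p"
  obtains e r where "r > 0" "norm e = 1"
    "\<And>z s. z \<in> closure \<Omega> \<Longrightarrow> z \<in> ball p r \<Longrightarrow> z + s *\<^sub>R e \<in> ball p r \<Longrightarrow> s > 0 \<Longrightarrow> z + s *\<^sub>R e \<in> \<Omega>"
proof -
  from assms obtain U T b \<phi> L where U: "open U" "p \<in> U" and T: "rigid_motion T" and b: "b \<in> Basis"
    and fr: "\<And>x. x \<in> U \<Longrightarrow> x \<in> frontier \<Omega> \<longleftrightarrow> T x \<bullet> b = \<phi> (T x - (T x \<bullet> b) *\<^sub>R b)"
    and ins: "\<And>x. x \<in> U \<Longrightarrow> x \<in> \<Omega> \<longleftrightarrow> T x \<bullet> b > \<phi> (T x - (T x \<bullet> b) *\<^sub>R b)"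
    unfolding lipschitz_boundary_at_def by blast
  from T obtain c Q where Q: "orthogonal_transformation Q" and TQ: "T = (\<lambda>x. c + Q x)"
    unfolding rigid_motion_def by blast
  obtain e where e: "Q e = b" using orthogonal_transformation_surj[OF Q] by (metis surjD)
  have lin: "linear Q" by (rule orthogonal_transformation_linear[OF Q])
  have Te: "T (z + s *\<^sub>R e) = T z + s *\<^sub>R b" for z s
    unfolding TQ using e by (simp add: linear_add[OF lin] linear_scale[OF lin])
  have bb: "b \<bullet> b = 1" using b by (simp add: inner_Basis)
  obtain r where r: "r > 0" "ball p r \<subseteq> U" using U open_contains_ball by metis
  show ?thesis
  proof (rule that[OF r(1)])
    show "norm e = 1" using orthogonal_transformation_norm[OF Q, of e] e b by simp
    fix z s
    assume z: "z \<in> closure \<Omega>" "z \<in> ball p r" and zs: "z + s *\<^sub>R e \<in> ball p r" and s: "s > 0"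
    have zU: "z \<in> U" "z + s *\<^sub>R e \<in> U" using r z zs by auto
    have "T z \<bullet> b \<ge> \<phi> (T z - (T z \<bullet> b) *\<^sub>R b)"
      using z(1) fr[OF zU(1)] ins[OF zU(1)] by (metis UnE closure_Un_frontier less_imp_le order_refl)
    moreover have "T (z + s *\<^sub>R e) - (T (z + s *\<^sub>R e) \<bullet> b) *\<^sub>R b = T z - (T z \<bullet> b) *\<^sub>R b"
      by (simp add: Te inner_add_left bb algebra_simps)
    moreover have "T (z + s *\<^sub>R e) \<bullet> b = T z \<bullet> b + s" by (simp add: Te inner_add_left bb)
    ultimately show "z + s *\<^sub>R e \<in> \<Omega>" using ins[OF zU(2)] s by simp
  qed
qed

text \<open>The displacements are added one at a time. A chart direction is inward only within its
  own ball, hence the condition \<open>near\<close> on all partial sums; a positive step leads from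
  the closure into the open set, and later steps stay there. The point \<open>x\<close> that selects
  the active charts is separate from the starting point \<open>z0\<close>, which allows the use in
  both directions.\<close>

lemma push_inside:
  fixes \<Omega> :: "'a::euclidean_space set" and s :: "'a \<Rightarrow> real"
  assumes J: "finite J" and s: "\<And>p. p \<in> J \<Longrightarrow> s p \<ge> 0"
    and inw: "\<And>p z t. p \<in> J \<Longrightarrow> z \<in> closure \<Omega> \<Longrightarrow> z \<in> ball p (2 * r p) \<Longrightarrow> z + t *\<^sub>R e p \<in> ball p (2 * r p) \<Longrightarrow> t > 0 \<Longrightarrow> z + t *\<^sub>R e p \<in> \<Omega>"
    and \<delta>: "\<And>p. p \<in> J \<Longrightarrow> \<delta> \<le> r p" and x: "\<And>p. p \<in> J \<Longrightarrow> s p > 0 \<Longrightarrow> x \<in> ball p (r p)"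
    and near: "\<And>J'. J' \<subseteq> J \<Longrightarrow> norm (z0 + (\<Sum>p\<in>J'. s p *\<^sub>R e p) - x) < \<delta>"
    and z0: "z0 \<in> closure \<Omega>"
  shows "z0 + (\<Sum>p\<in>J. s p *\<^sub>R e p) \<in> closure \<Omega> \<and>
     (z0 \<in> \<Omega> \<or> (\<exists>p\<in>J. s p > 0) \<longrightarrow> z0 + (\<Sum>p\<in>J. s p *\<^sub>R e p) \<in> \<Omega>)"
proof -
  have "J' \<subseteq> J \<Longrightarrow> z0 + (\<Sum>p\<in>J'. s p *\<^sub>R e p) \<in> closure \<Omega> \<and>
     (z0 \<in> \<Omega> \<or> (\<exists>p\<in>J'. s p > 0) \<longrightarrow> z0 + (\<Sum>p\<in>J'. s p *\<^sub>R e p) \<in> \<Omega>)" if "finite J'" for J'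
    using that
  proof (induction J' rule: finite_induct)
    case empty
    then show ?case using z0 by simp
  next
    case (insert q J')
    let ?z = "z0 + (\<Sum>p\<in>J'. s p *\<^sub>R e p)"
    have eq: "z0 + (\<Sum>p\<in>insert q J'. s p *\<^sub>R e p) = ?z + s q *\<^sub>R e q"
      using insert.hyps by (simp add: algebra_simps)
    have q: "q \<in> J" and J': "J' \<subseteq> J" using insert.prems by auto
    note IH = insert.IH[OF J']
    show ?case
    proof (cases "s q > 0")
      case True
      have xq: "norm (x - q) < r q" using x[OF q True] by (simp add: dist_norm norm_minus_commute)
      have "norm (?z - x) < r q" "norm (?z + s q *\<^sub>R e q - x) < r q"
        using near[OF J'] near[OF insert.prems] \<delta>[OF q] unfolding eq by linarith+
      then have "?z \<in> ball q (2 * r q)" "?z + s q *\<^sub>R e q \<in> ball q (2 * r q)"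
        using xq norm_triangle_ineq[of "?z - x" "x - q"] norm_triangle_ineq[of "?z + s q *\<^sub>R e q - x" "x - q"]
        by (simp_all add: dist_norm norm_minus_commute)
      then have "?z + s q *\<^sub>R e q \<in> \<Omega>" using inw[OF q] IH True by blast
      then show ?thesis unfolding eq using closure_subset by blast
    next
      case False
      then have "s q = 0" using s[OF q] by simp
      then show ?thesis unfolding eq using IH by auto
    qed
  qed
  then show ?thesis using J by blast
qed

section \<open>A C^1 vector field pointing inwards\<close>

lemma max_square_derivative: "((\<lambda>s. (max 0 s)\<^sup>2) has_real_derivative 2 * max 0 s) (at (s::real))"
proof -
  consider "s > 0" | "s < 0" | "s = 0" by linarith
  then show ?thesis
  proof cases
    case 1
    have "((\<lambda>s. s\<^sup>2) has_real_derivative 2 * max 0 s) (at s)"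
      using 1 by (auto intro!: derivative_eq_intros)
    then show ?thesis
      by (rule has_field_derivative_transform_within_open[of _ _ _ "{0<..}"]) (use 1 in auto)
  next
    case 2
    have "((\<lambda>s. 0) has_real_derivative 2 * max 0 s) (at s)" using 2 by simp
    then show ?thesis
      by (rule has_field_derivative_transform_within_open[of _ _ _ "{..<0}"]) (use 2 in auto)
  next
    case 3
    have "((\<lambda>h::real. h * (if h > 0 then 1 else 0)) \<longlongrightarrow> 0) (at 0)"
      by (rule Lim_null_comparison[of _ "\<lambda>h. \<bar>h\<bar>"]) (auto intro!: always_eventually tendsto_eq_intros)
    then have "((\<lambda>h. ((max 0 (0 + h))\<^sup>2 - (max 0 (0::real))\<^sup>2) / h) \<longlongrightarrow> 0) (at 0)"
      by (rule Lim_transform_eventually) (auto simp: eventually_at_filter power2_eq_square)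
    then show ?thesis using 3 by (simp add: DERIV_def)
  qed
qed

text \<open>The field only has to be C^1, so a squared positive part is enough; it is positive
  exactly on the open ball.\<close>

definition quartic_bump :: "'a::euclidean_space \<Rightarrow> real \<Rightarrow> 'a \<Rightarrow> real" where
  "quartic_bump p r x = (max 0 (r\<^sup>2 - (x - p) \<bullet> (x - p)))\<^sup>2"

definition quartic_bump_grad :: "'a::euclidean_space \<Rightarrow> real \<Rightarrow> 'a \<Rightarrow> 'a" where
  "quartic_bump_grad p r x = (2 * max 0 (r\<^sup>2 - (x - p) \<bullet> (x - p))) *\<^sub>R ((- 2) *\<^sub>R (x - p))"

lemma quartic_bump:
  assumes r: "r > 0"
  shows "has_grad (quartic_bump p r) (quartic_bump_grad p r)" "quartic_bump p r x \<ge> 0"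
    "quartic_bump p r x > 0 \<longleftrightarrow> x \<in> ball p r" "quartic_bump p r x \<le> r ^ 4"
    "norm (quartic_bump_grad p r x) \<le> 4 * r ^ 3"
proof -
  show "has_grad (quartic_bump p r) (quartic_bump_grad p r)"
    unfolding has_grad_def
  proof (intro conjI allI)
    fix x
    have "((\<lambda>x. r\<^sup>2 - (x - p) \<bullet> (x - p)) has_derivative (\<lambda>v. - (2 * ((x - p) \<bullet> v)))) (at x)"
      by (auto intro!: derivative_eq_intros simp: inner_commute)
    from has_derivative_compose[OF this max_square_derivative[unfolded has_field_derivative_def]]
    have "(quartic_bump p r has_derivative (\<lambda>v. 2 * max 0 (r\<^sup>2 - (x - p) \<bullet> (x - p)) * - (2 * ((x - p) \<bullet> v)))) (at x)"
      unfolding quartic_bump_def[abs_def] .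
    moreover have "(\<lambda>v. 2 * max 0 (r\<^sup>2 - (x - p) \<bullet> (x - p)) * - (2 * ((x - p) \<bullet> v))) = (\<bullet>) (quartic_bump_grad p r x)"
      by (simp add: fun_eq_iff quartic_bump_grad_def)
    ultimately show "(quartic_bump p r has_derivative (\<bullet>) (quartic_bump_grad p r x)) (at x)" by simp
  next
    show "continuous_on UNIV (quartic_bump_grad p r)" unfolding quartic_bump_grad_def[abs_def] by (intro continuous_intros)
  qed
  show "quartic_bump p r x \<ge> 0" by (simp add: quartic_bump_def)
  have d: "(x - p) \<bullet> (x - p) = (norm (x - p))\<^sup>2" by (simp add: power2_norm_eq_inner)
  have eqv: "r\<^sup>2 - (x - p) \<bullet> (x - p) > 0 \<longleftrightarrow> x \<in> ball p r"
    unfolding d using r power2_less_imp_less[of "norm (x - p)" r] power_strict_mono[of "norm (x - p)" r 2]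
    by (auto simp: dist_norm norm_minus_commute)
  then show "quartic_bump p r x > 0 \<longleftrightarrow> x \<in> ball p r" by (auto simp: quartic_bump_def max_def)
  have m: "max 0 (r\<^sup>2 - (x - p) \<bullet> (x - p)) \<le> r\<^sup>2" by simp
  then have "(max 0 (r\<^sup>2 - (x - p) \<bullet> (x - p)))\<^sup>2 \<le> (r\<^sup>2)\<^sup>2" by (intro power_mono) auto
  then show "quartic_bump p r x \<le> r ^ 4" by (simp add: quartic_bump_def)
  show "norm (quartic_bump_grad p r x) \<le> 4 * r ^ 3"
  proof (cases "x \<in> ball p r")
    case True
    then have "norm (x - p) \<le> r" by (simp add: dist_norm norm_minus_commute)
    then have "(2 * max 0 (r\<^sup>2 - (x - p) \<bullet> (x - p))) * (2 * norm (x - p)) \<le> (2 * r\<^sup>2) * (2 * r)"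
      using m by (intro mult_mono) auto
    then show ?thesis by (simp add: quartic_bump_grad_def power2_eq_square power3_eq_cube norm_minus_commute)
  next
    case False
    then have "max 0 (r\<^sup>2 - (x - p) \<bullet> (x - p)) = 0" using eqv by (simp add: max_def)
    then show ?thesis using r by (simp add: quartic_bump_grad_def)
  qed
qed

text \<open>The field sums the inward directions of a finite subcover of the frontier, weighted by
  bumps. The directions of overlapping charts are reconciled by \<open>push_inside\<close>, which
  uses them one after the other. A final rescaling makes every \<open>t\<close> up to 1
  admissible.\<close>

lemma inward_field:
  fixes \<Omega> :: "'a::euclidean_space set"
  assumes \<Omega>: "lipschitz_open \<Omega>"
  obtains X X' L where "L > 0"
    "\<And>t. 0 < t \<Longrightarrow> t \<le> 1 \<Longrightarrow> c1_field (\<lambda>x. t *\<^sub>R X x) (\<lambda>x v. t *\<^sub>R X' x v) (t * L)"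
    "\<And>t x. 0 < t \<Longrightarrow> t \<le> 1 \<Longrightarrow> x \<in> closure \<Omega> \<Longrightarrow> x + t *\<^sub>R X x \<in> \<Omega>"
    "\<And>t x. 0 < t \<Longrightarrow> t \<le> 1 \<Longrightarrow> x \<notin> \<Omega> \<Longrightarrow> x - t *\<^sub>R X x \<notin> closure \<Omega>"
proof -
  have op: "open \<Omega>" and cp: "compact (frontier \<Omega>)" and lb: "\<And>p. p \<in> frontier \<Omega> \<Longrightarrow> lipschitz_boundary_at \<Omega> p"
    using \<Omega> by (auto simp: lipschitz_open_def)
  have "\<forall>p\<in>frontier \<Omega>. \<exists>e r. r > 0 \<and> norm e = 1 \<and>
    (\<forall>z s. z \<in> closure \<Omega> \<longrightarrow> z \<in> ball p (2 * r) \<longrightarrow> z + s *\<^sub>R e \<in> ball p (2 * r) \<longrightarrow> s > 0 \<longrightarrow> z + s *\<^sub>R e \<in> \<Omega>)"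
  proof
    fix p assume "p \<in> frontier \<Omega>"
    then obtain e r where er: "r > 0" "norm e = 1"
      "\<And>z s. z \<in> closure \<Omega> \<Longrightarrow> z \<in> ball p r \<Longrightarrow> z + s *\<^sub>R e \<in> ball p r \<Longrightarrow> s > 0 \<Longrightarrow> z + s *\<^sub>R e \<in> \<Omega>"
      using lipschitz_boundary_inward[OF lb] by metis
    \<comment> \<open>The radius is halved so that the chart is valid on twice the ball used in the
      covering; this leaves room for the displacement.\<close>
    show "\<exists>e r. r > 0 \<and> norm e = 1 \<and>
    (\<forall>z s. z \<in> closure \<Omega> \<longrightarrow> z \<in> ball p (2 * r) \<longrightarrow> z + s *\<^sub>R e \<in> ball p (2 * r) \<longrightarrow> s > 0 \<longrightarrow> z + s *\<^sub>R e \<in> \<Omega>)"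
      by (rule exI[of _ e], rule exI[of _ "r/2"]) (use er in auto)
  qed
  then obtain e r where r: "\<And>p. p \<in> frontier \<Omega> \<Longrightarrow> r p > 0" and e: "\<And>p. p \<in> frontier \<Omega> \<Longrightarrow> norm (e p) = 1"
    and inw: "\<And>p z s. p \<in> frontier \<Omega> \<Longrightarrow> z \<in> closure \<Omega> \<Longrightarrow> z \<in> ball p (2 * r p) \<Longrightarrow> z + s *\<^sub>R e p \<in> ball p (2 * r p) \<Longrightarrow> s > 0 \<Longrightarrow> z + s *\<^sub>R e p \<in> \<Omega>"
    by metis
  have cov: "frontier \<Omega> \<subseteq> (\<Union>p\<in>frontier \<Omega>. ball p (r p))" using r by force
  obtain J where J: "J \<subseteq> frontier \<Omega>" "finite J" "frontier \<Omega> \<subseteq> (\<Union>p\<in>J. ball p (r p))"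
    using compactE_image[OF cp _ cov] by auto
  define \<eta> where "\<eta> p = quartic_bump p (r p)" for p
  define \<eta>' where "\<eta>' p = quartic_bump_grad p (r p)" for p
  have \<eta>: "has_grad (\<eta> p) (\<eta>' p)" "\<eta> p x \<ge> 0" "\<eta> p x > 0 \<longleftrightarrow> x \<in> ball p (r p)" "\<eta> p x \<le> (r p) ^ 4"
    "norm (\<eta>' p x) \<le> 4 * (r p) ^ 3" if "p \<in> frontier \<Omega>" for p x
    unfolding \<eta>_def \<eta>'_def by (rule quartic_bump[OF r[OF that]])+
  define X where "X x = (\<Sum>p\<in>J. \<eta> p x *\<^sub>R e p)" for x
  define X' where "X' x v = (\<Sum>p\<in>J. (\<eta>' p x \<bullet> v) *\<^sub>R e p)" for x v
  \<comment> \<open>Each chart contributes the bounds for its bump and for the gradient of the bump;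
    the summand 1 keeps \<open>L\<close> positive when the covering is empty.\<close>
  define L where "L = (\<Sum>p\<in>J. (r p) ^ 4 + 4 * (r p) ^ 3) + 1"
  have rJ: "r p > 0" "norm (e p) = 1" if "p \<in> J" for p using r e J that by auto
  have Lpos: "L > 0" unfolding L_def by (intro add_nonneg_pos sum_nonneg) (use rJ in \<open>auto intro!: add_nonneg_nonneg simp: less_imp_le\<close>)
  have \<eta>J: "0 \<le> \<eta> p x" "\<eta> p x \<le> (r p) ^ 4 + 4 * (r p) ^ 3" if "p \<in> J" for p x
  proof -
    have p: "p \<in> frontier \<Omega>" using J(1) that by blast
    show "0 \<le> \<eta> p x" by (rule \<eta>(2)[OF p])
    have "0 \<le> 4 * (r p) ^ 3" using rJ(1)[OF that] by simp
    then show "\<eta> p x \<le> (r p) ^ 4 + 4 * (r p) ^ 3" using \<eta>(4)[OF p, of x] by linarith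
  qed
  have field: "c1_field X X' L"
    unfolding c1_field_def
  proof (intro conjI allI)
    fix x v
    show "(X has_derivative X' x) (at x)"
      unfolding X_def[abs_def] X'_def[abs_def]
    proof (rule has_derivative_sum)
      fix p assume "p \<in> J"
      then have "(\<eta> p has_derivative (\<lambda>v. \<eta>' p x \<bullet> v)) (at x)" using J by (intro has_gradD[OF \<eta>(1)]) auto
      then show "((\<lambda>x. \<eta> p x *\<^sub>R e p) has_derivative (\<lambda>v. (\<eta>' p x \<bullet> v) *\<^sub>R e p)) (at x)"
        by (rule has_derivative_scaleR_left)
    qed
    show "continuous_on UNIV (\<lambda>x. X' x v)"
      unfolding X'_def by (intro continuous_intros has_grad_continuous_grad[OF \<eta>(1)]) (use J in auto)
    have "norm (X' x v) \<le> (\<Sum>p\<in>J. norm ((\<eta>' p x \<bullet> v) *\<^sub>R e p))" unfolding X'_def by (rule norm_sum)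
    also have "\<dots> \<le> (\<Sum>p\<in>J. ((r p) ^ 4 + 4 * (r p) ^ 3) * norm v)"
    proof (rule sum_mono)
      fix p assume p: "p \<in> J"
      have "norm ((\<eta>' p x \<bullet> v) *\<^sub>R e p) \<le> norm (\<eta>' p x) * norm v" using rJ[OF p] Cauchy_Schwarz_ineq2 by simp
      also have "\<dots> \<le> ((r p) ^ 4 + 4 * (r p) ^ 3) * norm v"
      proof (rule mult_right_mono)
        have "norm (\<eta>' p x) \<le> 4 * (r p) ^ 3" by (rule \<eta>(5)[OF subsetD[OF J(1) p]])
        moreover have "0 \<le> (r p) ^ 4" by simp
        ultimately show "norm (\<eta>' p x) \<le> (r p) ^ 4 + 4 * (r p) ^ 3" by linarith
      qed simp
      finally show "norm ((\<eta>' p x \<bullet> v) *\<^sub>R e p) \<le> ((r p) ^ 4 + 4 * (r p) ^ 3) * norm v" .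
    qed
    also have "\<dots> \<le> L * norm v" unfolding L_def sum_distrib_right[symmetric] by (intro mult_right_mono) auto
    finally show "norm (X' x v) \<le> L * norm v" .
    have "norm (X x) \<le> (\<Sum>p\<in>J. norm (\<eta> p x *\<^sub>R e p))" unfolding X_def by (rule norm_sum)
    also have "\<dots> \<le> (\<Sum>p\<in>J. ((r p) ^ 4 + 4 * (r p) ^ 3))"
    proof (rule sum_mono)
      fix p assume p: "p \<in> J"
      then show "norm (\<eta> p x *\<^sub>R e p) \<le> ((r p) ^ 4 + 4 * (r p) ^ 3)"
        using \<eta>J[OF p, of x] rJ[OF p] by simp
    qed
    finally show "norm (X x) \<le> L" by (simp add: L_def)
  qed
  have sumL: "(\<Sum>p\<in>J'. \<eta> p x) \<le> L" if "J' \<subseteq> J" for J' x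
  proof -
    have "(\<Sum>p\<in>J'. \<eta> p x) \<le> (\<Sum>p\<in>J. \<eta> p x)"
      using J that \<eta>J(1) by (intro sum_mono2) auto
    also have "\<dots> \<le> (\<Sum>p\<in>J. ((r p) ^ 4 + 4 * (r p) ^ 3))"
      by (intro sum_mono \<eta>J(2))
    finally show ?thesis by (simp add: L_def)
  qed
  \<comment> \<open>The value 1 is a default for an empty covering, over which \<open>Min\<close>
    says nothing.\<close>
  define \<delta> where "\<delta> = (if J = {} then 1 else Min (r ` J))"
  have \<delta>: "\<delta> > 0" "\<And>p. p \<in> J \<Longrightarrow> \<delta> \<le> r p" using J(2) rJ by (auto simp: \<delta>_def)
  \<comment> \<open>At the largest step the total displacement is at most \<open>t0 * L\<close>,
    which is half of \<open>\<delta>\<close>.\<close>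
  define t0 where "t0 = \<delta> / (2 * L)"
  have t0: "t0 > 0" using \<delta> Lpos by (simp add: t0_def)
  have part: "norm (\<Sum>p\<in>J'. (t * \<eta> p x) *\<^sub>R e p) < \<delta>" if "J' \<subseteq> J" "0 < t" "t \<le> t0" for J' t x
  proof -
    have "norm (\<Sum>p\<in>J'. (t * \<eta> p x) *\<^sub>R e p) \<le> (\<Sum>p\<in>J'. norm ((t * \<eta> p x) *\<^sub>R e p))" by (rule norm_sum)
    also have "\<dots> = (\<Sum>p\<in>J'. t * \<eta> p x)"
      using that rJ \<eta>J(1) by (intro sum.cong) (auto simp: subset_iff)
    also have "\<dots> = t * (\<Sum>p\<in>J'. \<eta> p x)" by (simp add: sum_distrib_left)
    also have "\<dots> \<le> t0 * L" using that sumL[OF that(1), of x] Lpos t0 by (intro mult_mono sum_nonneg) (use \<eta>J(1) in auto)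
    also have "\<dots> < \<delta>" using \<delta>(1) Lpos by (simp add: t0_def)
    finally show ?thesis .
  qed
  have X_eq: "t *\<^sub>R X x = (\<Sum>p\<in>J. (t * \<eta> p x) *\<^sub>R e p)" for t x by (simp add: X_def scaleR_sum_right)
  have snn: "t * \<eta> p x \<ge> 0" if "0 < t" "p \<in> J" for t p x using \<eta>J(1)[OF that(2), of x] that(1) by simp
  have spos: "x \<in> ball p (r p)" if "0 < t" "p \<in> J" "t * \<eta> p x > 0" for t p x
    using \<eta>(3)[OF subsetD[OF J(1) that(2)], of x] that by (simp add: zero_less_mult_iff)
  have covx: "\<exists>p\<in>J. t * \<eta> p x > 0" if x: "x \<in> frontier \<Omega>" and t: "0 < t" for x t
  proof -
    obtain p where p: "p \<in> J" "x \<in> ball p (r p)" using J(3) x by blast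
    then have "\<eta> p x > 0" using \<eta>(3)[OF subsetD[OF J(1) p(1)]] by blast
    then show ?thesis using p(1) t by (intro bexI[of _ p]) simp_all
  qed
  have main1: "x + t *\<^sub>R X x \<in> \<Omega>" if t: "0 < t" "t \<le> t0" and x: "x \<in> closure \<Omega>" for t x
  proof -
    have "x + (\<Sum>p\<in>J. (t * \<eta> p x) *\<^sub>R e p) \<in> closure \<Omega> \<and>
       (x \<in> \<Omega> \<or> (\<exists>p\<in>J. t * \<eta> p x > 0) \<longrightarrow> x + (\<Sum>p\<in>J. (t * \<eta> p x) *\<^sub>R e p) \<in> \<Omega>)"
    proof (rule push_inside[where r = r and \<delta> = \<delta> and x = x])
      show "norm (x + (\<Sum>p\<in>J'. (t * \<eta> p x) *\<^sub>R e p) - x) < \<delta>" if "J' \<subseteq> J" for J'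
        using part[OF that t, of x] by simp
    qed (use J \<delta> x inw t snn spos in blast)+
    moreover have "x \<in> \<Omega> \<or> x \<in> frontier \<Omega>" using x closure_Un_frontier by blast
    ultimately show ?thesis using covx[OF _ t(1)] X_eq by auto
  qed
  \<comment> \<open>The motion run backwards: the weights are those at \<open>x\<close>, so adding
    all displacements to \<open>x - t *\<^sub>R X x\<close> returns to \<open>x\<close>, and a
    partial sum over \<open>J'\<close> differs from \<open>x\<close> by the displacements over
    \<open>J - J'\<close>. Were the starting point in the closure, \<open>x\<close> would be in the
    closure and hence on the frontier, where some weight is positive and forces \<open>x\<close>
    into \<open>\<Omega>\<close>.\<close>
  have main2: "x - t *\<^sub>R X x \<notin> closure \<Omega>" if t: "0 < t" "t \<le> t0" and x: "x \<notin> \<Omega>" for t x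
  proof
    assume cl: "x - t *\<^sub>R X x \<in> closure \<Omega>"
    have "(x - t *\<^sub>R X x) + (\<Sum>p\<in>J. (t * \<eta> p x) *\<^sub>R e p) \<in> closure \<Omega> \<and>
       (x - t *\<^sub>R X x \<in> \<Omega> \<or> (\<exists>p\<in>J. t * \<eta> p x > 0) \<longrightarrow> (x - t *\<^sub>R X x) + (\<Sum>p\<in>J. (t * \<eta> p x) *\<^sub>R e p) \<in> \<Omega>)"
    proof (rule push_inside[where r = r and \<delta> = \<delta> and x = x])
      fix J' assume J': "J' \<subseteq> J"
      have "(x - t *\<^sub>R X x) + (\<Sum>p\<in>J'. (t * \<eta> p x) *\<^sub>R e p) - x = - (\<Sum>p\<in>J - J'. (t * \<eta> p x) *\<^sub>R e p)"
        unfolding X_eq using J J' by (simp add: sum_diff)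
      then show "norm ((x - t *\<^sub>R X x) + (\<Sum>p\<in>J'. (t * \<eta> p x) *\<^sub>R e p) - x) < \<delta>"
        using part[OF _ t, of "J - J'" x] by (simp only: norm_minus_cancel Diff_subset)
    qed (use J \<delta> cl inw t snn spos in blast)+
    then have "x \<in> closure \<Omega>" and imp: "(\<exists>p\<in>J. t * \<eta> p x > 0) \<longrightarrow> x \<in> \<Omega>" unfolding X_eq by simp_all
    then have "x \<in> frontier \<Omega>" using x op by (simp add: frontier_def interior_open)
    then show False using covx[OF _ t(1)] imp x by blast
  qed
  define t1 where "t1 = min 1 t0"
  have t1: "t1 > 0" "t1 \<le> t0" using t0 by (auto simp: t1_def)
  have sc: "0 < t * t1" "t * t1 \<le> t0" if "0 < t" "t \<le> 1" for t
  proof -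
    have "t * t1 \<le> 1 * t1" using that t1 by (intro mult_right_mono) auto
    then show "t * t1 \<le> t0" using t1 by linarith
  qed (use that t1 in simp)
  show ?thesis
  proof (rule that[of "t1 * L" "\<lambda>x. t1 *\<^sub>R X x" "\<lambda>x v. t1 *\<^sub>R X' x v"])
    show "t1 * L > 0" using t1 Lpos by simp
    fix t :: real assume t: "0 < t" "t \<le> 1"
    show "c1_field (\<lambda>x. t *\<^sub>R t1 *\<^sub>R X x) (\<lambda>x v. t *\<^sub>R t1 *\<^sub>R X' x v) (t * (t1 * L))"
      by (intro c1_field_scaleR field) (use t t1 in auto)
    fix x
    show "x + t *\<^sub>R t1 *\<^sub>R X x \<in> \<Omega>" if "x \<in> closure \<Omega>" using main1[OF sc[OF t] that] by simp
    show "x - t *\<^sub>R t1 *\<^sub>R X x \<notin> closure \<Omega>" if "x \<notin> \<Omega>" using main2[OF sc[OF t] that] by simp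
  qed
qed

section \<open>Approximation with compact supports inside the open set\<close>

lemma compact_enlargement:
  fixes K :: "'a::euclidean_space set"
  assumes "compact K"
  shows "compact {x. \<exists>y\<in>K. norm (x - y) \<le> d}"
proof -
  have "{x. \<exists>y\<in>K. norm (x - y) \<le> d} = {a + b |a b. a \<in> K \<and> b \<in> cball 0 d}"
  proof (intro set_eqI iffI)
    fix x assume "x \<in> {x. \<exists>y\<in>K. norm (x - y) \<le> d}"
    then obtain y where "y \<in> K" "norm (x - y) \<le> d" by blast
    then have "x = y + (x - y)" "x - y \<in> cball 0 d" by auto
    then show "x \<in> {a + b |a b. a \<in> K \<and> b \<in> cball 0 d}" using \<open>y \<in> K\<close> by blast
  qed force
  then show ?thesis using compact_sums[OF assms compact_cball, of 0 d] by simp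
qed

lemma l2_norm_less_from_limit:
  assumes "(\<lambda>n. l2_norm (f n)) \<longlonglongrightarrow> 0" "\<eta> > 0"
  obtains n0 where "\<And>n. n \<ge> n0 \<Longrightarrow> l2_norm (f n) < \<eta>"
  using order_tendstoD(2)[OF assms] unfolding eventually_sequentially by blast

text \<open>The choices depend on each other in this order: \<open>n0\<close> gives the reference
  gradient, this the size of the vector field, the field the gap \<open>d\<close>, and the gap the
  index \<open>n\<close> at which \<open>u n\<close> is pulled back. At that index the support is so
  close to \<open>\<Omega>\<close> that the pull-back lives on a compact subset of
  \<open>\<Omega>\<close>.\<close>

lemma gradient_approximation:
  fixes \<Omega> :: "'a::euclidean_space set" and u :: "nat \<Rightarrow> 'a \<Rightarrow> real"
  assumes \<Omega>: "lipschitz_open \<Omega>" "bounded \<Omega>"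
    and u: "\<And>n. has_grad (u n) (p n)" and supp: "\<And>n x. u n x \<noteq> 0 \<Longrightarrow> \<exists>y\<in>\<Omega>. norm (x - y) \<le> \<delta> n"
    and \<delta>: "\<delta> \<longlonglongrightarrow> 0" and R: "\<And>n x. x \<notin> cball 0 R \<Longrightarrow> u n x = 0"
    and G: "square_integrable G" and lim: "(\<lambda>n. l2_norm (\<lambda>x. p n x - G x)) \<longlonglongrightarrow> 0" and \<eta>: "\<eta> > 0"
  obtains \<phi> where "\<phi> \<in> test_functions \<Omega>" "l2_norm (\<lambda>x. gradient \<phi> x - G x) < \<eta>"
proof -
  obtain C where C: "C \<ge> 0" and est: "\<And>(p0 :: 'a \<Rightarrow> 'a) R \<eta>.
     \<lbrakk>continuous_on UNIV p0; \<And>x. x \<notin> cball 0 R \<Longrightarrow> p0 x = 0; \<eta> > 0\<rbrakk> \<Longrightarrow>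
     \<exists>L0>0. \<forall>X X' L p. c1_field X X' L \<and> L \<le> L0 \<and> continuous_on UNIV p \<and> (\<forall>x. x \<notin> cball 0 R \<longrightarrow> p x = 0) \<longrightarrow>
       l2_norm (\<lambda>x. p (x - X x) - adjoint (X' x) (p (x - X x)) - p0 x) \<le> C * l2_norm (\<lambda>x. p x - p0 x) + \<eta>"
    by (rule pullback_estimate) blast
  \<comment> \<open>The error will be \<open>\<mu>\<close> for the mollification,
    \<open>C * (2 * \<mu>) + \<mu>\<close> for the pull-back and \<open>\<mu>\<close> for the
    reference gradient, in total less than \<open>\<eta>\<close>.\<close>
  define \<mu> where "\<mu> = \<eta> / (2 * C + 4)"
  have \<mu>: "\<mu> > 0" using \<eta> C by (simp add: \<mu>_def)
  have pc: "continuous_on UNIV (p n)" for n by (rule has_grad_continuous_grad[OF u])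
  have pR: "p n x = 0" if "x \<notin> cball 0 R" for n x by (rule has_grad_support[OF u R that])
  have ps: "square_integrable (p n)" for n by (rule square_integrable_continuous_bounded_support[OF pc pR])
  obtain n0 where n0: "\<And>n. n \<ge> n0 \<Longrightarrow> l2_norm (\<lambda>x. p n x - G x) < \<mu>"
    by (rule l2_norm_less_from_limit[OF lim \<mu>]) blast
  obtain L0 where L0: "L0 > 0" "\<And>X X' L q. c1_field X X' L \<Longrightarrow> L \<le> L0 \<Longrightarrow> continuous_on UNIV q \<Longrightarrow> (\<And>x. x \<notin> cball 0 R \<Longrightarrow> q x = 0) \<Longrightarrow>
       l2_norm (\<lambda>x. q (x - X x) - adjoint (X' x) (q (x - X x)) - p n0 x) \<le> C * l2_norm (\<lambda>x. q x - p n0 x) + \<mu>"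
    using est[of "p n0" R \<mu>, OF pc pR \<mu>] by blast
  obtain Y Y' L where L: "L > 0" and Y: "\<And>t. 0 < t \<Longrightarrow> t \<le> 1 \<Longrightarrow> c1_field (\<lambda>x. t *\<^sub>R Y x) (\<lambda>x v. t *\<^sub>R Y' x v) (t * L)"
    and out: "\<And>t x. 0 < t \<Longrightarrow> t \<le> 1 \<Longrightarrow> x \<notin> \<Omega> \<Longrightarrow> x - t *\<^sub>R Y x \<notin> closure \<Omega>"
    by (rule inward_field[OF \<Omega>(1)]) blast
  \<comment> \<open>\<open>t * L\<close> bounds the scaled field and its derivative: at most
    \<open>L0\<close> for the estimate, and at most 1 so that no point moves farther than 1.\<close>
  define t where "t = min 1 (min L0 1 / L)"
  have t: "0 < t" "t \<le> 1" "t * L \<le> L0" "t * L \<le> 1"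
  proof -
    have "t * L \<le> (min L0 1 / L) * L" using L by (intro mult_right_mono) (simp_all add: t_def)
    then have "t * L \<le> min L0 1" using L by simp
    then show "t * L \<le> L0" "t * L \<le> 1" by auto
  qed (use L0 L in \<open>auto simp: t_def\<close>)
  define X where "X x = t *\<^sub>R Y x" for x
  define X' where "X' x v = t *\<^sub>R Y' x v" for x v
  have X: "c1_field X X' (t * L)" unfolding X_def[abs_def] X'_def[abs_def] by (rule Y[OF t(1,2)])
  define \<Psi> where "\<Psi> x = x - X x" for x
  have \<Psi>c: "continuous_on UNIV \<Psi>" unfolding \<Psi>_def by (intro continuous_intros c1_fieldD[OF X])
  have \<Psi>1: "norm (\<Psi> x - x) \<le> 1" for x using c1_fieldD(4)[OF X, of x] t by (simp add: \<Psi>_def)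
  obtain S where S: "\<And>x. x \<in> \<Omega> \<Longrightarrow> norm x \<le> S" using \<Omega>(2) unfolding bounded_iff by blast
  have clS: "norm x \<le> S" if "x \<in> closure \<Omega>" for x
  proof -
    have "closure \<Omega> \<subseteq> cball 0 S" using S by (intro closure_minimal) auto
    then show ?thesis using that by auto
  qed
  have cpcl: "compact (closure \<Omega>)" using \<Omega>(2) by simp
  \<comment> \<open>Compactness gives the gap for \<open>x\<close> in the ball of radius
    \<open>S + 2\<close>. Farther out, \<open>\<Psi> x\<close> still has norm greater than
    \<open>S + 1\<close> and is at least 1 away from the closure.\<close>
  obtain d where d: "d > 0" "\<And>x y. x \<notin> \<Omega> \<Longrightarrow> y \<in> closure \<Omega> \<Longrightarrow> norm (\<Psi> x - y) > d"
  proof -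
    have op: "open \<Omega>" using \<Omega>(1) by (simp add: lipschitz_open_def)
    have "compact (\<Psi> ` (cball 0 (S + 2) - \<Omega>))"
      by (intro compact_continuous_image continuous_on_subset[OF \<Psi>c] compact_diff op) auto
    moreover have "\<Psi> ` (cball 0 (S + 2) - \<Omega>) \<inter> closure \<Omega> = {}"
      using out[OF t(1,2)] by (auto simp: \<Psi>_def X_def)
    ultimately obtain d where d: "d > 0" "\<And>x y. x \<in> \<Psi> ` (cball 0 (S + 2) - \<Omega>) \<Longrightarrow> y \<in> closure \<Omega> \<Longrightarrow> d \<le> dist x y"
      using separate_compact_closed[of "\<Psi> ` (cball 0 (S + 2) - \<Omega>)" "closure \<Omega>"] by auto
    show ?thesis
    \<comment> \<open>Halving turns the weak inequality of the separation into a strict one.\<close>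
    proof (rule that[of "min (1/2) (d/2)"])
      fix x y assume x: "x \<notin> \<Omega>" and y: "y \<in> closure \<Omega>"
      show "norm (\<Psi> x - y) > min (1/2) (d/2)"
      proof (cases "x \<in> cball 0 (S + 2)")
        case True
        then have "d \<le> norm (\<Psi> x - y)" using d(2)[of "\<Psi> x" y] x y by (auto simp: dist_norm)
        then show ?thesis using d(1) by (auto simp: min_def)
      next
        case False
        then have "norm (\<Psi> x - y) \<ge> 1"
          using \<Psi>1[of x] clS[OF y] norm_triangle_ineq2[of x "x - \<Psi> x"] norm_triangle_ineq2[of "\<Psi> x" y] by (auto simp: norm_minus_commute)
        then show ?thesis by (auto simp: min_def)
      qed
    qed (use d in auto)
  qed
  \<comment> \<open>The points that \<open>\<Psi>\<close> sends within \<open>d\<close> of the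
    closure; by the choice of \<open>d\<close> none of them lies outside
    \<open>\<Omega>\<close>.\<close>
  define K where "K = \<Psi> -` {w. \<exists>y\<in>closure \<Omega>. norm (w - y) \<le> d}"
  have K\<Omega>: "K \<subseteq> \<Omega>" unfolding K_def using d(2) by (auto simp: not_less[symmetric])
  have Kc: "compact K"
  proof -
    have "closed K" unfolding K_def
      by (rule closed_vimage[OF compact_imp_closed[OF compact_enlargement[OF cpcl]] \<Psi>c])
    moreover have "bounded K" using K\<Omega> \<Omega>(2) by (rule bounded_subset[rotated])
    ultimately show ?thesis by (simp add: compact_eq_bounded_closed)
  qed
  obtain n1 where n1: "\<And>n. n \<ge> n1 \<Longrightarrow> \<delta> n < d"
    using order_tendstoD(2)[OF \<delta> d(1)] unfolding eventually_sequentially by blast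
  define n where "n = max n0 n1"
  have n: "n \<ge> n0" "n \<ge> n1" by (auto simp: n_def)
  define q where "q x = p n (\<Psi> x) - adjoint (X' x) (p n (\<Psi> x))" for x
  have v: "has_grad (\<lambda>x. u n (\<Psi> x)) q"
    unfolding q_def \<Psi>_def by (rule has_grad_pullback[OF u X])
  have vK: "x \<in> K" if nz: "u n (\<Psi> x) \<noteq> 0" for x
  proof -
    obtain y where "y \<in> \<Omega>" "norm (\<Psi> x - y) \<le> \<delta> n" using supp[OF nz] by blast
    then have "y \<in> closure \<Omega>" "norm (\<Psi> x - y) \<le> d" using n1[OF n(2)] closure_subset by auto
    then show ?thesis by (auto simp: K_def)
  qed
  obtain \<phi> where \<phi>: "\<phi> \<in> test_functions \<Omega>" "l2_norm (\<lambda>x. gradient \<phi> x - q x) < \<mu>"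
  proof (rule c1_approx_test_function[OF v Kc _ _ K\<Omega> \<mu>])
    show "open \<Omega>" using \<Omega>(1) by (simp add: lipschitz_open_def)
  qed (use vK in auto)
  have qe: "l2_norm (\<lambda>x. q x - p n0 x) \<le> C * l2_norm (\<lambda>x. p n x - p n0 x) + \<mu>"
    unfolding q_def \<Psi>_def by (rule L0(2)[OF X t(3) pc pR])
  have "l2_norm (\<lambda>x. p n x - p n0 x) \<le> l2_norm (\<lambda>x. p n x - G x) + l2_norm (\<lambda>x. G x - p n0 x)"
    by (rule l2_norm_triangle_sub[OF ps G ps])
  then have pp: "l2_norm (\<lambda>x. p n x - p n0 x) \<le> 2 * \<mu>"
    using n0[OF n(1)] n0[OF order_refl] l2_norm_diff_commute[of G "p n0"] by simp
  have qs: "square_integrable q"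
    by (rule square_integrable_continuous_bounded_support[OF has_grad_continuous_grad[OF v], of S])
       (rule has_grad_support[OF v, of S], use vK K\<Omega> S in \<open>auto\<close>)
  obtain T where T: "\<And>x. \<phi> x \<noteq> 0 \<Longrightarrow> norm x \<le> T"
    using test_functionsD(3)[OF \<phi>(1)] S by blast
  have g\<phi>: "has_grad \<phi> (gradient \<phi>)" by (rule smooth_has_grad(1)[OF test_functionsD(1)[OF \<phi>(1)]])
  have \<phi>s: "square_integrable (gradient \<phi>)"
    by (rule square_integrable_continuous_bounded_support[OF has_grad_continuous_grad[OF g\<phi>], of T])
       (rule has_grad_support[OF g\<phi>, of T], use T in auto)
  have "l2_norm (\<lambda>x. gradient \<phi> x - G x) \<le> l2_norm (\<lambda>x. gradient \<phi> x - q x) + l2_norm (\<lambda>x. q x - G x)"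
    by (rule l2_norm_triangle_sub[OF \<phi>s qs G])
  also have "l2_norm (\<lambda>x. q x - G x) \<le> l2_norm (\<lambda>x. q x - p n0 x) + l2_norm (\<lambda>x. p n0 x - G x)"
    by (rule l2_norm_triangle_sub[OF qs ps G])
  finally have "l2_norm (\<lambda>x. gradient \<phi> x - G x) < \<mu> + (C * (2 * \<mu>) + \<mu>) + \<mu>"
    using \<phi>(2) qe mult_left_mono[OF pp C] n0[OF order_refl] by linarith
  also have "\<dots> \<le> \<eta>"
  proof -
    have "\<mu> * (2 * C + 4) = \<eta>" using C by (simp add: \<mu>_def)
    then show ?thesis using \<mu> by (simp add: algebra_simps)
  qed
  finally show ?thesis using that \<phi>(1) by blast
qed

text \<open>The order of choices is that for gradients, but the map acts forwards:
  \<open>id + X\<close> sends the closure of \<open>\<Omega>\<close> onto a compact subset of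
  \<open>\<Omega>\<close>. The transport contains its own mollification, so no further smoothing
  follows.\<close>

lemma solenoidal_approximation:
  fixes \<Omega> :: "'a::euclidean_space set" and h :: "nat \<Rightarrow> 'a \<Rightarrow> 'a"
  assumes \<Omega>: "lipschitz_open \<Omega>" "bounded \<Omega>"
    and h: "\<And>n. continuous_on UNIV (h n)" "\<And>n. weakly_div_free (h n)"
    and supp: "\<And>n x. h n x \<noteq> 0 \<Longrightarrow> \<exists>y\<in>\<Omega>. norm (x - y) \<le> \<delta> n"
    and \<delta>: "\<delta> \<longlonglongrightarrow> 0" and R: "\<And>n x. x \<notin> cball 0 R \<Longrightarrow> h n x = 0"
    and G: "square_integrable G" and lim: "(\<lambda>n. l2_norm (\<lambda>x. h n x - G x)) \<longlonglongrightarrow> 0" and \<eta>: "\<eta> > 0"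
  obtains \<psi> where "\<psi> \<in> test_functions \<Omega>" "\<And>x. divergence \<psi> x = 0" "l2_norm (\<lambda>x. \<psi> x - G x) < \<eta>"
proof -
  obtain C where C: "C \<ge> 0" and est: "\<And>(h0 :: 'a \<Rightarrow> 'a) R \<eta>.
     \<lbrakk>continuous_on UNIV h0; \<And>x. x \<notin> cball 0 R \<Longrightarrow> h0 x = 0; \<eta> > 0\<rbrakk> \<Longrightarrow>
     \<exists>L0>0. \<forall>X X' L h e. c1_field X X' L \<and> L \<le> L0 \<and> 0 < e \<and> e \<le> L0 \<and> continuous_on UNIV h \<and> (\<forall>x. x \<notin> cball 0 R \<longrightarrow> h x = 0) \<longrightarrow>
       l2_norm (\<lambda>x. transport X X' e h x - h0 x) \<le> C * l2_norm (\<lambda>x. h x - h0 x) + \<eta>"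
    by (rule transport_estimate) blast
  define \<mu> where "\<mu> = \<eta> / (2 * C + 4)"
  have \<mu>: "\<mu> > 0" using \<eta> C by (simp add: \<mu>_def)
  have hs: "square_integrable (h n)" for n by (rule square_integrable_continuous_bounded_support[OF h(1) R])
  obtain n0 where n0: "\<And>n. n \<ge> n0 \<Longrightarrow> l2_norm (\<lambda>x. h n x - G x) < \<mu>"
    by (rule l2_norm_less_from_limit[OF lim \<mu>]) blast
  obtain L0 where L0: "L0 > 0" "\<And>X X' L q e. c1_field X X' L \<Longrightarrow> L \<le> L0 \<Longrightarrow> 0 < e \<Longrightarrow> e \<le> L0 \<Longrightarrow> continuous_on UNIV q \<Longrightarrow>
       (\<And>x. x \<notin> cball 0 R \<Longrightarrow> q x = 0) \<Longrightarrow>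
       l2_norm (\<lambda>x. transport X X' e q x - h n0 x) \<le> C * l2_norm (\<lambda>x. q x - h n0 x) + \<mu>"
    using est[of "h n0" R \<mu>, OF h(1) R \<mu>] by blast
  obtain Y Y' L where L: "L > 0" and Y: "\<And>t. 0 < t \<Longrightarrow> t \<le> 1 \<Longrightarrow> c1_field (\<lambda>x. t *\<^sub>R Y x) (\<lambda>x v. t *\<^sub>R Y' x v) (t * L)"
    and inn: "\<And>t x. 0 < t \<Longrightarrow> t \<le> 1 \<Longrightarrow> x \<in> closure \<Omega> \<Longrightarrow> x + t *\<^sub>R Y x \<in> \<Omega>"
    by (rule inward_field[OF \<Omega>(1)]) blast
  define t where "t = min 1 (min L0 1 / L)"
  have t: "0 < t" "t \<le> 1" "t * L \<le> L0" "t * L \<le> 1"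
  proof -
    have "t * L \<le> (min L0 1 / L) * L" using L by (intro mult_right_mono) (simp_all add: t_def)
    then have "t * L \<le> min L0 1" using L by simp
    then show "t * L \<le> L0" "t * L \<le> 1" by auto
  qed (use L0 L in \<open>auto simp: t_def\<close>)
  define X where "X x = t *\<^sub>R Y x" for x
  define X' where "X' x v = t *\<^sub>R Y' x v" for x v
  have X: "c1_field X X' (t * L)" unfolding X_def[abs_def] X'_def[abs_def] by (rule Y[OF t(1,2)])
  define \<Phi> where "\<Phi> x = x + X x" for x
  have \<Phi>c: "continuous_on UNIV \<Phi>" unfolding \<Phi>_def by (intro continuous_intros c1_fieldD[OF X])
  have \<Phi>lip: "norm (\<Phi> x - \<Phi> y) \<le> 2 * norm (x - y)" for x y
  proof -
    have "norm (X x - X y) \<le> (t * L) * norm (x - y)" by (rule c1_field_lipschitz[OF X])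
    also have "\<dots> \<le> 1 * norm (x - y)" by (intro mult_right_mono t) auto
    finally show ?thesis using norm_triangle_ineq[of "x - y" "X x - X y"] by (simp add: \<Phi>_def algebra_simps)
  qed
  have Kc: "compact (\<Phi> ` closure \<Omega>)"
    by (intro compact_continuous_image continuous_on_subset[OF \<Phi>c]) (use \<Omega>(2) in auto)
  have K\<Omega>: "\<Phi> ` closure \<Omega> \<subseteq> \<Omega>" using inn[OF t(1,2)] by (auto simp: \<Phi>_def X_def)
  have op: "open \<Omega>" using \<Omega>(1) by (simp add: lipschitz_open_def)
  obtain d where d: "d > 0" "(\<Union>y\<in>\<Phi> ` closure \<Omega>. cball y d) \<subseteq> \<Omega>"
    using compact_subset_open_imp_cball_epsilon_subset[OF Kc op K\<Omega>] .
  \<comment> \<open>The margin \<open>d\<close> is shared between the mollification,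
    \<open>e \<le> d / 2\<close>, and the excess of the support, which is less than
    \<open>d / 4\<close> and at most doubled by \<open>\<Phi>\<close>.\<close>
  obtain n1 where n1: "\<And>n. n \<ge> n1 \<Longrightarrow> \<delta> n < d / 4"
    using order_tendstoD(2)[OF \<delta>, of "d/4"] d(1) unfolding eventually_sequentially by auto
  define n where "n = max n0 n1"
  have n: "n \<ge> n0" "n \<ge> n1" by (auto simp: n_def)
  define e where "e = min L0 (d / 2)"
  have e: "e > 0" "e \<le> L0" "e \<le> d / 2" using L0 d by (auto simp: e_def)
  define K where "K = {x. \<exists>y\<in>\<Phi> ` closure \<Omega>. norm (x - y) \<le> d}"
  have K: "compact K" "K \<subseteq> \<Omega>"
    using compact_enlargement[OF Kc] d(2) by (auto simp: K_def dist_norm norm_minus_commute subset_iff)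
  have near: "x \<in> K" if nz: "h n y \<noteq> 0" and xe: "norm (x - (y + X y)) \<le> e" for x y
  proof -
    obtain w where w: "w \<in> \<Omega>" "norm (y - w) \<le> \<delta> n" using supp[OF nz] by blast
    have "norm (x - \<Phi> w) \<le> norm (x - \<Phi> y) + norm (\<Phi> y - \<Phi> w)" using norm_triangle_ineq[of "x - \<Phi> y" "\<Phi> y - \<Phi> w"] by simp
    also have "\<dots> \<le> e + 2 * \<delta> n" using xe \<Phi>lip[of y w] w(2) by (simp add: \<Phi>_def)
    also have "\<dots> \<le> d" using e(3) n1[OF n(2)] by simp
    finally show ?thesis using w(1) closure_subset unfolding K_def by blast
  qed
  define \<psi> where "\<psi> = transport X X' e (h n)"
  have \<psi>: "\<psi> \<in> test_functions \<Omega>" "\<And>x. divergence \<psi> x = 0"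
    unfolding \<psi>_def by (rule transport_test_function[OF X h(1) R K near e(1) h(2)]; assumption)+
  have qe: "l2_norm (\<lambda>x. \<psi> x - h n0 x) \<le> C * l2_norm (\<lambda>x. h n x - h n0 x) + \<mu>"
    unfolding \<psi>_def by (rule L0(2)[OF X t(3) e(1,2) h(1) R])
  have "l2_norm (\<lambda>x. h n x - h n0 x) \<le> l2_norm (\<lambda>x. h n x - G x) + l2_norm (\<lambda>x. G x - h n0 x)"
    by (rule l2_norm_triangle_sub[OF hs G hs])
  then have pp: "l2_norm (\<lambda>x. h n x - h n0 x) \<le> 2 * \<mu>"
    using n0[OF n(1)] n0[OF order_refl] l2_norm_diff_commute[of G "h n0"] by simp
  obtain S where S: "\<And>x. x \<in> \<Omega> \<Longrightarrow> norm x \<le> S" using \<Omega>(2) unfolding bounded_iff by blast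
  have \<psi>s: "square_integrable \<psi>"
    by (rule square_integrable_continuous_bounded_support[OF times_cont_diff_continuous[OF test_functionsD(1)[OF \<psi>(1)]], of S])
       (use test_functionsD(3)[OF \<psi>(1)] S in auto)
  have "l2_norm (\<lambda>x. \<psi> x - G x) \<le> l2_norm (\<lambda>x. \<psi> x - h n0 x) + l2_norm (\<lambda>x. h n0 x - G x)"
    by (rule l2_norm_triangle_sub[OF \<psi>s hs G])
  then have "l2_norm (\<lambda>x. \<psi> x - G x) < (C * (2 * \<mu>) + \<mu>) + \<mu>"
    using qe mult_left_mono[OF pp C] n0[OF order_refl] by linarith
  also have "\<dots> \<le> \<eta>"
  proof -
    have "\<mu> * (2 * C + 4) = \<eta>" using C by (simp add: \<mu>_def)
    then show ?thesis using \<mu> by (simp add: algebra_simps)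
  qed
  finally show ?thesis using that \<psi> by blast
qed

section \<open>A regularised Newton kernel\<close>

lemma DERIV_glue:
  fixes f g :: "real \<Rightarrow> real"
  assumes f: "\<And>s. s \<le> a \<Longrightarrow> (f has_real_derivative f' s) (at s)"
    and g: "\<And>s. a \<le> s \<Longrightarrow> (g has_real_derivative g' s) (at s)"
    and eq: "f a = g a" "f' a = g' a"
  shows "((\<lambda>s. if s < a then f s else g s) has_real_derivative (if s < a then f' s else g' s)) (at s)"
proof -
  consider "s < a" | "s > a" | "s = a" by linarith
  then show ?thesis
  proof cases
    case 1
    then have "(f has_real_derivative (if s < a then f' s else g' s)) (at s)" using f[of s] by simp
    then show ?thesis
      by (rule has_field_derivative_transform_within_open[of _ _ _ "{..<a}"]) (use 1 in auto)
  next
    case 2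
    then have "(g has_real_derivative (if s < a then f' s else g' s)) (at s)" using g[of s] by simp
    then show ?thesis
      by (rule has_field_derivative_transform_within_open[of _ _ _ "{a<..}"]) (use 2 in auto)
  next
    case 3
    have l1: "((\<lambda>h. (f (a + h) - f a) / h) \<longlongrightarrow> g' a) (at 0)" using f[of a] eq by (simp add: DERIV_def)
    have l2: "((\<lambda>h. (g (a + h) - g a) / h) \<longlongrightarrow> g' a) (at 0)" using g[of a] by (simp add: DERIV_def)
    have "((\<lambda>h. if h < 0 then (f (a + h) - f a) / h else (g (a + h) - g a) / h) \<longlongrightarrow> g' a) (at 0)"
      by (rule filterlim_If) (rule tendsto_mono[OF inf_le1 l1], rule tendsto_mono[OF inf_le1 l2])
    then have "((\<lambda>h. ((if a + h < a then f (a + h) else g (a + h)) - (if a < a then f a else g a)) / h) \<longlongrightarrow> g' a) (at 0)"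
      by (rule Lim_transform_eventually) (use eq in \<open>auto intro!: always_eventually\<close>)
    then show ?thesis using 3 by (simp add: DERIV_def)
  qed
qed

text \<open>\<open>x \<mapsto> radial_profile \<delta> d (x \<bullet> x) *\<^sub>R x\<close> agrees with \<open>x / |x|\<^sup>d\<close> outside the ball of radius \<open>\<delta>\<close>;
  inside, \<open>s\<^bsup>-d/2\<^esup>\<close> is replaced by its first-order Taylor polynomial at \<open>\<delta>\<^sup>2\<close>.\<close>

definition radial_profile :: "real \<Rightarrow> real \<Rightarrow> real \<Rightarrow> real" where
  "radial_profile \<delta> d s = (if s < \<delta>\<^sup>2 then \<delta> powr (- d) * (1 - d / 2 * (s / \<delta>\<^sup>2 - 1)) else s powr (- d / 2))"

definition radial_profile' :: "real \<Rightarrow> real \<Rightarrow> real \<Rightarrow> real" where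
  "radial_profile' \<delta> d s = (if s < \<delta>\<^sup>2 then - (d / 2) * (\<delta> powr (- d) / \<delta>\<^sup>2) else - (d / 2) * s powr (- d / 2 - 1))"

lemma power2_powr_half:
  fixes \<delta> :: real assumes "\<delta> > 0" shows "(\<delta>\<^sup>2) powr (a / 2) = \<delta> powr a"
proof -
  have "\<delta>\<^sup>2 = \<delta> powr 2" using assms by simp
  then have "(\<delta>\<^sup>2) powr (a / 2) = (\<delta> powr 2) powr (a / 2)" by (simp only:)
  also have "\<dots> = \<delta> powr a" unfolding powr_powr by simp
  finally show ?thesis .
qed

lemma radial_profile_derivative:
  assumes \<delta>: "\<delta> > 0"
  shows "(radial_profile \<delta> d has_real_derivative radial_profile' \<delta> d s) (at s)"
proof -
  have d2: "\<delta>\<^sup>2 > 0" using \<delta> by simp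
  show ?thesis
    unfolding radial_profile_def[abs_def] radial_profile'_def
  proof (rule DERIV_glue)
    show "((\<lambda>s. \<delta> powr (- d) * (1 - d / 2 * (s / \<delta>\<^sup>2 - 1))) has_real_derivative - (d / 2) * (\<delta> powr (- d) / \<delta>\<^sup>2)) (at s)" for s
    proof -
      have gen: "((\<lambda>s. A * (1 - d / 2 * (s / a - 1))) has_real_derivative - (d / 2) * (A / a)) (at s)" if "a \<noteq> 0" for A a
        using that by (auto intro!: derivative_eq_intros)
      show ?thesis by (rule gen) (use d2 in simp)
    qed
    show "((\<lambda>s. s powr (- d / 2)) has_real_derivative - (d / 2) * s powr (- d / 2 - 1)) (at s)" if "\<delta>\<^sup>2 \<le> s" for s
    proof -
      have "s > 0" using that d2 by linarith
      then show ?thesis using has_real_derivative_powr[of s "- d / 2"] by simp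
    qed
    show "\<delta> powr - d * (1 - d / 2 * (\<delta>\<^sup>2 / \<delta>\<^sup>2 - 1)) = \<delta>\<^sup>2 powr (- d / 2)"
      using d2 power2_powr_half[OF \<delta>, of "- d"] by simp
    have "\<delta>\<^sup>2 powr (- d / 2 - 1) = \<delta> powr (- d) / \<delta>\<^sup>2"
      using d2 power2_powr_half[OF \<delta>, of "- d"] by (simp add: powr_diff)
    then show "- (d / 2) * (\<delta> powr - d / \<delta>\<^sup>2) = - (d / 2) * \<delta>\<^sup>2 powr (- d / 2 - 1)" by simp
  qed
qed

lemma continuous_radial_profile:
  assumes \<delta>: "\<delta> > 0"
  shows "continuous_on UNIV (radial_profile \<delta> d)" "continuous_on UNIV (radial_profile' \<delta> d)"
proof -
  show "continuous_on UNIV (radial_profile \<delta> d)"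
    by (intro continuous_at_imp_continuous_on ballI DERIV_isCont[OF radial_profile_derivative[OF \<delta>]])
  have d2: "\<delta>\<^sup>2 > 0" using \<delta> by simp
  have eq: "\<delta>\<^sup>2 powr (- d / 2 - 1) = \<delta> powr (- d) / \<delta>\<^sup>2"
    using d2 power2_powr_half[OF \<delta>, of "- d"] by (simp add: powr_diff)
  have "continuous_on ({..\<delta>\<^sup>2} \<union> {\<delta>\<^sup>2..}) (\<lambda>s. if s < \<delta>\<^sup>2 then - (d / 2) * (\<delta> powr (- d) / \<delta>\<^sup>2) else - (d / 2) * s powr (- d / 2 - 1))"
  proof (rule continuous_on_If)
    show "continuous_on {\<delta>\<^sup>2..} (\<lambda>s. - (d / 2) * s powr (- d / 2 - 1))"
      using d2 by (intro continuous_intros) auto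
  qed (use eq in \<open>auto intro!: continuous_intros\<close>)
  moreover have "{..\<delta>\<^sup>2} \<union> {\<delta>\<^sup>2..} = (UNIV :: real set)" by auto
  ultimately show "continuous_on UNIV (radial_profile' \<delta> d)" unfolding radial_profile'_def[abs_def] by simp
qed

text \<open>Half of it, evaluated at \<open>z \<bullet> z\<close>, is a potential of the regularised
  kernel. For \<open>d > 2\<close> the exponent \<open>1 - d / 2\<close> is not 0, so the outer
  branch is a power; the constant added to the inner branch makes the two agree at
  \<open>\<delta>\<^sup>2\<close>.\<close>

lemma radial_profile_antiderivative:
  assumes \<delta>: "\<delta> > 0" and d: "d > 2"
  obtains m where "\<And>s. (m has_real_derivative radial_profile \<delta> d s) (at s)"
proof -
  have d2: "\<delta>\<^sup>2 > 0" using \<delta> by simp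
  define P where "P s = \<delta> powr (- d) * (s - d / 2 * (s\<^sup>2 / (2 * \<delta>\<^sup>2) - s))" for s
  define Q where "Q s = s powr (1 - d / 2) / (1 - d / 2)" for s
  have "((\<lambda>s. if s < \<delta>\<^sup>2 then P s - P (\<delta>\<^sup>2) + Q (\<delta>\<^sup>2) else Q s) has_real_derivative radial_profile \<delta> d s) (at s)" for s
    unfolding radial_profile_def
  proof (rule DERIV_glue)
    show "((\<lambda>s. P s - P (\<delta>\<^sup>2) + Q (\<delta>\<^sup>2)) has_real_derivative \<delta> powr (- d) * (1 - d / 2 * (s / \<delta>\<^sup>2 - 1))) (at s)" for s
    proof -
      have gen: "((\<lambda>s. A * (s - d / 2 * (s\<^sup>2 / (2 * a) - s)) - B + C) has_real_derivative A * (1 - d / 2 * (s / a - 1))) (at s)"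
        if "a \<noteq> 0" for A B C a
        using that by (auto intro!: derivative_eq_intros simp: field_simps)
      show ?thesis unfolding P_def by (rule gen) (use d2 in simp)
    qed
    show "(Q has_real_derivative s powr (- d / 2)) (at s)" if "\<delta>\<^sup>2 \<le> s" for s
    proof -
      have "s > 0" using that d2 by linarith
      then show ?thesis unfolding Q_def
        using d by (auto intro!: derivative_eq_intros has_real_derivative_powr[of s "1 - d / 2"])
    qed
    show "\<delta> powr - d * (1 - d / 2 * (\<delta>\<^sup>2 / \<delta>\<^sup>2 - 1)) = \<delta>\<^sup>2 powr (- d / 2)"
      using d2 power2_powr_half[OF \<delta>, of "- d"] by simp
  qed simp
  then show ?thesis by (rule that)
qed

section \<open>The regularised kernel, its Jacobian and its divergence\<close>

definition reg_kernel :: "real \<Rightarrow> 'a::euclidean_space \<Rightarrow> 'a" where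
  "reg_kernel \<delta> x = radial_profile \<delta> (real DIM('a)) (x \<bullet> x) *\<^sub>R x"

definition reg_kernel_grad :: "real \<Rightarrow> 'a::euclidean_space \<Rightarrow> 'a \<Rightarrow> 'a" where
  "reg_kernel_grad \<delta> c x = radial_profile \<delta> (real DIM('a)) (x \<bullet> x) *\<^sub>R c
     + (2 * radial_profile' \<delta> (real DIM('a)) (x \<bullet> x) * (x \<bullet> c)) *\<^sub>R x"

text \<open>The divergence of \<open>reg_kernel 1\<close>. Outside the unit ball
  \<open>x / |x|\<^sup>d\<close> is divergence free. Inside, with \<open>s = x \<bullet> x\<close>
  and the affine profile \<open>k\<close>, the divergence \<open>d * k + 2 * k' * s\<close>
  collapses to this multiple of \<open>1 - s\<close>.\<close>

definition cone_kernel :: "'a::euclidean_space \<Rightarrow> real" where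
  "cone_kernel x = real DIM('a) * (1 + real DIM('a) / 2) * max 0 (1 - x \<bullet> x)"

lemma has_grad_reg_kernel:
  assumes \<delta>: "\<delta> > 0"
  shows "has_grad (\<lambda>x. reg_kernel \<delta> x \<bullet> c) (reg_kernel_grad \<delta> (c::'a::euclidean_space))"
  unfolding has_grad_def
proof (intro conjI allI)
  fix x :: 'a
  let ?k = "radial_profile \<delta> (real DIM('a))" and ?k' = "radial_profile' \<delta> (real DIM('a))"
  have "((\<lambda>x. x \<bullet> x) has_derivative (\<lambda>v. 2 * (x \<bullet> v))) (at x)"
    by (auto intro!: derivative_eq_intros simp: inner_commute)
  from has_derivative_compose[OF this radial_profile_derivative[OF \<delta>, unfolded has_field_derivative_def]]
  have d: "((\<lambda>x. ?k (x \<bullet> x)) has_derivative (\<lambda>v. ?k' (x \<bullet> x) * (2 * (x \<bullet> v)))) (at x)" .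
  have d2: "((\<lambda>x. x \<bullet> c) has_derivative (\<lambda>v. v \<bullet> c)) (at x)" by (auto intro!: derivative_eq_intros)
  have "((\<lambda>x. ?k (x \<bullet> x) * (x \<bullet> c)) has_derivative (\<lambda>v. ?k (x \<bullet> x) * (v \<bullet> c) + ?k' (x \<bullet> x) * (2 * (x \<bullet> v)) * (x \<bullet> c))) (at x)"
    by (rule has_derivative_mult[OF d d2])
  moreover have "(\<lambda>v. ?k (x \<bullet> x) * (v \<bullet> c) + ?k' (x \<bullet> x) * (2 * (x \<bullet> v)) * (x \<bullet> c)) = (\<bullet>) (reg_kernel_grad \<delta> c x)"
    by (simp add: fun_eq_iff reg_kernel_grad_def inner_add_left inner_commute[of _ c])
  ultimately show "((\<lambda>x. reg_kernel \<delta> x \<bullet> c) has_derivative (\<bullet>) (reg_kernel_grad \<delta> c x)) (at x)"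
    by (simp add: reg_kernel_def)
next
  have c1: "continuous_on UNIV (\<lambda>x::'a. radial_profile \<delta> (real DIM('a)) (x \<bullet> x))"
    by (rule continuous_on_compose2[OF continuous_radial_profile(1)[OF \<delta>]]) (auto intro!: continuous_intros)
  have c2: "continuous_on UNIV (\<lambda>x::'a. radial_profile' \<delta> (real DIM('a)) (x \<bullet> x))"
    by (rule continuous_on_compose2[OF continuous_radial_profile(2)[OF \<delta>]]) (auto intro!: continuous_intros)
  show "continuous_on UNIV (reg_kernel_grad \<delta> c)"
    unfolding reg_kernel_grad_def[abs_def] by (intro continuous_intros c1 c2)
qed

text \<open>The kernel is itself a gradient, so its Jacobian is a Hessian.\<close>

lemma reg_kernel_grad_symmetric: "reg_kernel_grad \<delta> c x \<bullet> b = reg_kernel_grad \<delta> b x \<bullet> c"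
  by (simp add: reg_kernel_grad_def inner_add_left inner_commute[of c b])

lemma reg_kernel_divergence:
  fixes x :: "'a::euclidean_space"
  assumes \<delta>: "\<delta> > 0"
  shows "(\<Sum>b\<in>Basis. reg_kernel_grad \<delta> b x \<bullet> b) = rescale \<delta> cone_kernel x"
proof -
  let ?D = "real DIM('a)"
  have "(\<Sum>b\<in>Basis. reg_kernel_grad \<delta> b x \<bullet> b) =
      (\<Sum>b\<in>Basis. radial_profile \<delta> ?D (x \<bullet> x) + 2 * radial_profile' \<delta> ?D (x \<bullet> x) * ((x \<bullet> b) * (x \<bullet> b)))"
    by (intro sum.cong) (auto simp: reg_kernel_grad_def inner_add_left)
  also have "\<dots> = ?D * radial_profile \<delta> ?D (x \<bullet> x) + 2 * radial_profile' \<delta> ?D (x \<bullet> x) * (x \<bullet> x)"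
    by (simp add: sum.distrib sum_distrib_left[symmetric] euclidean_inner[of x x])
  also have "\<dots> = rescale \<delta> cone_kernel x"
  proof -
    have pw: "\<delta> powr (- ?D) = (1 / \<delta>) ^ DIM('a)"
      using \<delta> by (simp add: powr_minus powr_realpow power_inverse divide_inverse)
    have sc: "((1 / \<delta>) *\<^sub>R x) \<bullet> ((1 / \<delta>) *\<^sub>R x) = (x \<bullet> x) / \<delta>\<^sup>2" by (simp add: power2_eq_square)
    show ?thesis
    proof (cases "x \<bullet> x < \<delta>\<^sup>2")
      case True
      then have "(x \<bullet> x) / \<delta>\<^sup>2 < 1" using \<delta> by (simp add: divide_less_eq)
      then have m: "max 0 (1 - (x \<bullet> x) / \<delta>\<^sup>2) = 1 - (x \<bullet> x) / \<delta>\<^sup>2" by simp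
      \<comment> \<open>The computation inside the ball in abstract form: \<open>A\<close> stands
        for \<open>\<delta> powr (- D)\<close>, \<open>y\<close> for \<open>x \<bullet> x\<close>,
        \<open>q\<close> for its quotient by \<open>\<delta>\<^sup>2\<close>, and \<open>B\<close>
        for the quotient of \<open>A\<close> by \<open>\<delta>\<^sup>2\<close>.\<close>
      have alg: "D * (A * (1 - D / 2 * (q - 1))) + 2 * (- (D / 2) * B) * y = A * (D * (1 + D / 2) * (1 - q))"
        if "B * y = A * q" for D A q B y :: real
      proof -
        have "2 * (- (D / 2) * B) * y = - D * (B * y)" by simp
        also have "\<dots> = - D * (A * q)" by (simp only: that)
        finally have "2 * (- (D / 2) * B) * y = - D * (A * q)" .
        moreover have "D * (A * (1 - D / 2 * (q - 1))) + - D * (A * q) = A * (D * (1 + D / 2) * (1 - q))"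
          by (simp add: field_simps)
        ultimately show ?thesis by (simp only:)
      qed
      have "\<delta> powr (- ?D) / \<delta>\<^sup>2 * (x \<bullet> x) = \<delta> powr (- ?D) * ((x \<bullet> x) / \<delta>\<^sup>2)" by simp
      from alg[OF this, of ?D] True m show ?thesis
        unfolding rescale_def cone_kernel_def sc radial_profile_def radial_profile'_def pw[symmetric] by simp
    next
      case False
      then have pos: "x \<bullet> x > 0" and "(x \<bullet> x) / \<delta>\<^sup>2 \<ge> 1" using \<delta> zero_less_power2[of \<delta>] by (auto simp: le_divide_eq not_less intro: less_le_trans)
      moreover have "(x \<bullet> x) powr (- ?D / 2 - 1) * (x \<bullet> x) = (x \<bullet> x) powr (- ?D / 2)"
        using pos by (simp add: powr_diff)
      ultimately show ?thesis using False
        unfolding rescale_def cone_kernel_def sc radial_profile_def radial_profile'_def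
        by (simp add: max_def mult.assoc)
    qed
  qed
  finally show ?thesis .
qed

lemma cone_kernel_unit_kernel: "unit_kernel (cone_kernel :: 'a::euclidean_space \<Rightarrow> real)"
  and integral_cone_kernel_pos: "(LINT x|lborel. cone_kernel (x::'a::euclidean_space)) > 0"
proof -
  let ?D = "real DIM('a)"
  have ge1: "x \<bullet> x > 1" if "x \<notin> cball 0 1" for x :: 'a
  proof -
    have "1 < norm x" using that by simp
    then have "1 < (norm x)\<^sup>2" by (simp add: power2_eq_square less_1_mult)
    then show ?thesis by (simp add: power2_norm_eq_inner)
  qed
  show uk: "unit_kernel (cone_kernel :: 'a \<Rightarrow> real)"
    unfolding unit_kernel_def
  proof (intro conjI allI impI)
    show "continuous_on UNIV (cone_kernel :: 'a \<Rightarrow> real)"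
      unfolding cone_kernel_def[abs_def] by (intro continuous_intros)
    fix x :: 'a
    show "0 \<le> cone_kernel x" by (simp add: cone_kernel_def)
    assume "x \<notin> cball 0 1"
    from ge1[OF this] show "cone_kernel x = 0" by (simp add: cone_kernel_def)
  qed
  have ci: "integrable lborel (cone_kernel :: 'a \<Rightarrow> real)"
    using uk by (intro integrable_continuous_bounded_support[of _ 1]) (auto simp: unit_kernel_def)
  \<comment> \<open>On the ball of radius 1/2 the positive part is at least \<open>3 / 4\<close>,
    and the dimensional factor is at least 1.\<close>
  have "(LINT x|lborel. 3 / 4 * indicator (cball (0::'a) (1/2)) x) \<le> (LINT x|lborel. cone_kernel (x::'a))"
  proof (rule integral_mono[OF _ ci])
    show "integrable lborel (\<lambda>x. 3 / 4 * indicator (cball (0::'a) (1/2)) x :: real)"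
      using emeasure_bounded_finite[of "cball (0::'a) (1/2)"] by (intro integrable_mult_right integrable_real_indicator) auto
    fix x :: 'a
    show "3 / 4 * indicator (cball (0::'a) (1/2)) x \<le> cone_kernel x"
    proof (cases "x \<in> cball 0 (1/2)")
      case True
      then have "(norm x)\<^sup>2 \<le> (1/2)\<^sup>2" by (intro power_mono) auto
      then have "x \<bullet> x \<le> (1/2)\<^sup>2" unfolding power2_norm_eq_inner .
      then have *: "3 / 4 \<le> max 0 (1 - x \<bullet> x)" by (simp add: power2_eq_square)
      have D1: "1 * (1 + 0) \<le> ?D * (1 + ?D / 2)" by (intro mult_mono add_mono) (auto simp: Suc_le_eq)
      have "1 * (3 / 4) \<le> (?D * (1 + ?D / 2)) * max 0 (1 - x \<bullet> x)"
      proof (rule mult_mono)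
        show "1 \<le> ?D * (1 + ?D / 2)" using D1 by simp
        show "3 / 4 \<le> max 0 (1 - x \<bullet> x)" by (rule *)
      qed auto
      then show ?thesis using True by (simp add: cone_kernel_def)
    qed (use uk in \<open>simp add: unit_kernel_def\<close>)
  qed
  moreover have "(LINT x|lborel. 3 / 4 * indicator (cball (0::'a) (1/2)) x) > (0::real)" by simp
  ultimately show "(LINT x|lborel. cone_kernel (x::'a)) > 0" by linarith
qed

lemma unit_sphere_area_pos: "unit_sphere_area TYPE('a::euclidean_space) > 0"
proof -
  have "measure lborel (ball (0::'a) 1) > 0" by simp
  then show ?thesis by (simp add: unit_sphere_area_def)
qed

lemma gradient_newton_kernel:
  fixes z :: "'a::euclidean_space"
  assumes d: "DIM('a) \<ge> 3" and \<delta>: "\<delta> > 0" and z: "norm z \<ge> \<delta>"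
  shows "gradient newton_kernel z = - (1 / unit_sphere_area TYPE('a)) *\<^sub>R reg_kernel \<delta> z"
proof -
  let ?D = "real DIM('a)" and ?A = "unit_sphere_area TYPE('a)"
  have z0: "z \<noteq> 0" using z \<delta> by auto
  then have zz: "z \<bullet> z > 0" by simp
  \<comment> \<open>A power of \<open>x \<bullet> x\<close> can be differentiated by the chain rule
    away from 0. At 0 both sides are 0 because \<open>0 powr a = 0\<close>.\<close>
  have nk: "newton_kernel x = 1 / ((?D - 2) * ?A) * (x \<bullet> x) powr ((2 - ?D) / 2)" for x :: 'a
  proof (cases "x = 0")
    case False
    then have "norm x powr (2 - ?D) = ((norm x)\<^sup>2) powr ((2 - ?D) / 2)" by (intro power2_powr_half[symmetric]) simp
    then show ?thesis by (simp only: newton_kernel_def power2_norm_eq_inner)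
  qed (simp add: newton_kernel_def)
  have "((\<lambda>x. x \<bullet> x) has_derivative (\<lambda>v. 2 * (z \<bullet> v))) (at z)"
    by (auto intro!: derivative_eq_intros simp: inner_commute)
  from has_derivative_compose[OF this has_real_derivative_powr[OF zz, of "(2 - ?D) / 2", unfolded has_field_derivative_def]]
  have "((\<lambda>x. (x \<bullet> x) powr ((2 - ?D) / 2)) has_derivative
      (\<lambda>v. (2 - ?D) / 2 * (z \<bullet> z) powr ((2 - ?D) / 2 - 1) * (2 * (z \<bullet> v)))) (at z)" .
  from has_derivative_mult_right[OF this, of "1 / ((?D - 2) * ?A)"]
  have d1: "(newton_kernel has_derivative
      (\<lambda>v. 1 / ((?D - 2) * ?A) * ((2 - ?D) / 2 * (z \<bullet> z) powr ((2 - ?D) / 2 - 1) * (2 * (z \<bullet> v))))) (at z)"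
    unfolding nk[abs_def] .
  have e: "(2 - ?D) / 2 - 1 = - ?D / 2" by (simp add: field_simps)
  have "\<delta>\<^sup>2 \<le> z \<bullet> z" using z \<delta> power_mono[of \<delta> "norm z" 2] by (simp add: power2_norm_eq_inner)
  then have rp: "radial_profile \<delta> ?D (z \<bullet> z) = (z \<bullet> z) powr (- ?D / 2)" by (simp add: radial_profile_def)
  have "1 / ((?D - 2) * ?A) * ((2 - ?D) / 2 * P * (2 * t)) = - (1 / ?A) * (P * t)" for P t
  proof -
    have "?D - 2 \<noteq> 0" "?A \<noteq> 0" using d unit_sphere_area_pos[where 'a = 'a] by auto
    then show ?thesis by (simp add: field_simps)
  qed
  then have "(\<lambda>v. 1 / ((?D - 2) * ?A) * ((2 - ?D) / 2 * (z \<bullet> z) powr ((2 - ?D) / 2 - 1) * (2 * (z \<bullet> v))))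
      = (\<bullet>) (- (1 / ?A) *\<^sub>R reg_kernel \<delta> z)"
    unfolding e by (simp add: fun_eq_iff reg_kernel_def rp)
  then show ?thesis using d1 by (intro gradient_eqI) (simp only:)
qed

text \<open>Written by components so that the differentiation theorem for scalar kernels applies to
  each summand; \<open>potential_eq\<close> recovers the inner product under one integral.\<close>

definition potential :: "real \<Rightarrow> ('a::euclidean_space \<Rightarrow> 'a) \<Rightarrow> 'a \<Rightarrow> real" where
  "potential \<delta> F x = (\<Sum>c\<in>Basis. LINT y|lborel. (reg_kernel \<delta> (x - y) \<bullet> c) *\<^sub>R (F y \<bullet> c))"

definition potential_grad :: "real \<Rightarrow> ('a::euclidean_space \<Rightarrow> 'a) \<Rightarrow> 'a \<Rightarrow> 'a" where
  "potential_grad \<delta> F x = (\<Sum>b\<in>Basis. (\<Sum>c\<in>Basis. LINT y|lborel. (reg_kernel_grad \<delta> c (x - y) \<bullet> b) *\<^sub>R (F y \<bullet> c)) *\<^sub>R b)"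

section \<open>Potentials of square integrable fields\<close>

context
  fixes F :: "'a::euclidean_space \<Rightarrow> 'a" and S :: real
  assumes F: "square_integrable F" and supp: "\<And>y. y \<notin> cball 0 S \<Longrightarrow> F y = 0"
begin

lemma component_integrable: "integrable lborel (\<lambda>y. F y \<bullet> c)" "y \<notin> cball 0 S \<Longrightarrow> F y \<bullet> c = 0"
  using square_integrable_imp_integrable[OF F supp] supp by (auto intro: integrable_inner_left)

lemma reg_kernel_integrable:
  assumes \<delta>: "\<delta> > 0"
  shows "integrable lborel (\<lambda>y. (reg_kernel \<delta> (x - y) \<bullet> c) *\<^sub>R (F y \<bullet> c'))"
    "integrable lborel (\<lambda>y. (reg_kernel_grad \<delta> c (x - y) \<bullet> b) *\<^sub>R (F y \<bullet> c'))"
proof -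
  note g = has_grad_reg_kernel[OF \<delta>]
  have "continuous_on UNIV (\<lambda>y. reg_kernel \<delta> (x - y) \<bullet> c)"
    by (rule continuous_on_diff_image(2)[OF has_grad_continuous[OF g] continuous_on_id])
  then show "integrable lborel (\<lambda>y. (reg_kernel \<delta> (x - y) \<bullet> c) *\<^sub>R (F y \<bullet> c'))"
    by (rule integrable_continuous_scaleR[where R = S]) (auto intro: component_integrable)
  have "continuous_on UNIV (\<lambda>y. reg_kernel_grad \<delta> c (x - y))"
    by (rule continuous_on_diff_image(2)[OF has_grad_continuous_grad[OF g] continuous_on_id])
  then have "continuous_on UNIV (\<lambda>y. reg_kernel_grad \<delta> c (x - y) \<bullet> b)" by (intro continuous_intros)
  then show "integrable lborel (\<lambda>y. (reg_kernel_grad \<delta> c (x - y) \<bullet> b) *\<^sub>R (F y \<bullet> c'))"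
    by (rule integrable_continuous_scaleR[where R = S]) (auto intro: component_integrable)
qed

lemma potential_eq:
  assumes \<delta>: "\<delta> > 0"
  shows "potential \<delta> F x = (LINT y|lborel. reg_kernel \<delta> (x - y) \<bullet> F y)"
proof -
  have "potential \<delta> F x = (LINT y|lborel. (\<Sum>c\<in>Basis. (reg_kernel \<delta> (x - y) \<bullet> c) *\<^sub>R (F y \<bullet> c)))"
    unfolding potential_def
    by (rule Bochner_Integration.integral_sum[symmetric]) (rule reg_kernel_integrable(1)[OF \<delta>])
  then show ?thesis by (subst euclidean_inner) simp
qed

lemma potential_has_grad:
  assumes \<delta>: "\<delta> > 0"
  shows "has_grad (potential \<delta> F) (potential_grad \<delta> F)"
  unfolding has_grad_def
proof (intro conjI allI)
  note g = has_grad_reg_kernel[OF \<delta>]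
  fix x
  have "(potential \<delta> F has_derivative (\<lambda>v. \<Sum>c\<in>Basis. LINT y|lborel. (reg_kernel_grad \<delta> c (x - y) \<bullet> v) *\<^sub>R (F y \<bullet> c))) (at x)"
    unfolding potential_def[abs_def]
  proof (rule has_derivative_sum)
    fix c :: 'a
    show "((\<lambda>x. LINT y|lborel. (reg_kernel \<delta> (x - y) \<bullet> c) *\<^sub>R (F y \<bullet> c)) has_derivative
        (\<lambda>v. LINT y|lborel. (reg_kernel_grad \<delta> c (x - y) \<bullet> v) *\<^sub>R (F y \<bullet> c))) (at x)"
      by (rule has_derivative_kernel_integral[OF g continuous_on_id component_integrable(1), where R = S])
         (rule component_integrable(2))
  qed
  moreover have "(\<lambda>v. \<Sum>c\<in>Basis. LINT y|lborel. (reg_kernel_grad \<delta> c (x - y) \<bullet> v) *\<^sub>R (F y \<bullet> c)) = (\<bullet>) (potential_grad \<delta> F x)"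
  proof
    fix v
    have "(LINT y|lborel. (reg_kernel_grad \<delta> c (x - y) \<bullet> v) *\<^sub>R (F y \<bullet> c)) =
        (\<Sum>b\<in>Basis. (LINT y|lborel. (reg_kernel_grad \<delta> c (x - y) \<bullet> b) *\<^sub>R (F y \<bullet> c)) * (v \<bullet> b))" for c
    proof -
      have "(reg_kernel_grad \<delta> c (x - y) \<bullet> v) *\<^sub>R (F y \<bullet> c) =
          (\<Sum>b\<in>Basis. ((reg_kernel_grad \<delta> c (x - y) \<bullet> b) *\<^sub>R (F y \<bullet> c)) * (v \<bullet> b))" for y
        by (subst euclidean_inner[of _ v]) (simp add: sum_distrib_left sum_distrib_right ac_simps)
      then have "(LINT y|lborel. (reg_kernel_grad \<delta> c (x - y) \<bullet> v) *\<^sub>R (F y \<bullet> c)) =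
          (LINT y|lborel. (\<Sum>b\<in>Basis. ((reg_kernel_grad \<delta> c (x - y) \<bullet> b) *\<^sub>R (F y \<bullet> c)) * (v \<bullet> b)))" by (simp only:)
      also have "\<dots> = (\<Sum>b\<in>Basis. LINT y|lborel. ((reg_kernel_grad \<delta> c (x - y) \<bullet> b) *\<^sub>R (F y \<bullet> c)) * (v \<bullet> b))"
        by (rule Bochner_Integration.integral_sum) (rule integrable_mult_left[OF reg_kernel_integrable(2)[OF \<delta>]])
      finally show ?thesis by (simp only: integral_mult_left_zero)
    qed
    then have "(\<Sum>c\<in>Basis. LINT y|lborel. (reg_kernel_grad \<delta> c (x - y) \<bullet> v) *\<^sub>R (F y \<bullet> c))
      = (\<Sum>c\<in>Basis. \<Sum>b\<in>Basis. (LINT y|lborel. (reg_kernel_grad \<delta> c (x - y) \<bullet> b) *\<^sub>R (F y \<bullet> c)) * (v \<bullet> b))" by (simp only:)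
    also have "\<dots> = (\<Sum>b\<in>Basis. \<Sum>c\<in>Basis. (LINT y|lborel. (reg_kernel_grad \<delta> c (x - y) \<bullet> b) *\<^sub>R (F y \<bullet> c)) * (v \<bullet> b))"
      by (rule sum.swap)
    also have "\<dots> = potential_grad \<delta> F x \<bullet> v"
      by (simp only: potential_grad_def inner_sum_left inner_scaleR_left sum_distrib_right inner_commute[of v])
    finally show "(\<Sum>c\<in>Basis. LINT y|lborel. (reg_kernel_grad \<delta> c (x - y) \<bullet> v) *\<^sub>R (F y \<bullet> c)) = potential_grad \<delta> F x \<bullet> v" .
  qed
  ultimately show "(potential \<delta> F has_derivative (\<bullet>) (potential_grad \<delta> F x)) (at x)" by simp
next
  note g = has_grad_reg_kernel[OF \<delta>]
  have "continuous_on UNIV (\<lambda>x. LINT y|lborel. (reg_kernel_grad \<delta> c (x - y) \<bullet> b) *\<^sub>R (F y \<bullet> c))" for b c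
  proof (rule continuous_kernel_integral[where R = S])
    have "continuous_on UNIV (\<lambda>z :: 'a \<times> 'a. reg_kernel_grad \<delta> c (fst z - snd z))"
      using continuous_on_diff_image(1)[OF has_grad_continuous_grad[OF g] continuous_on_id] by (simp add: case_prod_beta')
    then have "continuous_on UNIV (\<lambda>z :: 'a \<times> 'a. reg_kernel_grad \<delta> c (fst z - snd z) \<bullet> b)" by (intro continuous_intros)
    then show "continuous_on UNIV (\<lambda>(x, y). reg_kernel_grad \<delta> c (x - y) \<bullet> b)" by (simp add: case_prod_beta')
  qed (auto intro: component_integrable)
  then show "continuous_on UNIV (potential_grad \<delta> F)"
    unfolding potential_grad_def[abs_def] by (intro continuous_intros)
qed

text \<open>As the kernel is the gradient of a radial function, the two fields are
  \<open>grad div\<close> and the Laplacian of the convolution of that function with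
  \<open>F\<close>. Their difference is a double curl and therefore orthogonal to gradients. The
  derivatives are rearranged inside the double integral, where each function is differentiated only
  once.\<close>

lemma potential_solenoidal:
  assumes \<delta>: "\<delta> > 0" and \<psi>: "has_grad \<psi> s" "\<And>x. x \<notin> cball 0 R \<Longrightarrow> \<psi> x = 0"
  shows "(LINT x|lborel. potential_grad \<delta> F x \<bullet> s x) = (LINT x|lborel. smear cone_kernel \<delta> F x \<bullet> s x)"
proof -
  note g = has_grad_reg_kernel[OF \<delta>]
  define T where "T = max R S"
  have sc: "continuous_on UNIV s" by (rule has_grad_continuous_grad[OF \<psi>(1)])
  have ssupp: "s x = 0" if "x \<notin> cball 0 R" for x by (rule has_grad_support[OF \<psi> that])
  have si: "integrable lborel (\<lambda>x. s x \<bullet> b)" for b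
    by (rule integrable_continuous_bounded_support[of _ R]) (use sc ssupp in \<open>auto intro: continuous_intros\<close>)
  have kc: "continuous_on UNIV (\<lambda>(x, y). reg_kernel_grad \<delta> c (x - y) \<bullet> b)" for b c :: 'a
  proof -
    have "continuous_on UNIV (\<lambda>z :: 'a \<times> 'a. reg_kernel_grad \<delta> c (fst z - snd z))"
      using continuous_on_diff_image(1)[OF has_grad_continuous_grad[OF g] continuous_on_id] by (simp add: case_prod_beta')
    then have "continuous_on UNIV (\<lambda>z :: 'a \<times> 'a. reg_kernel_grad \<delta> c (fst z - snd z) \<bullet> b)" by (intro continuous_intros)
    then show ?thesis by (simp add: case_prod_beta')
  qed
  have Ts: "s x \<bullet> b = 0" if "x \<notin> cball 0 T" for x b using ssupp[of x] that by (auto simp: T_def)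
  have TF: "F x \<bullet> b = 0" if "x \<notin> cball 0 T" for x b using supp[of x] that by (auto simp: T_def)
  define I where "I b c x = (LINT y|lborel. (reg_kernel_grad \<delta> c (x - y) \<bullet> b) * (F y \<bullet> c))" for b c x
  have Ic: "continuous_on UNIV (I b c)" for b c
  proof -
    have "continuous_on UNIV (\<lambda>x. LINT y|lborel. (reg_kernel_grad \<delta> c (x - y) \<bullet> b) *\<^sub>R (F y \<bullet> c))"
      by (rule continuous_kernel_integral[OF kc component_integrable(1), where R = S]) (rule component_integrable(2))
    then show ?thesis unfolding I_def[abs_def] by simp
  qed
  have Iint: "integrable lborel (\<lambda>x. I b c x * (s x \<bullet> b'))" for b b' c
    by (rule integrable_continuous_bounded_support[of _ R]) (use ssupp in \<open>auto intro!: continuous_intros Ic sc\<close>)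
  have "potential_grad \<delta> F x \<bullet> s x = (\<Sum>b\<in>Basis. \<Sum>c\<in>Basis. I b c x * (s x \<bullet> b))" for x
    by (simp only: potential_grad_def I_def inner_sum_left inner_scaleR_left sum_distrib_right real_scaleR_def inner_commute[of "s x"])
  then have "(LINT x|lborel. potential_grad \<delta> F x \<bullet> s x) = (LINT x|lborel. (\<Sum>b\<in>Basis. \<Sum>c\<in>Basis. I b c x * (s x \<bullet> b)))"
    by (simp only:)
  also have "\<dots> = (\<Sum>b\<in>Basis. \<Sum>c\<in>Basis. LINT x|lborel. I b c x * (s x \<bullet> b))"
    using Iint by (simp add: Bochner_Integration.integral_sum)
  also have "\<dots> = (\<Sum>c\<in>Basis. \<Sum>b\<in>Basis. LINT x|lborel. I b c x * (s x \<bullet> b))" by (rule sum.swap)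
  also have "\<dots> = (\<Sum>c\<in>Basis. \<Sum>b\<in>Basis. LINT y|lborel. (LINT x|lborel. (reg_kernel_grad \<delta> c (x - y) \<bullet> b) * (s x \<bullet> b)) * (F y \<bullet> c))"
    unfolding I_def by (intro sum.cong refl fubini_kernel[OF kc si component_integrable(1) Ts TF])
  also have "\<dots> = (\<Sum>c\<in>Basis. \<Sum>b\<in>Basis. LINT y|lborel. (LINT x|lborel. (reg_kernel_grad \<delta> b (x - y) \<bullet> b) * (s x \<bullet> c)) * (F y \<bullet> c))"
  proof (intro sum.cong refl)
    fix c b :: 'a
    \<comment> \<open>Symmetry exchanges the two indices of the Jacobian; then the two derivatives
      are exchanged between kernel and test function. After this, the sum over \<open>b\<close> is
      the divergence of the kernel.\<close>
    have "(LINT x|lborel. (reg_kernel_grad \<delta> c (x - y) \<bullet> b) * (s x \<bullet> b)) = (LINT x|lborel. (reg_kernel_grad \<delta> b (x - y) \<bullet> b) * (s x \<bullet> c))" for y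
    proof -
      have "(LINT x|lborel. (reg_kernel_grad \<delta> c (x - y) \<bullet> b) * (s x \<bullet> b)) = (LINT x|lborel. (reg_kernel_grad \<delta> b (x - y) \<bullet> c) * (s x \<bullet> b))"
        by (simp only: reg_kernel_grad_symmetric[of \<delta> c _ b])
      also have "\<dots> = (LINT x|lborel. (reg_kernel_grad \<delta> b (x - y) \<bullet> b) * (s x \<bullet> c))"
        by (rule integral_partials_swap[OF has_grad_translate[OF g] \<psi>])
      finally show ?thesis .
    qed
    then show "(LINT y|lborel. (LINT x|lborel. (reg_kernel_grad \<delta> c (x - y) \<bullet> b) * (s x \<bullet> b)) * (F y \<bullet> c)) =
       (LINT y|lborel. (LINT x|lborel. (reg_kernel_grad \<delta> b (x - y) \<bullet> b) * (s x \<bullet> c)) * (F y \<bullet> c))" by (simp only:)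
  qed
  also have "\<dots> = (\<Sum>c\<in>Basis. \<Sum>b\<in>Basis. LINT x|lborel. (LINT y|lborel. (reg_kernel_grad \<delta> b (x - y) \<bullet> b) * (F y \<bullet> c)) * (s x \<bullet> c))"
    by (intro sum.cong refl fubini_kernel[OF kc si component_integrable(1) Ts TF, symmetric])
  also have "\<dots> = (\<Sum>c\<in>Basis. LINT x|lborel. (smear cone_kernel \<delta> F x \<bullet> c) * (s x \<bullet> c))"
  proof (intro sum.cong refl)
    fix c :: 'a
    have J: "continuous_on UNIV (\<lambda>x. LINT y|lborel. (reg_kernel_grad \<delta> b (x - y) \<bullet> b) * (F y \<bullet> c))" for b
    proof -
      have "continuous_on UNIV (\<lambda>x. LINT y|lborel. (reg_kernel_grad \<delta> b (x - y) \<bullet> b) *\<^sub>R (F y \<bullet> c))"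
        by (rule continuous_kernel_integral[OF kc component_integrable(1), where R = S]) (rule component_integrable(2))
      then show ?thesis by simp
    qed
    have Ji: "integrable lborel (\<lambda>x. (LINT y|lborel. (reg_kernel_grad \<delta> b (x - y) \<bullet> b) * (F y \<bullet> c)) * (s x \<bullet> c))" for b
      by (rule integrable_continuous_bounded_support[of _ R]) (use ssupp in \<open>auto intro!: continuous_intros J sc\<close>)
    have sm: "(\<Sum>b\<in>Basis. LINT y|lborel. (reg_kernel_grad \<delta> b (x - y) \<bullet> b) * (F y \<bullet> c)) = smear cone_kernel \<delta> F x \<bullet> c" for x
    proof -
      have "(\<Sum>b\<in>Basis. LINT y|lborel. (reg_kernel_grad \<delta> b (x - y) \<bullet> b) * (F y \<bullet> c)) =
          (LINT y|lborel. (\<Sum>b\<in>Basis. (reg_kernel_grad \<delta> b (x - y) \<bullet> b) * (F y \<bullet> c)))"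
        using reg_kernel_integrable(2)[OF \<delta>] by (intro Bochner_Integration.integral_sum[symmetric]) simp
      also have "\<dots> = (LINT y|lborel. rescale \<delta> cone_kernel (x - y) * (F y \<bullet> c))"
        by (simp only: sum_distrib_right[symmetric] reg_kernel_divergence[OF \<delta>])
      also have "\<dots> = (LINT y|lborel. (rescale \<delta> cone_kernel (x - y) *\<^sub>R F y) \<bullet> c)" by simp
      also have "\<dots> = smear cone_kernel \<delta> F x \<bullet> c"
        unfolding smear_def
        by (rule integral_inner_left, rule integrable_continuous_scaleR[OF continuous_rescale_diff(2)[OF cone_kernel_unit_kernel continuous_on_id]
            square_integrable_imp_integrable[OF F supp] supp])
      finally show ?thesis .
    qed
    have "(\<Sum>b\<in>Basis. LINT x|lborel. (LINT y|lborel. (reg_kernel_grad \<delta> b (x - y) \<bullet> b) * (F y \<bullet> c)) * (s x \<bullet> c)) =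
        (LINT x|lborel. (\<Sum>b\<in>Basis. (LINT y|lborel. (reg_kernel_grad \<delta> b (x - y) \<bullet> b) * (F y \<bullet> c)) * (s x \<bullet> c)))"
      by (rule Bochner_Integration.integral_sum[symmetric]) (rule Ji)
    then show "(\<Sum>b\<in>Basis. LINT x|lborel. (LINT y|lborel. (reg_kernel_grad \<delta> b (x - y) \<bullet> b) * (F y \<bullet> c)) * (s x \<bullet> c)) =
       (LINT x|lborel. (smear cone_kernel \<delta> F x \<bullet> c) * (s x \<bullet> c))"
      by (simp only: sum_distrib_right[symmetric] sm)
  qed
  also have "\<dots> = (LINT x|lborel. (\<Sum>c\<in>Basis. (smear cone_kernel \<delta> F x \<bullet> c) * (s x \<bullet> c)))"
  proof (rule Bochner_Integration.integral_sum[symmetric])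
    have "continuous_on UNIV (smear cone_kernel \<delta> F)"
      by (rule continuous_smear[OF cone_kernel_unit_kernel square_integrable_imp_integrable[OF F supp] supp])
    then show "integrable lborel (\<lambda>x. (smear cone_kernel \<delta> F x \<bullet> c) * (s x \<bullet> c))" for c
      by (intro integrable_continuous_bounded_support[of _ R]) (use ssupp in \<open>auto intro!: continuous_intros sc\<close>)
  qed
  also have "\<dots> = (LINT x|lborel. smear cone_kernel \<delta> F x \<bullet> s x)"
    by (subst (3) euclidean_inner) simp
  finally show ?thesis .
qed

end

section \<open>The Helmholtz decomposition\<close>

lemma l2_norm_self_inner: "square_integrable a \<Longrightarrow> (LINT x|lborel. a x \<bullet> a x) = (l2_norm a)\<^sup>2"
  by (simp add: l2_norm_power2 power2_norm_eq_inner)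

text \<open>By orthogonality the square of the norm of \<open>a\<close> is the inner product of
  \<open>a\<close> with \<open>a + b\<close>; Cauchy-Schwarz does the rest.\<close>

lemma l2_norm_le_add_orthogonal:
  assumes a: "square_integrable a" and b: "square_integrable b" and orth: "(LINT x|lborel. a x \<bullet> b x) = 0"
  shows "l2_norm a \<le> l2_norm (\<lambda>x. a x + b x)"
proof (cases "l2_norm a = 0")
  case False
  have "(l2_norm a)\<^sup>2 = (LINT x|lborel. a x \<bullet> a x) + (LINT x|lborel. a x \<bullet> b x)"
    using l2_norm_self_inner[OF a] orth by simp
  also have "\<dots> = (LINT x|lborel. a x \<bullet> (a x + b x))"
    using integrable_inner_l2[OF a a] integrable_inner_l2[OF a b] by (simp add: inner_add_right)
  also have "\<dots> \<le> l2_norm a * l2_norm (\<lambda>x. a x + b x)"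
    using l2_cauchy_schwarz[OF a square_integrable_add[OF a b]] by linarith
  finally have "l2_norm a * l2_norm a \<le> l2_norm a * l2_norm (\<lambda>x. a x + b x)" by (simp add: power2_eq_square)
  moreover have "l2_norm a > 0" using False l2_norm_nonneg[of a] by linarith
  ultimately show ?thesis by simp
qed simp

lemma weakly_div_free_diff:
  fixes h k :: "'a::euclidean_space \<Rightarrow> 'a"
  assumes "weakly_div_free h" "weakly_div_free k" "square_integrable h" "square_integrable k"
  shows "weakly_div_free (\<lambda>x. h x - k x)"
  unfolding weakly_div_free_def
proof (intro allI impI, elim conjE)
  fix \<psi> :: "'a \<Rightarrow> real" and s R assume \<psi>: "has_grad \<psi> s" "\<forall>x. x \<notin> cball 0 R \<longrightarrow> \<psi> x = (0::real)"
  have s: "square_integrable s"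
    by (rule square_integrable_continuous_bounded_support[OF has_grad_continuous_grad[OF \<psi>(1)], of R])
       (rule has_grad_support[OF \<psi>(1), of R], use \<psi>(2) in auto)
  have "(LINT x|lborel. h x \<bullet> s x) = 0" "(LINT x|lborel. k x \<bullet> s x) = 0"
    using assms(1,2) \<psi> unfolding weakly_div_free_def by blast+
  then show "(LINT x|lborel. (h x - k x) \<bullet> s x) = 0"
    using integrable_inner_l2[OF assms(3) s] integrable_inner_l2[OF assms(4) s] by (simp add: inner_diff_left)
qed

text \<open>The assumption \<open>null\<close> is the form in which the null space enters: at
  distance more than \<open>\<delta>\<close> from \<open>\<Omega>\<close> the regularised potential
  is a nonzero multiple of the magnetic potential.\<close>

lemma helmholtz_decomposition:
  fixes \<Omega> :: "'a::euclidean_space set" and F :: "'a \<Rightarrow> 'a"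
  assumes \<Omega>: "lipschitz_open \<Omega>" "bounded \<Omega>" and F: "square_integrable F" and supp: "\<And>y. y \<notin> \<Omega> \<Longrightarrow> F y = 0"
    and null: "\<And>\<delta> x. \<delta> > 0 \<Longrightarrow> (\<And>y. y \<in> \<Omega> \<Longrightarrow> \<delta> < norm (x - y)) \<Longrightarrow> potential \<delta> F x = 0"
  obtains G H where "square_integrable G" "square_integrable H" "\<And>x. F x = G x + H x"
    "\<And>\<eta>. \<eta> > 0 \<Longrightarrow> \<exists>\<phi>\<in>test_functions \<Omega>. l2_norm (\<lambda>x. gradient \<phi> x - G x) < \<eta>"
    "\<And>\<eta>. \<eta> > 0 \<Longrightarrow> \<exists>\<psi>\<in>test_functions \<Omega>. (\<forall>x. divergence \<psi> x = 0) \<and> l2_norm (\<lambda>x. \<psi> x - H x) < \<eta>"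
proof -
  obtain S where S: "\<And>x. x \<in> \<Omega> \<Longrightarrow> norm x \<le> S" using \<Omega>(2) unfolding bounded_iff by blast
  have suppS: "F y = 0" if "y \<notin> cball 0 S" for y using supp[of y] S[of y] that by auto
  have Fi: "integrable lborel F" by (rule square_integrable_imp_integrable[OF F suppS])
  define I where "I = (LINT x|lborel. cone_kernel (x::'a))"
  have I: "I > 0" unfolding I_def by (rule integral_cone_kernel_pos)
  note ck = cone_kernel_unit_kernel[where 'a = 'a]
  define \<delta> where "\<delta> n = 1 / real (Suc n)" for n
  have \<delta>: "\<delta> n > 0" "\<delta> n \<le> 1" for n by (auto simp: \<delta>_def)
  have \<delta>0: "\<delta> \<longlonglongrightarrow> 0" unfolding \<delta>_def[abs_def] using LIMSEQ_inverse_real_of_nat by (simp add: inverse_eq_divide)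
  \<comment> \<open>Division by the mass \<open>I\<close> of the cone kernel makes
    \<open>f n\<close> converge to \<open>F\<close> itself.\<close>
  define u where "u n x = 1 / I * potential (\<delta> n) F x" for n x
  define p where "p n x = (1 / I) *\<^sub>R potential_grad (\<delta> n) F x" for n x
  define f where "f n x = (1 / I) *\<^sub>R smear cone_kernel (\<delta> n) F x" for n x
  define h where "h n x = f n x - p n x" for n x
  have up: "has_grad (u n) (p n)" for n
    unfolding u_def[abs_def] p_def[abs_def]
    by (rule has_grad_cmult[OF potential_has_grad[OF F _ \<delta>(1)]]) (use suppS in auto)
  have usupp: "\<exists>y\<in>\<Omega>. norm (x - y) \<le> \<delta> n" if "u n x \<noteq> 0" for n x
  proof (rule ccontr)
    assume "\<not> (\<exists>y\<in>\<Omega>. norm (x - y) \<le> \<delta> n)"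
    then have "potential (\<delta> n) F x = 0" by (intro null \<delta>) (auto simp: not_le)
    then show False using that by (simp add: u_def)
  qed
  \<comment> \<open>The factor 2 arises because \<open>p n\<close> vanishes at \<open>x\<close> when
    \<open>u n\<close> vanishes in a neighbourhood of \<open>x\<close>, for which the ball of radius
    \<open>\<delta> n\<close> is taken.\<close>
  have hsupp: "\<exists>y\<in>\<Omega>. norm (x - y) \<le> 2 * \<delta> n" if "h n x \<noteq> 0" for n x
  proof (rule ccontr)
    assume "\<not> (\<exists>y\<in>\<Omega>. norm (x - y) \<le> 2 * \<delta> n)"
    then have far: "norm (x - y) > 2 * \<delta> n" if "y \<in> \<Omega>" for y using that by (auto simp: not_le)
    have "u n z = 0" if z: "z \<in> ball x (\<delta> n)" for z
    proof (rule ccontr)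
      assume "u n z \<noteq> 0"
      then obtain y where y: "y \<in> \<Omega>" "norm (z - y) \<le> \<delta> n" using usupp by blast
      then have "norm (x - y) \<le> 2 * \<delta> n" using z norm_triangle_ineq[of "x - z" "z - y"] by (simp add: dist_norm)
      then show False using far[OF y(1)] by simp
    qed
    then have "p n x = 0" by (rule has_grad_eq_0_on_open[OF up open_ball]) (use \<delta> in auto)
    moreover have "smear cone_kernel (\<delta> n) F x = 0"
    proof (rule smear_eq_0[OF ck \<delta>(1)])
      fix y assume "F y \<noteq> 0"
      then have "y \<in> \<Omega>" using supp by blast
      then show "\<delta> n < norm (x - y)" using far[of y] \<delta>(1)[of n] by linarith
    qed
    ultimately show False using that by (simp add: h_def f_def)
  qed
  have uR: "u n x = 0" if "x \<notin> cball 0 (S + 2)" for n x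
  proof (rule ccontr)
    assume "u n x \<noteq> 0"
    then obtain y where "y \<in> \<Omega>" "norm (x - y) \<le> \<delta> n" using usupp by blast
    then show False using S[of y] \<delta>(2)[of n] norm_triangle_ineq2[of x y] that by auto
  qed
  have hR: "h n x = 0" if "x \<notin> cball 0 (S + 2)" for n x
  proof (rule ccontr)
    assume "h n x \<noteq> 0"
    then obtain y where "y \<in> \<Omega>" "norm (x - y) \<le> 2 * \<delta> n" using hsupp by blast
    then show False using S[of y] \<delta>(2)[of n] norm_triangle_ineq2[of x y] that by auto
  qed
  have pc: "continuous_on UNIV (p n)" for n by (rule has_grad_continuous_grad[OF up])
  have pR: "p n x = 0" if "x \<notin> cball 0 (S + 2)" for n x by (rule has_grad_support[OF up uR that])
  have ps: "square_integrable (p n)" for n by (rule square_integrable_continuous_bounded_support[OF pc pR])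
  have fc: "continuous_on UNIV (f n)" for n
    unfolding f_def[abs_def] by (intro continuous_intros continuous_smear[OF ck Fi suppS])
  have hc: "continuous_on UNIV (h n)" for n unfolding h_def[abs_def] by (intro continuous_intros fc pc)
  have hs: "square_integrable (h n)" for n by (rule square_integrable_continuous_bounded_support[OF hc hR])
  have f_eq: "f n x = p n x + h n x" for n x by (simp add: h_def)
  have fs: "square_integrable (f n)" for n unfolding f_eq[abs_def] by (rule square_integrable_add[OF ps hs])
  have hdf: "weakly_div_free (h n)" for n
    unfolding weakly_div_free_def
  proof (intro allI impI, elim conjE)
    fix \<psi> :: "'a \<Rightarrow> real" and s R assume \<psi>: "has_grad \<psi> s" "\<forall>x. x \<notin> cball 0 R \<longrightarrow> \<psi> x = (0::real)"
    have s: "square_integrable s"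
      by (rule square_integrable_continuous_bounded_support[OF has_grad_continuous_grad[OF \<psi>(1)], of R])
         (rule has_grad_support[OF \<psi>(1), of R], use \<psi>(2) in auto)
    have "(LINT x|lborel. potential_grad (\<delta> n) F x \<bullet> s x) = (LINT x|lborel. smear cone_kernel (\<delta> n) F x \<bullet> s x)"
      by (rule potential_solenoidal[OF F _ \<delta>(1) \<psi>(1), of S R]) (use suppS \<psi>(2) in auto)
    then have "(LINT x|lborel. f n x \<bullet> s x) = (LINT x|lborel. p n x \<bullet> s x)" by (simp add: f_def p_def)
    then show "(LINT x|lborel. h n x \<bullet> s x) = 0"
      using integrable_inner_l2[OF fs s] integrable_inner_l2[OF ps s] by (simp add: h_def inner_diff_left)
  qed
  have flim: "(\<lambda>n. l2_norm (\<lambda>x. f n x - F x)) \<longlonglongrightarrow> 0"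
  proof (rule LIMSEQ_I)
    fix \<epsilon> :: real assume \<epsilon>: "\<epsilon> > 0"
    then have "I * \<epsilon> > 0" using I by simp
    then obtain \<tau> where \<tau>: "\<tau> > 0" "\<And>e. 0 < e \<Longrightarrow> e < \<tau> \<Longrightarrow> l2_norm (\<lambda>x. smear cone_kernel e F x - I *\<^sub>R F x) < I * \<epsilon>"
      using smear_tendsto_l2[OF ck F suppS, folded I_def] by metis
    obtain n0 where n0: "\<And>n. n \<ge> n0 \<Longrightarrow> \<delta> n < \<tau>"
      using order_tendstoD(2)[OF \<delta>0 \<tau>(1)] unfolding eventually_sequentially by blast
    have "l2_norm (\<lambda>x. f n x - F x) < \<epsilon>" if "n \<ge> n0" for n
    proof -
      have "f n x - F x = (1 / I) *\<^sub>R (smear cone_kernel (\<delta> n) F x - I *\<^sub>R F x)" for x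
        using I by (simp add: f_def scaleR_diff_right)
      then have "l2_norm (\<lambda>x. f n x - F x) = 1 / I * l2_norm (\<lambda>x. smear cone_kernel (\<delta> n) F x - I *\<^sub>R F x)"
        using l2_norm_scaleR[of "1 / I"] I by simp
      also have "\<dots> < 1 / I * (I * \<epsilon>)" by (rule mult_strict_left_mono[OF \<tau>(2)[OF \<delta>(1) n0[OF that]]]) (use I in simp)
      finally show ?thesis using I by simp
    qed
    then show "\<exists>no. \<forall>n\<ge>no. norm (l2_norm (\<lambda>x. f n x - F x) - 0) < \<epsilon>" by auto
  qed
  \<comment> \<open>\<open>h n - h m\<close> is orthogonal to the gradient \<open>p n - p m\<close>,
    so the increments of the gradients are dominated by those of the mollified fields.\<close>
  have dom: "l2_norm (\<lambda>x. p n x - p m x) \<le> l2_norm (\<lambda>x. f n x - f m x)" for n m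
  proof -
    have "(LINT x|lborel. (h n x - h m x) \<bullet> (p n x - p m x)) = 0"
      by (rule weakly_div_free_diff[OF hdf[of n] hdf[of m] hs hs, unfolded weakly_div_free_def, rule_format,
          OF conjI[OF has_grad_diff[OF up[of n] up[of m]]], of "S + 2"]) (use uR in simp)
    then have "l2_norm (\<lambda>x. p n x - p m x) \<le> l2_norm (\<lambda>x. (p n x - p m x) + (h n x - h m x))"
      by (intro l2_norm_le_add_orthogonal square_integrable_diff ps hs) (simp add: inner_commute)
    then show ?thesis by (simp add: f_eq algebra_simps)
  qed
  have cau: "\<exists>N. \<forall>m\<ge>N. \<forall>n\<ge>N. l2_norm (\<lambda>x. p m x - p n x) < e" if e: "e > 0" for e
  proof -
    have "e / 2 > 0" using e by simp
    then obtain N where N: "\<And>n. n \<ge> N \<Longrightarrow> l2_norm (\<lambda>x. f n x - F x) < e / 2"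
      by (rule l2_norm_less_from_limit[OF flim]) blast
    have "l2_norm (\<lambda>x. p m x - p n x) < e" if "m \<ge> N" "n \<ge> N" for m n
      using dom[of m n] l2_norm_triangle_sub[OF fs[of m] F fs[of n]] N[OF that(1)] N[OF that(2)]
        l2_norm_diff_commute[of F "f n"] by linarith
    then show ?thesis by blast
  qed
  obtain G where G: "square_integrable G" and Glim: "(\<lambda>n. l2_norm (\<lambda>x. p n x - G x)) \<longlonglongrightarrow> 0"
    by (rule l2_complete[of p, OF ps cau])
  define H where "H x = F x - G x" for x
  have H: "square_integrable H" unfolding H_def[abs_def] by (rule square_integrable_diff[OF F G])
  have Hlim: "(\<lambda>n. l2_norm (\<lambda>x. h n x - H x)) \<longlonglongrightarrow> 0"
  proof (rule tendsto_sandwich[of "\<lambda>_. 0"])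
    have "h n x - H x = (f n x - F x) + - (p n x - G x)" for n x by (simp add: h_def H_def)
    then have "l2_norm (\<lambda>x. h n x - H x) \<le> l2_norm (\<lambda>x. f n x - F x) + l2_norm (\<lambda>x. p n x - G x)" for n
      using l2_norm_triangle[OF square_integrable_diff[OF fs[of n] F] square_integrable_minus[OF square_integrable_diff[OF ps[of n] G]]]
      by (simp only: l2_norm_minus)
    then show "\<forall>\<^sub>F n in sequentially. l2_norm (\<lambda>x. h n x - H x) \<le> l2_norm (\<lambda>x. f n x - F x) + l2_norm (\<lambda>x. p n x - G x)"
      by simp
    show "(\<lambda>n. l2_norm (\<lambda>x. f n x - F x) + l2_norm (\<lambda>x. p n x - G x)) \<longlonglongrightarrow> 0"
      using tendsto_add[OF flim Glim] by simp
  qed auto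
  show ?thesis
  proof (rule that[OF G H])
    show "F x = G x + H x" for x by (simp add: H_def)
    fix \<eta> :: real assume \<eta>: "\<eta> > 0"
    show "\<exists>\<phi>\<in>test_functions \<Omega>. l2_norm (\<lambda>x. gradient \<phi> x - G x) < \<eta>"
      by (rule gradient_approximation[OF \<Omega> up usupp \<delta>0 uR G Glim \<eta>]) blast+
    have \<delta>2: "(\<lambda>n. 2 * \<delta> n) \<longlonglongrightarrow> 0" using tendsto_mult_right_zero[OF \<delta>0] by simp
    show "\<exists>\<psi>\<in>test_functions \<Omega>. (\<forall>x. divergence \<psi> x = 0) \<and> l2_norm (\<lambda>x. \<psi> x - H x) < \<eta>"
      by (rule solenoidal_approximation[OF \<Omega> hc hdf hsupp \<delta>2 hR H Hlim \<eta>]) blast+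
  qed
qed

text \<open>Integrating a directional derivative of the square of \<open>v\<close> against the
  coordinate \<open>x \<bullet> b\<close> expresses \<open>(l2_norm v)\<^sup>2\<close> as minus
  twice the integral of \<open>v x * (p x \<bullet> b) * (x \<bullet> b)\<close>, and
  \<open>\<bar>x \<bullet> b\<bar> \<le> R\<close> on the support.\<close>

lemma friedrichs_inequality:
  fixes v :: "'a::euclidean_space \<Rightarrow> real"
  assumes v: "has_grad v p" and supp: "\<And>x. x \<notin> cball 0 R \<Longrightarrow> v x = 0" and R: "R \<ge> 0"
  shows "l2_norm v \<le> 2 * R * l2_norm p"
proof -
  obtain b :: 'a where b: "b \<in> Basis" using nonempty_Basis by blast
  have nb: "norm b = 1" and bb: "b \<bullet> b = 1" using b by (auto simp: inner_Basis)
  note vc = has_grad_continuous[OF v] and pc = has_grad_continuous_grad[OF v]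
  have psupp: "p x = 0" if "x \<notin> cball 0 R" for x by (rule has_grad_support[OF v supp that])
  have vs: "square_integrable v" by (rule square_integrable_continuous_bounded_support[OF vc supp])
  have ps: "square_integrable p" by (rule square_integrable_continuous_bounded_support[OF pc psupp])
  have g: "has_grad (\<lambda>x. x \<bullet> b) (\<lambda>x. b)"
    unfolding has_grad_def by (auto intro!: derivative_eq_intros simp: inner_commute)
  have "(LINT x|lborel. ((v x *\<^sub>R p x + v x *\<^sub>R p x) \<bullet> b) * (x \<bullet> b)) = - (LINT x|lborel. (v x * v x) * (b \<bullet> b))"
    by (rule integral_by_parts[OF has_grad_mult[OF v v] _ g, of R]) (use supp in auto)
  moreover have "(l2_norm v)\<^sup>2 = (LINT x|lborel. (v x * v x) * (b \<bullet> b))"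
    unfolding l2_norm_power2 by (simp add: bb power2_eq_square)
  moreover have "((v x *\<^sub>R p x + v x *\<^sub>R p x) \<bullet> b) * (x \<bullet> b) = 2 * (v x * (p x \<bullet> b)) * (x \<bullet> b)" for x
    by (simp add: inner_add_left)
  ultimately have "(l2_norm v)\<^sup>2 = - (LINT x|lborel. 2 * (v x * (p x \<bullet> b)) * (x \<bullet> b))"
    by (simp only: minus_minus)
  also have "\<dots> = (LINT x|lborel. - (2 * (v x * (p x \<bullet> b)) * (x \<bullet> b)))" by simp
  also have "\<dots> \<le> (LINT x|lborel. 2 * R * (norm (v x) * norm (p x)))"
  proof (rule integral_mono)
    show "integrable lborel (\<lambda>x. - (2 * (v x * (p x \<bullet> b)) * (x \<bullet> b)))"
      by (rule integrable_continuous_bounded_support[of _ R]) (use supp in \<open>auto intro!: continuous_intros vc pc\<close>)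
    show "integrable lborel (\<lambda>x. 2 * R * (norm (v x) * norm (p x)))"
      using integrable_norm_mult[OF vs ps] by simp
    fix x
    show "- (2 * (v x * (p x \<bullet> b)) * (x \<bullet> b)) \<le> 2 * R * (norm (v x) * norm (p x))"
    proof (cases "x \<in> cball 0 R")
      case True
      have 1: "\<bar>x \<bullet> b\<bar> \<le> R" using Cauchy_Schwarz_ineq2[of x b] nb True by simp
      have 2: "\<bar>p x \<bullet> b\<bar> \<le> norm (p x)" using Cauchy_Schwarz_ineq2[of "p x" b] nb by simp
      have "- (2 * (v x * (p x \<bullet> b)) * (x \<bullet> b)) \<le> 2 * (\<bar>v x\<bar> * \<bar>p x \<bullet> b\<bar>) * \<bar>x \<bullet> b\<bar>"
        by (simp only: abs_mult[symmetric] mult.assoc)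
      also have "\<dots> \<le> 2 * (\<bar>v x\<bar> * norm (p x)) * R" using 1 2 by (intro mult_mono mult_left_mono) auto
      also have "\<dots> = 2 * R * (norm (v x) * norm (p x))" by simp
      finally show ?thesis .
    qed (use supp in simp)
  qed
  also have "\<dots> = 2 * R * (LINT x|lborel. norm (v x) * norm (p x))" by simp
  also have "\<dots> \<le> 2 * R * (l2_norm v * l2_norm p)"
    using l2_cauchy_schwarz_norm[OF vs ps] R by (intro mult_left_mono) auto
  also have "\<dots> = l2_norm v * (2 * R * l2_norm p)" by simp
  finally have *: "l2_norm v * l2_norm v \<le> l2_norm v * (2 * R * l2_norm p)" unfolding power2_eq_square .
  show ?thesis
  proof (cases "l2_norm v = 0")
    case True then show ?thesis using R by simp
  next
    case False
    then have "l2_norm v > 0" using l2_norm_nonneg[of v] by linarith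
    then show ?thesis using * by simp
  qed
qed

section \<open>The fundamental lemma of the calculus of variations\<close>

lemma l2_norm_eq_0_iff:
  assumes "square_integrable f"
  shows "l2_norm f = 0 \<longleftrightarrow> (AE x in lborel. f x = 0)"
proof -
  have "l2_norm f = 0 \<longleftrightarrow> (LINT x|lborel. (norm (f x))\<^sup>2) = 0" by (simp add: l2_norm_def)
  also have "\<dots> \<longleftrightarrow> (AE x in lborel. (norm (f x))\<^sup>2 = 0)"
    using assms by (intro integral_nonneg_eq_0_iff_AE) (auto simp: square_integrable_def)
  finally show ?thesis by simp
qed

text \<open>At a point farther than \<open>e\<close> from the complement of \<open>U\<close> the
  mollification of \<open>D\<close> is an integral of \<open>D\<close> against a test function,
  hence 0. Letting \<open>e\<close> tend to 0 in \<open>L\<^sup>2\<close> gives \<open>D = 0\<close>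
  almost everywhere on each \<open>V n\<close>, and these sets exhaust \<open>U\<close>.\<close>

lemma fundamental_lemma:
  fixes D :: "'a::euclidean_space \<Rightarrow> 'b::euclidean_space"
  assumes U: "open U" "bounded U" and D: "square_integrable D" and supp: "\<And>x. x \<notin> U \<Longrightarrow> D x = 0"
    and test: "\<And>\<phi> :: 'a \<Rightarrow> real. \<phi> \<in> test_functions U \<Longrightarrow> (LINT x|lborel. \<phi> x *\<^sub>R D x) = 0"
  shows "AE x in lborel. D x = 0"
proof -
  obtain S where S: "\<And>x. x \<in> U \<Longrightarrow> norm x \<le> S" using U(2) unfolding bounded_iff by blast
  have suppS: "D y = 0" if "y \<notin> cball 0 S" for y using supp[of y] S[of y] that by auto
  have [measurable]: "D \<in> borel_measurable borel" using D by (rule square_integrable_measurable)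
  \<comment> \<open>The points at distance at least \<open>1 / real (Suc n)\<close> from the
    complement of \<open>U\<close>; on them every smaller mollification scale is admissible.\<close>
  define V where "V n = {x. \<forall>y. y \<notin> U \<longrightarrow> 1 / real (Suc n) \<le> norm (x - y)}" for n
  have Vc: "closed (V n)" for n
  proof -
    have "V n = (\<Inter>y\<in>- U. {x. 1 / real (Suc n) \<le> norm (x - y)})" by (auto simp: V_def)
    moreover have "closed {x. 1 / real (Suc n) \<le> norm (x - y)}" for y :: 'a
      by (intro closed_Collect_le continuous_intros)
    ultimately show ?thesis by auto
  qed
  have [measurable]: "V n \<in> sets borel" for n using Vc by (rule borel_closed)
  have "AE x in lborel. indicator (V n) x *\<^sub>R D x = 0" for n
  proof -
    have meas: "(\<lambda>x. indicator (V n) x *\<^sub>R D x) \<in> borel_measurable borel" by measurable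
    have VD: "square_integrable (\<lambda>x. indicator (V n) x *\<^sub>R D x)"
      by (rule l2_norm_mono(1)[OF D meas]) (simp add: indicator_def)
    have "l2_norm (\<lambda>x. indicator (V n) x *\<^sub>R D x) \<le> 0 + \<eta>" if \<eta>: "\<eta> > 0" for \<eta>
    proof -
      obtain \<tau> where \<tau>: "\<tau> > 0" "\<And>e. 0 < e \<Longrightarrow> e < \<tau> \<Longrightarrow>
          l2_norm (\<lambda>x. smear mollifier e D x - (LINT y|lborel. (mollifier :: 'a \<Rightarrow> real) y) *\<^sub>R D x) < \<eta>"
        using smear_tendsto_l2[OF mollifier_unit_kernel D suppS \<eta>] by blast
      define m where "m = min (1 / real (Suc n)) \<tau>"
      have m: "m > 0" "m \<le> \<tau>" "m \<le> 1 / real (Suc n)" using \<tau>(1) by (simp_all add: m_def)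
      define e where "e = m / 2"
      have e: "e > 0" "e < \<tau>" "e < 1 / real (Suc n)" using m by (simp_all add: e_def)
      have s0: "smear mollifier e D x = 0" if x: "x \<in> V n" for x
      proof -
        have "(\<lambda>y. rescale e mollifier (x - y)) \<in> test_functions U"
        proof (rule test_functionsI[OF smooth_rescale_mollifier(2)])
          show "compact (cball x e)" by simp
          show "cball x e \<subseteq> U" using x e(3) by (force simp: V_def dist_norm)
          show "y \<in> cball x e" if "rescale e mollifier (x - y) \<noteq> 0" for y
            using rescale_eq_0[OF mollifier_unit_kernel e(1), of "x - y"] that by (force simp: dist_norm)
        qed
        from test[OF this] show ?thesis by (simp add: smear_def)
      qed
      have sm: "square_integrable (smear mollifier e D)"
        by (rule smear_bound(1)[OF mollifier_unit_kernel e(1) D suppS])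
      have ds: "square_integrable (\<lambda>x. smear mollifier e D x - D x)" by (rule square_integrable_diff[OF sm D])
      have "l2_norm (\<lambda>x. indicator (V n) x *\<^sub>R D x) \<le> l2_norm (\<lambda>x. smear mollifier e D x - D x)"
        by (rule l2_norm_mono(2)[OF ds meas]) (use s0 in \<open>auto simp: indicator_def\<close>)
      also have "\<dots> < \<eta>" using \<tau>(2)[OF e(1,2)] by (simp add: integral_mollifier)
      finally show ?thesis by simp
    qed
    then have "l2_norm (\<lambda>x. indicator (V n) x *\<^sub>R D x) \<le> 0" by (rule field_le_epsilon)
    then have "l2_norm (\<lambda>x. indicator (V n) x *\<^sub>R D x) = 0" using l2_norm_nonneg by (metis order_antisym)
    then show ?thesis using l2_norm_eq_0_iff[OF VD] by simp
  qed
  then have "AE x in lborel. \<forall>n. indicator (V n) x *\<^sub>R D x = 0" unfolding AE_all_countable by blast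
  then show ?thesis
  proof (rule AE_mp, intro AE_I2 impI)
    fix x assume x: "\<forall>n. indicator (V n) x *\<^sub>R D x = 0"
    show "D x = 0"
    proof (cases "x \<in> U")
      case True
      then obtain r where r: "r > 0" "ball x r \<subseteq> U" using U(1) open_contains_ball by metis
      obtain n where n: "1 / real (Suc n) < r" using nat_approx_posE[OF r(1)] by blast
      have "x \<in> V n" unfolding V_def
      proof (intro CollectI allI impI)
        fix y assume "y \<notin> U"
        then have "r \<le> norm (x - y)" using r(2) by (force simp: dist_norm)
        then show "1 / real (Suc n) \<le> norm (x - y)" using n by simp
      qed
      then show ?thesis using x by (auto simp: indicator_def)
    qed (rule supp)
  qed
qed

section \<open>Passage to the function spaces\<close>

text \<open>The bridge from Lebesgue measurable functions, considered on \<open>U\<close> up to null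
  sets, to Borel functions on the whole space that vanish exactly outside \<open>U\<close>.\<close>

definition represents :: "'a::euclidean_space set \<Rightarrow> ('a \<Rightarrow> 'b::euclidean_space) \<Rightarrow> ('a \<Rightarrow> 'b) \<Rightarrow> bool" where
  "represents U f F \<longleftrightarrow> square_integrable F \<and> (\<forall>x. x \<notin> U \<longrightarrow> F x = 0) \<and> (AE x in lebesgue_on U. f x = F x)"

lemma open_lebesgue: "open U \<Longrightarrow> U \<inter> space lebesgue \<in> sets (lebesgue :: 'a::euclidean_space measure)"
  by simp

lemma borel_imp_lebesgue_on: "F \<in> borel_measurable borel \<Longrightarrow> F \<in> borel_measurable (lebesgue_on U)"
  by (intro measurable_restrict_space1 measurable_completion) simp

lemma AE_lebesgue_on:
  assumes "open (U :: 'a::euclidean_space set)"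
  shows "(AE x in lebesgue_on U. P x) \<longleftrightarrow> (AE x in lborel. x \<in> U \<longrightarrow> P x)"
  using AE_restrict_space_iff[OF open_lebesgue[OF assms]] by (simp add: AE_completion_iff)

text \<open>Translates the restricted Lebesgue integrals of the definitions into the Borel integrals
  over the whole space for which the analysis is done.\<close>

lemma LINT_lebesgue_on_eq:
  fixes q Q :: "'a::euclidean_space \<Rightarrow> 'b::euclidean_space"
  assumes U: "open U" and q: "q \<in> borel_measurable (lebesgue_on U)" and Q: "Q \<in> borel_measurable borel"
    and supp: "\<And>x. x \<notin> U \<Longrightarrow> Q x = 0" and eq: "AE x in lebesgue_on U. q x = Q x"
  shows "(LINT x|lebesgue_on U. q x) = (LINT x|lborel. Q x)"
    and "integrable (lebesgue_on U) q \<longleftrightarrow> integrable lborel Q"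
proof -
  have qm: "(\<lambda>x. indicator U x *\<^sub>R q x) \<in> borel_measurable lebesgue"
    using q borel_measurable_restrict_space_iff[OF open_lebesgue[OF U], of q] by simp
  have Qm: "Q \<in> borel_measurable lebesgue" using Q by (intro measurable_completion) simp
  have "AE x in lebesgue. indicator U x *\<^sub>R q x = Q x"
    using eq unfolding AE_restrict_space_iff[OF open_lebesgue[OF U]]
    by (rule AE_mp) (use supp in \<open>auto simp: indicator_def\<close>)
  note ae = this
  have "(LINT x|lebesgue_on U. q x) = (LINT x|lebesgue. indicator U x *\<^sub>R q x)"
    by (rule integral_restrict_space[OF open_lebesgue[OF U]])
  also have "\<dots> = (LINT x|lebesgue. Q x)" by (rule integral_cong_AE[OF qm Qm ae])
  also have "\<dots> = (LINT x|lborel. Q x)" by (rule integral_completion) (use Q in simp)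
  finally show "(LINT x|lebesgue_on U. q x) = (LINT x|lborel. Q x)" .
  have "integrable (lebesgue_on U) q \<longleftrightarrow> integrable lebesgue (\<lambda>x. indicator U x *\<^sub>R q x)"
    by (rule integrable_restrict_space[OF open_lebesgue[OF U]])
  also have "\<dots> \<longleftrightarrow> integrable lebesgue Q" by (rule integrable_cong_AE[OF qm Qm ae])
  also have "\<dots> \<longleftrightarrow> integrable lborel Q" by (rule integrable_completion) (use Q in simp)
  finally show "integrable (lebesgue_on U) q \<longleftrightarrow> integrable lborel Q" .
qed

text \<open>A Lebesgue measurable real function agrees almost everywhere with a Borel measurable
  one. This is applied to each coordinate, and the indicator of \<open>U\<close> makes the values
  outside exact.\<close>

lemma L2_representative:
  fixes f :: "'a::euclidean_space \<Rightarrow> 'b::euclidean_space"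
  assumes U: "open U" and f: "f \<in> L2 U"
  obtains F where "represents U f F"
proof -
  have fm: "f \<in> borel_measurable (lebesgue_on U)" and fi: "integrable (lebesgue_on U) (\<lambda>x. (norm (f x))\<^sup>2)"
    using f by (auto simp: L2_def)
  define f0 where "f0 x = indicator U x *\<^sub>R f x" for x
  have f0: "f0 \<in> borel_measurable lebesgue"
    unfolding f0_def[abs_def] using fm borel_measurable_restrict_space_iff[OF open_lebesgue[OF U], of f] by simp
  have "\<forall>b\<in>(Basis :: 'b set). \<exists>g\<in>borel_measurable lborel. AE x in lborel. f0 x \<bullet> b = g x"
  proof
    fix b :: 'b
    have "(\<lambda>x. f0 x \<bullet> b) \<in> borel_measurable lebesgue" using f0 by simp
    from completion_ex_borel_measurable_real[OF this]
    show "\<exists>g\<in>borel_measurable lborel. AE x in lborel. f0 x \<bullet> b = g x" .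
  qed
  then obtain g where g: "\<And>b. b \<in> Basis \<Longrightarrow> g b \<in> borel_measurable lborel"
    and gae: "\<And>b. b \<in> Basis \<Longrightarrow> AE x in lborel. f0 x \<bullet> b = g b x" by metis
  define F where "F x = indicator U x *\<^sub>R (\<Sum>b\<in>Basis. g b x *\<^sub>R b)" for x
  have [measurable]: "U \<in> sets borel" using U by (rule borel_open)
  have Fm: "F \<in> borel_measurable borel"
    unfolding F_def[abs_def]
    by (intro borel_measurable_scaleR borel_measurable_sum borel_measurable_const borel_measurable_indicator) (use g in simp_all)
  have "AE x in lborel. \<forall>b\<in>Basis. f0 x \<bullet> b = g b x" by (rule AE_finite_allI) (use gae in auto)
  then have ae: "AE x in lborel. f0 x = F x"
  proof (rule AE_mp, intro AE_I2 impI)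
    fix x assume x: "\<forall>b\<in>Basis. f0 x \<bullet> b = g b x"
    have "f0 x = (\<Sum>b\<in>Basis. (f0 x \<bullet> b) *\<^sub>R b)" by (simp add: euclidean_representation)
    also have "\<dots> = (\<Sum>b\<in>Basis. g b x *\<^sub>R b)" using x by (intro sum.cong) auto
    finally have "f0 x = (\<Sum>b\<in>Basis. g b x *\<^sub>R b)" .
    moreover have "indicator U x *\<^sub>R f0 x = f0 x" by (simp add: f0_def indicator_def)
    ultimately show "f0 x = F x" by (simp add: F_def)
  qed
  then have aeU: "AE x in lebesgue_on U. f x = F x"
    unfolding AE_lebesgue_on[OF U] by (rule AE_mp) (auto simp: f0_def indicator_def intro!: AE_I2)
  have z: "F x = 0" if "x \<notin> U" for x using that by (simp add: F_def)
  have "AE x in lebesgue_on U. (norm (f x))\<^sup>2 = (norm (F x))\<^sup>2" using aeU by (rule AE_mp) (auto intro!: AE_I2)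
  then have "integrable lborel (\<lambda>x. (norm (F x))\<^sup>2)"
    using LINT_lebesgue_on_eq(2)[OF U, of "\<lambda>x. (norm (f x))\<^sup>2" "\<lambda>x. (norm (F x))\<^sup>2"] fm fi Fm z by simp
  then show ?thesis using that[of F] Fm z aeU by (simp add: represents_def square_integrable_def)
qed

lemma representative_L2:
  assumes U: "open U" and F: "square_integrable F" "\<And>x. x \<notin> U \<Longrightarrow> F x = 0"
  shows "F \<in> L2 U" "represents U F F"
proof -
  note Fm = square_integrable_measurable[OF F(1)]
  have "integrable (lebesgue_on U) (\<lambda>x. (norm (F x))\<^sup>2) \<longleftrightarrow> integrable lborel (\<lambda>x. (norm (F x))\<^sup>2)"
    by (rule LINT_lebesgue_on_eq(2)[OF U borel_imp_lebesgue_on]) (use Fm F(2) in auto)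
  then show "F \<in> L2 U" using F Fm by (simp add: L2_def borel_imp_lebesgue_on square_integrable_def)
  show "represents U F F" using F by (simp add: represents_def)
qed

lemma L2_measurable: "f \<in> L2 U \<Longrightarrow> f \<in> borel_measurable (lebesgue_on U)"
  by (simp add: L2_def)

lemma L2_dist_representative:
  fixes f g :: "'a::euclidean_space \<Rightarrow> 'b::euclidean_space"
  assumes U: "open U" and "f \<in> L2 U" "represents U f F" "g \<in> L2 U" "represents U g G"
  shows "L2_dist U f g = l2_norm (\<lambda>x. F x - G x)"
proof -
  have m: "f \<in> borel_measurable (lebesgue_on U)" "g \<in> borel_measurable (lebesgue_on U)"
    "F \<in> borel_measurable borel" "G \<in> borel_measurable borel"
    using assms by (auto simp: represents_def L2_def intro: square_integrable_measurable)
  have "AE x in lebesgue_on U. f x = F x" "AE x in lebesgue_on U. g x = G x"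
    using assms by (auto simp: represents_def)
  then have ae: "AE x in lebesgue_on U. (norm (f x - g x))\<^sup>2 = (norm (F x - G x))\<^sup>2" by eventually_elim simp
  have "(LINT x|lebesgue_on U. (norm (f x - g x))\<^sup>2) = (LINT x|lborel. (norm (F x - G x))\<^sup>2)"
    by (rule LINT_lebesgue_on_eq(1)[OF U _ _ _ ae]) (use m assms in \<open>auto simp: represents_def\<close>)
  then show ?thesis by (simp add: L2_dist_def l2_norm_def)
qed

lemma representative_scaleR_integral:
  fixes f :: "'a::euclidean_space \<Rightarrow> 'b::euclidean_space" and c :: "'a \<Rightarrow> real"
  assumes U: "open U" and f: "f \<in> L2 U" "represents U f F" and c: "continuous_on UNIV c"
  shows "(LINT x|lebesgue_on U. c x *\<^sub>R f x) = (LINT x|lborel. c x *\<^sub>R F x)"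
proof -
  have cm: "c \<in> borel_measurable borel" by (rule borel_measurable_continuous[OF c])
  have Fm: "F \<in> borel_measurable borel" using f(2) by (auto simp: represents_def intro: square_integrable_measurable)
  have "AE x in lebesgue_on U. f x = F x" using f(2) by (simp add: represents_def)
  then have ae: "AE x in lebesgue_on U. c x *\<^sub>R f x = c x *\<^sub>R F x" by eventually_elim simp
  show ?thesis
    by (rule LINT_lebesgue_on_eq(1)[OF U _ _ _ ae])
       (use L2_measurable[OF f(1)] cm borel_imp_lebesgue_on[OF cm] Fm f(2) in \<open>auto simp: represents_def\<close>)
qed

lemma representative_real_scaleR_integral:
  fixes f :: "'a::euclidean_space \<Rightarrow> real" and c :: "'a \<Rightarrow> 'b::euclidean_space"
  assumes U: "open U" and f: "f \<in> L2 U" "represents U f F" and c: "continuous_on UNIV c"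
  shows "(LINT x|lebesgue_on U. f x *\<^sub>R c x) = (LINT x|lborel. F x *\<^sub>R c x)"
proof -
  have cm: "c \<in> borel_measurable borel" by (rule borel_measurable_continuous[OF c])
  have Fm: "F \<in> borel_measurable borel" using f(2) by (auto simp: represents_def intro: square_integrable_measurable)
  have "AE x in lebesgue_on U. f x = F x" using f(2) by (simp add: represents_def)
  then have ae: "AE x in lebesgue_on U. f x *\<^sub>R c x = F x *\<^sub>R c x" by eventually_elim simp
  show ?thesis
    by (rule LINT_lebesgue_on_eq(1)[OF U _ _ _ ae])
       (use L2_measurable[OF f(1)] cm borel_imp_lebesgue_on[OF cm] Fm f(2) in \<open>auto simp: represents_def\<close>)
qed

section \<open>Gradient and solenoidal closures versus the function spaces\<close>

lemma test_function_square_integrable: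
  fixes \<phi> :: "'a::euclidean_space \<Rightarrow> 'b::euclidean_space"
  assumes "bounded U" "\<phi> \<in> test_functions U"
  shows "square_integrable \<phi>"
proof -
  obtain S where S: "\<And>x. x \<in> U \<Longrightarrow> norm x \<le> S" using assms(1) unfolding bounded_iff by blast
  show ?thesis
    by (rule square_integrable_continuous_bounded_support[OF times_cont_diff_continuous[OF test_functionsD(1)[OF assms(2)]], of S])
       (use test_functionsD(3)[OF assms(2)] S in auto)
qed

lemma test_function_gradient:
  fixes \<phi> :: "'a::euclidean_space \<Rightarrow> real"
  assumes U: "bounded U" and \<phi>: "\<phi> \<in> test_functions U"
  shows "has_grad \<phi> (gradient \<phi>)" "x \<notin> U \<Longrightarrow> gradient \<phi> x = 0" "square_integrable (gradient \<phi>)"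
proof -
  show g: "has_grad \<phi> (gradient \<phi>)" by (rule smooth_has_grad(1)[OF test_functionsD(1)[OF \<phi>]])
  have "closure {x. \<phi> x \<noteq> 0} \<subseteq> U" using \<phi> by (simp add: test_functions_def)
  then have z: "gradient \<phi> x = 0" if "x \<notin> U" for x
  proof (intro has_grad_eq_0_on_open[OF g, of "- closure {x. \<phi> x \<noteq> 0}"])
    show "\<phi> y = 0" if "y \<in> - closure {x. \<phi> x \<noteq> 0}" for y
      using that closure_subset[of "{x. \<phi> x \<noteq> 0}"] by blast
  qed (use that in auto)
  then show "x \<notin> U \<Longrightarrow> gradient \<phi> x = 0" .
  obtain S where S: "\<And>x. x \<in> U \<Longrightarrow> norm x \<le> S" using U unfolding bounded_iff by blast
  show "square_integrable (gradient \<phi>)"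
    by (rule square_integrable_continuous_bounded_support[OF has_grad_continuous_grad[OF g], of S]) (use z S in force)
qed

lemma test_function_representative:
  assumes U: "open U" "bounded U"
  shows "\<phi> \<in> test_functions U \<Longrightarrow> \<phi> \<in> L2 U \<and> represents U \<phi> \<phi>"
    "\<psi> \<in> test_functions U \<Longrightarrow> gradient \<psi> \<in> L2 U \<and> represents U (gradient \<psi>) (gradient \<psi>)"
  using representative_L2[OF U(1)] test_function_square_integrable[OF U(2)] test_function_gradient[OF U(2)] test_functionsD(3)
  by metis+

text \<open>For Borel fields extended by zero this is \<open>grad_H1_0\<close> on a bounded open
  set, but it mentions only gradients; the two lemmas below translate in both directions.\<close>

definition grad_closure :: "'a::euclidean_space set \<Rightarrow> ('a \<Rightarrow> 'a) \<Rightarrow> bool" where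
  "grad_closure U G \<longleftrightarrow> square_integrable G \<and> (\<forall>x. x \<notin> U \<longrightarrow> G x = 0) \<and>
     (\<forall>\<eta>>0. \<exists>\<phi>\<in>test_functions U. l2_norm (\<lambda>x. gradient \<phi> x - G x) < \<eta>)"

definition solenoidal_closure :: "'a::euclidean_space set \<Rightarrow> ('a \<Rightarrow> 'a) \<Rightarrow> bool" where
  "solenoidal_closure U H \<longleftrightarrow> square_integrable H \<and> (\<forall>x. x \<notin> U \<longrightarrow> H x = 0) \<and>
     (\<forall>\<eta>>0. \<exists>\<psi>\<in>test_functions U. (\<forall>x. divergence \<psi> x = 0) \<and> l2_norm (\<lambda>x. \<psi> x - H x) < \<eta>)"

lemma solenoidal_closure_H_div_0:
  assumes U: "open U" "bounded U" and H: "solenoidal_closure U H"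
  shows "H \<in> H_div_0 U"
proof -
  have Hs: "square_integrable H" "\<And>x. x \<notin> U \<Longrightarrow> H x = 0" using H by (auto simp: solenoidal_closure_def)
  note HL = representative_L2[OF U(1) Hs]
  have "\<exists>\<psi>\<in>test_functions U. (\<forall>x. divergence \<psi> x = 0) \<and> L2_dist U H \<psi> < \<eta>" if \<eta>: "\<eta> > 0" for \<eta>
  proof -
    obtain \<psi> where \<psi>: "\<psi> \<in> test_functions U" "\<forall>x. divergence \<psi> x = 0" "l2_norm (\<lambda>x. \<psi> x - H x) < \<eta>"
      using H \<eta> unfolding solenoidal_closure_def by blast
    have "L2_dist U H \<psi> = l2_norm (\<lambda>x. H x - \<psi> x)"
      using L2_dist_representative[OF U(1) HL] test_function_representative(1)[OF U \<psi>(1)] by blast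
    then show ?thesis using \<psi> l2_norm_diff_commute[of H \<psi>] by auto
  qed
  then show ?thesis using HL(1) by (auto simp: H_div_0_def)
qed

lemma H_div_0_solenoidal_closure:
  assumes U: "open U" "bounded U" and h: "h \<in> H_div_0 U"
  obtains H where "represents U h H" "solenoidal_closure U H"
proof -
  have hL: "h \<in> L2 U" using h by (simp add: H_div_0_def)
  obtain H where H: "represents U h H" by (rule L2_representative[OF U(1) hL])
  have "\<exists>\<psi>\<in>test_functions U. (\<forall>x. divergence \<psi> x = 0) \<and> l2_norm (\<lambda>x. \<psi> x - H x) < \<eta>" if \<eta>: "\<eta> > 0" for \<eta>
  proof -
    obtain \<psi> where \<psi>: "\<psi> \<in> test_functions U" "\<forall>x. divergence \<psi> x = 0" "L2_dist U h \<psi> < \<eta>"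
      using h \<eta> unfolding H_div_0_def by blast
    have "L2_dist U h \<psi> = l2_norm (\<lambda>x. H x - \<psi> x)"
      using L2_dist_representative[OF U(1) hL H] test_function_representative(1)[OF U \<psi>(1)] by blast
    then show ?thesis using \<psi> l2_norm_diff_commute[of H \<psi>] by auto
  qed
  then have "solenoidal_closure U H" using H by (auto simp: solenoidal_closure_def represents_def)
  then show ?thesis using that H by blast
qed

lemma integrable_scaleR_l2:
  fixes a :: "'a::euclidean_space \<Rightarrow> real" and K :: "'a \<Rightarrow> 'b::euclidean_space"
  assumes "square_integrable a" "square_integrable K"
  shows "integrable lborel (\<lambda>x. a x *\<^sub>R K x)"
  by (rule Bochner_Integration.integrable_bound[OF integrable_norm_mult[OF assms]])
     (use assms in \<open>auto simp: square_integrable_def intro!: borel_measurable_scaleR\<close>)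

lemma l2_inner_tendsto:
  fixes f :: "nat \<Rightarrow> 'a::euclidean_space \<Rightarrow> 'b::euclidean_space"
  assumes "\<And>n. square_integrable (f n)" "square_integrable f0" "square_integrable g" "(\<lambda>n. l2_norm (\<lambda>x. f n x - f0 x)) \<longlonglongrightarrow> 0"
  shows "(\<lambda>n. LINT x|lborel. f n x \<bullet> g x) \<longlonglongrightarrow> (LINT x|lborel. f0 x \<bullet> g x)"
proof (rule LIM_zero_cancel, rule Lim_null_comparison)
  have "(LINT x|lborel. f n x \<bullet> g x) - (LINT x|lborel. f0 x \<bullet> g x) = (LINT x|lborel. (f n x - f0 x) \<bullet> g x)" for n
    using integrable_inner_l2[OF assms(1,3)] integrable_inner_l2[OF assms(2,3)] by (simp add: inner_diff_left)
  then show "\<forall>\<^sub>F n in sequentially. norm ((LINT x|lborel. f n x \<bullet> g x) - (LINT x|lborel. f0 x \<bullet> g x))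
      \<le> l2_norm (\<lambda>x. f n x - f0 x) * l2_norm g"
    using l2_cauchy_schwarz[OF square_integrable_diff[OF assms(1,2)] assms(3)] by simp
  show "(\<lambda>n. l2_norm (\<lambda>x. f n x - f0 x) * l2_norm g) \<longlonglongrightarrow> 0"
    using tendsto_mult_left_zero[OF assms(4)] by simp
qed

text \<open>By Friedrichs' inequality the test functions with convergent gradients are themselves
  Cauchy. Their limit is the potential, and integration by parts passes to the limit.\<close>

lemma grad_closure_grad_H1_0:
  fixes U :: "'a::euclidean_space set"
  assumes U: "open U" "bounded U" and G: "grad_closure U G"
  shows "G \<in> grad_H1_0 U"
proof -
  have Gs: "square_integrable G" "\<And>x. x \<notin> U \<Longrightarrow> G x = 0" using G by (auto simp: grad_closure_def)
  note GL = representative_L2[OF U(1) Gs]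
  have "\<forall>n. \<exists>\<phi>\<in>test_functions U. l2_norm (\<lambda>x. gradient \<phi> x - G x) < 1 / real (Suc n)"
    using G unfolding grad_closure_def by simp
  then obtain \<phi> where \<phi>: "\<And>n. \<phi> n \<in> test_functions U" and \<phi>G: "\<And>n. l2_norm (\<lambda>x. gradient (\<phi> n) x - G x) < 1 / real (Suc n)"
    by metis
  note g = test_function_gradient[OF U(2) \<phi>]
  have ps: "square_integrable (\<phi> n)" for n by (rule test_function_square_integrable[OF U(2) \<phi>])
  have lim: "(\<lambda>n. l2_norm (\<lambda>x. gradient (\<phi> n) x - G x)) \<longlonglongrightarrow> 0"
  proof (rule tendsto_sandwich[of "\<lambda>_. 0"])
    show "\<forall>\<^sub>F n in sequentially. l2_norm (\<lambda>x. gradient (\<phi> n) x - G x) \<le> 1 / real (Suc n)"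
      by (intro always_eventually allI less_imp_le \<phi>G)
    show "(\<lambda>n. 1 / real (Suc n)) \<longlonglongrightarrow> 0" using LIMSEQ_inverse_real_of_nat by (simp add: inverse_eq_divide)
  qed auto
  obtain S0 where S0: "\<And>x. x \<in> U \<Longrightarrow> norm x \<le> S0" using U(2) unfolding bounded_iff by blast
  define S where "S = max S0 1"
  have S: "\<And>x. x \<in> U \<Longrightarrow> norm x \<le> S" "S > 0" using S0 by (auto simp: S_def intro: max.coboundedI1)
  have \<phi>S: "\<phi> n x = 0" if "x \<notin> cball 0 S" for n x using test_functionsD(3)[OF \<phi>] S(1) that by fastforce
  have cau: "\<exists>N. \<forall>m\<ge>N. \<forall>n\<ge>N. l2_norm (\<lambda>x. \<phi> m x - \<phi> n x) < e" if e: "e > 0" for e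
  proof -
    \<comment> \<open>Friedrichs' inequality contributes the factor \<open>2 * S\<close>, and two
      gradients are compared with \<open>G\<close>.\<close>
    have "e / (4 * S) > 0" using e S(2) by simp
    then obtain N where N: "\<And>n. n \<ge> N \<Longrightarrow> l2_norm (\<lambda>x. gradient (\<phi> n) x - G x) < e / (4 * S)"
      by (rule l2_norm_less_from_limit[OF lim]) blast
    have "l2_norm (\<lambda>x. \<phi> m x - \<phi> n x) < e" if mn: "m \<ge> N" "n \<ge> N" for m n
    proof -
      have "l2_norm (\<lambda>x. \<phi> m x - \<phi> n x) \<le> 2 * S * l2_norm (\<lambda>x. gradient (\<phi> m) x - gradient (\<phi> n) x)"
        by (rule friedrichs_inequality[OF has_grad_diff[OF g(1) g(1)]]) (use \<phi>S S in auto)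
      also have "\<dots> < 2 * S * (e / (4 * S) + e / (4 * S))"
        using l2_norm_triangle_sub[OF g(3)[of m] Gs(1) g(3)[of n]] N[OF mn(1)] N[OF mn(2)]
          l2_norm_diff_commute[of G "gradient (\<phi> n)"] S(2)
        by (intro mult_strict_left_mono) auto
      also have "\<dots> = e" using S(2) by (simp add: field_simps)
      finally show ?thesis .
    qed
    then show ?thesis by blast
  qed
  obtain u0 where u0: "square_integrable u0" "(\<lambda>n. l2_norm (\<lambda>x. \<phi> n x - u0 x)) \<longlonglongrightarrow> 0"
    by (rule l2_complete[of \<phi>, OF ps cau])
  \<comment> \<open>The limit is made to vanish exactly outside \<open>U\<close>. This does not
    increase the distance to the \<open>\<phi> n\<close>, which vanish there as well.\<close>
  define u where "u x = indicator U x * u0 x" for x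
  have [measurable]: "U \<in> sets borel" using U by (simp add: borel_open)
  have [measurable]: "u0 \<in> borel_measurable borel" using u0(1) by (rule square_integrable_measurable)
  have um: "u \<in> borel_measurable borel" unfolding u_def[abs_def] by measurable
  have us: "square_integrable u" by (rule l2_norm_mono(1)[OF u0(1) um]) (simp add: u_def indicator_def)
  have uz: "u x = 0" if "x \<notin> U" for x using that by (simp add: u_def)
  note uL = representative_L2[OF U(1) us uz]
  have ulim: "(\<lambda>n. l2_norm (\<lambda>x. \<phi> n x - u x)) \<longlonglongrightarrow> 0"
  proof (rule tendsto_sandwich[of "\<lambda>_. 0"])
    have "l2_norm (\<lambda>x. \<phi> n x - u x) \<le> l2_norm (\<lambda>x. \<phi> n x - u0 x)" for n
    proof (rule l2_norm_mono(2)[OF square_integrable_diff[OF ps u0(1)]])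
      show "(\<lambda>x. \<phi> n x - u x) \<in> borel_measurable borel"
        using um square_integrable_measurable[OF ps] by (intro borel_measurable_diff)
      show "norm (\<phi> n x - u x) \<le> norm (\<phi> n x - u0 x)" for x
      proof (cases "x \<in> U")
        case False
        then have "\<phi> n x = 0" using test_functionsD(3)[OF \<phi>] by blast
        then show ?thesis using uz[OF False] by simp
      qed (simp add: u_def)
    qed
    then show "\<forall>\<^sub>F n in sequentially. l2_norm (\<lambda>x. \<phi> n x - u x) \<le> l2_norm (\<lambda>x. \<phi> n x - u0 x)" by simp
  qed (use u0(2) in auto)
  have weak: "has_weak_gradient U u G"
    unfolding has_weak_gradient_def
  proof
    fix \<theta> :: "'a \<Rightarrow> real" assume \<theta>: "\<theta> \<in> test_functions U"
    note \<theta>g = test_function_gradient[OF U(2) \<theta>] and \<theta>s = test_function_square_integrable[OF U(2) \<theta>]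
    have ui: "integrable lborel (\<lambda>x. u x *\<^sub>R gradient \<theta> x)"
      by (rule integrable_scaleR_l2[OF us \<theta>g(3)])
    have Gi: "integrable lborel (\<lambda>x. \<theta> x *\<^sub>R G x)"
      by (rule integrable_scaleR_l2[OF \<theta>s Gs(1)])
    \<comment> \<open>The vector identity is tested against each \<open>v\<close>, which turns both
      sides into inner products to which \<open>l2_inner_tendsto\<close> applies.\<close>
    have "(LINT x|lborel. u x *\<^sub>R gradient \<theta> x) \<bullet> v = - (LINT x|lborel. \<theta> x *\<^sub>R G x) \<bullet> v" for v
    proof -
      have \<theta>v: "square_integrable (\<lambda>x. gradient \<theta> x \<bullet> v)"
      proof (rule l2_norm_mono(1)[OF square_integrable_scaleR[OF \<theta>g(3), of "norm v"]])
        show "(\<lambda>x. gradient \<theta> x \<bullet> v) \<in> borel_measurable borel"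
          using square_integrable_measurable[OF \<theta>g(3)] by simp
        show "norm (gradient \<theta> x \<bullet> v) \<le> norm (norm v *\<^sub>R gradient \<theta> x)" for x
          using Cauchy_Schwarz_ineq2[of "gradient \<theta> x" v] by (simp add: mult.commute)
      qed
      have \<theta>v2: "square_integrable (\<lambda>x. \<theta> x *\<^sub>R v)"
      proof (rule l2_norm_mono(1)[OF square_integrable_scaleR[OF \<theta>s, of "norm v"]])
        show "(\<lambda>x. \<theta> x *\<^sub>R v) \<in> borel_measurable borel"
          using square_integrable_measurable[OF \<theta>s] by simp
      qed (simp add: abs_mult mult.commute)
      have 1: "(\<lambda>n. LINT x|lborel. \<phi> n x \<bullet> (gradient \<theta> x \<bullet> v)) \<longlonglongrightarrow> (LINT x|lborel. u x \<bullet> (gradient \<theta> x \<bullet> v))"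
        by (rule l2_inner_tendsto[OF ps us \<theta>v ulim])
      have 2: "(\<lambda>n. LINT x|lborel. gradient (\<phi> n) x \<bullet> (\<theta> x *\<^sub>R v)) \<longlonglongrightarrow> (LINT x|lborel. G x \<bullet> (\<theta> x *\<^sub>R v))"
        by (rule l2_inner_tendsto[OF g(3) Gs(1) \<theta>v2 lim])
      have "(LINT x|lborel. \<phi> n x \<bullet> (gradient \<theta> x \<bullet> v)) = - (LINT x|lborel. gradient (\<phi> n) x \<bullet> (\<theta> x *\<^sub>R v))" for n
        using integral_by_parts[OF g(1)[of n] _ \<theta>g(1), of S v] \<phi>S by (simp add: mult.commute)
      then have "(\<lambda>n. LINT x|lborel. \<phi> n x \<bullet> (gradient \<theta> x \<bullet> v)) \<longlonglongrightarrow> - (LINT x|lborel. G x \<bullet> (\<theta> x *\<^sub>R v))"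
        using tendsto_minus[OF 2] by simp
      from LIMSEQ_unique[OF 1 this]
      have "(LINT x|lborel. u x \<bullet> (gradient \<theta> x \<bullet> v)) = - (LINT x|lborel. G x \<bullet> (\<theta> x *\<^sub>R v))" .
      moreover have "(LINT x|lborel. u x *\<^sub>R gradient \<theta> x) \<bullet> v = (LINT x|lborel. u x \<bullet> (gradient \<theta> x \<bullet> v))"
        using integral_inner_left[OF ui, of v] by simp
      moreover have "(LINT x|lborel. \<theta> x *\<^sub>R G x) \<bullet> v = (LINT x|lborel. G x \<bullet> (\<theta> x *\<^sub>R v))"
        using integral_inner_left[OF Gi, of v] by simp
      ultimately show ?thesis by simp
    qed
    then have "(LINT x|lborel. u x *\<^sub>R gradient \<theta> x) = - (LINT x|lborel. \<theta> x *\<^sub>R G x)"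
      by (intro vector_eq_ldot[THEN iffD1]) (simp add: inner_commute)
    then show "(LINT x|lebesgue_on U. u x *\<^sub>R gradient \<theta> x) = - (LINT x|lebesgue_on U. \<theta> x *\<^sub>R G x)"
      using representative_real_scaleR_integral[OF U(1) uL has_grad_continuous_grad[OF \<theta>g(1)]]
        representative_scaleR_integral[OF U(1) GL has_grad_continuous[OF \<theta>g(1)]] by simp
  qed
  have "\<exists>\<theta>\<in>test_functions U. L2_dist U u \<theta> < \<epsilon> \<and> L2_dist U G (gradient \<theta>) < \<epsilon>" if \<epsilon>: "\<epsilon> > 0" for \<epsilon>
  proof -
    obtain N1 where N1: "\<And>n. n \<ge> N1 \<Longrightarrow> l2_norm (\<lambda>x. \<phi> n x - u x) < \<epsilon>"
      by (rule l2_norm_less_from_limit[OF ulim \<epsilon>]) blast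
    obtain N2 where N2: "\<And>n. n \<ge> N2 \<Longrightarrow> l2_norm (\<lambda>x. gradient (\<phi> n) x - G x) < \<epsilon>"
      by (rule l2_norm_less_from_limit[OF lim \<epsilon>]) blast
    let ?n = "max N1 N2"
    have "L2_dist U u (\<phi> ?n) = l2_norm (\<lambda>x. u x - \<phi> ?n x)"
      using L2_dist_representative[OF U(1) uL] test_function_representative(1)[OF U \<phi>] by blast
    moreover have "L2_dist U G (gradient (\<phi> ?n)) = l2_norm (\<lambda>x. G x - gradient (\<phi> ?n) x)"
      using L2_dist_representative[OF U(1) GL] test_function_representative(2)[OF U \<phi>] by blast
    ultimately show ?thesis
      using N1[of ?n] N2[of ?n] l2_norm_diff_commute[of u "\<phi> ?n"] l2_norm_diff_commute[of G "gradient (\<phi> ?n)"] \<phi>[of ?n]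
      by (intro bexI[of _ "\<phi> ?n"]) auto
  qed
  then have "u \<in> H1_0 U" using uL(1) GL(1) weak unfolding H1_0_def by blast
  then show ?thesis using GL(1) weak unfolding grad_H1_0_def by blast
qed

text \<open>The weak gradient \<open>g\<close> and the weak gradient \<open>g'\<close> that is
  approximated in \<open>H1_0\<close> are separate witnesses for the same \<open>u\<close>; the
  fundamental lemma identifies them almost everywhere.\<close>

lemma grad_H1_0_grad_closure:
  fixes U :: "'a::euclidean_space set"
  assumes U: "open U" "bounded U" and g: "g \<in> grad_H1_0 U"
  obtains G where "represents U g G" "grad_closure U G"
proof -
  from g obtain u where gL: "g \<in> L2 U" and u: "u \<in> H1_0 U" and wg: "has_weak_gradient U u g"
    by (auto simp: grad_H1_0_def)
  from u obtain g' where g'L: "g' \<in> L2 U" and wg': "has_weak_gradient U u g'"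
    and ap: "\<And>\<epsilon>. \<epsilon> > 0 \<Longrightarrow> \<exists>\<phi>\<in>test_functions U. L2_dist U u \<phi> < \<epsilon> \<and> L2_dist U g' (gradient \<phi>) < \<epsilon>"
    unfolding H1_0_def by blast
  obtain G where G: "represents U g G" by (rule L2_representative[OF U(1) gL])
  obtain G' where G': "represents U g' G'" by (rule L2_representative[OF U(1) g'L])
  have Gs: "square_integrable G" "\<And>x. x \<notin> U \<Longrightarrow> G x = 0" and G's: "square_integrable G'" "\<And>x. x \<notin> U \<Longrightarrow> G' x = 0"
    using G G' by (auto simp: represents_def)
  have D: "square_integrable (\<lambda>x. G x - G' x)" by (rule square_integrable_diff[OF Gs(1) G's(1)])
  have "AE x in lborel. G x - G' x = 0"
  proof (rule fundamental_lemma[OF U D])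
    show "x \<notin> U \<Longrightarrow> G x - G' x = 0" for x using Gs(2) G's(2) by simp
    fix \<phi> :: "'a \<Rightarrow> real" assume \<phi>: "\<phi> \<in> test_functions U"
    have c: "continuous_on UNIV \<phi>" by (rule has_grad_continuous[OF test_function_gradient(1)[OF U(2) \<phi>]])
    have ps: "square_integrable \<phi>" by (rule test_function_square_integrable[OF U(2) \<phi>])
    note i = integrable_scaleR_l2[OF ps]
    have "(LINT x|lebesgue_on U. \<phi> x *\<^sub>R g x) = (LINT x|lebesgue_on U. \<phi> x *\<^sub>R g' x)"
      using wg wg' \<phi> unfolding has_weak_gradient_def by (metis neg_equal_iff_equal)
    then have "(LINT x|lborel. \<phi> x *\<^sub>R G x) = (LINT x|lborel. \<phi> x *\<^sub>R G' x)"
      using representative_scaleR_integral[OF U(1) gL G c] representative_scaleR_integral[OF U(1) g'L G' c] by simp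
    then show "(LINT x|lborel. \<phi> x *\<^sub>R (G x - G' x)) = 0"
      using i[OF Gs(1)] i[OF G's(1)] by (simp add: scaleR_diff_right)
  qed
  then have GG': "l2_norm (\<lambda>x. G' x - G x) = 0"
    using l2_norm_eq_0_iff[OF D] l2_norm_diff_commute[of G' G] by simp
  have "\<exists>\<phi>\<in>test_functions U. l2_norm (\<lambda>x. gradient \<phi> x - G x) < \<eta>" if \<eta>: "\<eta> > 0" for \<eta>
  proof -
    obtain \<phi> where \<phi>: "\<phi> \<in> test_functions U" "L2_dist U g' (gradient \<phi>) < \<eta>" using ap[OF \<eta>] by blast
    have "L2_dist U g' (gradient \<phi>) = l2_norm (\<lambda>x. G' x - gradient \<phi> x)"
      using L2_dist_representative[OF U(1) g'L G'] test_function_representative(2)[OF U \<phi>(1)] by blast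
    then have "l2_norm (\<lambda>x. gradient \<phi> x - G x) < \<eta>"
      using l2_norm_triangle_sub[OF test_function_gradient(3)[OF U(2) \<phi>(1)] G's(1) Gs(1)] GG' \<phi>(2)
        l2_norm_diff_commute[of G' "gradient \<phi>"] by linarith
    then show ?thesis using \<phi>(1) by blast
  qed
  then have "grad_closure U G" using Gs by (auto simp: grad_closure_def)
  then show ?thesis using that G by blast
qed

section \<open>Fields on the components\<close>

lemma smooth_inner_const:
  assumes "times_cont_diff k f" shows "times_cont_diff k (\<lambda>x. f x \<bullet> c)"
  using assms
proof (induction k arbitrary: f)
  case 0
  then show ?case by (simp add: continuous_on_inner)
next
  case (Suc k)
  note d = times_cont_diff_SucD[OF Suc.prems]
  show ?case
    by (rule times_cont_diff_SucI[OF has_derivative_inner_left[OF d(1)] Suc.IH[OF d(2)]])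
qed

lemma continuous_reg_kernel:
  assumes \<delta>: "\<delta> > 0"
  shows "continuous_on UNIV (\<lambda>y. reg_kernel \<delta> (x - y) :: 'a::euclidean_space)"
proof (subst continuous_on_componentwise, intro ballI)
  fix b :: 'a
  show "continuous_on UNIV (\<lambda>y. reg_kernel \<delta> (x - y) \<bullet> b)"
    by (rule continuous_on_diff_image(2)[OF has_grad_continuous[OF has_grad_reg_kernel[OF \<delta>]] continuous_on_id])
qed

text \<open>Integration by parts leaves the divergence of the kernel at \<open>x - y\<close>, a
  rescaled cone kernel. It vanishes for \<open>norm (x - y) \<ge> \<delta>\<close>, the boundary
  value included.\<close>

lemma reg_kernel_gradient_orthogonal:
  fixes \<phi> :: "'a::euclidean_space \<Rightarrow> real"
  assumes \<delta>: "\<delta> > 0" and \<phi>: "has_grad \<phi> p" "\<And>y. y \<notin> cball 0 S \<Longrightarrow> \<phi> y = 0" and far: "\<And>y. \<phi> y \<noteq> 0 \<Longrightarrow> \<delta> \<le> norm (x - y)"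
  shows "(LINT y|lborel. reg_kernel \<delta> (x - y) \<bullet> p y) = 0"
proof -
  note g = has_grad_reg_kernel[OF \<delta>]
  have gx: "has_grad (\<lambda>y. reg_kernel \<delta> (x - y) \<bullet> b) (\<lambda>y. - reg_kernel_grad \<delta> b (x - y))" for b :: 'a
    by (rule has_grad_reflect[OF g])
  note kc = has_grad_continuous[OF gx] and kgc = has_grad_continuous_grad[OF gx]
  have pc: "continuous_on UNIV p" by (rule has_grad_continuous_grad[OF \<phi>(1)])
  have pS: "p y = 0" if "y \<notin> cball 0 S" for y by (rule has_grad_support[OF \<phi> that])
  have i: "integrable lborel (\<lambda>y. (reg_kernel \<delta> (x - y) \<bullet> b) * (p y \<bullet> b))" for b
    by (rule integrable_continuous_bounded_support[of _ S]) (use pS in \<open>auto intro!: continuous_intros kc pc\<close>)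
  have i2: "integrable lborel (\<lambda>y. \<phi> y * (- reg_kernel_grad \<delta> b (x - y) \<bullet> b))" for b
    by (rule integrable_continuous_bounded_support[of _ S])
       (use \<phi>(2) in \<open>auto intro!: continuous_on_mult continuous_on_inner kgc has_grad_continuous[OF \<phi>(1)] simp del: inner_minus_left\<close>)
  have "(LINT y|lborel. reg_kernel \<delta> (x - y) \<bullet> p y) = (LINT y|lborel. (\<Sum>b\<in>Basis. (reg_kernel \<delta> (x - y) \<bullet> b) * (p y \<bullet> b)))"
    by (subst euclidean_inner) simp
  also have "\<dots> = (\<Sum>b\<in>Basis. LINT y|lborel. (reg_kernel \<delta> (x - y) \<bullet> b) * (p y \<bullet> b))"
    by (rule Bochner_Integration.integral_sum) (rule i)
  also have "\<dots> = (\<Sum>b\<in>Basis. - (LINT y|lborel. \<phi> y * (- reg_kernel_grad \<delta> b (x - y) \<bullet> b)))"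
  proof (rule sum.cong[OF refl])
    fix b :: 'a
    have "(LINT y|lborel. (p y \<bullet> b) * (reg_kernel \<delta> (x - y) \<bullet> b)) = - (LINT y|lborel. \<phi> y * (- reg_kernel_grad \<delta> b (x - y) \<bullet> b))"
      by (rule integral_by_parts[OF \<phi> gx])
    then show "(LINT y|lborel. (reg_kernel \<delta> (x - y) \<bullet> b) * (p y \<bullet> b)) = - (LINT y|lborel. \<phi> y * (- reg_kernel_grad \<delta> b (x - y) \<bullet> b))"
      by (simp only: mult.commute)
  qed
  also have "\<dots> = - (LINT y|lborel. (\<Sum>b\<in>Basis. \<phi> y * (- reg_kernel_grad \<delta> b (x - y) \<bullet> b)))"
    unfolding sum_negf by (subst Bochner_Integration.integral_sum) (auto simp only: i2)
  also have "(\<lambda>y. \<Sum>b\<in>Basis. \<phi> y * (- reg_kernel_grad \<delta> b (x - y) \<bullet> b)) = (\<lambda>y. 0)"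
  proof
    fix y
    have "(\<Sum>b\<in>Basis. \<phi> y * (- reg_kernel_grad \<delta> b (x - y) \<bullet> b)) = - \<phi> y * (\<Sum>b\<in>Basis. reg_kernel_grad \<delta> b (x - y) \<bullet> b)"
      by (simp add: sum_distrib_left sum_negf)
    also have "\<dots> = - \<phi> y * rescale \<delta> cone_kernel (x - y)" by (simp only: reg_kernel_divergence[OF \<delta>])
    also have "\<dots> = 0"
    proof (cases "\<phi> y = 0")
      case False
      have "1 \<le> norm ((1 / \<delta>) *\<^sub>R (x - y))" using far[OF False] \<delta> by (simp add: le_divide_eq)
      then have "1 \<le> (norm ((1 / \<delta>) *\<^sub>R (x - y)))\<^sup>2" by (metis one_le_power)
      then have "1 \<le> ((1 / \<delta>) *\<^sub>R (x - y)) \<bullet> ((1 / \<delta>) *\<^sub>R (x - y))" unfolding power2_norm_eq_inner .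
      then show ?thesis unfolding rescale_def cone_kernel_def by (simp only: max_def) auto
    qed simp
    finally show "(\<Sum>b\<in>Basis. \<phi> y * (- reg_kernel_grad \<delta> b (x - y) \<bullet> b)) = 0" .
  qed
  finally show ?thesis by simp
qed

text \<open>The kernel is the gradient of a C^1 function \<open>M\<close>, so integration by parts
  leaves \<open>M\<close> times the divergence of \<open>\<psi>\<close>.\<close>

lemma reg_kernel_solenoidal_orthogonal:
  fixes \<psi> :: "'a::euclidean_space \<Rightarrow> 'a"
  assumes d: "DIM('a) \<ge> 3" and \<delta>: "\<delta> > 0" and \<psi>: "\<And>k. times_cont_diff k \<psi>" "\<And>y. y \<notin> cball 0 S \<Longrightarrow> \<psi> y = 0"
    and div: "\<And>y. divergence \<psi> y = 0"
  shows "(LINT y|lborel. reg_kernel \<delta> (x - y) \<bullet> \<psi> y) = 0"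
proof -
  obtain m where m: "\<And>s. (m has_real_derivative radial_profile \<delta> (real DIM('a)) s) (at s)"
    by (rule radial_profile_antiderivative[OF \<delta>, of "real DIM('a)"]) (use d in auto)
  define M where "M z = m (z \<bullet> z) / 2" for z :: 'a
  have M: "has_grad M (reg_kernel \<delta>)"
    unfolding has_grad_def
  proof (intro conjI allI)
    fix z :: 'a
    have "((\<lambda>z. z \<bullet> z) has_derivative (\<lambda>v. 2 * (z \<bullet> v))) (at z)"
      by (auto intro!: derivative_eq_intros simp: inner_commute)
    from has_derivative_compose[OF this m[unfolded has_field_derivative_def]]
    have "((\<lambda>z. m (z \<bullet> z)) has_derivative (\<lambda>v. radial_profile \<delta> (real DIM('a)) (z \<bullet> z) * (2 * (z \<bullet> v)))) (at z)" .
    from has_derivative_mult_right[OF this, of "1/2"]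
    have "(M has_derivative (\<lambda>v. 1/2 * (radial_profile \<delta> (real DIM('a)) (z \<bullet> z) * (2 * (z \<bullet> v))))) (at z)"
      unfolding M_def[abs_def] by simp
    moreover have "(\<lambda>v. 1/2 * (radial_profile \<delta> (real DIM('a)) (z \<bullet> z) * (2 * (z \<bullet> v)))) = (\<bullet>) (reg_kernel \<delta> z)"
      by (simp add: fun_eq_iff reg_kernel_def)
    ultimately show "(M has_derivative (\<bullet>) (reg_kernel \<delta> z)) (at z)" by simp
    show "continuous_on UNIV (reg_kernel \<delta> :: 'a \<Rightarrow> 'a)"
    proof (subst continuous_on_componentwise, intro ballI)
      fix b :: 'a
      show "continuous_on UNIV (\<lambda>y. reg_kernel \<delta> y \<bullet> b)" by (rule has_grad_continuous[OF has_grad_reg_kernel[OF \<delta>]])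
    qed
  qed
  have Mx: "has_grad (\<lambda>y. M (x - y)) (\<lambda>y. - reg_kernel \<delta> (x - y))" by (rule has_grad_reflect[OF M])
  define p where "p b = gradient (\<lambda>y. \<psi> y \<bullet> b)" for b
  have p: "has_grad (\<lambda>y. \<psi> y \<bullet> b) (p b)" for b
    unfolding p_def by (rule smooth_has_grad(1)[OF smooth_inner_const[OF \<psi>(1)]])
  note Mc = has_grad_continuous[OF Mx] and kc = continuous_reg_kernel[OF \<delta>, of x]
  have \<psi>c: "continuous_on UNIV \<psi>" by (rule times_cont_diff_continuous[OF \<psi>(1)])
  have pS: "p b y = 0" if "y \<notin> cball 0 S" for y b by (rule has_grad_support[OF p _ that]) (use \<psi>(2) in simp)
  have pdiv: "(\<Sum>b\<in>Basis. p b y \<bullet> b) = 0" for y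
  proof -
    have "(\<psi> has_derivative frechet_derivative \<psi> (at y)) (at y)" by (rule times_cont_diff_SucD(1)[OF \<psi>(1)])
    from has_derivative_inner_left[OF this]
    have "(\<lambda>v. frechet_derivative \<psi> (at y) v \<bullet> b) = (\<lambda>v. p b y \<bullet> v)" for b
      using has_derivative_unique[OF _ has_gradD[OF p]] by blast
    then have "p b y \<bullet> b = frechet_derivative \<psi> (at y) b \<bullet> b" for b by metis
    then show ?thesis using div[of y] by (simp add: divergence_def)
  qed
  have "(LINT y|lborel. reg_kernel \<delta> (x - y) \<bullet> \<psi> y) = (LINT y|lborel. (\<Sum>b\<in>Basis. (reg_kernel \<delta> (x - y) \<bullet> b) * (\<psi> y \<bullet> b)))"
    by (subst euclidean_inner) simp
  also have "\<dots> = (\<Sum>b\<in>Basis. LINT y|lborel. (reg_kernel \<delta> (x - y) \<bullet> b) * (\<psi> y \<bullet> b))"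
  proof (rule Bochner_Integration.integral_sum)
    show "integrable lborel (\<lambda>y. (reg_kernel \<delta> (x - y) \<bullet> b) * (\<psi> y \<bullet> b))" for b
      by (rule integrable_continuous_bounded_support[of _ S]) (use \<psi>(2) in \<open>auto intro!: continuous_intros kc \<psi>c\<close>)
  qed
  also have "\<dots> = (\<Sum>b\<in>Basis. LINT y|lborel. (p b y \<bullet> b) * M (x - y))"
  proof (rule sum.cong[OF refl])
    fix b :: 'a
    have "(LINT y|lborel. (p b y \<bullet> b) * M (x - y)) = - (LINT y|lborel. (\<psi> y \<bullet> b) * (- reg_kernel \<delta> (x - y) \<bullet> b))"
      by (rule integral_by_parts[OF p _ Mx, of S]) (use \<psi>(2) in simp)
    then show "(LINT y|lborel. (reg_kernel \<delta> (x - y) \<bullet> b) * (\<psi> y \<bullet> b)) = (LINT y|lborel. (p b y \<bullet> b) * M (x - y))"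
      by (simp add: mult.commute)
  qed
  also have "\<dots> = (LINT y|lborel. (\<Sum>b\<in>Basis. (p b y \<bullet> b) * M (x - y)))"
  proof (rule Bochner_Integration.integral_sum[symmetric])
    show "integrable lborel (\<lambda>y. (p b y \<bullet> b) * M (x - y))" for b
      by (rule integrable_continuous_bounded_support[of _ S])
         (use pS in \<open>auto intro!: continuous_intros Mc has_grad_continuous_grad[OF p]\<close>)
  qed
  also have "\<dots> = 0" by (simp add: sum_distrib_right[symmetric] pdiv)
  finally show ?thesis .
qed

text \<open>The pairing with \<open>K\<close> is continuous in \<open>L\<^sup>2\<close> once
  \<open>K\<close> is cut off to a ball containing \<open>U\<close>, and the cutoff changes no
  pairing with a field supported in \<open>U\<close>.\<close>

lemma orthogonal_to_limit:
  fixes K G :: "'a::euclidean_space \<Rightarrow> 'a"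
  assumes U: "bounded U" and K: "continuous_on UNIV K" and G: "square_integrable G" "\<And>y. y \<notin> U \<Longrightarrow> G y = 0"
    and ap: "\<And>\<eta>. \<eta> > 0 \<Longrightarrow> \<exists>T. square_integrable T \<and> (\<forall>y. y \<notin> U \<longrightarrow> T y = 0) \<and> l2_norm (\<lambda>y. T y - G y) < \<eta> \<and> (LINT y|lborel. K y \<bullet> T y) = 0"
  shows "(LINT y|lborel. K y \<bullet> G y) = 0"
proof -
  obtain S where S: "\<And>x. x \<in> U \<Longrightarrow> norm x \<le> S" using U unfolding bounded_iff by blast
  define k where "k y = indicator (cball 0 S) y *\<^sub>R K y" for y
  have km: "k \<in> borel_measurable borel"
    unfolding k_def[abs_def] using borel_measurable_continuous[OF K] by (intro borel_measurable_scaleR borel_measurable_indicator) auto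
  obtain B where B: "B > 0" "\<And>y. y \<in> cball 0 S \<Longrightarrow> norm (K y) \<le> B"
    by (rule continuous_bounded_on_cball[OF K, of S]) blast
  have ks: "square_integrable k"
  proof (rule square_integrable_bounded_support(1)[OF km])
    show "norm (k y) \<le> B" for y using B by (cases "y \<in> cball 0 S") (auto simp: k_def)
    show "y \<notin> cball 0 S \<Longrightarrow> k y = 0" for y by (simp add: k_def)
  qed
  have kK: "K y \<bullet> T y = k y \<bullet> T y" if "\<forall>y. y \<notin> U \<longrightarrow> T y = 0" for T y
    using that S[of y] by (cases "y \<in> U") (auto simp: k_def)
  have "\<bar>LINT y|lborel. k y \<bullet> G y\<bar> \<le> 0 + \<epsilon>" if \<epsilon>: "\<epsilon> > 0" for \<epsilon>
  proof -
    have pos: "l2_norm k + 1 > 0" using l2_norm_nonneg[of k] by linarith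
    then have "\<epsilon> / (l2_norm k + 1) > 0" using \<epsilon> by simp
    then obtain T where T: "square_integrable T" "\<forall>y. y \<notin> U \<longrightarrow> T y = 0" "l2_norm (\<lambda>y. T y - G y) < \<epsilon> / (l2_norm k + 1)"
      "(LINT y|lborel. K y \<bullet> T y) = 0" using ap by blast
    have "(LINT y|lborel. k y \<bullet> T y) = 0" using T(4) kK[OF T(2)] by simp
    then have "(LINT y|lborel. k y \<bullet> G y) = - (LINT y|lborel. k y \<bullet> (T y - G y))"
      using integrable_inner_l2[OF ks T(1)] integrable_inner_l2[OF ks G(1)] by (simp add: inner_diff_right)
    then have "\<bar>LINT y|lborel. k y \<bullet> G y\<bar> \<le> l2_norm k * l2_norm (\<lambda>y. T y - G y)"
      using l2_cauchy_schwarz[OF ks square_integrable_diff[OF T(1) G(1)]] by simp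
    also have "\<dots> \<le> (l2_norm k + 1) * (\<epsilon> / (l2_norm k + 1))" using T(3) by (intro mult_mono) auto
    also have "\<dots> = \<epsilon>" using pos by simp
    finally show ?thesis by simp
  qed
  then have "\<bar>LINT y|lborel. k y \<bullet> G y\<bar> \<le> 0" by (rule field_le_epsilon)
  then show ?thesis using kK[of G] G(2) by simp
qed

lemma reg_kernel_orthogonal_closures:
  fixes U :: "'a::euclidean_space set"
  assumes d: "DIM('a) \<ge> 3" and U: "bounded U" and \<delta>: "\<delta> > 0" and far: "\<And>y. y \<in> U \<Longrightarrow> \<delta> \<le> norm (x - y)"
  shows "grad_closure U G \<Longrightarrow> (LINT y|lborel. reg_kernel \<delta> (x - y) \<bullet> G y) = 0"
    "solenoidal_closure U H \<Longrightarrow> (LINT y|lborel. reg_kernel \<delta> (x - y) \<bullet> H y) = 0"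
proof -
  obtain S where S: "\<And>x. x \<in> U \<Longrightarrow> norm x \<le> S" using U unfolding bounded_iff by blast
  show "(LINT y|lborel. reg_kernel \<delta> (x - y) \<bullet> G y) = 0" if G: "grad_closure U G"
  proof (rule orthogonal_to_limit[OF U continuous_reg_kernel[OF \<delta>]])
    show "square_integrable G" "\<And>y. y \<notin> U \<Longrightarrow> G y = 0" using G by (auto simp: grad_closure_def)
    fix \<eta> :: real assume "\<eta> > 0"
    then obtain \<phi> where \<phi>: "\<phi> \<in> test_functions U" "l2_norm (\<lambda>x. gradient \<phi> x - G x) < \<eta>"
      using G unfolding grad_closure_def by blast
    note g = test_function_gradient[OF U \<phi>(1)] and t = test_functionsD(3)[OF \<phi>(1)]
    have "(LINT y|lborel. reg_kernel \<delta> (x - y) \<bullet> gradient \<phi> y) = 0"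
      by (rule reg_kernel_gradient_orthogonal[OF \<delta> g(1), of S]) (use t S far in force)+
    then show "\<exists>T. square_integrable T \<and> (\<forall>y. y \<notin> U \<longrightarrow> T y = 0) \<and> l2_norm (\<lambda>y. T y - G y) < \<eta> \<and> (LINT y|lborel. reg_kernel \<delta> (x - y) \<bullet> T y) = 0"
      using g \<phi>(2) by blast
  qed
  show "(LINT y|lborel. reg_kernel \<delta> (x - y) \<bullet> H y) = 0" if H: "solenoidal_closure U H"
  proof (rule orthogonal_to_limit[OF U continuous_reg_kernel[OF \<delta>]])
    show "square_integrable H" "\<And>y. y \<notin> U \<Longrightarrow> H y = 0" using H by (auto simp: solenoidal_closure_def)
    fix \<eta> :: real assume "\<eta> > 0"
    then obtain \<psi> where \<psi>: "\<psi> \<in> test_functions U" "\<forall>x. divergence \<psi> x = 0" "l2_norm (\<lambda>x. \<psi> x - H x) < \<eta>"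
      using H unfolding solenoidal_closure_def by blast
    note t = test_functionsD(1,3)[OF \<psi>(1)]
    have "(LINT y|lborel. reg_kernel \<delta> (x - y) \<bullet> \<psi> y) = 0"
      by (rule reg_kernel_solenoidal_orthogonal[OF d \<delta> t(1), of S]) (use t(2) S \<psi>(2) in force)+
    then show "\<exists>T. square_integrable T \<and> (\<forall>y. y \<notin> U \<longrightarrow> T y = 0) \<and> l2_norm (\<lambda>y. T y - H y) < \<eta> \<and> (LINT y|lborel. reg_kernel \<delta> (x - y) \<bullet> T y) = 0"
      using test_function_square_integrable[OF U \<psi>(1)] t(2) \<psi>(3) by blast
  qed
qed

text \<open>Seen from \<open>x\<close>, all of \<open>\<Omega>\<close> lies where the regularisation
  has not changed the kernel.\<close>

lemma magnetic_potential_eq: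
  fixes \<Omega> :: "'a::euclidean_space set"
  assumes d: "DIM('a) \<ge> 3" and \<Omega>: "open \<Omega>" and f: "f \<in> L2 \<Omega>" "represents \<Omega> f F"
    and \<delta>: "\<delta> > 0" and far: "\<And>y. y \<in> \<Omega> \<Longrightarrow> \<delta> \<le> norm (x - y)"
  shows "magnetic_potential \<Omega> f x = - (1 / unit_sphere_area TYPE('a)) * (LINT y|lborel. reg_kernel \<delta> (x - y) \<bullet> F y)"
proof -
  let ?A = "unit_sphere_area TYPE('a)"
  have kc: "continuous_on UNIV (\<lambda>y. reg_kernel \<delta> (x - y) :: 'a)" by (rule continuous_reg_kernel[OF \<delta>])
  have Fm: "F \<in> borel_measurable borel" using f(2) by (auto simp: represents_def intro: square_integrable_measurable)
  have km: "(\<lambda>y. reg_kernel \<delta> (x - y) :: 'a) \<in> borel_measurable borel" by (rule borel_measurable_continuous[OF kc])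
  have "magnetic_potential \<Omega> f x = (LINT y|lebesgue_on \<Omega>. - (1 / ?A) * (reg_kernel \<delta> (x - y) \<bullet> f y))"
    unfolding magnetic_potential_def
  proof (rule Bochner_Integration.integral_cong[OF refl])
    fix y assume "y \<in> space (lebesgue_on \<Omega>)"
    then have "\<delta> \<le> norm (x - y)" using far by (simp add: space_restrict_space)
    then show "gradient newton_kernel (x - y) \<bullet> f y = - (1 / ?A) * (reg_kernel \<delta> (x - y) \<bullet> f y)"
      using gradient_newton_kernel[OF d \<delta>, of "x - y"] by simp
  qed
  also have "\<dots> = - (1 / ?A) * (LINT y|lebesgue_on \<Omega>. reg_kernel \<delta> (x - y) \<bullet> f y)" by simp
  also have "(LINT y|lebesgue_on \<Omega>. reg_kernel \<delta> (x - y) \<bullet> f y) = (LINT y|lborel. reg_kernel \<delta> (x - y) \<bullet> F y)"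
  proof (rule LINT_lebesgue_on_eq(1)[OF \<Omega>])
    have "AE y in lebesgue_on \<Omega>. f y = F y" using f(2) by (simp add: represents_def)
    then show "AE y in lebesgue_on \<Omega>. reg_kernel \<delta> (x - y) \<bullet> f y = reg_kernel \<delta> (x - y) \<bullet> F y" by eventually_elim simp
    show "(\<lambda>y. reg_kernel \<delta> (x - y) \<bullet> f y) \<in> borel_measurable (lebesgue_on \<Omega>)"
      by (rule borel_measurable_inner[OF borel_imp_lebesgue_on[OF km] L2_measurable[OF f(1)]])
    show "(\<lambda>y. reg_kernel \<delta> (x - y) \<bullet> F y) \<in> borel_measurable borel"
      by (rule borel_measurable_inner[OF km Fm])
  qed (use f(2) in \<open>simp add: represents_def\<close>)
  finally show ?thesis .
qed

section \<open>Cutting test functions down to a component\<close>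

lemma zero_ext_has_derivative:
  fixes f :: "'a::euclidean_space \<Rightarrow> 'b::euclidean_space"
  assumes U: "open U" and C: "closed (C \<inter> U)" and f: "\<And>x. x \<notin> C \<Longrightarrow> f x = 0" and d: "\<And>x. (f has_derivative D x) (at x)"
  shows "(zero_ext U f has_derivative (if x \<in> U then D x else (\<lambda>v. 0))) (at x)"
proof (cases "x \<in> U")
  case True
  have "(zero_ext U f has_derivative D x) (at x)"
    by (rule has_derivative_transform_within_open[OF d U True]) (simp add: zero_ext_def)
  then show ?thesis using True by simp
next
  case False
  have "(zero_ext U f has_derivative (\<lambda>v. 0)) (at x)"
  proof (rule has_derivative_transform_within_open[OF has_derivative_const])
    show "open (- (C \<inter> U))" using C by (rule open_Compl)
    show "x \<in> - (C \<inter> U)" using False by simp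
    show "0 = zero_ext U f y" if "y \<in> - (C \<inter> U)" for y using that f[of y] by (auto simp: zero_ext_def)
  qed
  then show ?thesis using False by simp
qed

text \<open>Because \<open>C \<inter> U\<close> is closed, the extension vanishes near every point
  outside \<open>U\<close>. The induction keeps the same \<open>C\<close>, since the derivatives of
  \<open>f\<close> vanish off the closed set \<open>C\<close> too.\<close>

lemma smooth_zero_ext:
  fixes f :: "'a::euclidean_space \<Rightarrow> 'b::euclidean_space"
  assumes U: "open U" and C: "closed C" "closed (C \<inter> U)" and f: "times_cont_diff k f" "\<And>x. x \<notin> C \<Longrightarrow> f x = 0"
  shows "times_cont_diff k (zero_ext U f)"
  using f
proof (induction k arbitrary: f)
  case 0
  have "continuous_on (U \<union> - (C \<inter> U)) (zero_ext U f)"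
  proof (rule continuous_on_open_Un)
    show "open U" by (rule U)
    show "open (- (C \<inter> U))" using C(2) by (rule open_Compl)
    have "continuous_on U f" using 0 by (auto intro: continuous_on_subset)
    then show "continuous_on U (zero_ext U f)" by (rule continuous_on_eq) (simp add: zero_ext_def)
    have "continuous_on (- (C \<inter> U)) (\<lambda>x. 0 :: 'b)" by (rule continuous_on_const)
    then show "continuous_on (- (C \<inter> U)) (zero_ext U f)"
      by (rule continuous_on_eq) (use 0(2) in \<open>auto simp: zero_ext_def\<close>)
  qed
  moreover have "U \<union> - (C \<inter> U) = UNIV" by blast
  ultimately show ?case by simp
next
  case (Suc k)
  note d = times_cont_diff_SucD[OF Suc.prems(1)]
  show ?case
  proof (rule times_cont_diff_SucI[OF zero_ext_has_derivative[OF U C(2) Suc.prems(2) d(1)]])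
    fix b :: 'a assume b: "b \<in> Basis"
    have "times_cont_diff k (zero_ext U (\<lambda>x. frechet_derivative f (at x) b))"
    proof (rule Suc.IH[OF d(2)[OF b]])
      fix x assume x: "x \<notin> C"
      have "(f has_derivative (\<lambda>v. 0)) (at x)"
        by (rule has_derivative_transform_within_open[OF has_derivative_const, of "- C"])
           (use C(1) x Suc.prems(2) in auto)
      then show "frechet_derivative f (at x) b = 0" using frechet_derivative_at by metis
    qed
    moreover have "zero_ext U (\<lambda>x. frechet_derivative f (at x) b) = (\<lambda>x. (if x \<in> U then frechet_derivative f (at x) else (\<lambda>v. 0)) b)"
      by (auto simp: zero_ext_def fun_eq_iff)
    ultimately show "times_cont_diff k (\<lambda>x. (if x \<in> U then frechet_derivative f (at x) else (\<lambda>v. 0)) b)" by simp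
  qed
qed

text \<open>A component is open and also relatively closed in \<open>\<Omega>\<close>, so the
  compact support of \<open>\<phi>\<close> meets it in a compact set.\<close>

lemma zero_ext_test_function:
  fixes \<phi> :: "'a::euclidean_space \<Rightarrow> 'b::euclidean_space"
  assumes \<Omega>: "open \<Omega>" and U: "U \<in> components \<Omega>" and \<phi>: "\<phi> \<in> test_functions \<Omega>"
  shows "zero_ext U \<phi> \<in> test_functions U"
    "(zero_ext U \<phi> has_derivative (if x \<in> U then frechet_derivative \<phi> (at x) else (\<lambda>v. 0))) (at x)"
proof -
  define C where "C = closure {x. \<phi> x \<noteq> 0}"
  have C: "compact C" "C \<subseteq> \<Omega>" and \<phi>C: "\<And>x. x \<notin> C \<Longrightarrow> \<phi> x = 0"
    using \<phi> closure_subset[of "{x. \<phi> x \<noteq> 0}"] by (auto simp: C_def test_functions_def)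
  have oU: "open U" by (rule open_components[OF \<Omega> U])
  have "closedin (top_of_set \<Omega>) U" by (rule closedin_component[OF U])
  then obtain T where T: "closed T" "U = \<Omega> \<inter> T" by (auto simp: closedin_closed)
  have CU: "C \<inter> U = C \<inter> T" using C(2) T(2) by blast
  have cCU: "compact (C \<inter> U)" unfolding CU by (rule compact_Int_closed[OF C(1) T(1)])
  show "zero_ext U \<phi> \<in> test_functions U"
  proof (rule test_functionsI)
    show "times_cont_diff k (zero_ext U \<phi>)" for k
      by (rule smooth_zero_ext[OF oU compact_imp_closed[OF C(1)] compact_imp_closed[OF cCU] test_functionsD(1)[OF \<phi>] \<phi>C])
    show "compact (C \<inter> U)" by (rule cCU)
    show "zero_ext U \<phi> x \<noteq> 0 \<Longrightarrow> x \<in> C \<inter> U" for x using \<phi>C by (auto simp: zero_ext_def split: if_splits)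
  qed auto
  show "(zero_ext U \<phi> has_derivative (if x \<in> U then frechet_derivative \<phi> (at x) else (\<lambda>v. 0))) (at x)"
    by (rule zero_ext_has_derivative[OF oU compact_imp_closed[OF cCU] \<phi>C times_cont_diff_SucD(1)[OF test_functionsD(1)[OF \<phi>]]])
qed

lemma l2_norm_zero_ext_le:
  fixes g :: "'a::euclidean_space \<Rightarrow> 'b::euclidean_space"
  assumes U: "open U" and g: "square_integrable g"
  shows "square_integrable (zero_ext U g)" "l2_norm (zero_ext U g) \<le> l2_norm g"
proof -
  have eq: "zero_ext U g = (\<lambda>x. indicator U x *\<^sub>R g x)" by (auto simp: fun_eq_iff zero_ext_def)
  have m: "zero_ext U g \<in> borel_measurable borel"
    unfolding eq using U square_integrable_measurable[OF g] by (intro borel_measurable_scaleR borel_measurable_indicator) auto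
  have le: "norm (zero_ext U g x) \<le> norm (g x)" for x by (simp add: zero_ext_def)
  show "square_integrable (zero_ext U g)" "l2_norm (zero_ext U g) \<le> l2_norm g" using l2_norm_mono[OF g m le] by auto
qed

text \<open>Zero extension from a component commutes with the gradient of a test function and does
  not increase the \<open>L\<^sup>2\<close> norm, so approximations on \<open>\<Omega>\<close> yield
  approximations on the component.\<close>

lemma grad_closure_component:
  fixes G :: "'a::euclidean_space \<Rightarrow> 'a"
  assumes \<Omega>: "open \<Omega>" "bounded \<Omega>" and U: "U \<in> components \<Omega>" and G: "square_integrable G"
    and ap: "\<And>\<eta>. \<eta> > 0 \<Longrightarrow> \<exists>\<phi>\<in>test_functions \<Omega>. l2_norm (\<lambda>x. gradient \<phi> x - G x) < \<eta>"
  shows "grad_closure U (zero_ext U G)"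
proof -
  have oU: "open U" by (rule open_components[OF \<Omega>(1) U])
  have "\<exists>\<phi>\<in>test_functions U. l2_norm (\<lambda>x. gradient \<phi> x - zero_ext U G x) < \<eta>" if \<eta>: "\<eta> > 0" for \<eta>
  proof -
    obtain \<phi> where \<phi>: "\<phi> \<in> test_functions \<Omega>" "l2_norm (\<lambda>x. gradient \<phi> x - G x) < \<eta>" using ap[OF \<eta>] by blast
    note z = zero_ext_test_function[OF \<Omega>(1) U \<phi>(1)]
    have "gradient (zero_ext U \<phi>) x - zero_ext U G x = zero_ext U (\<lambda>x. gradient \<phi> x - G x) x" for x
      unfolding gradient_def frechet_derivative_at[OF z(2), symmetric] by (simp add: zero_ext_def)
    then have "l2_norm (\<lambda>x. gradient (zero_ext U \<phi>) x - zero_ext U G x) \<le> l2_norm (\<lambda>x. gradient \<phi> x - G x)"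
      using l2_norm_zero_ext_le(2)[OF oU square_integrable_diff[OF test_function_gradient(3)[OF \<Omega>(2) \<phi>(1)] G]] by simp
    then show ?thesis using z(1) \<phi>(2) by (intro bexI[of _ "zero_ext U \<phi>"]) auto
  qed
  then show ?thesis using l2_norm_zero_ext_le(1)[OF oU G] by (auto simp: grad_closure_def zero_ext_def)
qed

lemma solenoidal_closure_component:
  fixes H :: "'a::euclidean_space \<Rightarrow> 'a"
  assumes \<Omega>: "open \<Omega>" "bounded \<Omega>" and U: "U \<in> components \<Omega>" and H: "square_integrable H"
    and ap: "\<And>\<eta>. \<eta> > 0 \<Longrightarrow> \<exists>\<psi>\<in>test_functions \<Omega>. (\<forall>x. divergence \<psi> x = 0) \<and> l2_norm (\<lambda>x. \<psi> x - H x) < \<eta>"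
  shows "solenoidal_closure U (zero_ext U H)"
proof -
  have oU: "open U" by (rule open_components[OF \<Omega>(1) U])
  have "\<exists>\<psi>\<in>test_functions U. (\<forall>x. divergence \<psi> x = 0) \<and> l2_norm (\<lambda>x. \<psi> x - zero_ext U H x) < \<eta>" if \<eta>: "\<eta> > 0" for \<eta>
  proof -
    obtain \<psi> where \<psi>: "\<psi> \<in> test_functions \<Omega>" "\<forall>x. divergence \<psi> x = 0" "l2_norm (\<lambda>x. \<psi> x - H x) < \<eta>" using ap[OF \<eta>] by blast
    note z = zero_ext_test_function[OF \<Omega>(1) U \<psi>(1)]
    have dv: "divergence (zero_ext U \<psi>) x = 0" for x
      using \<psi>(2) unfolding divergence_def frechet_derivative_at[OF z(2), symmetric] by simp
    have "zero_ext U \<psi> x - zero_ext U H x = zero_ext U (\<lambda>x. \<psi> x - H x) x" for x by (simp add: zero_ext_def)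
    then have "l2_norm (\<lambda>x. zero_ext U \<psi> x - zero_ext U H x) \<le> l2_norm (\<lambda>x. \<psi> x - H x)"
      using l2_norm_zero_ext_le(2)[OF oU square_integrable_diff[OF test_function_square_integrable[OF \<Omega>(2) \<psi>(1)] H]] by simp
    then show ?thesis using z(1) \<psi>(3) dv by (intro bexI[of _ "zero_ext U \<psi>"]) auto
  qed
  then show ?thesis using l2_norm_zero_ext_le(1)[OF oU H] by (auto simp: solenoidal_closure_def zero_ext_def)
qed

theorem corollary3p6:
  fixes \<Omega> :: "'a::euclidean_space set" and \<omega> :: "nat \<Rightarrow> 'a set" and N :: nat
  assumes "DIM('a) \<ge> 3"
    and "lipschitz_cluster \<Omega>"
    and "bij_betw \<omega> {1..N} (components \<Omega>)"
  shows "L2_direct_sum \<Omega> {1..N}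
           (\<lambda>i. zero_ext (\<omega> i) ` space_sum (grad_H1_0 (\<omega> i)) (H_div_0 (\<omega> i)))
           (magnetic_null_space \<Omega>)"
proof -
  let ?V = "\<lambda>i. zero_ext (\<omega> i) ` space_sum (grad_H1_0 (\<omega> i)) (H_div_0 (\<omega> i))"
  have lip: "lipschitz_open \<Omega>" and bdd: "bounded \<Omega>"
    using assms(2) by (auto simp: lipschitz_cluster_def)
  have op: "open \<Omega>" using lip by (simp add: lipschitz_open_def)
  have comp: "\<omega> i \<in> components \<Omega>" if "i \<in> {1..N}" for i using assms(3) that by (rule bij_betwE[rule_format])
  have sub: "\<omega> i \<subseteq> \<Omega>" if "i \<in> {1..N}" for i using in_components_subset[OF comp[OF that]] .
  have opi: "open (\<omega> i)" if "i \<in> {1..N}" for i by (rule open_components[OF op comp[OF that]])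
  have bdi: "bounded (\<omega> i)" if "i \<in> {1..N}" for i by (rule bounded_subset[OF bdd sub[OF that]])
  have disj: "i = j" if "i \<in> {1..N}" "j \<in> {1..N}" "x \<in> \<omega> i" "x \<in> \<omega> j" for i j x
  proof -
    have "\<omega> i = \<omega> j" using components_nonoverlap[OF comp[OF that(1)] comp[OF that(2)]] that(3,4) by blast
    then show ?thesis by (rule inj_onD[OF bij_betw_imp_inj_on[OF assms(3)] _ that(1,2)])
  qed
  have cover: "\<exists>j\<in>{1..N}. x \<in> \<omega> j" if "x \<in> \<Omega>" for x
  proof -
    have "x \<in> \<Union>(components \<Omega>)" using that by (simp only: Union_components)
    then obtain U where U: "U \<in> components \<Omega>" "x \<in> U" by (rule UnionE)
    have "U \<in> \<omega> ` {1..N}" using U(1) bij_betw_imp_surj_on[OF assms(3)] by (simp only:)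
    then obtain j where "j \<in> {1..N}" "U = \<omega> j" by blast
    then show ?thesis using U(2) by blast
  qed
  have single: "(\<Sum>i\<in>{1..N}. g i x) = g j x"
    if j: "j \<in> {1..N}" "x \<in> \<omega> j" and g: "\<And>i. i \<in> {1..N} \<Longrightarrow> x \<notin> \<omega> i \<Longrightarrow> g i x = 0" for g :: "nat \<Rightarrow> 'a \<Rightarrow> 'a" and j x
  proof -
    have "(\<Sum>i\<in>{1..N}. g i x) = (\<Sum>i\<in>{j}. g i x)"
    proof (rule sum.mono_neutral_right)
      show "\<forall>i\<in>{1..N} - {j}. g i x = 0"
      proof
        fix i assume i: "i \<in> {1..N} - {j}"
        then have "x \<notin> \<omega> i" using disj[OF _ j(1) _ j(2), of i] by blast
        then show "g i x = 0" using g[of i] i by blast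
      qed
    qed (use j(1) in auto)
    then show ?thesis by simp
  qed
  have Vz: "g x = 0" if "g \<in> ?V i" "x \<notin> \<omega> i" for g i x using that by (auto simp: zero_ext_def)
  \<comment> \<open>Elements of \<open>?V i\<close> vanish exactly outside
    \<open>\<omega> i\<close>, so at a point of a component both sums reduce to a single
    term.\<close>
  have uniq: "AE x in lebesgue_on \<Omega>. g i x = h i x"
    if gh: "\<forall>i\<in>{1..N}. g i \<in> ?V i \<and> h i \<in> ?V i" and eq: "AE x in lebesgue_on \<Omega>. (\<Sum>i\<in>{1..N}. g i x) = (\<Sum>i\<in>{1..N}. h i x)"
      and i: "i \<in> {1..N}" for g h :: "nat \<Rightarrow> 'a \<Rightarrow> 'a" and i
    using eq
  proof eventually_elim
    case (elim x)
    show "g i x = h i x"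
    proof (cases "x \<in> \<omega> i")
      case True
      have "(\<Sum>i\<in>{1..N}. g i x) = g i x" "(\<Sum>i\<in>{1..N}. h i x) = h i x"
        by (rule single[OF i True]; use gh Vz in blast)+
      then show ?thesis using elim by simp
    next
      case False
      then show ?thesis using Vz gh i by metis
    qed
  qed
  have fwd: "\<exists>g. (\<forall>i\<in>{1..N}. g i \<in> ?V i) \<and> (AE x in lebesgue_on \<Omega>. f x = (\<Sum>i\<in>{1..N}. g i x))"
    if f: "f \<in> magnetic_null_space \<Omega>" for f
  proof -
    have fL: "f \<in> L2 \<Omega>" and null: "\<And>x. x \<in> - closure \<Omega> \<Longrightarrow> magnetic_potential \<Omega> f x = 0"
      using f by (auto simp: magnetic_null_space_def)
    obtain F where F: "represents \<Omega> f F" by (rule L2_representative[OF op fL])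
    have Fs: "square_integrable F" "\<And>x. x \<notin> \<Omega> \<Longrightarrow> F x = 0" using F by (auto simp: represents_def)
    obtain S where S: "\<And>x. x \<in> \<Omega> \<Longrightarrow> norm x \<le> S" using bdd unfolding bounded_iff by blast
    \<comment> \<open>Such a point is outside the closure, where the magnetic potential vanishes;
      there it is a nonzero multiple of the regularised potential.\<close>
    have pot: "potential \<delta> F x = 0" if \<delta>: "\<delta> > 0" and far: "\<And>y. y \<in> \<Omega> \<Longrightarrow> \<delta> < norm (x - y)" for \<delta> x
    proof -
      have "\<Omega> \<subseteq> - ball x \<delta>" using far by (force simp: dist_norm)
      then have "closure \<Omega> \<subseteq> - ball x \<delta>" by (intro closure_minimal) auto
      then have "x \<in> - closure \<Omega>" using \<delta> by auto
      from null[OF this] have "- (1 / unit_sphere_area TYPE('a)) * (LINT y|lborel. reg_kernel \<delta> (x - y) \<bullet> F y) = 0"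
        using magnetic_potential_eq[OF assms(1) op fL F \<delta>, of x] far by (simp add: less_imp_le)
      then have "(LINT y|lborel. reg_kernel \<delta> (x - y) \<bullet> F y) = 0" using unit_sphere_area_pos[where 'a = 'a] by simp
      moreover have "potential \<delta> F x = (LINT y|lborel. reg_kernel \<delta> (x - y) \<bullet> F y)"
        by (rule potential_eq[OF Fs(1) _ \<delta>, of S]) (use Fs(2) S in force)
      ultimately show ?thesis by simp
    qed
    obtain G H where G: "square_integrable G" and H: "square_integrable H" and FGH: "\<And>x. F x = G x + H x"
      and Gap: "\<And>\<eta>. \<eta> > 0 \<Longrightarrow> \<exists>\<phi>\<in>test_functions \<Omega>. l2_norm (\<lambda>x. gradient \<phi> x - G x) < \<eta>"
      and Hap: "\<And>\<eta>. \<eta> > 0 \<Longrightarrow> \<exists>\<psi>\<in>test_functions \<Omega>. (\<forall>x. divergence \<psi> x = 0) \<and> l2_norm (\<lambda>x. \<psi> x - H x) < \<eta>"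
      by (rule helmholtz_decomposition[OF lip bdd Fs pot]) blast+
    \<comment> \<open>The decomposition is made once on all of \<open>\<Omega>\<close> and then cut
      along the components. The inner extensions give members of the two spaces, the outer one the
      form required by \<open>?V i\<close>.\<close>
    define g where "g i = zero_ext (\<omega> i) (\<lambda>x. zero_ext (\<omega> i) G x + zero_ext (\<omega> i) H x)" for i
    have gV: "g i \<in> ?V i" if i: "i \<in> {1..N}" for i
    proof -
      have "zero_ext (\<omega> i) G \<in> grad_H1_0 (\<omega> i)"
        by (rule grad_closure_grad_H1_0[OF opi[OF i] bdi[OF i] grad_closure_component[OF op bdd comp[OF i] G Gap]])
      moreover have "zero_ext (\<omega> i) H \<in> H_div_0 (\<omega> i)"
        by (rule solenoidal_closure_H_div_0[OF opi[OF i] bdi[OF i] solenoidal_closure_component[OF op bdd comp[OF i] H Hap]])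
      ultimately show ?thesis unfolding g_def space_sum_def by blast
    qed
    have "AE x in lebesgue_on \<Omega>. f x = F x" using F by (simp add: represents_def)
    moreover have "AE x in lebesgue_on \<Omega>. x \<in> \<Omega>" by (rule AE_I2) (simp add: space_restrict_space)
    ultimately have "AE x in lebesgue_on \<Omega>. f x = (\<Sum>i\<in>{1..N}. g i x)"
    proof eventually_elim
      case (elim x)
      obtain j where j: "j \<in> {1..N}" "x \<in> \<omega> j" using cover[OF elim(2)] by blast
      have "(\<Sum>i\<in>{1..N}. g i x) = g j x" by (rule single[OF j]) (simp add: g_def zero_ext_def)
      also have "\<dots> = F x" using j(2) by (simp add: g_def zero_ext_def FGH)
      finally show ?case using elim(1) by simp
    qed
    then show ?thesis using gV by blast
  qed
  have bwd: "f \<in> magnetic_null_space \<Omega>"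
    if fL: "f \<in> L2 \<Omega>" and gV: "\<forall>i\<in>{1..N}. g i \<in> ?V i" and ae: "AE x in lebesgue_on \<Omega>. f x = (\<Sum>i\<in>{1..N}. g i x)" for f g
  proof -
    obtain F where F: "represents \<Omega> f F" by (rule L2_representative[OF op fL])
    \<comment> \<open>Borel representatives are chosen on each component. Both sides vanish outside
      \<open>\<omega> i\<close>, so the equality holds almost everywhere on the whole space and the
      summands can be compared there.\<close>
    have "\<forall>i\<in>{1..N}. \<exists>A B. grad_closure (\<omega> i) A \<and> solenoidal_closure (\<omega> i) B \<and> (AE x in lborel. g i x = A x + B x)"
    proof
      fix i assume i: "i \<in> {1..N}"
      from gV i obtain a b where ab: "a \<in> grad_H1_0 (\<omega> i)" "b \<in> H_div_0 (\<omega> i)" "g i = zero_ext (\<omega> i) (\<lambda>x. a x + b x)"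
        unfolding space_sum_def by blast
      obtain A where A: "represents (\<omega> i) a A" "grad_closure (\<omega> i) A" by (rule grad_H1_0_grad_closure[OF opi[OF i] bdi[OF i] ab(1)])
      obtain B where B: "represents (\<omega> i) b B" "solenoidal_closure (\<omega> i) B" by (rule H_div_0_solenoidal_closure[OF opi[OF i] bdi[OF i] ab(2)])
      have "AE x in lborel. x \<in> \<omega> i \<longrightarrow> a x = A x" "AE x in lborel. x \<in> \<omega> i \<longrightarrow> b x = B x"
        using A(1) B(1) AE_lebesgue_on[OF opi[OF i]] by (simp_all add: represents_def)
      then have "AE x in lborel. g i x = A x + B x"
      proof eventually_elim
        case (elim x)
        show ?case
        proof (cases "x \<in> \<omega> i")
          case False
          then have "A x = 0" "B x = 0" using A(1) B(1) by (auto simp: represents_def)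
          then show ?thesis using False by (simp add: ab(3) zero_ext_def)
        qed (use elim in \<open>simp add: ab(3) zero_ext_def\<close>)
      qed
      then show "\<exists>A B. grad_closure (\<omega> i) A \<and> solenoidal_closure (\<omega> i) B \<and> (AE x in lborel. g i x = A x + B x)" using A B by blast
    qed
    then obtain A B where A: "\<And>i. i \<in> {1..N} \<Longrightarrow> grad_closure (\<omega> i) (A i)" and B: "\<And>i. i \<in> {1..N} \<Longrightarrow> solenoidal_closure (\<omega> i) (B i)"
      and AB: "\<And>i. i \<in> {1..N} \<Longrightarrow> AE x in lborel. g i x = A i x + B i x" by metis
    have As: "square_integrable (A i)" "\<And>x. x \<notin> \<omega> i \<Longrightarrow> A i x = 0" if "i \<in> {1..N}" for i using A[OF that] by (auto simp: grad_closure_def)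
    have Bs: "square_integrable (B i)" "\<And>x. x \<notin> \<omega> i \<Longrightarrow> B i x = 0" if "i \<in> {1..N}" for i using B[OF that] by (auto simp: solenoidal_closure_def)
    have "AE x in lborel. \<forall>i\<in>{1..N}. g i x = A i x + B i x" by (rule AE_finite_allI) (use AB in auto)
    moreover have "AE x in lborel. x \<in> \<Omega> \<longrightarrow> f x = F x" using F AE_lebesgue_on[OF op] by (simp add: represents_def)
    moreover have "AE x in lborel. x \<in> \<Omega> \<longrightarrow> f x = (\<Sum>i\<in>{1..N}. g i x)" using ae AE_lebesgue_on[OF op] by simp
    ultimately have Fae: "AE x in lborel. F x = (\<Sum>i\<in>{1..N}. A i x + B i x)"
    proof eventually_elim
      case (elim x)
      show ?case
      proof (cases "x \<in> \<Omega>")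
        case True
        then have "F x = (\<Sum>i\<in>{1..N}. g i x)" using elim by simp
        also have "\<dots> = (\<Sum>i\<in>{1..N}. A i x + B i x)" using elim(1) by (intro sum.cong) auto
        finally show ?thesis .
      next
        case False
        have "A i x + B i x = 0" if "i \<in> {1..N}" for i using As(2)[OF that] Bs(2)[OF that] sub[OF that] False by (metis add_0 subsetD)
        then show ?thesis using F False by (simp add: represents_def)
      qed
    qed
    have "magnetic_potential \<Omega> f x = 0" if x: "x \<in> - closure \<Omega>" for x
    proof -
      have "open (- closure \<Omega>)" by auto
      \<comment> \<open>The radius of a ball about \<open>x\<close> that misses the closure serves
        as regularisation radius: the regularised kernel is then proportional to the gradient of the
        Newton kernel on all of \<open>\<Omega>\<close>.\<close>
      then obtain \<delta> where \<delta>: "\<delta> > 0" "ball x \<delta> \<subseteq> - closure \<Omega>" using x open_contains_ball by metis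
      have far: "\<delta> \<le> norm (x - y)" if "y \<in> \<Omega>" for y
      proof (rule ccontr)
        assume "\<not> \<delta> \<le> norm (x - y)"
        then have "y \<in> ball x \<delta>" by (simp add: dist_norm)
        then show False using \<delta>(2) that closure_subset by blast
      qed
      let ?k = "\<lambda>y. reg_kernel \<delta> (x - y) :: 'a"
      have kc: "continuous_on UNIV ?k" by (rule continuous_reg_kernel[OF \<delta>(1)])
      have km: "?k \<in> borel_measurable borel" by (rule borel_measurable_continuous[OF kc])
      have int: "integrable lborel (\<lambda>y. ?k y \<bullet> T y)"
        if i: "i \<in> {1..N}" and T: "square_integrable T" "\<And>x. x \<notin> \<omega> i \<Longrightarrow> T x = 0" for T i
      proof -
        obtain S where S: "\<And>x. x \<in> \<omega> i \<Longrightarrow> norm x \<le> S" using bdi[OF i] unfolding bounded_iff by blast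
        have TS: "T x = 0" if "x \<notin> cball 0 S" for x using T(2)[of x] S[of x] that by auto
        have "integrable lborel (\<lambda>y. (?k y \<bullet> b) *\<^sub>R T y)" for b
          by (rule integrable_continuous_scaleR[OF continuous_on_inner[OF kc continuous_on_const] square_integrable_imp_integrable[OF T(1) TS] TS])
        then have "integrable lborel (\<lambda>y. (?k y \<bullet> b) * (T y \<bullet> b))" for b
          using integrable_inner_left[of b lborel "\<lambda>y. (?k y \<bullet> b) *\<^sub>R T y"] by simp
        then show ?thesis by (subst euclidean_inner) (rule Bochner_Integration.integrable_sum)
      qed
      have "(LINT y|lborel. ?k y \<bullet> F y) = (LINT y|lborel. (\<Sum>i\<in>{1..N}. ?k y \<bullet> A i y + ?k y \<bullet> B i y))"
      proof (rule integral_cong_AE)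
        show "(\<lambda>y. ?k y \<bullet> F y) \<in> borel_measurable lborel"
          using borel_measurable_inner[OF km square_integrable_measurable[of F]] F by (simp add: represents_def)
        show "(\<lambda>y. \<Sum>i\<in>{1..N}. ?k y \<bullet> A i y + ?k y \<bullet> B i y) \<in> borel_measurable lborel"
        proof (rule borel_measurable_sum)
          fix i assume i: "i \<in> {1..N}"
          have "(\<lambda>y. ?k y \<bullet> A i y + ?k y \<bullet> B i y) \<in> borel_measurable borel"
            by (intro borel_measurable_add borel_measurable_inner km square_integrable_measurable[OF As(1)[OF i]]
                square_integrable_measurable[OF Bs(1)[OF i]])
          then show "(\<lambda>y. ?k y \<bullet> A i y + ?k y \<bullet> B i y) \<in> borel_measurable lborel" by simp
        qed
        show "AE y in lborel. ?k y \<bullet> F y = (\<Sum>i\<in>{1..N}. ?k y \<bullet> A i y + ?k y \<bullet> B i y)"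
          using Fae by eventually_elim (simp add: inner_sum_right inner_add_right)
      qed
      also have "\<dots> = (\<Sum>i\<in>{1..N}. LINT y|lborel. ?k y \<bullet> A i y + ?k y \<bullet> B i y)"
        by (rule Bochner_Integration.integral_sum) (intro Bochner_Integration.integrable_add int As Bs; assumption)
      also have "\<dots> = (\<Sum>i\<in>{1..N}. 0)"
      proof (rule sum.cong[OF refl])
        fix i assume i: "i \<in> {1..N}"
        have fari: "\<delta> \<le> norm (x - y)" if "y \<in> \<omega> i" for y using far sub[OF i] that by blast
        note o = reg_kernel_orthogonal_closures[OF assms(1) bdi[OF i] \<delta>(1) fari]
        show "(LINT y|lborel. ?k y \<bullet> A i y + ?k y \<bullet> B i y) = 0"
          using o(1)[OF _ A[OF i]] o(2)[OF _ B[OF i]] int[OF i As[OF i]] int[OF i Bs[OF i]] by simp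
      qed
      finally have "(LINT y|lborel. ?k y \<bullet> F y) = 0" by simp
      then show ?thesis using magnetic_potential_eq[OF assms(1) op fL F \<delta>(1), of x] far by simp
    qed
    then show ?thesis using fL by (simp add: magnetic_null_space_def)
  qed
  have "magnetic_null_space \<Omega> = {f \<in> L2 \<Omega>. \<exists>g. (\<forall>i\<in>{1..N}. g i \<in> ?V i) \<and>
      (AE x in lebesgue_on \<Omega>. f x = (\<Sum>i\<in>{1..N}. g i x))}"
  proof (intro set_eqI iffI)
    fix f assume f: "f \<in> magnetic_null_space \<Omega>"
    then have "f \<in> L2 \<Omega>" by (simp add: magnetic_null_space_def)
    then show "f \<in> {f \<in> L2 \<Omega>. \<exists>g. (\<forall>i\<in>{1..N}. g i \<in> ?V i) \<and> (AE x in lebesgue_on \<Omega>. f x = (\<Sum>i\<in>{1..N}. g i x))}"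
      using fwd[OF f] by simp
  next
    fix f assume "f \<in> {f \<in> L2 \<Omega>. \<exists>g. (\<forall>i\<in>{1..N}. g i \<in> ?V i) \<and> (AE x in lebesgue_on \<Omega>. f x = (\<Sum>i\<in>{1..N}. g i x))}"
    then obtain g where "f \<in> L2 \<Omega>" "\<forall>i\<in>{1..N}. g i \<in> ?V i" "AE x in lebesgue_on \<Omega>. f x = (\<Sum>i\<in>{1..N}. g i x)" by blast
    then show "f \<in> magnetic_null_space \<Omega>" by (rule bwd)
  qed
  then show ?thesis
    unfolding L2_direct_sum_def using uniq by blast
qed

end
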